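(* For any $\varphi\in\mathcal{D}(\mathcal{A})$, $\varphi^\star\in\mathcal{D}(\mathcal{A}^\star)$, $\varphi^\odot\in\mathcal{D}(\mathcal{A}^\odot)$ and $\varphi^{\odot\star}\in\mathcal{D}(\mathcal{A}^{\odot\star})$ there holds $$\langle\mathcal{A}^\star\varphi^\star,\varphi\rangle_T=\langle\varphi^\star,\mathcal{A}\varphi\rangle_T,\qquad \langle\mathcal{A}^{\odot\star}\varphi^{\odot\star},\varphi^\odot\rangle_T=\langle\varphi^{\odot\star},\mathcal{A}^\odot\varphi^\odot\rangle_T.$$ Moreover, $\mathcal{A}^\star:\mathcal{D}(\mathcal{A}^\star)\to C_T(\mathbb{R},X^\star)$ and $\mathcal{A}^{\odot\star}:\mathcal{D}(\mathcal{A}^{\odot\star})\to C_T(\mathbb{R},X^{\odot\star})$ are the unique linear operators (on these domains) satisfying these identities.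
   Context: Setting. Fix a delay $0<h<\infty$ and integers $n\ge 1$, $k\ge 1$. Let $X=C([-h,0],\mathbb{R}^n)$ with the supremum norm, and write $x_t(\theta)=x(t+\theta)$, $\theta\in[-h,0]$. Let $F:X\to\mathbb{R}^n$ be $C^{k+1}$-smooth and let $\gamma:\mathbb{R}\to\mathbb{R}^n$ be a periodic solution, with minimal period $T>0$, of $\dot x(t)=F(x_t)$. Put $L(t)=DF(\gamma_t)\in\mathcal{L}(X,\mathbb{R}^n)$, which is $T$-periodic and $C^k$ in $t$, and write $L(t)\varphi=\int_0^h d_2\zeta(t,\theta)\varphi(-\theta)$ (Riemann-Stieltjes integral in $\theta$), where $\zeta(t,\cdot):[0,h]\to\mathbb{R}^{n\times n}$ has bounded variation, is right-continuous on $(0,h)$, and $\zeta(t,0)=0$. Spaces, operators and (bilinear) pairings are complexified without change of notation. Duals. $\mathbb{R}^{n\star}$ denotes row vectors. $X^\star\cong NBV([0,h],\mathbb{R}^{n\star})$ (functions $f$ of bounded variation, $f(0)=0$, right-continuous on $(0,h)$), $\langle f,\varphi\rangle=\int_0^h df(\theta)\varphi(-\theta)$. $\mathcal{D}(A_0^\star)$ is the set of $f\in X^\star$ of the form $f(\theta)=f(0^+)+\int_0^\theta g$ for $\theta\in(0,h]$ with $g\in NBV([0,h],\mathbb{R}^{n\star})$, $g(h)=0$; $f':=g$. $X^\odot$ is the norm closure of $\mathcal{D}(A_0^\star)$ in $X^\star$; it consists of the $f$ with $f(0)=0$, $f(\theta)=c+\int_0^\theta g$ on $(0,h]$, $(c,g)\in\mathbb{R}^{n\star}\times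 L^1([0,h],\mathbb{R}^{n\star})$, and $f$ is identified with $(c,g)$. $X^{\odot\star}=\mathbb{R}^n\times L^\infty([-h,0],\mathbb{R}^n)$ is the dual of $X^\odot$ via $\langle(a,\psi),(c,g)\rangle=ca+\int_0^hg(\theta)\psi(-\theta)d\theta$. Operators. For $\tau\in\mathbb{R}$: $\mathcal{D}(A(\tau))=\{\varphi\in C^1([-h,0],\mathbb{R}^n):\varphi'(0)=L(\tau)\varphi\}$, $A(\tau)\varphi=\varphi'$; $\mathcal{D}(A^\star(\tau))=\mathcal{D}(A_0^\star)$, $A^\star(\tau)f=f'+f(0^+)\zeta(\tau,\cdot)$; $\mathcal{D}(A^\odot(\tau))=\{(c,g)\in\mathcal{D}(A_0^\star):g+c\,\zeta(\tau,\cdot)\in X^\odot\}$, $A^\odot(\tau)(c,g)=g+c\,\zeta(\tau,\cdot)$; $\mathcal{D}(A^{\odot\star}(\tau))=\{(\alpha,\varphi)\in X^{\odot\star}:\varphi\text{ Lipschitz},\varphi(0)=\alpha\}$, $A^{\odot\star}(\tau)(\alpha,\varphi)=(L(\tau)\varphi,\varphi')$. $C_T(\mathbb{R},E)$ (resp. $C_T^1(\mathbb{R},E)$) is the space of continuous (resp. $C^1$) $T$-periodic functions $\mathbb{R}\to E$. Each of $\mathcal{A},\mathcal{A}^\star,\mathcal{A}^\odot,\mathcal{A}^{\odot\star}$ has as domain the set of $\varphi\in C_T^1(\mathbb{R},E)$, with $E=X,X^\star,X^\odot,X^{\odot\star}$ respectively, such that $\varphi(\tau)$ lies in $\mathcal{D}(A(\tau)),\mathcal{D}(A^\star(\tau)),\mathcal{D}(A^\odot(\tau)),\mathcal{D}(A^{\odot\star}(\tau))$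 respectively for all $\tau$, and $(\mathcal{A}\varphi)(\tau)=A(\tau)\varphi(\tau)-\dot\varphi(\tau)$, $(\mathcal{A}^\star\varphi^\star)(\tau)=A^\star(\tau)\varphi^\star(\tau)+\dot\varphi^\star(\tau)$, $(\mathcal{A}^\odot\varphi^\odot)(\tau)=A^\odot(\tau)\varphi^\odot(\tau)+\dot\varphi^\odot(\tau)$, $(\mathcal{A}^{\odot\star}\varphi^{\odot\star})(\tau)=A^{\odot\star}(\tau)\varphi^{\odot\star}(\tau)-\dot\varphi^{\odot\star}(\tau)$. Pairings. $\langle\varphi^\star,\varphi\rangle_T=\int_0^T\langle\varphi^\star(\tau),\varphi(\tau)\rangle d\tau$ on $C_T(\mathbb{R},X^\star)\times C_T(\mathbb{R},X)$ and $\langle\varphi^{\odot\star},\varphi^\odot\rangle_T=\int_0^T\langle\varphi^{\odot\star}(\tau),\varphi^\odot(\tau)\rangle d\tau$ on $C_T(\mathbb{R},X^{\odot\star})\times C_T(\mathbb{R},X^\odot)$.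
   Formalization: Uniqueness is stated on those elements of D(A* ) and D(A^{⊙*}) whose image under the operator is continuous, because on the full domains as defined these operators do not always map into C_T(R,X* ) and C_T(R,X^{⊙*}). *)

theory Defs
  imports "HOL-Analysis.Analysis"
begin

section \<open>Functions of bounded variation as a normed space\<close>

definition variation_sums :: "real set \<Rightarrow> (real \<Rightarrow> 'a::real_normed_vector) \<Rightarrow> real set" where
  "variation_sums S f =
     {\<Sum>i<m. norm (f (t (Suc i)) - f (t i)) | (m::nat) (t::nat \<Rightarrow> real). mono t \<and> range t \<subseteq> S}"

definition bounded_variation_on :: "real set \<Rightarrow> (real \<Rightarrow> 'a::real_normed_vector) \<Rightarrow> bool" where
  "bounded_variation_on S f \<longleftrightarrow> bdd_above (variation_sums S f)"

definition total_variation :: "real set \<Rightarrow> (real \<Rightarrow> 'a::real_normed_vector) \<Rightarrow> real" where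
  "total_variation S f = Sup (variation_sums S f)"

lemma variation_sums_I:
  "mono t \<Longrightarrow> range t \<subseteq> S \<Longrightarrow> (\<Sum>i<m. norm (f (t (Suc i)) - f (t i))) \<in> variation_sums S f"
  unfolding variation_sums_def by blast

lemma variation_sums_ne: "variation_sums UNIV f \<noteq> {}"
  using variation_sums_I[of "\<lambda>_. 0" UNIV f 0] by (auto simp: mono_def)

lemma bounded_variation_iff:
  "bounded_variation_on S f \<longleftrightarrow>
   (\<exists>M. \<forall>t m. mono t \<longrightarrow> range t \<subseteq> S \<longrightarrow> (\<Sum>i<m. norm (f (t (Suc i)) - f (t i))) \<le> M)"
  unfolding bounded_variation_on_def bdd_above_def variation_sums_def by blast

lemma variation_le_total:
  "bounded_variation_on UNIV f \<Longrightarrow> mono t \<Longrightarrow>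
   (\<Sum>i<m. norm (f (t (Suc i)) - f (t i))) \<le> total_variation UNIV f"
  unfolding bounded_variation_on_def total_variation_def
  by (rule cSup_upper) (auto intro: variation_sums_I)

lemma total_variation_le:
  assumes "\<And>t m. mono t \<Longrightarrow> (\<Sum>i<m. norm (f (t (Suc i)) - f (t i))) \<le> M"
  shows "total_variation UNIV f \<le> M"
  unfolding total_variation_def
  using assms by (intro cSup_least variation_sums_ne) (auto simp: variation_sums_def)

lemma bounded_variation_add:
  assumes "bounded_variation_on S f" "bounded_variation_on S g"
  shows "bounded_variation_on S (\<lambda>x. f x + g x)"
proof -
  obtain M where M: "\<And>t m. mono t \<Longrightarrow> range t \<subseteq> S \<Longrightarrow> (\<Sum>i<m. norm (f (t (Suc i)) - f (t i))) \<le> M"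
    using assms(1) unfolding bounded_variation_iff by blast
  obtain N where N: "\<And>t m. mono t \<Longrightarrow> range t \<subseteq> S \<Longrightarrow> (\<Sum>i<m. norm (g (t (Suc i)) - g (t i))) \<le> N"
    using assms(2) unfolding bounded_variation_iff by blast
  show ?thesis unfolding bounded_variation_iff
  proof (intro exI allI impI)
    fix t :: "nat \<Rightarrow> real" and m :: nat assume t: "mono t" "range t \<subseteq> S"
    have "(\<Sum>i<m. norm (f (t (Suc i)) + g (t (Suc i)) - (f (t i) + g (t i))))
        \<le> (\<Sum>i<m. norm (f (t (Suc i)) - f (t i)) + norm (g (t (Suc i)) - g (t i)))"
      by (intro sum_mono) (metis add_diff_add norm_triangle_ineq)
    also have "\<dots> \<le> M + N"
      unfolding sum.distrib using M[OF t] N[OF t] by (rule add_mono)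
    finally show "(\<Sum>i<m. norm (f (t (Suc i)) + g (t (Suc i)) - (f (t i) + g (t i)))) \<le> M + N" .
  qed
qed

lemma bounded_variation_linear:
  assumes "bounded_variation_on S f" "bounded_linear L"
  shows "bounded_variation_on S (\<lambda>x. L (f x))"
proof -
  obtain M where M: "\<And>t m. mono t \<Longrightarrow> range t \<subseteq> S \<Longrightarrow> (\<Sum>i<m. norm (f (t (Suc i)) - f (t i))) \<le> M"
    using assms(1) unfolding bounded_variation_iff by blast
  obtain K where K: "K > 0" "\<And>x. norm (L x) \<le> norm x * K"
    using bounded_linear.pos_bounded[OF assms(2)] by blast
  show ?thesis unfolding bounded_variation_iff
  proof (intro exI allI impI)
    fix t :: "nat \<Rightarrow> real" and m :: nat assume t: "mono t" "range t \<subseteq> S"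
    have "(\<Sum>i<m. norm (L (f (t (Suc i))) - L (f (t i))))
        \<le> (\<Sum>i<m. norm (f (t (Suc i)) - f (t i)) * K)"
      by (intro sum_mono)
        (simp add: K(2) flip: linear_diff[OF bounded_linear.linear[OF assms(2)]])
    also have "\<dots> \<le> M * K"
      unfolding sum_distrib_right[symmetric] using M[OF t] K(1) by (intro mult_right_mono) auto
    finally show "(\<Sum>i<m. norm (L (f (t (Suc i))) - L (f (t i)))) \<le> M * K" .
  qed
qed

lemma bounded_variation_zero: "bounded_variation_on S (\<lambda>_. 0)"
  unfolding bounded_variation_iff by (auto intro!: exI[of _ 0])

text \<open>The condition \<open>f 0 = 0\<close> makes the total variation a norm. Spaces of functions on a compact
  interval are realised below as subspaces, by extending the functions constantly.\<close>

typedef (overloaded) 'a bv =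
  "{f :: real \<Rightarrow> 'a::real_normed_vector. f 0 = 0 \<and> bounded_variation_on UNIV f}"
  morphisms apply_bv Bv
  by (rule exI[of _ "\<lambda>_. 0"]) (simp add: bounded_variation_zero)

setup_lifting type_definition_bv

declare [[coercion "apply_bv :: 'a::real_normed_vector bv \<Rightarrow> real \<Rightarrow> 'a"]]

instantiation bv :: (real_normed_vector) real_vector
begin

lift_definition zero_bv :: "'a bv" is "\<lambda>_. 0" by (simp add: bounded_variation_zero)

lift_definition plus_bv :: "'a bv \<Rightarrow> 'a bv \<Rightarrow> 'a bv" is "\<lambda>f g x. f x + g x"
  by (simp add: bounded_variation_add)

lift_definition scaleR_bv :: "real \<Rightarrow> 'a bv \<Rightarrow> 'a bv" is "\<lambda>r f x. r *\<^sub>R f x"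
  using bounded_variation_linear[OF _ bounded_linear_scaleR_right] by auto

lift_definition uminus_bv :: "'a bv \<Rightarrow> 'a bv" is "\<lambda>f x. - f x"
  using bounded_variation_linear[OF _ bounded_linear_minus[OF bounded_linear_ident]] by auto

lift_definition minus_bv :: "'a bv \<Rightarrow> 'a bv \<Rightarrow> 'a bv" is "\<lambda>f g x. f x - g x"
  using bounded_variation_add[OF _
      bounded_variation_linear[OF _ bounded_linear_minus[OF bounded_linear_ident]]] by fastforce

instance
proof
  fix f g h :: "'a bv" and a b :: real
  show "f + g + h = f + (g + h)" by transfer (simp add: add.assoc)
  show "f + g = g + f" by transfer (simp add: add.commute)
  show "0 + f = f" by transfer simp
  show "- f + f = 0" by transfer simp
  show "f - g = f + - g" by transfer simp
  show "a *\<^sub>R (f + g) = a *\<^sub>R f + a *\<^sub>R g" by transfer (simp add: scaleR_add_right)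
  show "(a + b) *\<^sub>R f = a *\<^sub>R f + b *\<^sub>R f" by transfer (simp add: scaleR_add_left)
  show "a *\<^sub>R b *\<^sub>R f = (a * b) *\<^sub>R f" by transfer simp
  show "1 *\<^sub>R f = f" by transfer simp
qed

end

instantiation bv :: (real_normed_vector) real_normed_vector
begin

lift_definition norm_bv :: "'a bv \<Rightarrow> real" is "\<lambda>f. total_variation UNIV f" .

definition sgn_bv :: "'a bv \<Rightarrow> 'a bv" where "sgn_bv f = f /\<^sub>R norm f"

definition dist_bv :: "'a bv \<Rightarrow> 'a bv \<Rightarrow> real" where "dist_bv f g = norm (f - g)"

definition uniformity_bv :: "('a bv \<times> 'a bv) filter" where
  "uniformity_bv = (INF e\<in>{0 <..}. principal {(x, y). dist x y < e})"

definition open_bv :: "'a bv set \<Rightarrow> bool" where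
  "open_bv S = (\<forall>x\<in>S. \<forall>\<^sub>F (x', y) in uniformity. x' = x \<longrightarrow> y \<in> S)"

instance
proof
  fix f g h :: "'a bv" and a b :: real
  show "sgn f = f /\<^sub>R norm f" by (rule sgn_bv_def)
  show "dist f g = norm (f - g)" by (rule dist_bv_def)
  show "uniformity = (INF e\<in>{0 <..}. principal {(x, y). dist (x :: 'a bv) y < e})"
    by (rule uniformity_bv_def)
  show "open U \<longleftrightarrow> (\<forall>x\<in>U. \<forall>\<^sub>F (x', y) in uniformity. x' = x \<longrightarrow> y \<in> U)" for U :: "'a bv set"
    by (rule open_bv_def)
  show "norm f = 0 \<longleftrightarrow> f = 0"
  proof
    assume "norm f = 0"
    then show "f = 0"
    proof transfer
      fix f :: "real \<Rightarrow> 'a"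
      assume f: "f 0 = 0 \<and> bounded_variation_on UNIV f" and z: "total_variation UNIV f = 0"
      show "f = (\<lambda>_. 0)"
      proof
        fix x :: real
        let ?t = "\<lambda>i::nat. if i = 0 then min 0 x else max 0 x"
        have "mono ?t" by (auto simp: mono_def)
        from variation_le_total[OF _ this, of f 1] f z
        have "norm (f (max 0 x) - f (min 0 x)) \<le> 0" by simp
        then show "f x = 0" using f by (auto simp: max_def min_def split: if_splits)
      qed
    qed
  next
    assume "f = 0"
    moreover have "total_variation UNIV (\<lambda>_::real. 0::'a) = 0"
      by (rule antisym[OF total_variation_le])
        (use variation_le_total[OF bounded_variation_zero, of "\<lambda>_. 0" 0] in \<open>auto simp: mono_def\<close>)
    ultimately show "norm f = 0" by (simp add: norm_bv.rep_eq zero_bv.rep_eq)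
  qed
  show "norm (f + g) \<le> norm f + norm g"
  proof transfer
    fix f g :: "real \<Rightarrow> 'a"
    assume f: "f 0 = 0 \<and> bounded_variation_on UNIV f" and g: "g 0 = 0 \<and> bounded_variation_on UNIV g"
    show "total_variation UNIV (\<lambda>x. f x + g x) \<le> total_variation UNIV f + total_variation UNIV g"
    proof (rule total_variation_le)
      fix t :: "nat \<Rightarrow> real" and m :: nat assume t: "mono t"
      have "(\<Sum>i<m. norm (f (t (Suc i)) + g (t (Suc i)) - (f (t i) + g (t i))))
          \<le> (\<Sum>i<m. norm (f (t (Suc i)) - f (t i)) + norm (g (t (Suc i)) - g (t i)))"
        by (intro sum_mono) (metis add_diff_add norm_triangle_ineq)
      also have "\<dots> \<le> total_variation UNIV f + total_variation UNIV g"
        unfolding sum.distrib using f g t by (intro add_mono variation_le_total) auto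
      finally show "(\<Sum>i<m. norm (f (t (Suc i)) + g (t (Suc i)) - (f (t i) + g (t i))))
          \<le> total_variation UNIV f + total_variation UNIV g" .
    qed
  qed
  show "norm (a *\<^sub>R f) = \<bar>a\<bar> * norm f"
  proof -
    have le: "norm (a *\<^sub>R f) \<le> \<bar>a\<bar> * norm f" for a and f :: "'a bv"
    proof transfer
      fix a and f :: "real \<Rightarrow> 'a" assume f: "f 0 = 0 \<and> bounded_variation_on UNIV f"
      show "total_variation UNIV (\<lambda>x. a *\<^sub>R f x) \<le> \<bar>a\<bar> * total_variation UNIV f"
        using f by (intro total_variation_le)
          (auto simp flip: scaleR_diff_right sum_distrib_left intro!: mult_left_mono variation_le_total)
    qed
    show ?thesis
    proof (cases "a = 0")
      case True
      have "norm (0::'a bv) = 0" using \<open>norm f = 0 \<longleftrightarrow> f = 0\<close>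
        by transfer (rule antisym[OF total_variation_le],
            use variation_le_total[OF bounded_variation_zero, of "\<lambda>_. 0" 0] in \<open>auto simp: mono_def\<close>)
      moreover have "a *\<^sub>R f = 0" using True by transfer simp
      ultimately show ?thesis using True by simp
    next
      case False
      have "f = inverse a *\<^sub>R (a *\<^sub>R f)" using False by transfer simp
      then have "norm f \<le> \<bar>inverse a\<bar> * norm (a *\<^sub>R f)" using le by metis
      then have "\<bar>a\<bar> * norm f \<le> norm (a *\<^sub>R f)" using False by (simp add: field_simps)
      then show ?thesis using le[of a f] by simp
    qed
  qed
qed

end

section \<open>Essentially bounded functions modulo equality almost everywhere\<close>

definition ess_bounded :: "(real \<Rightarrow> 'a::euclidean_space) \<Rightarrow> bool" where
  "ess_bounded f \<longleftrightarrow> f \<in> borel_measurable borel \<and> (\<exists>C. AE x in lborel. norm (f x) \<le> C)"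

definition ess_sup_norm :: "(real \<Rightarrow> 'a::euclidean_space) \<Rightarrow> real" where
  "ess_sup_norm f = Inf {C. 0 \<le> C \<and> (AE x in lborel. norm (f x) \<le> C)}"

lemma ess_bounded_zero: "ess_bounded (\<lambda>_. 0)"
  unfolding ess_bounded_def by auto

lemma ess_bounded_nonneg:
  assumes "ess_bounded f" shows "\<exists>C. 0 \<le> C \<and> (AE x in lborel. norm (f x) \<le> C)"
proof -
  obtain C where "AE x in lborel. norm (f x) \<le> C" using assms unfolding ess_bounded_def by blast
  then have "AE x in lborel. norm (f x) \<le> max 0 C" by eventually_elim auto
  then show ?thesis by (intro exI[of _ "max 0 C"]) auto
qed

lemma ess_sup_norm_le: "0 \<le> C \<Longrightarrow> AE x in lborel. norm (f x) \<le> C \<Longrightarrow> ess_sup_norm f \<le> C"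
  unfolding ess_sup_norm_def by (rule cInf_lower) (auto intro!: bdd_belowI[of _ 0])

lemma ess_sup_norm_nonneg:
  assumes "ess_bounded f" shows "0 \<le> ess_sup_norm f"
  unfolding ess_sup_norm_def
proof (rule cInf_greatest)
  show "{C. 0 \<le> C \<and> (AE x in lborel. norm (f x) \<le> C)} \<noteq> {}"
    using ess_bounded_nonneg[OF assms] by blast
qed simp

lemma AE_le_ess_sup_norm:
  assumes "ess_bounded f" shows "AE x in lborel. norm (f x) \<le> ess_sup_norm f"
proof -
  let ?S = "{C. 0 \<le> C \<and> (AE x in lborel. norm (f x) \<le> C)}"
  have "AE x in lborel. norm (f x) \<le> ess_sup_norm f + inverse (real (Suc n))" for n
  proof -
    have "Inf ?S < ess_sup_norm f + inverse (real (Suc n))" by (simp add: ess_sup_norm_def)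
    moreover have "?S \<noteq> {}" using ess_bounded_nonneg[OF assms] by blast
    ultimately obtain C where C: "C \<in> ?S" "C < ess_sup_norm f + inverse (real (Suc n))"
      using cInf_lessD[of ?S] by meson
    from C(1) have "AE x in lborel. norm (f x) \<le> C" by simp
    then show ?thesis by eventually_elim (use C(2) in linarith)
  qed
  then have "AE x in lborel. \<forall>n. norm (f x) \<le> ess_sup_norm f + inverse (real (Suc n))"
    unfolding AE_all_countable by blast
  then show ?thesis
  proof eventually_elim
    case (elim x)
    have "(\<lambda>n. ess_sup_norm f + inverse (real (Suc n))) \<longlonglongrightarrow> ess_sup_norm f + 0"
      by (intro tendsto_intros LIMSEQ_inverse_real_of_nat)
    then have "(\<lambda>n. ess_sup_norm f + inverse (real (Suc n))) \<longlonglongrightarrow> ess_sup_norm f" by simp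
    then show ?case by (rule LIMSEQ_le_const) (use elim in blast)
  qed
qed

lemma ess_bounded_add:
  assumes "ess_bounded f" "ess_bounded g"
  shows "ess_bounded (\<lambda>x. f x + g x)" "ess_sup_norm (\<lambda>x. f x + g x) \<le> ess_sup_norm f + ess_sup_norm g"
proof -
  have *: "AE x in lborel. norm (f x + g x) \<le> ess_sup_norm f + ess_sup_norm g"
    using AE_le_ess_sup_norm[OF assms(1)] AE_le_ess_sup_norm[OF assms(2)]
    by eventually_elim (rule order_trans[OF norm_triangle_ineq add_mono])
  have "(\<lambda>x. f x + g x) \<in> borel_measurable borel"
    using assms unfolding ess_bounded_def by (intro borel_measurable_add) simp_all
  with * show "ess_bounded (\<lambda>x. f x + g x)" unfolding ess_bounded_def by blast
  show "ess_sup_norm (\<lambda>x. f x + g x) \<le> ess_sup_norm f + ess_sup_norm g"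
    using * assms by (intro ess_sup_norm_le add_nonneg_nonneg ess_sup_norm_nonneg)
qed

lemma ess_bounded_linear:
  fixes f :: "real \<Rightarrow> 'a::euclidean_space" and L :: "'a \<Rightarrow> 'b::euclidean_space"
  assumes "ess_bounded f" "bounded_linear L"
  shows "ess_bounded (\<lambda>x. L (f x))"
proof -
  obtain K where K: "K > 0" "\<And>x. norm (L x) \<le> norm x * K"
    using bounded_linear.pos_bounded[OF assms(2)] by blast
  have "AE x in lborel. norm (L (f x)) \<le> ess_sup_norm f * K"
    using AE_le_ess_sup_norm[OF assms(1)]
    by eventually_elim (rule order_trans[OF K(2) mult_right_mono], use K(1) in auto)
  moreover have "(\<lambda>x. L (f x)) \<in> borel_measurable borel"
    using assms unfolding ess_bounded_def
    by (intro borel_measurable_continuous_on[of L] linear_continuous_on) auto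
  ultimately show ?thesis unfolding ess_bounded_def by blast
qed

lemma ess_bounded_diff:
  assumes "ess_bounded f" "ess_bounded g" shows "ess_bounded (\<lambda>x. f x - g x)"
  using ess_bounded_add(1)[OF assms(1)
      ess_bounded_linear[OF assms(2) bounded_linear_minus[OF bounded_linear_ident]]] by simp

quotient_type (overloaded) 'a linf = "real \<Rightarrow> 'a::euclidean_space" /
  partial: "\<lambda>f g. ess_bounded f \<and> ess_bounded g \<and> (AE x in lborel. f x = g x)"
proof (rule part_equivpI)
  show "\<exists>f::real \<Rightarrow> 'a. ess_bounded f \<and> ess_bounded f \<and> (AE x in lborel. f x = f x)"
    using ess_bounded_zero by auto
  show "symp (\<lambda>f g::real \<Rightarrow> 'a. ess_bounded f \<and> ess_bounded g \<and> (AE x in lborel. f x = g x))"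
    by (auto simp: symp_def)
  show "transp (\<lambda>f g::real \<Rightarrow> 'a. ess_bounded f \<and> ess_bounded g \<and> (AE x in lborel. f x = g x))"
    unfolding transp_def
  proof (intro allI impI conjI)
    fix f g k :: "real \<Rightarrow> 'a"
    assume "ess_bounded f \<and> ess_bounded g \<and> (AE x in lborel. f x = g x)"
      and "ess_bounded g \<and> ess_bounded k \<and> (AE x in lborel. g x = k x)"
    then have eq: "AE x in lborel. f x = g x" "AE x in lborel. g x = k x"
      and "ess_bounded f" "ess_bounded k" by auto
    from eq show "AE x in lborel. f x = k x" by eventually_elim simp
    show "ess_bounded f" "ess_bounded k" by fact+
  qed
qed

instantiation linf :: (euclidean_space) real_vector
begin

lift_definition zero_linf :: "'a linf" is "\<lambda>_. 0" by (simp add: ess_bounded_zero)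

lift_definition plus_linf :: "'a linf \<Rightarrow> 'a linf \<Rightarrow> 'a linf" is "\<lambda>f g x. f x + g x"
proof (elim conjE, intro conjI)
  fix f f' g g' :: "real \<Rightarrow> 'a"
  assume "AE x in lborel. f x = f' x" "AE x in lborel. g x = g' x"
  then show "AE x in lborel. f x + g x = f' x + g' x" by eventually_elim simp
qed (simp_all add: ess_bounded_add)

lift_definition scaleR_linf :: "real \<Rightarrow> 'a linf \<Rightarrow> 'a linf" is "\<lambda>r f x. r *\<^sub>R f x"
proof (elim conjE, intro conjI)
  fix r and f f' :: "real \<Rightarrow> 'a"
  assume "AE x in lborel. f x = f' x"
  then show "AE x in lborel. r *\<^sub>R f x = r *\<^sub>R f' x" by eventually_elim simp
qed (rule ess_bounded_linear[OF _ bounded_linear_scaleR_right], assumption)+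

lift_definition uminus_linf :: "'a linf \<Rightarrow> 'a linf" is "\<lambda>f x. - f x"
proof (elim conjE, intro conjI)
  fix f f' :: "real \<Rightarrow> 'a"
  assume "AE x in lborel. f x = f' x"
  then show "AE x in lborel. - f x = - f' x" by eventually_elim simp
qed (rule ess_bounded_linear[OF _ bounded_linear_minus[OF bounded_linear_ident]], assumption)+

lift_definition minus_linf :: "'a linf \<Rightarrow> 'a linf \<Rightarrow> 'a linf" is "\<lambda>f g x. f x - g x"
proof (elim conjE, intro conjI)
  fix f f' g g' :: "real \<Rightarrow> 'a"
  assume "AE x in lborel. f x = f' x" "AE x in lborel. g x = g' x"
  then show "AE x in lborel. f x - g x = f' x - g' x" by eventually_elim simp
qed (simp_all add: ess_bounded_diff)

instance
proof
  fix f g h :: "'a linf" and a b :: real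
  show "f + g + h = f + (g + h)"
    by transfer (auto simp: add.assoc intro!: ess_bounded_add)
  show "f + g = g + f" by transfer (auto simp: add.commute intro!: ess_bounded_add)
  show "0 + f = f" by transfer simp
  show "- f + f = 0" by transfer (simp add: ess_bounded_zero)
  show "f - g = f + - g"
    by transfer (simp add: ess_bounded_diff)
  show "a *\<^sub>R (f + g) = a *\<^sub>R f + a *\<^sub>R g"
    by transfer (auto simp: scaleR_add_right intro!: ess_bounded_add
        ess_bounded_linear[OF _ bounded_linear_scaleR_right])
  show "(a + b) *\<^sub>R f = a *\<^sub>R f + b *\<^sub>R f"
    by transfer (auto simp: scaleR_add_left intro!: ess_bounded_add
        ess_bounded_linear[OF _ bounded_linear_scaleR_right])
  show "a *\<^sub>R b *\<^sub>R f = (a * b) *\<^sub>R f"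
    by transfer (auto intro!: ess_bounded_linear[OF _ bounded_linear_scaleR_right])
  show "1 *\<^sub>R f = f" by transfer simp
qed

end

instantiation linf :: (euclidean_space) real_normed_vector
begin

lift_definition norm_linf :: "'a linf \<Rightarrow> real" is ess_sup_norm
proof -
  fix f g :: "real \<Rightarrow> 'a"
  assume a: "ess_bounded f \<and> ess_bounded g \<and> (AE x in lborel. f x = g x)"
  then have "AE x in lborel. f x = g x" by simp
  then have "(AE x in lborel. norm (f x) \<le> C) \<longleftrightarrow> (AE x in lborel. norm (g x) \<le> C)" for C
    by (intro eventually_subst) (rule eventually_mono, assumption, simp)
  then show "ess_sup_norm f = ess_sup_norm g" by (simp add: ess_sup_norm_def)
qed

definition sgn_linf :: "'a linf \<Rightarrow> 'a linf" where "sgn_linf f = f /\<^sub>R norm f"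

definition dist_linf :: "'a linf \<Rightarrow> 'a linf \<Rightarrow> real" where "dist_linf f g = norm (f - g)"

definition uniformity_linf :: "('a linf \<times> 'a linf) filter" where
  "uniformity_linf = (INF e\<in>{0 <..}. principal {(x, y). dist x y < e})"

definition open_linf :: "'a linf set \<Rightarrow> bool" where
  "open_linf S = (\<forall>x\<in>S. \<forall>\<^sub>F (x', y) in uniformity. x' = x \<longrightarrow> y \<in> S)"

instance
proof
  fix f g h :: "'a linf" and a b :: real
  show "sgn f = f /\<^sub>R norm f" by (rule sgn_linf_def)
  show "dist f g = norm (f - g)" by (rule dist_linf_def)
  show "uniformity = (INF e\<in>{0 <..}. principal {(x, y). dist (x :: 'a linf) y < e})"
    by (rule uniformity_linf_def)
  show "open U \<longleftrightarrow> (\<forall>x\<in>U. \<forall>\<^sub>F (x', y) in uniformity. x' = x \<longrightarrow> y \<in> U)" for U :: "'a linf set"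
    by (rule open_linf_def)
  have norm0: "norm (0::'a linf) = 0"
    by transfer (auto intro!: antisym ess_sup_norm_le ess_sup_norm_nonneg ess_bounded_zero)
  show "norm f = 0 \<longleftrightarrow> f = 0"
  proof
    assume "norm f = 0" then show "f = 0"
    proof transfer
      fix f :: "real \<Rightarrow> 'a"
      assume f: "ess_bounded f \<and> ess_bounded f \<and> (AE x in lborel. f x = f x)"
        and z: "ess_sup_norm f = 0"
      show "ess_bounded f \<and> ess_bounded (\<lambda>_. 0::'a) \<and> (AE x in lborel. f x = 0)"
        using AE_le_ess_sup_norm[of f] f z by (auto simp: ess_bounded_zero)
    qed
  qed (simp add: norm0)
  show "norm (f + g) \<le> norm f + norm g" by transfer (simp add: ess_bounded_add)
  show "norm (a *\<^sub>R f) = \<bar>a\<bar> * norm f"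
  proof -
    have le: "norm (a *\<^sub>R f) \<le> \<bar>a\<bar> * norm f" for a and f :: "'a linf"
    proof transfer
      fix a and f :: "real \<Rightarrow> 'a"
      assume f: "ess_bounded f \<and> ess_bounded f \<and> (AE x in lborel. f x = f x)"
      have "AE x in lborel. norm (a *\<^sub>R f x) \<le> \<bar>a\<bar> * ess_sup_norm f"
        using AE_le_ess_sup_norm[OF conjunct1[OF f]] by eventually_elim (simp add: mult_left_mono)
      then show "ess_sup_norm (\<lambda>x. a *\<^sub>R f x) \<le> \<bar>a\<bar> * ess_sup_norm f"
        using f by (intro ess_sup_norm_le mult_nonneg_nonneg ess_sup_norm_nonneg) auto
    qed
    show ?thesis
    proof (cases "a = 0")
      case True
      have "a *\<^sub>R f = 0" using True by transfer (simp add: ess_bounded_zero)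
      then show ?thesis using True norm0 by simp
    next
      case False
      have "f = inverse a *\<^sub>R (a *\<^sub>R f)" using False by transfer simp
      then have "norm f \<le> \<bar>inverse a\<bar> * norm (a *\<^sub>R f)" using le by metis
      then have "\<bar>a\<bar> * norm f \<le> norm (a *\<^sub>R f)" using False by (simp add: field_simps)
      then show ?thesis using le[of a f] by simp
    qed
  qed
qed

end

section \<open>Multiplication by complex scalars\<close>

lemma bounded_linear_vector_scalar_mult:
  "bounded_linear (\<lambda>x :: complex ^ 'n. c *s x)"
proof -
  have "linear (\<lambda>x :: complex ^ 'n. c *s x)"
    by (rule linearI) (simp_all add: vec_eq_iff algebra_simps)
  then show ?thesis by (simp add: linear_conv_bounded_linear)
qed

lift_definition scaleC_bv :: "complex \<Rightarrow> (complex ^ 'n) bv \<Rightarrow> (complex ^ 'n) bv"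
  is "\<lambda>c f x. c *s f x"
  using bounded_variation_linear[OF _ bounded_linear_vector_scalar_mult] by auto

lift_definition scaleC_linf :: "complex \<Rightarrow> (complex ^ 'n) linf \<Rightarrow> (complex ^ 'n) linf"
  is "\<lambda>c f x. c *s f x"
proof (elim conjE, intro conjI)
  fix c and f f' :: "real \<Rightarrow> complex ^ 'n"
  assume "AE x in lborel. f x = f' x"
  then show "AE x in lborel. c *s f x = c *s f' x" by eventually_elim simp
qed (rule ess_bounded_linear[OF _ bounded_linear_vector_scalar_mult], assumption)+

definition scaleC_sunstar ::
  "complex \<Rightarrow> (complex ^ 'n) \<times> (complex ^ 'n) linf \<Rightarrow> (complex ^ 'n) \<times> (complex ^ 'n) linf" where
  "scaleC_sunstar c v = (c *s fst v, scaleC_linf c (snd v))"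

section \<open>Smoothness in a normed space\<close>

text \<open>\<open>D x [v\<^sub>1, \<dots>, v\<^sub>j]\<close> is the \<open>j\<close>-th Frechet derivative at \<open>x\<close>, applied to \<open>v\<^sub>1, \<dots>, v\<^sub>j\<close>. The first
  two conditions say that it is a bounded \<open>j\<close>-linear form; the limits in the last two are taken in
  the operator norm of such forms. (The types \<open>X \<Rightarrow>\<^sub>L (X \<Rightarrow>\<^sub>L \<dots>)\<close> of iterated derivatives do not permit
  a recursive definition for variable \<open>m\<close>.)\<close>

definition Ck_smooth :: "nat \<Rightarrow> ('a::real_normed_vector \<Rightarrow> 'b::real_normed_vector) \<Rightarrow> bool" where
  "Ck_smooth m F \<longleftrightarrow> (\<exists>D :: 'a \<Rightarrow> 'a list \<Rightarrow> 'b.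
     (\<forall>x. D x [] = F x) \<and>
     (\<forall>x us vs. length us + length vs < m \<longrightarrow> linear (\<lambda>v. D x (us @ v # vs))) \<and>
     (\<forall>x. \<forall>j\<le>m. \<exists>M. \<forall>vs. length vs = j \<longrightarrow> norm (D x vs) \<le> M * (\<Prod>v\<leftarrow>vs. norm v)) \<and>
     (\<forall>x. \<forall>j<m. \<forall>e>0. \<exists>d>0. \<forall>y. norm (y - x) < d \<longrightarrow> (\<forall>vs. length vs = j \<longrightarrow>
        norm (D y vs - D x vs - D x ((y - x) # vs)) \<le> e * norm (y - x) * (\<Prod>v\<leftarrow>vs. norm v))) \<and>
     (\<forall>x. \<forall>e>0. \<exists>d>0. \<forall>y. norm (y - x) < d \<longrightarrow> (\<forall>vs. length vs = m \<longrightarrow>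
        norm (D y vs - D x vs) \<le> e * (\<Prod>v\<leftarrow>vs. norm v))))"

section \<open>The state space and its duals\<close>

text \<open>A continuous function on \<open>[-h, 0]\<close> is identified with its extension to \<open>\<real>\<close> that is constant
  on either side of the interval; this embedding into the bounded continuous functions preserves
  the supremum norm. \<open>hist h x t\<close> is the segment \<open>x\<^sub>t\<close>; in particular \<open>hist h \<phi> 0\<close> is the element
  of the state space given by the restriction of \<open>\<phi>\<close>.\<close>

definition hist :: "real \<Rightarrow> (real \<Rightarrow> 'a::metric_space) \<Rightarrow> real \<Rightarrow> (real \<Rightarrow>\<^sub>C 'a)" where
  "hist h x t = Bcontfun (\<lambda>\<theta>. x (t + max (-h) (min 0 \<theta>)))"

definition state_space :: "real \<Rightarrow> (real \<Rightarrow>\<^sub>C (complex ^ 'n)) set" where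
  "state_space h = {\<phi>. \<forall>\<theta>. apply_bcontfun \<phi> \<theta> = apply_bcontfun \<phi> (max (-h) (min 0 \<theta>))}"

text \<open>A function on \<open>C([-h, 0])\<close> is represented by its composition with the restriction map
  (a bounded linear surjection with a bounded linear right inverse, so that smoothness is
  unaffected).\<close>

definition depends_on_segment :: "real \<Rightarrow> ((real \<Rightarrow>\<^sub>C 'a::metric_space) \<Rightarrow> 'b) \<Rightarrow> bool" where
  "depends_on_segment h F \<longleftrightarrow> (\<forall>\<phi> \<psi>. (\<forall>\<theta>\<in>{-h..0}. apply_bcontfun \<phi> \<theta> = apply_bcontfun \<psi> \<theta>) \<longrightarrow> F \<phi> = F \<psi>)"

definition NBV :: "real \<Rightarrow> (real \<Rightarrow> 'a::real_normed_vector) \<Rightarrow> bool" where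
  "NBV h f \<longleftrightarrow> f 0 = 0 \<and> bounded_variation_on {0..h} f \<and>
     (\<forall>\<theta>\<in>{0<..<h}. continuous (at_right \<theta>) f)"

text \<open>Row vectors are also represented by \<open>complex ^ 'n\<close>; the product of a row and a column is
  bilinear, without conjugation.\<close>

definition row_col :: "complex ^ 'n \<Rightarrow> complex ^ 'n \<Rightarrow> complex" where
  "row_col c v = (\<Sum>i\<in>UNIV. c $ i * v $ i)"

definition star_space :: "real \<Rightarrow> (complex ^ 'n) bv set" where
  "star_space h = {f. NBV h (apply_bv f) \<and> (\<forall>\<theta>. apply_bv f \<theta> = apply_bv f (max 0 (min h \<theta>)))}"

text \<open>Riemann-Stieltjes integral \<open>\<integral> df(\<theta>) \<phi>(\<theta>)\<close> as the limit of the sums over tagged partitions as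
  the mesh tends to 0.\<close>

definition has_RS_integral ::
  "('a::real_normed_vector \<Rightarrow> 'b \<Rightarrow> 'c::real_normed_vector) \<Rightarrow> (real \<Rightarrow> 'a) \<Rightarrow> (real \<Rightarrow> 'b) \<Rightarrow>
   real set \<Rightarrow> 'c \<Rightarrow> bool" where
  "has_RS_integral prd f \<phi> S I \<longleftrightarrow>
     (\<forall>e>0. \<exists>d>0. \<forall>p. p tagged_division_of S \<and> (\<lambda>x. ball x d) fine p \<longrightarrow>
        norm ((\<Sum>(x, K)\<in>p. prd (f (Sup K) - f (Inf K)) (\<phi> x)) - I) < e)"

definition pairing :: "real \<Rightarrow> (complex ^ 'n) bv \<Rightarrow> (real \<Rightarrow>\<^sub>C (complex ^ 'n)) \<Rightarrow> complex" where
  "pairing h f \<phi> = (THE I. has_RS_integral row_col f (\<lambda>\<theta>. \<phi> (-\<theta>)) {0..h} I)"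

definition value0 :: "'a::real_normed_vector bv \<Rightarrow> 'a" where
  "value0 f = Lim (at_right 0) f"

definition is_star_deriv :: "real \<Rightarrow> (complex ^ 'n) bv \<Rightarrow> (complex ^ 'n) bv \<Rightarrow> bool" where
  "is_star_deriv h f g \<longleftrightarrow> g \<in> star_space h \<and> g h = 0 \<and>
     (\<forall>\<theta>\<in>{0<..h}. f \<theta> = value0 f + integral {0..\<theta>} g)"

definition dom_A0_star :: "real \<Rightarrow> (complex ^ 'n) bv set" where
  "dom_A0_star h = {f \<in> star_space h. \<exists>g. is_star_deriv h f g}"

definition star_deriv :: "real \<Rightarrow> (complex ^ 'n) bv \<Rightarrow> (complex ^ 'n) bv" where
  "star_deriv h f = (THE g. is_star_deriv h f g)"

definition sun_space :: "real \<Rightarrow> (complex ^ 'n) bv set" where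
  "sun_space h = closure (dom_A0_star h)"

text \<open>The integrable density \<open>g\<close> in \<open>f(\<theta>) = c + \<integral>\<^sub>0\<^sup>\<theta> g\<close>; it is determined up to a null set, which is
  immaterial in the pairing.\<close>

definition sun_density :: "real \<Rightarrow> (complex ^ 'n) bv \<Rightarrow> real \<Rightarrow> complex ^ 'n" where
  "sun_density h f = (SOME g. g absolutely_integrable_on {0..h} \<and>
     (\<forall>\<theta>\<in>{0<..h}. f \<theta> = value0 f + integral {0..\<theta>} g))"

definition represents :: "real \<Rightarrow> (real \<Rightarrow> 'a::euclidean_space) \<Rightarrow> 'a linf \<Rightarrow> bool" where
  "represents h u \<psi> \<longleftrightarrow> (AE \<theta> in lborel. \<theta> \<in> {-h..0} \<longrightarrow> rep_linf \<psi> \<theta> = u \<theta>)"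

definition sunstar_space :: "real \<Rightarrow> ((complex ^ 'n) \<times> (complex ^ 'n) linf) set" where
  "sunstar_space h = {(a, \<psi>). AE \<theta> in lborel. \<theta> \<notin> {-h..0} \<longrightarrow> rep_linf \<psi> \<theta> = 0}"

definition sun_pairing ::
  "real \<Rightarrow> (complex ^ 'n) \<times> (complex ^ 'n) linf \<Rightarrow> (complex ^ 'n) bv \<Rightarrow> complex" where
  "sun_pairing h v f = row_col (value0 f) (fst v) +
     integral {0..h} (\<lambda>\<theta>. row_col (sun_density h f \<theta>) (rep_linf (snd v) (-\<theta>)))"

section \<open>The operators at a fixed time\<close>

text \<open>In this section \<open>L\<close> and \<open>Z\<close> stand for \<open>L(\<tau>)\<close> and \<open>\<zeta>(\<tau>, \<cdot>)\<close>.\<close>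

definition complexify ::
  "real \<Rightarrow> ((real \<Rightarrow>\<^sub>C (real ^ 'n)) \<Rightarrow> real ^ 'n) \<Rightarrow> (real \<Rightarrow> complex ^ 'n) \<Rightarrow> complex ^ 'n" where
  "complexify h L \<phi> = (\<chi> i. Complex (L (hist h (\<lambda>\<theta>. \<chi> j. Re (\<phi> \<theta> $ j)) 0) $ i)
                                  (L (hist h (\<lambda>\<theta>. \<chi> j. Im (\<phi> \<theta> $ j)) 0) $ i))"

definition dom_A ::
  "real \<Rightarrow> ((real \<Rightarrow>\<^sub>C (real ^ 'n)) \<Rightarrow> real ^ 'n) \<Rightarrow> (real \<Rightarrow>\<^sub>C (complex ^ 'n)) set" where
  "dom_A h L = {\<phi> \<in> state_space h. \<exists>d. continuous_on {-h..0} d \<and>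
     (\<forall>\<theta>\<in>{-h..0}. (\<phi> has_vector_derivative d \<theta>) (at \<theta> within {-h..0})) \<and>
     d 0 = complexify h L \<phi>}"

definition op_A :: "real \<Rightarrow> (real \<Rightarrow>\<^sub>C (complex ^ 'n)) \<Rightarrow> (real \<Rightarrow>\<^sub>C (complex ^ 'n))" where
  "op_A h \<phi> = hist h (\<lambda>\<theta>. vector_derivative \<phi> (at \<theta> within {-h..0})) 0"

definition row_kernel ::
  "real \<Rightarrow> (real \<Rightarrow> real ^ 'n ^ 'n) \<Rightarrow> complex ^ 'n \<Rightarrow> (complex ^ 'n) bv" where
  "row_kernel h Z c = Bv (\<lambda>\<theta>. c v* map_matrix complex_of_real (Z (max 0 (min h \<theta>))))"

definition op_A_star ::
  "real \<Rightarrow> (real \<Rightarrow> real ^ 'n ^ 'n) \<Rightarrow> (complex ^ 'n) bv \<Rightarrow> (complex ^ 'n) bv" where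
  "op_A_star h Z f = star_deriv h f + row_kernel h Z (value0 f)"

text \<open>With \<open>(c, g)\<close> identified with \<open>f\<close>, the element \<open>g + c \<zeta>\<close> is \<open>op_A_star h Z f\<close>.\<close>

definition dom_A_sun :: "real \<Rightarrow> (real \<Rightarrow> real ^ 'n ^ 'n) \<Rightarrow> (complex ^ 'n) bv set" where
  "dom_A_sun h Z = {f \<in> dom_A0_star h. op_A_star h Z f \<in> sun_space h}"

definition op_A_sun ::
  "real \<Rightarrow> (real \<Rightarrow> real ^ 'n ^ 'n) \<Rightarrow> (complex ^ 'n) bv \<Rightarrow> (complex ^ 'n) bv" where
  "op_A_sun h Z f = op_A_star h Z f"

definition lipschitz_rep ::
  "real \<Rightarrow> (complex ^ 'n) \<times> (complex ^ 'n) linf \<Rightarrow> (real \<Rightarrow> complex ^ 'n) \<Rightarrow> bool" where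
  "lipschitz_rep h v u \<longleftrightarrow> (\<exists>C. C-lipschitz_on {-h..0} u) \<and> represents h u (snd v) \<and> u 0 = fst v"

definition dom_A_sunstar :: "real \<Rightarrow> ((complex ^ 'n) \<times> (complex ^ 'n) linf) set" where
  "dom_A_sunstar h = {v \<in> sunstar_space h. \<exists>u. lipschitz_rep h v u}"

text \<open>The Lipschitz representative is unique on \<open>[-h, 0]\<close>; its derivative exists almost everywhere
  and is an element of \<open>L\<^sup>\<infinity>\<close>.\<close>

definition op_A_sunstar ::
  "real \<Rightarrow> ((real \<Rightarrow>\<^sub>C (real ^ 'n)) \<Rightarrow> real ^ 'n) \<Rightarrow>
   (complex ^ 'n) \<times> (complex ^ 'n) linf \<Rightarrow> (complex ^ 'n) \<times> (complex ^ 'n) linf" where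
  "op_A_sunstar h L v = (let u = (SOME u. lipschitz_rep h v u) in
     (complexify h L u,
      THE \<psi>. (0, \<psi>) \<in> sunstar_space h \<and>
        (AE \<theta> in lborel. \<theta> \<in> {-h<..<0} \<longrightarrow> (u has_vector_derivative rep_linf \<psi> \<theta>) (at \<theta>))))"

section \<open>The operators on periodic functions\<close>

definition C_per :: "real \<Rightarrow> 'a::real_normed_vector set \<Rightarrow> (real \<Rightarrow> 'a) set" where
  "C_per T E = {u. continuous_on UNIV u \<and> (\<forall>\<tau>. u \<tau> \<in> E) \<and> (\<forall>\<tau>. u (\<tau> + T) = u \<tau>)}"

definition C1_per :: "real \<Rightarrow> 'a::real_normed_vector set \<Rightarrow> (real \<Rightarrow> 'a) set" where
  "C1_per T E = {u \<in> C_per T E. u C1_differentiable_on UNIV}"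

definition dom_cA ::
  "real \<Rightarrow> real \<Rightarrow> (real \<Rightarrow> (real \<Rightarrow>\<^sub>C (real ^ 'n)) \<Rightarrow> real ^ 'n) \<Rightarrow> (real \<Rightarrow> (real \<Rightarrow>\<^sub>C (complex ^ 'n))) set" where
  "dom_cA h T L = {u \<in> C1_per T (state_space h). \<forall>\<tau>. u \<tau> \<in> dom_A h (L \<tau>)}"

definition cA :: "real \<Rightarrow> (real \<Rightarrow> (real \<Rightarrow>\<^sub>C (complex ^ 'n))) \<Rightarrow> real \<Rightarrow> (real \<Rightarrow>\<^sub>C (complex ^ 'n))" where
  "cA h u = (\<lambda>\<tau>. op_A h (u \<tau>) - vector_derivative u (at \<tau>))"

definition dom_cA_star :: "real \<Rightarrow> real \<Rightarrow> (real \<Rightarrow> (complex ^ 'n) bv) set" where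
  "dom_cA_star h T = {u \<in> C1_per T (star_space h). \<forall>\<tau>. u \<tau> \<in> dom_A0_star h}"

definition cA_star ::
  "real \<Rightarrow> (real \<Rightarrow> real \<Rightarrow> real ^ 'n ^ 'n) \<Rightarrow> (real \<Rightarrow> (complex ^ 'n) bv) \<Rightarrow> real \<Rightarrow> (complex ^ 'n) bv" where
  "cA_star h \<zeta> u = (\<lambda>\<tau>. op_A_star h (\<zeta> \<tau>) (u \<tau>) + vector_derivative u (at \<tau>))"

definition dom_cA_sun ::
  "real \<Rightarrow> real \<Rightarrow> (real \<Rightarrow> real \<Rightarrow> real ^ 'n ^ 'n) \<Rightarrow> (real \<Rightarrow> (complex ^ 'n) bv) set" where
  "dom_cA_sun h T \<zeta> = {u \<in> C1_per T (sun_space h). \<forall>\<tau>. u \<tau> \<in> dom_A_sun h (\<zeta> \<tau>)}"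

definition cA_sun ::
  "real \<Rightarrow> (real \<Rightarrow> real \<Rightarrow> real ^ 'n ^ 'n) \<Rightarrow> (real \<Rightarrow> (complex ^ 'n) bv) \<Rightarrow> real \<Rightarrow> (complex ^ 'n) bv" where
  "cA_sun h \<zeta> u = (\<lambda>\<tau>. op_A_sun h (\<zeta> \<tau>) (u \<tau>) + vector_derivative u (at \<tau>))"

definition dom_cA_sunstar :: "real \<Rightarrow> real \<Rightarrow> (real \<Rightarrow> (complex ^ 'n) \<times> (complex ^ 'n) linf) set" where
  "dom_cA_sunstar h T = {u \<in> C1_per T (sunstar_space h). \<forall>\<tau>. u \<tau> \<in> dom_A_sunstar h}"

definition cA_sunstar ::
  "real \<Rightarrow> (real \<Rightarrow> (real \<Rightarrow>\<^sub>C (real ^ 'n)) \<Rightarrow> real ^ 'n) \<Rightarrow>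
   (real \<Rightarrow> (complex ^ 'n) \<times> (complex ^ 'n) linf) \<Rightarrow> real \<Rightarrow> (complex ^ 'n) \<times> (complex ^ 'n) linf" where
  "cA_sunstar h L u = (\<lambda>\<tau>. op_A_sunstar h (L \<tau>) (u \<tau>) - vector_derivative u (at \<tau>))"

definition pairing_per ::
  "real \<Rightarrow> real \<Rightarrow> (real \<Rightarrow> (complex ^ 'n) bv) \<Rightarrow> (real \<Rightarrow> (real \<Rightarrow>\<^sub>C (complex ^ 'n))) \<Rightarrow> complex" where
  "pairing_per h T f u = integral {0..T} (\<lambda>\<tau>. pairing h (f \<tau>) (u \<tau>))"

definition sun_pairing_per ::
  "real \<Rightarrow> real \<Rightarrow> (real \<Rightarrow> (complex ^ 'n) \<times> (complex ^ 'n) linf) \<Rightarrow> (real \<Rightarrow> (complex ^ 'n) bv) \<Rightarrow> complex" where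
  "sun_pairing_per h T v f = integral {0..T} (\<lambda>\<tau>. sun_pairing h (v \<tau>) (f \<tau>))"

section \<open>Uniqueness of operators\<close>

text \<open>A continuously differentiable \<open>u\<close> with values in the domains of \<open>A(\<tau>)\<close> need not have a
  continuous image \<open>\<tau> \<mapsto> A(\<tau>) u(\<tau>)\<close>, since differentiability of \<open>u\<close> is not required in the graph norm;
  likewise for the three other operators. \<open>part D R A\<close> is the domain of \<open>A\<close> as an operator with
  values in \<open>R\<close>.\<close>

definition part :: "'a set \<Rightarrow> 'b set \<Rightarrow> ('a \<Rightarrow> 'b) \<Rightarrow> 'a set" where
  "part D R A = {u \<in> D. A u \<in> R}"

definition linear_operator ::
  "(complex \<Rightarrow> 'a::real_normed_vector \<Rightarrow> 'a) \<Rightarrow> (real \<Rightarrow> 'a) set \<Rightarrow> (real \<Rightarrow> 'a) set \<Rightarrow>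
   ((real \<Rightarrow> 'a) \<Rightarrow> real \<Rightarrow> 'a) \<Rightarrow> bool" where
  "linear_operator smul D R B \<longleftrightarrow>
     (\<forall>u\<in>D. B u \<in> R) \<and>
     (\<forall>u\<in>D. \<forall>v\<in>D. (\<lambda>\<tau>. u \<tau> + v \<tau>) \<in> D \<and> B (\<lambda>\<tau>. u \<tau> + v \<tau>) = (\<lambda>\<tau>. B u \<tau> + B v \<tau>)) \<and>
     (\<forall>c. \<forall>u\<in>D. (\<lambda>\<tau>. smul c (u \<tau>)) \<in> D \<and> B (\<lambda>\<tau>. smul c (u \<tau>)) = (\<lambda>\<tau>. smul c (B u \<tau>)))"

definition unique_linear_operator ::
  "(complex \<Rightarrow> 'a::real_normed_vector \<Rightarrow> 'a) \<Rightarrow> (real \<Rightarrow> 'a) set \<Rightarrow> (real \<Rightarrow> 'a) set \<Rightarrow>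
   (((real \<Rightarrow> 'a) \<Rightarrow> real \<Rightarrow> 'a) \<Rightarrow> bool) \<Rightarrow> ((real \<Rightarrow> 'a) \<Rightarrow> real \<Rightarrow> 'a) \<Rightarrow> bool" where
  "unique_linear_operator smul D R P A \<longleftrightarrow>
     linear_operator smul D R A \<and> P A \<and>
     (\<forall>B. linear_operator smul D R B \<and> P B \<longrightarrow> (\<forall>u\<in>D. B u = A u))"

end

theory Submission
  imports Defs
begin

text \<open>
  Both identities hold at each time before they hold over a period. For fixed \<open>\<tau>\<close>, partial integration
  in the Riemann-Stieltjes integral shows that \<open>A_star(\<tau>)\<close> is dual to \<open>A(\<tau>)\<close>: the boundary condition
  \<open>\<phi>'(0) = L(\<tau>) \<phi>\<close> matches the kernel part \<open>c \<zeta>(\<tau>, _)\<close> of the adjoint (\<open>pairing_op_A_star\<close>). The second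
  pair is dual for the same reason, once a Lipschitz function is known to be the primitive of its
  almost everywhere derivative (\<open>lipschitz_has_derivative\<close>) and the elements of the sun dual are known
  to consist of a jump at \<open>0\<close> and an integrable density (\<open>sun_space_has_density\<close>). The first fact is
  derived from the theorems of Radon-Nikodym and Lebesgue, the second from the completeness of \<open>L\<^sup>1\<close>.
  The integrands of the two sides of each identity then differ by \<open>d/d\<tau>\<close> of the pairing of two
  periodic functions, and the integral of this derivative over a period is zero. If one of
  the two integrands is not integrable then neither is the other, and both integrals have the same
  default value.

  For uniqueness, let \<open>B\<close> be another operator with the duality property. For each \<open>u\<close> in its domain the
  continuous periodic function \<open>B u - A u\<close>, where \<open>A\<close> is the adjoint in question, annihilates the domain
  of the predual operator. So it suffices that these domains are large enough to separate continuous
  periodic functions with values in the dual space. The domain conditions depend on time through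
  \<open>L(\<tau>)\<close>, and the test functions must be \<open>C\<^sup>1\<close> in time with a continuous image. Here the smoothness
  of \<open>F\<close> enters: \<open>\<tau> \<mapsto> L(\<tau>)\<close> is \<open>C\<^sup>1\<close> in the operator norm (\<open>linearisation_C1\<close>).

  For the first pair, a product \<open>w(\<tau>) \<psi>\<close> of a scalar weight and a smooth profile is forced into the domain
  by adding \<open>\<epsilon> sin(\<theta>/\<epsilon>) c(\<tau>)\<close>, where \<open>c(\<tau>)\<close> solves a linear equation close to the identity
  (\<open>dom_cA_test_function\<close>); the correction disappears as \<open>\<epsilon>\<close> tends to \<open>0\<close>. For the second pair, primitives of
  functions that vanish to second order at both ends of the interval belong to the domain for every
  \<open>\<tau>\<close> and detect the \<open>L\<^sup>\<infinity>\<close> component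
  (\<open>sunstar_density_zero\<close>). The component in \<open>\<real>\<^sup>n\<close> is detected by the elements with derivative
  \<open>c (\<zeta>(\<tau>, h) - \<zeta>(\<tau>, _))\<close>, whose images are pure jumps (\<open>is_star_deriv_kernel_primitive\<close>). In both
  cases the weight \<open>w\<close> is arbitrary, which localises the result at each \<open>\<tau>\<close>
  (\<open>periodic_zero_if_orthogonal\<close>).
\<close>

section \<open>The Riemann-Stieltjes integral as a limit\<close>

text \<open>Riemann-Stieltjes sums converge along this filter; so uniqueness, linearity and uniform limits of
  the integral come from the general theory of limits.\<close>

definition mesh_filter :: "real set \<Rightarrow> (real \<times> real set) set filter" where
  "mesh_filter S = (INF d\<in>{0<..}. principal {p. p tagged_division_of S \<and> (\<lambda>x. ball x d) fine p})"

definition RS_sum ::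
  "('a::real_normed_vector \<Rightarrow> 'b \<Rightarrow> 'c::real_normed_vector) \<Rightarrow> (real \<Rightarrow> 'a) \<Rightarrow> (real \<Rightarrow> 'b) \<Rightarrow>
   (real \<times> real set) set \<Rightarrow> 'c" where
  "RS_sum prd f \<phi> p = (\<Sum>(x, K)\<in>p. prd (f (Sup K) - f (Inf K)) (\<phi> x))"

lemma eventually_mesh_filter:
  "eventually P (mesh_filter S) \<longleftrightarrow>
     (\<exists>d>0. \<forall>p. p tagged_division_of S \<and> (\<lambda>x. ball x d) fine p \<longrightarrow> P p)"
proof -
  have "\<exists>x\<in>{0<..}. principal {p. p tagged_division_of S \<and> (\<lambda>xa. ball xa x) fine p}
      \<le> inf (principal {p. p tagged_division_of S \<and> (\<lambda>x. ball x a) fine p})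
           (principal {p. p tagged_division_of S \<and> (\<lambda>x. ball x b) fine p})"
    if "a \<in> {0<..}" "b \<in> {0<..}" for a b :: real
    using that by (intro bexI[of _ "min a b"]) (fastforce simp: fine_def)+
  then show ?thesis
    unfolding mesh_filter_def by (subst eventually_INF_base) (auto simp: eventually_principal)
qed

lemma has_RS_integral_iff_tendsto:
  "has_RS_integral prd f \<phi> S I \<longleftrightarrow> (RS_sum prd f \<phi> \<longlongrightarrow> I) (mesh_filter S)"
  unfolding has_RS_integral_def tendsto_iff eventually_mesh_filter RS_sum_def dist_norm ..

lemma mesh_filter_ne_bot: "mesh_filter {a..b::real} \<noteq> bot"
proof
  assume "mesh_filter {a..b} = bot"
  then have "eventually (\<lambda>p. False) (mesh_filter {a..b})"
    by (simp only: eventually_bot)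
  then have "\<exists>d>0. \<forall>p. \<not> (p tagged_division_of {a..b} \<and> (\<lambda>x. ball x d) fine p)"
    by (simp only: eventually_mesh_filter not_def)
  then obtain d where d: "d > 0"
    "\<forall>p. \<not> (p tagged_division_of {a..b} \<and> (\<lambda>x. ball x d) fine p)"
    by (elim exE conjE)
  show False
    by (rule fine_division_exists_real[OF gauge_ball[OF d(1)], of a b]) (use d(2) in blast)
qed

lemma has_RS_integral_unique:
  assumes "has_RS_integral prd f \<phi> {a..b} I" "has_RS_integral prd f \<phi> {a..b} J"
  shows "I = J"
  using assms tendsto_unique[OF mesh_filter_ne_bot] unfolding has_RS_integral_iff_tendsto by blast

lemma tagged_division_interval_cases:
  assumes "p tagged_division_of {a..b::real}" "(x, K) \<in> p"
  obtains u v where "K = {u..v}" "a \<le> u" "u \<le> x" "x \<le> v" "v \<le> b" "Inf K = u" "Sup K = v"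
proof -
  obtain u v where "K = cbox u v"
    using tagged_division_ofD(4)[OF assms] by blast
  moreover have "x \<in> K" "K \<subseteq> {a..b}"
    using tagged_division_ofD(2,3)[OF assms] by auto
  ultimately show ?thesis
    using that[of u v] by auto
qed

lemma RS_sum_cong:
  assumes "p tagged_division_of {a..b}"
    and "\<And>u v x. a \<le> u \<Longrightarrow> u \<le> x \<Longrightarrow> x \<le> v \<Longrightarrow> v \<le> b \<Longrightarrow>
           prd (f v - f u) (\<phi> x) = prd' (f' v - f' u) (\<phi>' x)"
  shows "RS_sum prd f \<phi> p = RS_sum prd' f' \<phi>' p"
  unfolding RS_sum_def
proof (rule sum.cong[OF refl], clarify)
  fix x K assume "(x, K) \<in> p"
  then show "prd (f (Sup K) - f (Inf K)) (\<phi> x) = prd' (f' (Sup K) - f' (Inf K)) (\<phi>' x)"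
    by (elim tagged_division_interval_cases[OF assms(1)]) (simp add: assms(2))
qed

lemma has_RS_integral_transfer:
  assumes "has_RS_integral prd f \<phi> {a..b} I"
    and "\<And>u v x. a \<le> u \<Longrightarrow> u \<le> x \<Longrightarrow> x \<le> v \<Longrightarrow> v \<le> b \<Longrightarrow>
           prd (f v - f u) (\<phi> x) = prd' (f' v - f' u) (\<phi>' x)"
  shows "has_RS_integral prd' f' \<phi>' {a..b} I"
proof -
  have "eventually (\<lambda>p. RS_sum prd f \<phi> p = RS_sum prd' f' \<phi>' p) (mesh_filter {a..b})"
    unfolding eventually_mesh_filter by (intro exI[of _ 1]) (auto intro!: RS_sum_cong assms(2))
  then show ?thesis
    using assms(1) unfolding has_RS_integral_iff_tendsto by (simp add: tendsto_cong)
qed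

lemma has_RS_integral_linear:
  assumes "has_RS_integral prd f \<phi> S I" "bounded_linear A"
  shows "has_RS_integral (\<lambda>x y. A (prd x y)) f \<phi> S (A I)"
proof -
  have "RS_sum (\<lambda>x y. A (prd x y)) f \<phi> = (\<lambda>p. A (RS_sum prd f \<phi> p))"
    unfolding RS_sum_def
    by (simp add: linear_sum[OF bounded_linear.linear[OF assms(2)]] case_prod_beta fun_eq_iff)
  then show ?thesis
    using bounded_linear.tendsto[OF assms(2) assms(1)[unfolded has_RS_integral_iff_tendsto]]
    unfolding has_RS_integral_iff_tendsto by (simp only:)
qed

lemma has_RS_integral_add:
  assumes "has_RS_integral p1 f1 \<phi>1 {a..b} I1" "has_RS_integral p2 f2 \<phi>2 {a..b} I2"
    and "\<And>u v x. a \<le> u \<Longrightarrow> u \<le> x \<Longrightarrow> x \<le> v \<Longrightarrow> v \<le> b \<Longrightarrow>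
           p1 (f1 v - f1 u) (\<phi>1 x) + p2 (f2 v - f2 u) (\<phi>2 x) = p3 (f3 v - f3 u) (\<phi>3 x)"
  shows "has_RS_integral p3 f3 \<phi>3 {a..b} (I1 + I2)"
proof -
  have "RS_sum p1 f1 \<phi>1 p + RS_sum p2 f2 \<phi>2 p = RS_sum p3 f3 \<phi>3 p"
    if "p tagged_division_of {a..b}" for p
    unfolding RS_sum_def sum.distrib[symmetric]
  proof (rule sum.cong[OF refl], clarify)
    fix x K assume "(x, K) \<in> p"
    then show "p1 (f1 (Sup K) - f1 (Inf K)) (\<phi>1 x) + p2 (f2 (Sup K) - f2 (Inf K)) (\<phi>2 x)
        = p3 (f3 (Sup K) - f3 (Inf K)) (\<phi>3 x)"
      by (elim tagged_division_interval_cases[OF that]) (simp add: assms(3))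
  qed
  then have "eventually (\<lambda>p. RS_sum p1 f1 \<phi>1 p + RS_sum p2 f2 \<phi>2 p = RS_sum p3 f3 \<phi>3 p)
      (mesh_filter {a..b})"
    unfolding eventually_mesh_filter by (intro exI[of _ 1]) auto
  then show ?thesis
    using tendsto_add[OF assms(1,2)[unfolded has_RS_integral_iff_tendsto]]
    unfolding has_RS_integral_iff_tendsto by (simp add: tendsto_cong)
qed

text \<open>The basic estimate of Riemann-Stieltjes sums: bounds of the summands by increments of a fixed
  function telescope. That function is the variation of the integrator or an indefinite integral.\<close>

lemma tagged_sum_norm_le:
  fixes a b e :: real and V :: "real \<Rightarrow> real"
  assumes "p tagged_division_of {a..b}" "a \<le> b"
    and "\<And>x u v. (x, {u..v}) \<in> p \<Longrightarrow> a \<le> u \<Longrightarrow> u \<le> x \<Longrightarrow> x \<le> v \<Longrightarrow> v \<le> b \<Longrightarrow>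
           norm (g x {u..v}) \<le> e * (V v - V u)"
  shows "norm (\<Sum>(x, K)\<in>p. g x K) \<le> e * (V b - V a)"
proof -
  have "norm (\<Sum>(x, K)\<in>p. g x K) \<le> (\<Sum>(x, K)\<in>p. e * (V (Sup K) - V (Inf K)))"
  proof (rule sum_norm_le, clarify)
    fix x K assume xK: "(x, K) \<in> p"
    show "norm (g x K) \<le> e * (V (Sup K) - V (Inf K))"
      by (rule tagged_division_interval_cases[OF assms(1) xK]) (use assms(3) xK in auto)
  qed
  also have "\<dots> = e * (\<Sum>(x, K)\<in>p. V (Sup K) - V (Inf K))"
    by (simp add: sum_distrib_left case_prod_beta)
  also have "\<dots> = e * (V b - V a)"
    by (simp only: additive_tagged_division_1[OF assms(2,1)])
  finally show ?thesis .
qed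

section \<open>Functions of bounded variation\<close>

abbreviation variation_to :: "'a::real_normed_vector bv \<Rightarrow> real \<Rightarrow> real" where
  "variation_to f x \<equiv> total_variation {..x} (apply_bv f)"

lemma bounded_variation_apply_bv: "bounded_variation_on UNIV (apply_bv f)"
  using apply_bv by blast

lemma apply_bv_0 [simp]: "apply_bv f 0 = 0"
  using apply_bv by blast

lemma norm_bv_eq: "norm f = total_variation UNIV (apply_bv f)"
  by (rule norm_bv.rep_eq)

lemma variation_sums_le:
  assumes "s \<in> variation_sums S (apply_bv f)"
  shows "s \<le> norm f"
  using assms variation_le_total[OF bounded_variation_apply_bv] unfolding variation_sums_def norm_bv_eq
  by blast

lemma variation_sums_zero: "0 \<in> variation_sums {..x} f" for x :: real
  using variation_sums_I[of "\<lambda>_. x" "{..x}" f 0] by (auto simp: mono_def)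

lemma variation_to_nonneg: "0 \<le> variation_to f x"
  unfolding total_variation_def
  by (rule cSup_upper[OF variation_sums_zero]) (auto simp: bdd_above_def intro: variation_sums_le)

lemma variation_to_le: "variation_to f x \<le> norm f"
  unfolding total_variation_def using variation_sums_zero[of x f]
  by (intro cSup_least) (auto intro: variation_sums_le)

lemma variation_to_step:
  fixes f :: "'a::real_normed_vector bv"
  assumes "x \<le> y"
  shows "norm (f y - f x) \<le> variation_to f y - variation_to f x"
proof -
  have "s \<le> variation_to f y - norm (f y - f x)" if s: "s \<in> variation_sums {..x} f" for s
  proof -
    obtain m t where t: "s = (\<Sum>i<m. norm (f (t (Suc i)) - f (t i)))" "mono t" "range t \<subseteq> {..x}"
      using s unfolding variation_sums_def by blast
    \<comment> \<open>Continue the chosen points by \<open>x\<close> and then \<open>y\<close>.\<close>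
    define t' where "t' i = (if i \<le> m then t i else if i = Suc m then x else y)" for i
    have tx: "t i \<le> x" for i using t(3) by auto
    have ti: "t i \<le> y" for i using tx[of i] assms by linarith
    have mono: "mono t'"
      using t(2) tx ti assms unfolding t'_def mono_def by auto
    have range: "range t' \<subseteq> {..y}"
      using assms ti unfolding t'_def by auto
    have "s = (\<Sum>i<m. norm (f (t' (Suc i)) - f (t' i)))"
      unfolding t(1) by (intro sum.cong) (auto simp: t'_def)
    then have "s + norm (f y - f x) \<le> (\<Sum>i<Suc (Suc m). norm (f (t' (Suc i)) - f (t' i)))"
      by (simp add: t'_def)
    also have "\<dots> \<le> variation_to f y"
      unfolding total_variation_def
      by (rule cSup_upper[OF variation_sums_I[OF mono range]])
        (auto simp: bdd_above_def intro: variation_sums_le)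
    finally show ?thesis by simp
  qed
  then have "variation_to f x \<le> variation_to f y - norm (f y - f x)"
    unfolding total_variation_def[of "{..x}"] using variation_sums_zero[of x f]
    by (intro cSup_least) auto
  then show ?thesis by simp
qed

lemma variation_to_mono: "x \<le> y \<Longrightarrow> variation_to f x \<le> variation_to f y"
  using variation_to_step[of x y f] norm_ge_zero[of "apply_bv f y - apply_bv f x"] by linarith

lemma variation_to_increment_le: "variation_to f y - variation_to f x \<le> norm f"
  using variation_to_le[where f=f and x=y] variation_to_nonneg[where f=f and x=x] by linarith

lemma norm_apply_bv_diff_le: "norm (apply_bv f x - apply_bv f y) \<le> norm f"
proof (cases "x \<le> y")
  case True
  then show ?thesis
    using variation_to_step[of x y f] variation_to_increment_le[where f=f and x=x and y=y] by (simp add: norm_minus_commute)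
next
  case False
  then show ?thesis
    using variation_to_step[of y x f] variation_to_increment_le[where f=f and x=y and y=x] by simp
qed

lemma norm_apply_bv_le: "norm (apply_bv f x) \<le> norm f"
  using norm_apply_bv_diff_le[of f x 0] by simp

lemma bounded_linear_apply_bv: "bounded_linear (\<lambda>f. apply_bv f x)"
  by (rule bounded_linear_intro[where K=1])
    (auto simp: plus_bv.rep_eq scaleR_bv.rep_eq norm_apply_bv_le)

lemma bv_eqI: "(\<And>x. apply_bv f x = apply_bv g x) \<Longrightarrow> f = g"
  by (simp add: apply_bv_inject[symmetric] fun_eq_iff)

lemma apply_Bv: "f 0 = 0 \<Longrightarrow> bounded_variation_on UNIV f \<Longrightarrow> apply_bv (Bv f) = f"
  by (simp add: Bv_inverse)

text \<open>Each component is a difference of two monotone functions: the variation function, and the variation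
  function minus the component.\<close>

lemma borel_measurable_apply_bv [measurable]:
  fixes f :: "'a::euclidean_space bv"
  shows "apply_bv f \<in> borel_measurable borel"
proof (subst borel_measurable_euclidean_space, intro ballI)
  fix i :: 'a assume i: "i \<in> Basis"
  let ?V = "variation_to f"
  have "mono ?V" by (auto simp: mono_def variation_to_mono)
  moreover have "mono (\<lambda>x. ?V x - f x \<bullet> i)"
  proof (rule monoI)
    fix x y :: real assume "x \<le> y"
    then have "norm (f y - f x) \<le> ?V y - ?V x" by (rule variation_to_step)
    moreover have "f y \<bullet> i - f x \<bullet> i \<le> norm (f y - f x)"
      using Basis_le_norm[OF i, of "f y - f x"] by (simp add: inner_diff_left)
    ultimately show "?V x - f x \<bullet> i \<le> ?V y - f y \<bullet> i" by linarith
  qed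
  ultimately have "(\<lambda>x. ?V x - (?V x - f x \<bullet> i)) \<in> borel_measurable borel"
    by (intro borel_measurable_diff borel_measurable_mono)
  then show "(\<lambda>x. f x \<bullet> i) \<in> borel_measurable borel" by simp
qed

lemma bounded_apply_bv: "bounded (apply_bv f ` S)"
  using norm_apply_bv_le by (auto simp: bounded_iff)

lemma absolutely_integrable_apply_bv:
  fixes f :: "'a::euclidean_space bv"
  shows "apply_bv f absolutely_integrable_on {a..b}"
  by (rule measurable_bounded_by_integrable_imp_absolutely_integrable[where g="\<lambda>_. norm f"])
    (auto intro: norm_apply_bv_le simp: measurable_restrict_space1 measurable_completion)

text \<open>Since the variation function is monotone and bounded, a function of bounded variation with
  values in a complete space satisfies the Cauchy criterion from the right.\<close>

lemma value0_tendsto: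
  fixes f :: "'a::banach bv"
  shows "(apply_bv f \<longlongrightarrow> value0 f) (at_right 0)"
proof -
  define m where "m = Inf (variation_to f ` {0<..})"
  have bdd: "bdd_below (variation_to f ` {0<..})"
    using variation_to_nonneg by (auto simp: bdd_below_def)
  have near: "\<exists>d>0. \<forall>x y. 0 < x \<longrightarrow> x < d \<longrightarrow> 0 < y \<longrightarrow> y < d \<longrightarrow> dist (f x) (f y) < e" if "e > 0" for e
  proof -
    have "m < m + e" using that by simp
    then obtain d where d: "d > 0" "variation_to f d < m + e"
      unfolding m_def by (subst (asm) cInf_less_iff) (auto intro: bdd)
    have "dist (f x) (f y) < e" if xy: "0 < x" "x \<le> y" "y < d" for x y
    proof -
      have "m \<le> variation_to f x"
        unfolding m_def using bdd xy by (intro cInf_lower) auto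
      moreover have "variation_to f y \<le> variation_to f d"
        using xy by (intro variation_to_mono) auto
      ultimately show ?thesis
        using variation_to_step[OF xy(2), of f] d(2) by (simp add: dist_norm norm_minus_commute)
    qed
    then have "\<forall>x y. 0 < x \<longrightarrow> x < d \<longrightarrow> 0 < y \<longrightarrow> y < d \<longrightarrow> dist (f x) (f y) < e"
      by (metis dist_commute linear)
    with d(1) show ?thesis by blast
  qed
  have "\<exists>l. (apply_bv f \<longlongrightarrow> l) (at_right 0)"
  proof -
    have "cauchy_filter (filtermap f (at_right 0))"
      unfolding cauchy_filter_metric
    proof (intro allI impI)
      fix e :: real assume "e > 0"
      then obtain d where d: "d > 0"
        "\<And>x y. 0 < x \<Longrightarrow> x < d \<Longrightarrow> 0 < y \<Longrightarrow> y < d \<Longrightarrow> dist (f x) (f y) < e"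
        using near by blast
      have "eventually (\<lambda>z. z \<in> f ` {0<..<d}) (filtermap f (at_right 0))"
        unfolding eventually_filtermap eventually_at_right_field using d(1) by auto
      then show "\<exists>P. eventually P (filtermap f (at_right 0)) \<and>
          (\<forall>x y. P x \<and> P y \<longrightarrow> dist x y < e)"
        using d(2) by (intro exI[of _ "\<lambda>z. z \<in> f ` {0<..<d}"]) auto
    qed
    then obtain l where "filtermap f (at_right 0) \<le> nhds l"
      using complete_UNIV[where 'a='a, unfolded complete_uniform, rule_format,
          of "filtermap f (at_right 0)"]
      by (auto simp: filtermap_bot_iff)
    then show ?thesis
      by (auto simp: filterlim_def)
  qed
  then show ?thesis
    unfolding value0_def using tendsto_Lim[of "at_right (0::real)" "apply_bv f"] by auto
qed

lemma value0_eqI: "(apply_bv f \<longlongrightarrow> c) (at_right 0) \<Longrightarrow> value0 f = c"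
  unfolding value0_def by (rule tendsto_Lim) auto

lemma bounded_linear_value0: "bounded_linear (value0 :: 'a::banach bv \<Rightarrow> 'a)"
proof (rule bounded_linear_intro[where K=1])
  fix f g :: "'a bv" and r :: real
  show "value0 (f + g) = value0 f + value0 g"
    by (rule value0_eqI) (simp add: plus_bv.rep_eq[abs_def] tendsto_add value0_tendsto)
  show "value0 (r *\<^sub>R f) = r *\<^sub>R value0 f"
    by (rule value0_eqI) (simp add: scaleR_bv.rep_eq[abs_def] tendsto_scaleR value0_tendsto)
  show "norm (value0 f) \<le> norm f * 1"
    unfolding mult_1_right
    by (rule tendsto_upperbound[OF tendsto_norm[OF value0_tendsto]])
      (simp_all add: norm_apply_bv_le)
qed

section \<open>Stieltjes integrals against rows of bounded variation\<close>

lemma bilinear_row_col: "bilinear row_col"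
  unfolding bilinear_def row_col_def
  by (auto intro!: linearI simp: algebra_simps sum.distrib scaleR_sum_right)

interpretation row_col: bounded_bilinear row_col
  using bilinear_row_col by (simp add: bilinear_conv_bounded_bilinear)

lemma row_col_commute: "row_col c v = row_col v c"
  by (simp add: row_col_def mult.commute)

lemma row_col_axis: "row_col (axis i 1) v = v $ i" "row_col c (axis i 1) = c $ i"
  by (simp_all add: row_col_def axis_def if_distrib if_distribR cong: if_cong)

lemma absolutely_integrable_row_col_bounded_left:
  assumes "f \<in> borel_measurable (lebesgue_on {a..b})" "bounded (f ` {a..b})"
    "g absolutely_integrable_on {a..b}"
  shows "(\<lambda>s. row_col (f s) (g s)) absolutely_integrable_on {a..b::real}"
  by (rule absolutely_integrable_bounded_measurable_product[OF bilinear_row_col]) (use assms in auto)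

lemma absolutely_integrable_row_col_bounded_right:
  assumes "f \<in> borel_measurable (lebesgue_on {a..b})" "bounded (f ` {a..b})"
    "g absolutely_integrable_on {a..b}"
  shows "(\<lambda>s. row_col (g s) (f s)) absolutely_integrable_on {a..b::real}"
  using absolutely_integrable_row_col_bounded_left[OF assms] by (simp add: row_col_commute)

lemma bv_measurable_on: "apply_bv f \<in> borel_measurable (lebesgue_on {a..b})"
  for f :: "'a::euclidean_space bv"
  by (simp add: measurable_restrict_space1 measurable_completion)

lemma fine_diameter:
  assumes "(\<lambda>x. ball x d) fine p" "(x, {u..v}) \<in> p" "u \<le> x" "x \<le> v" "s \<in> {u..v}"
  shows "\<bar>x - s\<bar> < d" "v - u < 2 * d"
proof -
  have sub: "{u..v} \<subseteq> ball x d"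
    using fineD[OF assms(1,2)] by simp
  then show "\<bar>x - s\<bar> < d"
    using assms(5) by (auto simp: dist_real_def)
  have "u \<in> ball x d" "v \<in> ball x d"
    using subsetD[OF sub, of u] subsetD[OF sub, of v] assms(3,4) by simp_all
  then show "v - u < 2 * d"
    by (auto simp: dist_real_def)
qed

text \<open>Integration by parts, for an integrand that is the primitive of a bounded function. On a
  subinterval \<open>[u, v]\<close> with tag \<open>x\<close>, the summand differs from the increment of \<open>f y\<close> minus
  \<open>\<integral> f y'\<close> by integrals of \<open>(f s - f v) y' s\<close> and \<open>(f s - f u) y' s\<close>, which are at most the
  variation of \<open>f\<close> on \<open>[u, v]\<close> times the length of the subinterval.\<close>

lemma has_RS_integral_by_parts:
  fixes f :: "(complex ^ 'n) bv" and y y' :: "real \<Rightarrow> complex ^ 'n"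
  assumes h: "0 \<le> h"
    and y': "y' absolutely_integrable_on {0..h}" "\<And>s. s \<in> {0..h} \<Longrightarrow> norm (y' s) \<le> C"
    and y: "\<And>\<theta>. \<theta> \<in> {0..h} \<Longrightarrow> y \<theta> = y 0 + integral {0..\<theta>} y'"
  shows "has_RS_integral row_col f y {0..h}
           (row_col (f h) (y h) - integral {0..h} (\<lambda>s. row_col (f s) (y' s)))"
proof -
  obtain K where K: "K > 0" "\<And>a b. norm (row_col (a::complex ^ 'n) b) \<le> norm a * norm b * K"
    using row_col.pos_bounded by blast
  have C: "0 \<le> C"
    using y'(2)[of 0] h norm_ge_zero[of "y' 0"] by (simp, linarith)
  let ?V = "variation_to f"
  let ?F = "\<lambda>s. row_col (f s) (y' s)"
  let ?I = "row_col (f h) (y h) - integral {0..h} ?F"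
  have y'_int: "y' integrable_on {u..v}" if "0 \<le> u" "v \<le> h" for u v
    using integrable_on_subinterval[OF set_lebesgue_integral_eq_integral(1)[OF y'(1)]] that by auto
  have F: "?F absolutely_integrable_on {0..h}"
    by (intro absolutely_integrable_row_col_bounded_left bv_measurable_on bounded_apply_bv y'(1))
  have F_int: "?F integrable_on {u..v}" if "0 \<le> u" "v \<le> h" for u v
    using integrable_on_subinterval[OF set_lebesgue_integral_eq_integral(1)[OF F]] that by auto
  have y_diff: "y v - y u = integral {u..v} y'" if "0 \<le> u" "u \<le> v" "v \<le> h" for u v
    using Henstock_Kurzweil_Integration.integral_combine[of 0 u v y'] y'_int[of 0 v] y[of u] y[of v] that
    by (simp add: algebra_simps)
  have piece: "norm (integral {u..v} ?F - row_col (f w) (y v - y u)) \<le> K * C * (v - u) * (?V v' - ?V u')"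
    if "0 \<le> u'" "u' \<le> u" "u \<le> v" "v \<le> v'" "v' \<le> h" "u' \<le> w" "w \<le> v'" for u v w u' v'
  proof -
    have lin: "((\<lambda>s. row_col (f w) (y' s)) has_integral row_col (f w) (y v - y u)) {u..v}"
      using has_integral_linear[OF integrable_integral[OF y'_int[of u v]] row_col.bounded_linear_right[of "f w"]]
        y_diff[of u v] that by (simp add: o_def)
    have "((\<lambda>s. row_col (f s - f w) (y' s)) has_integral
        (integral {u..v} ?F - row_col (f w) (y v - y u))) {u..v}"
      using has_integral_diff[OF integrable_integral[OF F_int[of u v]] lin] that
      by (simp add: row_col.diff_left)
    moreover have "norm (row_col (f s - f w) (y' s)) \<le> K * C * (?V v' - ?V u')"
      if s: "s \<in> {u..v}" for s
    proof -
      have "norm (f s - f w) \<le> \<bar>?V s - ?V w\<bar>"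
        using variation_to_step[of s w f] variation_to_step[of w s f]
        by (cases "s \<le> w") (auto simp: norm_minus_commute)
      also have "\<dots> \<le> ?V v' - ?V u'"
        using variation_to_mono[of u' s f] variation_to_mono[of s v' f]
          variation_to_mono[of u' w f] variation_to_mono[of w v' f] s \<open>u' \<le> u\<close> \<open>v \<le> v'\<close> \<open>u' \<le> w\<close> \<open>w \<le> v'\<close>
        by auto
      finally have *: "norm (f s - f w) \<le> ?V v' - ?V u'" .
      have "norm (row_col (f s - f w) (y' s)) \<le> norm (f s - f w) * norm (y' s) * K"
        by (rule K(2))
      also have "\<dots> \<le> (?V v' - ?V u') * C * K"
        using * y'(2)[of s] s that K(1) \<open>0 \<le> u'\<close> \<open>u' \<le> u\<close> \<open>v \<le> v'\<close> \<open>v' \<le> h\<close> C order_trans[OF norm_ge_zero *]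
        by (intro mult_mono mult_nonneg_nonneg) auto
      finally show ?thesis by (simp add: mult_ac)
    qed
    moreover have "0 \<le> K * C * (?V v' - ?V u')"
      using K(1) C variation_to_mono[of u' v' f] that by (intro mult_nonneg_nonneg) auto
    ultimately show ?thesis
      using has_integral_bound[of "K * C * (?V v' - ?V u')" "\<lambda>s. row_col (f s - f w) (y' s)" _ u v] that
      by (simp add: mult_ac)
  qed
  have sum_bound: "norm (RS_sum row_col f y p - ?I) \<le> 4 * d * K * C * norm f"
    if d: "d > 0" and p: "p tagged_division_of {0..h}" and fine: "(\<lambda>x. ball x d) fine p" for d p
  proof -
    let ?B = "\<lambda>s. row_col (f s) (y s)"
    have "RS_sum row_col f y p - ?I = (\<Sum>(x, K)\<in>p. row_col (f (Sup K) - f (Inf K)) (y x)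
         - (?B (Sup K) - ?B (Inf K)) + integral K ?F)"
      using additive_tagged_division_1[OF h p, of ?B]
        integral_combine_tagged_division_topdown[OF _ p[folded box_real(2)], of ?F] F_int[of 0 h]
      by (simp add: RS_sum_def sum.distrib sum_subtractf case_prod_beta row_col.zero_left)
    also have "norm \<dots> \<le> (4 * d * K * C) * (?V h - ?V 0)"
    proof (rule tagged_sum_norm_le[OF p h])
      fix x u v
      assume xp: "(x, {u..v}) \<in> p" and uv: "0 \<le> u" "u \<le> x" "x \<le> v" "v \<le> h"
      have "integral {u..v} ?F = integral {u..x} ?F + integral {x..v} ?F"
        using Henstock_Kurzweil_Integration.integral_combine[of u x v ?F] F_int[of u v] uv by simp
      then have "row_col (f (Sup {u..v}) - f (Inf {u..v})) (y x)
           - (?B (Sup {u..v}) - ?B (Inf {u..v})) + integral {u..v} ?F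
         = (integral {u..x} ?F - row_col (f u) (y x - y u)) + (integral {x..v} ?F - row_col (f v) (y v - y x))"
        using uv by (simp add: row_col.diff_left row_col.diff_right)
      also have "norm \<dots> \<le> K * C * (x - u) * (?V v - ?V u) + K * C * (v - x) * (?V v - ?V u)"
        using uv by (intro order_trans[OF norm_triangle_ineq] add_mono piece) auto
      also have "\<dots> = K * C * (v - u) * (?V v - ?V u)"
        by (simp add: algebra_simps)
      also have "\<dots> \<le> K * C * (4 * d) * (?V v - ?V u)"
        using fine_diameter(2)[OF fine xp uv(2,3), of u] uv K(1) C variation_to_mono[of u v f] d
        by (intro mult_right_mono mult_left_mono) auto
      finally show "norm (row_col (f (Sup {u..v}) - f (Inf {u..v})) (y x)
           - (?B (Sup {u..v}) - ?B (Inf {u..v})) + integral {u..v} ?F)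
         \<le> 4 * d * K * C * (?V v - ?V u)" by (simp add: mult_ac)
    qed
    also have "\<dots> \<le> (4 * d * K * C) * norm f"
      using d K(1) C by (intro mult_left_mono variation_to_increment_le) auto
    finally show ?thesis .
  qed
  show ?thesis
    unfolding has_RS_integral_iff_tendsto tendsto_iff eventually_mesh_filter
  proof (intro allI impI)
    fix e :: real assume e: "e > 0"
    define d where "d = e / (4 * (K * C * norm f + 1))"
    have Q: "0 \<le> K * C * norm f" using K(1) C by simp
    then have d: "d > 0" using e by (simp add: d_def add_nonneg_pos)
    have "4 * d * K * C * norm f = e * (K * C * norm f / (K * C * norm f + 1))"
      using Q by (simp add: d_def divide_simps)
    also have "\<dots> < e * 1"
      using e Q by (intro mult_strict_left_mono) (auto simp: divide_simps)
    finally have "4 * d * K * C * norm f < e" by simp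
    then show "\<exists>d>0. \<forall>p. p tagged_division_of {0..h} \<and> (\<lambda>x. ball x d) fine p \<longrightarrow>
        dist (RS_sum row_col f y p) ?I < e"
      using d sum_bound[OF d] unfolding dist_norm by (meson order.strict_trans1)
  qed
qed

lemma RS_sum_norm_le:
  fixes f :: "(complex ^ 'n) bv"
  assumes K: "K \<ge> 0" "\<And>a b. norm (row_col (a::complex ^ 'n) b) \<le> norm a * norm b * K"
    and h: "0 \<le> h" and p: "p tagged_division_of {0..h}"
    and M: "\<And>s. s \<in> {0..h} \<Longrightarrow> norm (y s) \<le> M"
  shows "norm (RS_sum row_col f y p) \<le> norm f * M * K"
proof -
  have M0: "0 \<le> M"
    using M[of 0] h norm_ge_zero[of "y 0"] by (simp, linarith)
  have "norm (RS_sum row_col f y p) \<le> (M * K) * (variation_to f h - variation_to f 0)"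
    unfolding RS_sum_def
  proof (rule tagged_sum_norm_le[OF p h])
    fix x u v assume uv: "(x, {u..v}) \<in> p" "0 \<le> u" "u \<le> x" "x \<le> v" "v \<le> h"
    have "norm (row_col (f v - f u) (y x)) \<le> norm (f v - f u) * norm (y x) * K"
      by (rule K(2))
    also have "\<dots> \<le> (variation_to f v - variation_to f u) * M * K"
      using variation_to_step[of u v f] M[of x] uv K(1) variation_to_mono[of u v f]
      using M0 by (intro mult_mono) auto
    finally show "norm (row_col (f (Sup {u..v}) - f (Inf {u..v})) (y x))
        \<le> (M * K) * (variation_to f v - variation_to f u)"
      using uv by (simp add: mult_ac)
  qed
  also have "\<dots> \<le> (M * K) * norm f"
    using M0 K(1) by (intro mult_left_mono variation_to_increment_le) auto
  finally show ?thesis by (simp add: mult_ac)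
qed

lemma has_RS_integral_norm_le:
  fixes f :: "(complex ^ 'n) bv"
  assumes K: "K \<ge> 0" "\<And>a b. norm (row_col (a::complex ^ 'n) b) \<le> norm a * norm b * K"
    and h: "0 \<le> h" and I: "has_RS_integral row_col f y {0..h} I"
    and M: "\<And>s. s \<in> {0..h} \<Longrightarrow> norm (y s) \<le> M"
  shows "norm I \<le> norm f * M * K"
proof (rule tendsto_upperbound[OF tendsto_norm[OF I[unfolded has_RS_integral_iff_tendsto]] _ mesh_filter_ne_bot])
  show "\<forall>\<^sub>F p in mesh_filter {0..h}. norm (RS_sum row_col f y p) \<le> norm f * M * K"
    unfolding eventually_mesh_filter
    using RS_sum_norm_le[OF K h _ M] by (intro exI[of _ 1]) auto
qed

lemma has_RS_integral_row_col_diff: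
  assumes "has_RS_integral row_col f y1 {a..b} I1" "has_RS_integral row_col f y2 {a..b} I2"
  shows "has_RS_integral row_col f (\<lambda>s. y1 s - y2 s) {a..b} (I1 - I2)"
proof -
  have "has_RS_integral row_col f (\<lambda>s. - y2 s) {a..b} (- I2)"
    by (rule has_RS_integral_transfer[OF has_RS_integral_linear[OF assms(2)
            bounded_linear_minus[OF bounded_linear_ident]]])
      (simp add: row_col.minus_right)
  then have "has_RS_integral row_col f (\<lambda>s. y1 s - y2 s) {a..b} (I1 + (- I2))"
    by (rule has_RS_integral_add[OF assms(1)]) (simp add: row_col.diff_right row_col.minus_right)
  then show ?thesis by simp
qed

text \<open>Polynomials have a Stieltjes integral by partial integration, and the sums are bounded by the
  variation of \<open>f\<close> times the supremum norm of the integrand; so the integral of a continuous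
  function is the limit of the integrals of approximating polynomials.\<close>

lemma has_RS_integral_continuous:
  fixes f :: "(complex ^ 'n) bv"
  assumes h: "0 \<le> h" and y: "continuous_on {0..h} y"
  shows "\<exists>I. has_RS_integral row_col f y {0..h} I"
proof -
  obtain K where K: "K > 0" "\<And>a b. norm (row_col (a::complex ^ 'n) b) \<le> norm a * norm b * K"
    using row_col.pos_bounded by blast
  have K0: "K \<ge> 0" using K(1) by simp
  have "\<exists>q. polynomial_function q \<and> (\<forall>s\<in>{0..h}. norm (y s - q s) < inverse (Suc n))" for n
    by (intro Stone_Weierstrass_polynomial_function y) auto
  then obtain q where q: "\<And>n. polynomial_function (q n)"
    "\<And>n s. s \<in> {0..h} \<Longrightarrow> norm (y s - q n s) < inverse (Suc n)"
    by metis
  have "\<exists>I. has_RS_integral row_col f (q n) {0..h} I" for n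
  proof -
    obtain q' where q': "polynomial_function q'" "\<And>s. (q n has_vector_derivative q' s) (at s)"
      using has_vector_derivative_polynomial_function[OF q(1)] by blast
    have cont: "continuous_on {0..h} q'"
      by (rule continuous_on_polymonial_function[OF q'(1)])
    have "bounded (q' ` {0..h})"
      by (intro compact_imp_bounded compact_continuous_image cont) auto
    then obtain C where C: "\<And>s. s \<in> {0..h} \<Longrightarrow> norm (q' s) \<le> C"
      unfolding bounded_iff by blast
    have "q n \<theta> = q n 0 + integral {0..\<theta>} q'" if "\<theta> \<in> {0..h}" for \<theta>
    proof -
      have "(q' has_integral q n \<theta> - q n 0) {0..\<theta>}"
        by (rule fundamental_theorem_of_calculus)
          (use that has_vector_derivative_at_within[OF q'(2)] in auto)
      then show ?thesis by (simp add: integral_unique)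
    qed
    then show ?thesis
      using has_RS_integral_by_parts[OF h absolutely_integrable_continuous_real[OF cont] C] by blast
  qed
  then obtain J where J: "\<And>n. has_RS_integral row_col f (q n) {0..h} (J n)" by metis
  have near: "norm (J m - J n) \<le> norm f * (inverse (Suc m) + inverse (Suc n)) * K" for m n
  proof (rule has_RS_integral_norm_le[OF K0 K(2) h has_RS_integral_row_col_diff[OF J J]])
    fix s assume "s \<in> {0..h}"
    then show "norm (q m s - q n s) \<le> inverse (Suc m) + inverse (Suc n)"
      using q(2)[of s m] q(2)[of s n] norm_triangle_ineq4[of "y s - q n s" "y s - q m s"] by simp
  qed
  have lim0: "(\<lambda>n. norm f * (inverse (Suc n) + inverse (Suc n)) * K) \<longlonglongrightarrow> 0"
    using tendsto_mult_left[OF LIMSEQ_inverse_real_of_nat, of "2 * norm f * K"] by (simp add: mult_ac)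
  have "Cauchy J"
  proof (rule metric_CauchyI)
    fix e :: real assume "e > 0"
    then obtain N where N: "norm f * (inverse (Suc N) + inverse (Suc N)) * K < e"
      using order_tendstoD(2)[OF lim0] by (meson eventually_sequentially order_refl)
    have "dist (J m) (J n) < e" if "m \<ge> N" "n \<ge> N" for m n
    proof -
      have "norm f * (inverse (Suc m) + inverse (Suc n)) * K
          \<le> norm f * (inverse (Suc N) + inverse (Suc N)) * K"
        using that K(1) by (intro mult_right_mono mult_left_mono add_mono le_imp_inverse_le) auto
      then show ?thesis using near[of m n] N by (simp add: dist_norm)
    qed
    then show "\<exists>M. \<forall>m\<ge>M. \<forall>n\<ge>M. dist (J m) (J n) < e" by blast
  qed
  then obtain I where I: "J \<longlonglongrightarrow> I" using Cauchy_convergent convergent_def by blast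
  have "has_RS_integral row_col f y {0..h} I"
    unfolding has_RS_integral_iff_tendsto
  proof (rule swap_uniform_limit'[OF _ I _ _ sequentially_bot])
    show "\<forall>\<^sub>F n in sequentially. (RS_sum row_col f (q n) \<longlongrightarrow> J n) (mesh_filter {0..h})"
      using J unfolding has_RS_integral_iff_tendsto by simp
    show "\<forall>\<^sub>F p in mesh_filter {0..h}. p \<in> {p. p tagged_division_of {0..h}}"
      unfolding eventually_mesh_filter by (intro exI[of _ 1]) auto
    show "uniform_limit {p. p tagged_division_of {0..h}} (\<lambda>n. RS_sum row_col f (q n))
        (RS_sum row_col f y) sequentially"
    proof (rule uniform_limitI)
      fix e :: real assume "e > 0"
      then have "\<forall>\<^sub>F n in sequentially. norm f * (inverse (Suc n) + inverse (Suc n)) * K < e"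
        using order_tendstoD(2)[OF lim0] by blast
      then show "\<forall>\<^sub>F n in sequentially. \<forall>p\<in>{p. p tagged_division_of {0..h}}.
          dist (RS_sum row_col f (q n) p) (RS_sum row_col f y p) < e"
      proof eventually_elim
        case (elim n)
        show ?case
        proof clarify
          fix p assume p: "p tagged_division_of {0..h}"
          have "RS_sum row_col f (q n) p - RS_sum row_col f y p
              = RS_sum row_col f (\<lambda>s. q n s - y s) p"
            by (simp add: RS_sum_def row_col.diff_right sum_subtractf case_prod_beta)
          also have "norm \<dots> \<le> norm f * (inverse (Suc n) + inverse (Suc n)) * K"
          proof (rule RS_sum_norm_le[OF K0 K(2) h p])
            fix s assume "s \<in> {0..h}"
            moreover have "0 \<le> inverse (real (Suc n))" by simp
            ultimately show "norm (q n s - y s) \<le> inverse (Suc n) + inverse (Suc n)"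
              using q(2)[of s n] unfolding norm_minus_commute[of "q n s"] by linarith
          qed
          finally show "dist (RS_sum row_col f (q n) p) (RS_sum row_col f y p) < e"
            using elim by (simp add: dist_norm)
        qed
      qed
    qed
  qed
  then show ?thesis ..
qed

text \<open>A jump at \<open>0\<close> followed by an absolutely continuous part. The increments of the step function
  vanish except on the subinterval that begins at \<open>0\<close>, where the integrand is close to its value
  at \<open>0\<close>.\<close>

lemma has_RS_integral_jump_density:
  fixes f :: "(complex ^ 'n) bv"
  assumes h: "0 < h" and g: "g absolutely_integrable_on {0..h}"
    and f: "\<And>\<theta>. \<theta> \<in> {0<..h} \<Longrightarrow> f \<theta> = c + integral {0..\<theta>} g"
    and y: "continuous_on {0..h} y"
  shows "has_RS_integral row_col f y {0..h} (row_col c (y 0) + integral {0..h} (\<lambda>s. row_col (g s) (y s)))"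
proof -
  obtain K where K: "K > 0" "\<And>a b. norm (row_col (a::complex ^ 'n) b) \<le> norm a * norm b * K"
    using row_col.pos_bounded by blast
  let ?F = "\<lambda>s. row_col (g s) (y s)"
  let ?I = "row_col c (y 0) + integral {0..h} ?F"
  define H :: "real \<Rightarrow> real" where "H \<theta> = (if \<theta> \<le> 0 then 0 else 1)" for \<theta>
  define W where "W \<theta> = norm c * H \<theta> + integral {0..\<theta>} (\<lambda>s. norm (g s))" for \<theta>
  have g_int: "g integrable_on {u..v}" if "0 \<le> u" "v \<le> h" for u v
    using integrable_on_subinterval[OF set_lebesgue_integral_eq_integral(1)[OF g]] that by auto
  have ng_int: "(\<lambda>s. norm (g s)) integrable_on {u..v}" if "0 \<le> u" "v \<le> h" for u v
    using integrable_on_subinterval[OF set_lebesgue_integral_eq_integral(1)[OF absolutely_integrable_norm[OF g, unfolded o_def]]] that by auto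
  have F: "?F absolutely_integrable_on {0..h}"
    using y by (intro absolutely_integrable_row_col_bounded_right g
        continuous_imp_measurable_on_sets_lebesgue compact_imp_bounded compact_continuous_image) auto
  have F_int: "?F integrable_on {u..v}" if "0 \<le> u" "v \<le> h" for u v
    using integrable_on_subinterval[OF set_lebesgue_integral_eq_integral(1)[OF F]] that by auto
  have f_diff: "f v - f u = (H v - H u) *\<^sub>R c + integral {u..v} g" if "0 \<le> u" "u \<le> v" "v \<le> h" for u v
  proof -
    have "f \<theta> = H \<theta> *\<^sub>R c + integral {0..\<theta>} g" if "0 \<le> \<theta>" "\<theta> \<le> h" for \<theta>
      using f[of \<theta>] that by (cases "\<theta> = 0") (auto simp: H_def)
    then show ?thesis
      using Henstock_Kurzweil_Integration.integral_combine[of 0 u v g] g_int[of 0 v] that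
      by (simp add: algebra_simps)
  qed
  have W_diff: "W v - W u = norm c * (H v - H u) + integral {u..v} (\<lambda>s. norm (g s))"
    if "0 \<le> u" "u \<le> v" "v \<le> h" for u v
    using Henstock_Kurzweil_Integration.integral_combine[of 0 u v "\<lambda>s. norm (g s)"] ng_int[of 0 v] that
    by (simp add: W_def algebra_simps)
  have sum_bound: "norm (RS_sum row_col f y p - ?I) \<le> (K * e) * (W h - W 0)"
    if d: "\<And>s t. s \<in> {0..h} \<Longrightarrow> t \<in> {0..h} \<Longrightarrow> \<bar>s - t\<bar> < d \<Longrightarrow> norm (y s - y t) \<le> e" and e: "e > 0"
      and p: "p tagged_division_of {0..h}" and fine: "(\<lambda>x. ball x d) fine p" for d e p
  proof -
    let ?B = "\<lambda>s. H s *\<^sub>R row_col c (y 0)"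
    have "RS_sum row_col f y p - ?I = (\<Sum>(x, K)\<in>p. row_col (f (Sup K) - f (Inf K)) (y x)
         - (?B (Sup K) - ?B (Inf K)) - integral K ?F)"
      using additive_tagged_division_1[OF less_imp_le[OF h] p, of ?B] h
        integral_combine_tagged_division_topdown[OF _ p[folded box_real(2)], of ?F] F_int[of 0 h]
      by (simp add: RS_sum_def sum.distrib sum_subtractf case_prod_beta H_def)
    also have "norm \<dots> \<le> (K * e) * (W h - W 0)"
    proof (rule tagged_sum_norm_le[OF p less_imp_le[OF h]])
      fix x u v
      assume xp: "(x, {u..v}) \<in> p" and uv: "0 \<le> u" "u \<le> x" "x \<le> v" "v \<le> h"
      have lin: "((\<lambda>s. row_col (g s) (y x)) has_integral row_col (integral {u..v} g) (y x)) {u..v}"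
        using has_integral_linear[OF integrable_integral[OF g_int[of u v]] row_col.bounded_linear_left[of "y x"]]
          uv by (simp add: o_def)
      have diff: "((\<lambda>s. row_col (g s) (y x - y s)) has_integral
          (row_col (integral {u..v} g) (y x) - integral {u..v} ?F)) {u..v}"
        using has_integral_diff[OF lin integrable_integral[OF F_int[of u v]]] uv
        by (simp add: row_col.diff_right)
      have "norm (row_col (integral {u..v} g) (y x) - integral {u..v} ?F)
          \<le> integral {u..v} (\<lambda>s. K * e * norm (g s))"
        unfolding integral_unique[OF diff, symmetric]
      proof (rule integral_norm_bound_integral)
        show "(\<lambda>s. row_col (g s) (y x - y s)) integrable_on {u..v}" using diff by blast
        show "(\<lambda>s. K * e * norm (g s)) integrable_on {u..v}"
          using integrable_cmul[OF ng_int[of u v], of "K * e"] uv by simp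
        fix s assume s: "s \<in> {u..v}"
        have "norm (row_col (g s) (y x - y s)) \<le> norm (g s) * norm (y x - y s) * K" by (rule K(2))
        also have "\<dots> \<le> norm (g s) * e * K"
          using d[of x s] fine_diameter(1)[OF fine xp uv(2,3) s] s uv K(1)
          by (intro mult_right_mono mult_left_mono) auto
        finally show "norm (row_col (g s) (y x - y s)) \<le> K * e * norm (g s)" by (simp add: mult_ac)
      qed
      then have 1: "norm (row_col (integral {u..v} g) (y x) - integral {u..v} ?F)
          \<le> K * e * integral {u..v} (\<lambda>s. norm (g s))" by simp
      have 2: "norm ((H v - H u) *\<^sub>R row_col c (y x - y 0)) \<le> K * e * (norm c * (H v - H u))"
      proof (cases "u = 0 \<and> v > 0")
        case True
        have "norm (row_col c (y x - y 0)) \<le> norm c * norm (y x - y 0) * K" by (rule K(2))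
        also have "\<dots> \<le> norm c * e * K"
          using d[of x 0] fine_diameter(1)[OF fine xp uv(2,3), of 0] uv True K(1)
          by (intro mult_right_mono mult_left_mono) auto
        finally show ?thesis using True by (simp add: H_def mult_ac)
      next
        case False
        then have "H v = H u" using uv by (auto simp: H_def)
        then show ?thesis by simp
      qed
      have "row_col (f (Sup {u..v}) - f (Inf {u..v})) (y x)
           - (?B (Sup {u..v}) - ?B (Inf {u..v})) - integral {u..v} ?F
         = (H v - H u) *\<^sub>R row_col c (y x - y 0)
           + (row_col (integral {u..v} g) (y x) - integral {u..v} ?F)"
        using uv f_diff[of u v]
        by (simp add: row_col.add_left row_col.diff_right row_col.scaleR_left row_col.diff_left scaleR_diff_left scaleR_diff_right)
      also have "norm \<dots> \<le> K * e * (norm c * (H v - H u)) + K * e * integral {u..v} (\<lambda>s. norm (g s))"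
        by (intro order_trans[OF norm_triangle_ineq] add_mono 1 2)
      also have "\<dots> = K * e * (W v - W u)"
        by (subst W_diff) (use uv in \<open>simp_all add: distrib_left\<close>)
      finally show "norm (row_col (f (Sup {u..v}) - f (Inf {u..v})) (y x)
           - (?B (Sup {u..v}) - ?B (Inf {u..v})) - integral {u..v} ?F) \<le> K * e * (W v - W u)" .
    qed
    finally show ?thesis .
  qed
  show ?thesis
    unfolding has_RS_integral_iff_tendsto tendsto_iff eventually_mesh_filter
  proof (intro allI impI)
    fix e :: real assume e: "e > 0"
    have W: "0 \<le> W h - W 0"
      using W_diff[of 0 h] h ng_int[of 0 h] by (auto simp: H_def intro!: add_nonneg_nonneg integral_nonneg)
    define e' where "e' = e / (K * (W h - W 0) + 1)"
    have Q: "0 \<le> K * (W h - W 0)" using K(1) W by simp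
    then have e': "e' > 0" using e by (simp add: e'_def add_nonneg_pos)
    have "(K * e') * (W h - W 0) = e * (K * (W h - W 0) / (K * (W h - W 0) + 1))"
      using Q by (simp add: e'_def divide_simps)
    also have "\<dots> < e * 1"
      using e Q by (intro mult_strict_left_mono) (auto simp: divide_simps)
    finally have less: "(K * e') * (W h - W 0) < e" by simp
    have "uniformly_continuous_on {0..h} y"
      by (intro compact_uniformly_continuous y) auto
    then obtain d where d: "d > 0"
      "\<And>s t. s \<in> {0..h} \<Longrightarrow> t \<in> {0..h} \<Longrightarrow> dist t s < d \<Longrightarrow> dist (y t) (y s) < e'"
      using e' unfolding uniformly_continuous_on_def by metis
    have d': "norm (y s - y t) \<le> e'" if "s \<in> {0..h}" "t \<in> {0..h}" "\<bar>s - t\<bar> < d" for s t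
      using d(2)[of t s] that by (simp add: dist_norm)
    show "\<exists>d>0. \<forall>p. p tagged_division_of {0..h} \<and> (\<lambda>x. ball x d) fine p \<longrightarrow>
        dist (RS_sum row_col f y p) ?I < e"
    proof (intro exI conjI allI impI, rule d(1), elim conjE)
      fix p assume "p tagged_division_of {0..h}" "(\<lambda>x. ball x d) fine p"
      then have "norm (RS_sum row_col f y p - ?I) \<le> (K * e') * (W h - W 0)"
        using d' e' by (intro sum_bound[where d=d]) auto
      with less show "dist (RS_sum row_col f y p) ?I < e"
        by (simp add: dist_norm)
    qed
  qed
qed

section \<open>The pairing of a row of bounded variation with a continuous function\<close>

lemma continuous_on_reflect: "continuous_on {-h..0} \<phi> \<Longrightarrow> continuous_on {0..h} (\<lambda>\<theta>. \<phi> (- \<theta>))"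
  for h :: real
  by (rule continuous_on_compose2[where f=uminus]) (auto intro!: continuous_intros)

lemma continuous_on_bcontfun_reflect: "continuous_on S (\<lambda>\<theta>. apply_bcontfun \<phi> (- \<theta>))" for S :: "real set"
  by (rule continuous_on_compose2[OF continuous_on_apply_bcontfun[of UNIV]])
    (auto intro!: continuous_intros)

lemma pairing_eqI:
  assumes "has_RS_integral row_col (apply_bv f) (\<lambda>\<theta>. apply_bcontfun \<phi> (- \<theta>)) {0..h} I"
  shows "pairing h f \<phi> = I"
  unfolding pairing_def using assms has_RS_integral_unique by blast

lemma has_RS_integral_pairing:
  assumes "0 \<le> h"
  shows "has_RS_integral row_col (apply_bv f) (\<lambda>\<theta>. apply_bcontfun \<phi> (- \<theta>)) {0..h} (pairing h f \<phi>)"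
proof -
  obtain I where "has_RS_integral row_col (apply_bv f) (\<lambda>\<theta>. apply_bcontfun \<phi> (- \<theta>)) {0..h} I"
    using has_RS_integral_continuous[OF assms continuous_on_bcontfun_reflect] by blast
  then show ?thesis
    by (simp add: pairing_eqI)
qed

lemma bounded_bilinear_pairing:
  assumes h: "0 \<le> h"
  shows "bounded_bilinear (pairing h :: (complex ^ 'n) bv \<Rightarrow> _)"
proof
  note I = has_RS_integral_pairing[OF h]
  fix f f' :: "(complex ^ 'n) bv" and \<phi> \<phi>' :: "real \<Rightarrow>\<^sub>C (complex ^ 'n)" and r :: real
  show "pairing h (f + f') \<phi> = pairing h f \<phi> + pairing h f' \<phi>"
    by (rule pairing_eqI, rule has_RS_integral_add[OF I I])
      (simp add: plus_bv.rep_eq row_col.add_left row_col.diff_left)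
  show "pairing h f (\<phi> + \<phi>') = pairing h f \<phi> + pairing h f \<phi>'"
    by (rule pairing_eqI, rule has_RS_integral_add[OF I I]) (simp add: row_col.add_right)
  show "pairing h (r *\<^sub>R f) \<phi> = r *\<^sub>R pairing h f \<phi>"
    by (rule pairing_eqI,
        rule has_RS_integral_transfer[OF has_RS_integral_linear[OF I bounded_linear_scaleR_right]])
      (simp add: scaleR_bv.rep_eq row_col.scaleR_left row_col.diff_left scaleR_diff_right)
  show "pairing h f (r *\<^sub>R \<phi>) = r *\<^sub>R pairing h f \<phi>"
    by (rule pairing_eqI,
        rule has_RS_integral_transfer[OF has_RS_integral_linear[OF I bounded_linear_scaleR_right]])
      (simp add: row_col.scaleR_right)
  obtain K where K: "K > 0" "\<And>a b. norm (row_col (a::complex ^ 'n) b) \<le> norm a * norm b * K"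
    using row_col.pos_bounded by blast
  show "\<exists>K. \<forall>f \<phi>. norm (pairing h (f :: (complex ^ 'n) bv) \<phi>) \<le> norm f * norm \<phi> * K"
    using has_RS_integral_norm_le[OF less_imp_le[OF K(1)] K(2) h I norm_bounded] by blast
qed

section \<open>Segments and the dual operators at a fixed time\<close>

lemma apply_hist:
  assumes "0 \<le> h" "continuous_on {t - h..t} x"
  shows "apply_bcontfun (hist h x t) \<theta> = x (t + max (- h) (min 0 \<theta>))"
proof -
  have cont: "continuous_on UNIV (\<lambda>\<theta>. x (t + max (- h) (min 0 \<theta>)))"
    by (rule continuous_on_compose2[OF assms(2)]) (use assms(1) in \<open>auto intro!: continuous_intros\<close>)
  have "range (\<lambda>\<theta>. x (t + max (- h) (min 0 \<theta>))) \<subseteq> x ` {t - h..t}"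
    using assms(1) by auto
  moreover have "bounded (x ` {t - h..t})"
    by (intro compact_imp_bounded compact_continuous_image assms(2)) auto
  ultimately have "bounded (range (\<lambda>\<theta>. x (t + max (- h) (min 0 \<theta>))))"
    using bounded_subset by blast
  then show ?thesis
    unfolding hist_def by (subst Bcontfun_inverse) (auto simp: bcontfun_def cont)
qed

lemma apply_hist_0:
  assumes "0 \<le> h" "continuous_on {- h..0} x" "\<theta> \<in> {- h..0}"
  shows "apply_bcontfun (hist h x 0) \<theta> = x \<theta>"
  using apply_hist[of h 0 x \<theta>] assms by simp

lemma hist_in_state_space:
  assumes "0 \<le> h" "continuous_on {t - h..t} x"
  shows "hist h x t \<in> state_space h"
  unfolding state_space_def using assms(1) by (auto simp: apply_hist[OF assms])

text \<open>The right-hand derivative of the primitive at \<open>\<theta>\<close> is \<open>g \<theta>\<close>, and the primitive is constant.\<close>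

lemma zero_if_integrals_vanish:
  fixes g :: "real \<Rightarrow> 'a::euclidean_space"
  assumes int: "g integrable_on {a..b}" and zero: "\<And>x. x \<in> {a..b} \<Longrightarrow> integral {a..x} g = 0"
    and \<theta>: "a \<le> \<theta>" "\<theta> < b" and cont: "continuous (at_right \<theta>) g"
  shows "g \<theta> = 0"
proof -
  have "continuous (at \<theta> within {\<theta>..b}) g"
    using cont \<theta> by (simp add: at_within_Icc_at_right)
  then have "((\<lambda>u. integral {\<theta>..u} g) has_vector_derivative g \<theta>) (at \<theta> within {\<theta>..b})"
    using integral_has_vector_derivative_continuous_at[of g \<theta> b \<theta> "{}"]
      integrable_on_subinterval[OF int] \<theta> by simp
  moreover have "((\<lambda>u. integral {\<theta>..u} g) has_vector_derivative 0) (at \<theta> within {\<theta>..b})"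
  proof (rule has_vector_derivative_transform[OF _ _ has_vector_derivative_const[of 0]])
    fix u assume u: "u \<in> {\<theta>..b}"
    have "integral {a..\<theta>} g + integral {\<theta>..u} g = integral {a..u} g"
      using u \<theta> by (intro Henstock_Kurzweil_Integration.integral_combine integrable_on_subinterval[OF int]) auto
    then show "integral {\<theta>..u} g = 0"
      using zero[of \<theta>] zero[of u] u \<theta> by simp
  qed (use \<theta> in auto)
  ultimately show ?thesis
    by (rule vector_derivative_unique_within[rotated]) (use \<theta> in \<open>simp add: at_within_Icc_at_right\<close>)
qed

lemma bounded_variation_subset:
  "bounded_variation_on S f \<Longrightarrow> R \<subseteq> S \<Longrightarrow> bounded_variation_on R f"
  unfolding bounded_variation_on_def
proof (erule bdd_above_mono)
  assume RS: "R \<subseteq> S"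
  show "variation_sums R f \<subseteq> variation_sums S f"
  proof
    fix s assume "s \<in> variation_sums R f"
    then obtain m t where "s = (\<Sum>i<m. norm (f (t (Suc i)) - f (t i)))" "mono t" "range t \<subseteq> R"
      unfolding variation_sums_def by blast
    then show "s \<in> variation_sums S f"
      using variation_sums_I[of t S f m] RS by auto
  qed
qed

lemma star_space_iff:
  "f \<in> star_space h \<longleftrightarrow>
     (\<forall>\<theta>\<in>{0<..<h}. continuous (at_right \<theta>) (apply_bv f)) \<and>
     (\<forall>\<theta>. apply_bv f \<theta> = apply_bv f (max 0 (min h \<theta>)))"
  using bounded_variation_subset[OF bounded_variation_apply_bv, of "{0..h}" f]
  unfolding star_space_def NBV_def by auto

lemma star_space_linear:
  assumes "f \<in> star_space h" "g \<in> star_space h"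
  shows "f + g \<in> star_space h" "f - g \<in> star_space h" "scaleC_bv a f \<in> star_space h"
    "r *\<^sub>R f \<in> star_space h"
proof -
  note fg = assms[unfolded star_space_iff]
  have eq: "apply_bv f \<theta> = apply_bv f (max 0 (min h \<theta>))" "apply_bv g \<theta> = apply_bv g (max 0 (min h \<theta>))" for \<theta>
    using fg by blast+
  show "f + g \<in> star_space h"
    using fg unfolding star_space_iff plus_bv.rep_eq[abs_def]
    by (intro conjI ballI continuous_add allI arg_cong2[where f="(+)"] eq) auto
  show "f - g \<in> star_space h"
    using fg unfolding star_space_iff minus_bv.rep_eq[abs_def]
    by (intro conjI ballI continuous_diff allI arg_cong2[where f="(-)"] eq) auto
  show "r *\<^sub>R f \<in> star_space h"
    using fg unfolding star_space_iff scaleR_bv.rep_eq[abs_def]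
    by (intro conjI ballI continuous_scaleR continuous_const allI arg_cong2[where f="(*\<^sub>R)"] eq) auto
  show "scaleC_bv a f \<in> star_space h"
    using fg unfolding star_space_iff scaleC_bv.rep_eq[abs_def]
    by (intro conjI ballI allI arg_cong2[where f="(*s)"] eq refl
        bounded_linear.continuous[OF bounded_linear_vector_scalar_mult]) auto
qed

lemma star_space_eq_outside:
  assumes "f \<in> star_space h" "0 \<le> h"
  shows "\<theta> \<le> 0 \<Longrightarrow> apply_bv f \<theta> = 0" "h \<le> \<theta> \<Longrightarrow> apply_bv f \<theta> = apply_bv f h"
proof -
  have eq: "apply_bv f \<theta> = apply_bv f (max 0 (min h \<theta>))"
    using assms(1) unfolding star_space_iff by blast
  show "apply_bv f \<theta> = 0" if "\<theta> \<le> 0"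
    using assms(2) that by (subst eq) simp
  show "apply_bv f \<theta> = apply_bv f h" if "h \<le> \<theta>"
    using assms(2) that by (subst eq) simp
qed

text \<open>An element of the dual space vanishes if its primitive and its value at \<open>h\<close> do: right
  continuity takes care of the interior points.\<close>

lemma star_space_zeroI:
  fixes f :: "(complex ^ 'n) bv"
  assumes f: "f \<in> star_space h" "0 < h" "apply_bv f h = 0"
    and zero: "\<And>x. x \<in> {0..h} \<Longrightarrow> integral {0..x} (apply_bv f) = 0"
  shows "f = 0"
proof (rule bv_eqI)
  have int: "apply_bv f integrable_on {0..h}"
    using absolutely_integrable_apply_bv set_lebesgue_integral_eq_integral(1) by blast
  fix x
  have "apply_bv f x = 0"
  proof (cases "x \<in> {0<..<h}")
    case True
    then show ?thesis
      using zero_if_integrals_vanish[OF int zero, of x] f(1) by (auto simp: star_space_iff)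
  next
    case False
    then show ?thesis
      using star_space_eq_outside[OF f(1), of x] f(2,3) by (cases "x \<le> 0") auto
  qed
  then show "apply_bv f x = apply_bv 0 x" by (simp add: zero_bv.rep_eq)
qed

lemma bv_integrable: "apply_bv f integrable_on {a..b}" for f :: "'a::euclidean_space bv"
  using absolutely_integrable_apply_bv set_lebesgue_integral_eq_integral(1) by blast

text \<open>Two derivatives of the same element have the same primitive, and both vanish at \<open>h\<close>.\<close>

lemma is_star_deriv_unique:
  fixes g :: "(complex ^ 'n) bv"
  assumes h: "0 < h" and "is_star_deriv h f g" "is_star_deriv h f g'"
  shows "g = g'"
proof -
  have "g - g' = 0"
  proof (rule star_space_zeroI[OF _ h])
    show "g - g' \<in> star_space h" "apply_bv (g - g') h = 0"
      using assms unfolding is_star_deriv_def by (auto simp: star_space_linear minus_bv.rep_eq)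
    fix x assume x: "x \<in> {0..h}"
    have "integral {0..x} (apply_bv (g - g')) = integral {0..x} (apply_bv g) - integral {0..x} (apply_bv g')"
      unfolding minus_bv.rep_eq[abs_def] by (intro Henstock_Kurzweil_Integration.integral_diff bv_integrable)
    also have "\<dots> = 0"
    proof (cases "x = 0")
      case False
      then have "x \<in> {0<..h}" using x by auto
      then have "value0 f + integral {0..x} (apply_bv g) = value0 f + integral {0..x} (apply_bv g')"
        using assms(2,3) unfolding is_star_deriv_def by metis
      then show ?thesis by simp
    qed simp
    finally show "integral {0..x} (apply_bv (g - g')) = 0" .
  qed
  then show ?thesis by simp
qed

lemma star_deriv_eq:
  assumes "0 < h" "is_star_deriv h f g"
  shows "star_deriv h f = g"
  unfolding star_deriv_def using assms is_star_deriv_unique by blast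

lemma is_star_deriv_star_deriv:
  assumes "0 < h" "f \<in> dom_A0_star h"
  shows "is_star_deriv h f (star_deriv h f)"
  using assms star_deriv_eq unfolding dom_A0_star_def by blast

lemma bounded_linear_scaleC_bv: "bounded_linear (scaleC_bv a :: (complex ^ 'n) bv \<Rightarrow> _)"
proof -
  obtain K where K: "K > 0" "\<And>x :: complex ^ 'n. norm (a *s x) \<le> norm x * K"
    using bounded_linear.pos_bounded[OF bounded_linear_vector_scalar_mult] by blast
  note lin = bounded_linear.linear[OF bounded_linear_vector_scalar_mult[of a]]
  show ?thesis
  proof (rule bounded_linear_intro[where K=K])
    fix f g :: "(complex ^ 'n) bv" and r :: real
    show "scaleC_bv a (f + g) = scaleC_bv a f + scaleC_bv a g"
      by (rule bv_eqI) (simp add: scaleC_bv.rep_eq plus_bv.rep_eq linear_add[OF lin])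
    show "scaleC_bv a (r *\<^sub>R f) = r *\<^sub>R scaleC_bv a f"
      by (rule bv_eqI) (simp add: scaleC_bv.rep_eq scaleR_bv.rep_eq linear_cmul[OF lin])
    show "norm (scaleC_bv a f) \<le> norm f * K"
      unfolding norm_bv_eq
    proof (rule total_variation_le)
      fix t :: "nat \<Rightarrow> real" and m assume t: "mono t"
      have "(\<Sum>i<m. norm (apply_bv (scaleC_bv a f) (t (Suc i)) - apply_bv (scaleC_bv a f) (t i)))
          \<le> (\<Sum>i<m. norm (apply_bv f (t (Suc i)) - apply_bv f (t i)) * K)"
        unfolding scaleC_bv.rep_eq linear_diff[OF lin, symmetric] by (intro sum_mono K(2))
      also have "\<dots> \<le> total_variation UNIV (apply_bv f) * K"
        unfolding sum_distrib_right[symmetric]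
        using variation_le_total[OF bounded_variation_apply_bv t] K(1) by (intro mult_right_mono) auto
      finally show "(\<Sum>i<m. norm (apply_bv (scaleC_bv a f) (t (Suc i)) - apply_bv (scaleC_bv a f) (t i)))
          \<le> total_variation UNIV (apply_bv f) * K" .
    qed
  qed
qed

lemma value0_scaleC: "value0 (scaleC_bv a f) = a *s value0 f"
  by (rule value0_eqI)
    (simp add: scaleC_bv.rep_eq[abs_def] bounded_linear.tendsto[OF bounded_linear_vector_scalar_mult] value0_tendsto)

lemma value0_add: "value0 (f + g) = value0 f + value0 g" for f g :: "'a::banach bv"
  by (rule linear_add[OF bounded_linear.linear[OF bounded_linear_value0]])

lemma scaleC_bv_add: "scaleC_bv a (f + g) = scaleC_bv a f + scaleC_bv a g"
  by (rule linear_add[OF bounded_linear.linear[OF bounded_linear_scaleC_bv]])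

lemma is_star_deriv_add:
  fixes f :: "(complex ^ 'n) bv"
  assumes "is_star_deriv h f g" "is_star_deriv h f' g'"
  shows "is_star_deriv h (f + f') (g + g')"
  unfolding is_star_deriv_def
proof (intro conjI ballI)
  show "g + g' \<in> star_space h" "apply_bv (g + g') h = 0"
    using assms unfolding is_star_deriv_def by (auto simp: star_space_linear plus_bv.rep_eq)
  fix \<theta> assume "\<theta> \<in> {0<..h}"
  then have "apply_bv f \<theta> = value0 f + integral {0..\<theta>} (apply_bv g)"
    "apply_bv f' \<theta> = value0 f' + integral {0..\<theta>} (apply_bv g')"
    using assms unfolding is_star_deriv_def by auto
  then show "apply_bv (f + f') \<theta> = value0 (f + f') + integral {0..\<theta>} (apply_bv (g + g'))"
    by (simp add: plus_bv.rep_eq[abs_def] value0_add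
        Henstock_Kurzweil_Integration.integral_add bv_integrable)
qed

lemma is_star_deriv_scaleC:
  fixes f :: "(complex ^ 'n) bv"
  assumes "is_star_deriv h f g"
  shows "is_star_deriv h (scaleC_bv a f) (scaleC_bv a g)"
  unfolding is_star_deriv_def
proof (intro conjI ballI)
  show "scaleC_bv a g \<in> star_space h" "apply_bv (scaleC_bv a g) h = 0"
    using assms unfolding is_star_deriv_def by (auto simp: star_space_linear scaleC_bv.rep_eq)
  fix \<theta> assume "\<theta> \<in> {0<..h}"
  then have "apply_bv f \<theta> = value0 f + integral {0..\<theta>} (apply_bv g)"
    using assms unfolding is_star_deriv_def by auto
  moreover have "integral {0..\<theta>} (\<lambda>x. a *s apply_bv g x) = a *s integral {0..\<theta>} (apply_bv g)"
    using integral_linear[OF bv_integrable[of g 0 \<theta>] bounded_linear_vector_scalar_mult[of a]]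
    by (simp add: o_def)
  ultimately show "apply_bv (scaleC_bv a f) \<theta> = value0 (scaleC_bv a f) + integral {0..\<theta>} (apply_bv (scaleC_bv a g))"
    by (simp add: scaleC_bv.rep_eq[abs_def] value0_scaleC
        linear_add[OF bounded_linear.linear[OF bounded_linear_vector_scalar_mult]])
qed

lemma dom_A0_star_linear:
  fixes f f' :: "(complex ^ 'n) bv"
  assumes "0 < h" "f \<in> dom_A0_star h" "f' \<in> dom_A0_star h"
  shows "f + f' \<in> dom_A0_star h" "star_deriv h (f + f') = star_deriv h f + star_deriv h f'"
    "scaleC_bv a f \<in> dom_A0_star h" "star_deriv h (scaleC_bv a f) = scaleC_bv a (star_deriv h f)"
proof -
  note d = is_star_deriv_star_deriv[OF assms(1,2)] is_star_deriv_star_deriv[OF assms(1,3)]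
  show "f + f' \<in> dom_A0_star h" "scaleC_bv a f \<in> dom_A0_star h"
    using assms is_star_deriv_add[OF d] is_star_deriv_scaleC[OF d(1)]
    unfolding dom_A0_star_def by (auto simp: star_space_linear)
  show "star_deriv h (f + f') = star_deriv h f + star_deriv h f'"
    "star_deriv h (scaleC_bv a f) = scaleC_bv a (star_deriv h f)"
    using star_deriv_eq[OF assms(1)] is_star_deriv_add[OF d] is_star_deriv_scaleC[OF d(1)] by auto
qed

lemma bounded_linear_row_matrix:
  "bounded_linear (\<lambda>A :: real ^ 'n ^ 'n. c v* map_matrix complex_of_real A)"
proof -
  have "linear (\<lambda>A :: real ^ 'n ^ 'n. c v* map_matrix complex_of_real A)"
    by (rule linearI)
      (simp_all add: vec_eq_iff vector_matrix_mult_def map_matrix_def algebra_simps sum.distrib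
        scaleR_sum_right sum_distrib_left scaleR_conv_of_real[where 'a=complex])
  then show ?thesis by (simp add: linear_conv_bounded_linear)
qed

lemma bounded_variation_clamp:
  assumes "bounded_variation_on {0..h} f" "0 \<le> (h::real)"
  shows "bounded_variation_on UNIV (\<lambda>\<theta>. f (max 0 (min h \<theta>)))"
proof -
  obtain M where M: "\<And>t m. mono t \<Longrightarrow> range t \<subseteq> {0..h} \<Longrightarrow> (\<Sum>i<m. norm (f (t (Suc i)) - f (t i))) \<le> M"
    using assms(1) unfolding bounded_variation_iff by blast
  show ?thesis
    unfolding bounded_variation_iff
  proof (intro exI allI impI)
    fix t :: "nat \<Rightarrow> real" and m assume t: "mono t"
    have "mono (\<lambda>i. max 0 (min h (t i)))"
      using t unfolding mono_def by (meson max.mono min.mono order_refl)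
    then show "(\<Sum>i<m. norm (f (max 0 (min h (t (Suc i)))) - f (max 0 (min h (t i))))) \<le> M"
      using assms(2) by (intro M[of "\<lambda>i. max 0 (min h (t i))"]) auto
  qed
qed

lemma apply_row_kernel:
  assumes "NBV h Z" "0 \<le> h"
  shows "apply_bv (row_kernel h Z c) \<theta> = c v* map_matrix complex_of_real (Z (max 0 (min h \<theta>)))"
proof -
  have "bounded_variation_on UNIV (\<lambda>\<theta>. c v* map_matrix complex_of_real (Z (max 0 (min h \<theta>))))"
    using assms bounded_variation_linear[OF bounded_variation_clamp bounded_linear_row_matrix]
    unfolding NBV_def by blast
  then show ?thesis
    unfolding row_kernel_def using assms
    by (subst apply_Bv) (auto simp: NBV_def linear_0[OF bounded_linear.linear[OF bounded_linear_row_matrix]])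
qed

lemma row_kernel_in_star_space:
  assumes "NBV h Z" "0 \<le> h"
  shows "row_kernel h Z c \<in> star_space h"
  unfolding star_space_iff
proof (intro conjI ballI allI)
  fix \<theta> assume \<theta>: "\<theta> \<in> {0<..<h}"
  have "(Z \<longlongrightarrow> Z \<theta>) (at_right \<theta>)"
    using assms(1) \<theta> unfolding NBV_def continuous_within by blast
  moreover have "eventually (\<lambda>x. Z x = Z (max 0 (min h x))) (at_right \<theta>)"
    using \<theta> unfolding eventually_at_right_field by (intro exI[of _ h]) auto
  ultimately have "((\<lambda>x. Z (max 0 (min h x))) \<longlongrightarrow> Z \<theta>) (at_right \<theta>)"
    by (rule Lim_transform_eventually)
  then show "continuous (at_right \<theta>) (apply_bv (row_kernel h Z c))"
    unfolding continuous_within apply_row_kernel[OF assms] using \<theta>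
    by (intro bounded_linear.tendsto[OF bounded_linear_row_matrix]) auto
next
  show "apply_bv (row_kernel h Z c) \<theta> = apply_bv (row_kernel h Z c) (max 0 (min h \<theta>))" for \<theta>
    unfolding apply_row_kernel[OF assms] using assms(2) by auto
qed

lemma row_kernel_linear:
  assumes "NBV h Z" "0 \<le> h"
  shows "row_kernel h Z (c + d) = row_kernel h Z c + row_kernel h Z d"
    "row_kernel h Z (a *s c) = scaleC_bv a (row_kernel h Z c)"
  by (rule bv_eqI, simp add: apply_row_kernel[OF assms] plus_bv.rep_eq scaleC_bv.rep_eq vec_eq_iff
      vector_matrix_mult_def algebra_simps sum.distrib sum_distrib_left)+

lemma op_A_star_linear:
  assumes "NBV h Z" "0 < h" "f \<in> dom_A0_star h" "g \<in> dom_A0_star h"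
  shows "op_A_star h Z (f + g) = op_A_star h Z f + op_A_star h Z g"
    "op_A_star h Z (scaleC_bv a f) = scaleC_bv a (op_A_star h Z f)"
  using assms
  by (simp_all add: op_A_star_def dom_A0_star_linear row_kernel_linear value0_scaleC
      value0_add scaleC_bv_add)

lemma row_col_vector_matrix_mult: "row_col (c v* A) w = row_col c (A *v w)"
proof -
  have "row_col (c v* A) w = (\<Sum>j\<in>UNIV. \<Sum>i\<in>UNIV. A $ i $ j * c $ i * w $ j)"
    by (simp add: row_col_def vector_matrix_mult_def sum_distrib_left sum_distrib_right mult_ac)
  also have "\<dots> = (\<Sum>i\<in>UNIV. \<Sum>j\<in>UNIV. A $ i $ j * c $ i * w $ j)"
    by (rule sum.swap)
  also have "\<dots> = row_col c (A *v w)"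
    by (simp add: row_col_def matrix_vector_mult_def sum_distrib_left mult_ac)
  finally show ?thesis .
qed

text \<open>The real representation of \<open>L\<close> by \<open>Z\<close> is applied to the real and the imaginary part of \<open>u\<close>.\<close>

lemma has_RS_integral_row_kernel:
  fixes L :: "(real \<Rightarrow>\<^sub>C (real ^ 'n)) \<Rightarrow> real ^ 'n" and u :: "real \<Rightarrow> complex ^ 'n"
  assumes Z: "NBV h Z" and h: "0 \<le> h"
    and L: "\<And>\<phi>. has_RS_integral (*v) Z (\<lambda>\<theta>. apply_bcontfun \<phi> (- \<theta>)) {0..h} (L \<phi>)"
    and u: "continuous_on {- h..0} u"
  shows "has_RS_integral row_col (apply_bv (row_kernel h Z c)) (\<lambda>\<theta>. u (- \<theta>)) {0..h}
           (row_col c (complexify h L u))"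
proof -
  let ?R = "hist h (\<lambda>\<theta>. \<chi> j. Re (u \<theta> $ j)) 0" and ?I = "hist h (\<lambda>\<theta>. \<chi> j. Im (u \<theta> $ j)) 0"
  define A where "A a = row_col c (\<chi> i. Complex (a $ i) 0)" for a :: "real ^ 'n"
  define B where "B a = row_col c (\<chi> i. Complex 0 (a $ i))" for a :: "real ^ 'n"
  have "linear A" "linear B"
    by (auto intro!: linearI simp: A_def B_def row_col_def complex_eq_iff sum.distrib[symmetric]
        scaleR_sum_right algebra_simps)
  then have lin: "bounded_linear A" "bounded_linear B"
    by (simp_all add: linear_conv_bounded_linear)
  have contR: "continuous_on {- h..0} (\<lambda>\<theta>. \<chi> j. Re (u \<theta> $ j))"
    and contI: "continuous_on {- h..0} (\<lambda>\<theta>. \<chi> j. Im (u \<theta> $ j))"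
    using u by (auto intro!: continuous_intros)
  have "has_RS_integral row_col (apply_bv (row_kernel h Z c)) (\<lambda>\<theta>. u (- \<theta>)) {0..h} (A (L ?R) + B (L ?I))"
  proof (rule has_RS_integral_add[OF has_RS_integral_linear[OF L lin(1)] has_RS_integral_linear[OF L lin(2)]])
    fix r v x :: real assume v: "0 \<le> r" "r \<le> x" "x \<le> v" "v \<le> h"
    let ?M = "Z v - Z r"
    have R: "apply_bcontfun ?R (- x) = (\<chi> j. Re (u (- x) $ j))"
      using v by (intro apply_hist_0 contR h) auto
    have I: "apply_bcontfun ?I (- x) = (\<chi> j. Im (u (- x) $ j))"
      using v by (intro apply_hist_0 contI h) auto
    have "A (?M *v apply_bcontfun ?R (- x)) + B (?M *v apply_bcontfun ?I (- x))
        = row_col c (map_matrix complex_of_real ?M *v u (- x))"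
      unfolding A_def B_def row_col.add_right[symmetric] R I
      by (intro arg_cong[where f="row_col c"])
        (simp add: vec_eq_iff matrix_vector_mult_def complex_eq_iff)
    also have "\<dots> = row_col (c v* map_matrix complex_of_real ?M) (u (- x))"
      by (simp add: row_col_vector_matrix_mult)
    also have "c v* map_matrix complex_of_real ?M
        = apply_bv (row_kernel h Z c) v - apply_bv (row_kernel h Z c) r"
      using v by (simp add: apply_row_kernel[OF Z h] linear_diff[OF bounded_linear.linear[OF bounded_linear_row_matrix]])
    finally show "A (?M *v apply_bcontfun ?R (- x)) + B (?M *v apply_bcontfun ?I (- x))
      = row_col (apply_bv (row_kernel h Z c) v - apply_bv (row_kernel h Z c) r) (u (- x))" .
  qed
  also have "A (L ?R) + B (L ?I) = row_col c (complexify h L u)"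
    unfolding A_def B_def complexify_def row_col.add_right[symmetric]
    by (intro arg_cong[where f="row_col c"]) (simp add: vec_eq_iff complex_eq_iff)
  finally show ?thesis .
qed

text \<open>The function \<open>\<theta> \<mapsto> u (- \<theta>)\<close> has density \<open>- d (- \<theta>)\<close>, and \<open>g\<close> vanishes at both ends.\<close>

lemma has_RS_integral_star_deriv:
  fixes g :: "(complex ^ 'n) bv" and u d :: "real \<Rightarrow> complex ^ 'n"
  assumes h: "0 \<le> h" and g: "apply_bv g h = 0"
    and d: "(\<lambda>s. d (- s)) absolutely_integrable_on {0..h}" "\<And>s. s \<in> {0..h} \<Longrightarrow> norm (d (- s)) \<le> C"
    and u: "\<And>\<theta>. \<theta> \<in> {0..h} \<Longrightarrow> u (- \<theta>) = u 0 - integral {0..\<theta>} (\<lambda>s. d (- s))"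
  shows "has_RS_integral row_col (apply_bv g) (\<lambda>\<theta>. u (- \<theta>)) {0..h}
           (integral {0..h} (\<lambda>s. row_col (apply_bv g s) (d (- s))))"
proof -
  have "(\<lambda>s. - d (- s)) absolutely_integrable_on {0..h}"
    using absolutely_integrable_linear[OF d(1) bounded_linear_minus[OF bounded_linear_ident]]
    by (simp add: o_def)
  then have "has_RS_integral row_col (apply_bv g) (\<lambda>\<theta>. u (- \<theta>)) {0..h}
      (row_col (apply_bv g h) (u (- h)) - integral {0..h} (\<lambda>s. row_col (apply_bv g s) (- d (- s))))"
    using d(2) u by (intro has_RS_integral_by_parts[OF h, where C=C]) auto
  then show ?thesis
    by (simp add: g row_col.zero_left row_col.minus_right)
qed

lemma vector_derivative_dom_A:
  assumes h: "0 < h" and d: "\<And>\<theta>. \<theta> \<in> {- h..0} \<Longrightarrow> (\<phi> has_vector_derivative d \<theta>) (at \<theta> within {- h..0})"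
    and \<theta>: "\<theta> \<in> {- h..0}"
  shows "vector_derivative \<phi> (at \<theta> within {- h..0}) = d \<theta>"
  using vector_derivative_within_cbox[of "- h" 0 \<theta> \<phi> "d \<theta>"] d[OF \<theta>] h \<theta> by simp

lemma apply_op_A:
  assumes h: "0 < h" and d: "continuous_on {- h..0} d"
    "\<And>\<theta>. \<theta> \<in> {- h..0} \<Longrightarrow> (apply_bcontfun \<phi> has_vector_derivative d \<theta>) (at \<theta> within {- h..0})"
    and \<theta>: "\<theta> \<in> {- h..0}"
  shows "apply_bcontfun (op_A h \<phi>) \<theta> = d \<theta>" "op_A h \<phi> = hist h d 0"
proof -
  have eq: "vector_derivative (apply_bcontfun \<phi>) (at \<theta> within {- h..0}) = d \<theta>" if "\<theta> \<in> {- h..0}" for \<theta>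
    by (rule vector_derivative_dom_A[OF h d(2) that])
  show "op_A h \<phi> = hist h d 0"
    unfolding op_A_def hist_def using h by (intro arg_cong[where f=Bcontfun] ext) (auto intro!: eq)
  then show "apply_bcontfun (op_A h \<phi>) \<theta> = d \<theta>"
    using apply_hist_0[OF _ d(1) \<theta>] h by simp
qed

text \<open>Let \<open>c\<close> be the jump of \<open>f\<close> at \<open>0\<close> and \<open>g\<close> its derivative. The right-hand side is
  \<open>c \<phi>'(0) + \<integral> g(s) \<phi>'(- s) ds\<close>. The part \<open>g\<close> of the operator gives this integral by partial
  integration, and the kernel part gives \<open>c L \<phi>\<close>, which is \<open>c \<phi>'(0)\<close> by the boundary condition.\<close>

lemma pairing_op_A_star:
  fixes L :: "(real \<Rightarrow>\<^sub>C (real ^ 'n)) \<Rightarrow> real ^ 'n"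
  assumes Z: "NBV h Z" and h: "0 < h"
    and L: "\<And>\<phi>. has_RS_integral (*v) Z (\<lambda>\<theta>. apply_bcontfun \<phi> (- \<theta>)) {0..h} (L \<phi>)"
    and f: "f \<in> dom_A0_star h" and \<phi>: "\<phi> \<in> dom_A h L"
  shows "pairing h (op_A_star h Z f) \<phi> = pairing h f (op_A h \<phi>)"
proof -
  have h0: "0 \<le> h" using h by simp
  let ?g = "star_deriv h f" and ?c = "value0 f"
  have g: "is_star_deriv h f ?g" by (rule is_star_deriv_star_deriv[OF h f])
  obtain d where d: "continuous_on {- h..0} d"
    "\<And>\<theta>. \<theta> \<in> {- h..0} \<Longrightarrow> (apply_bcontfun \<phi> has_vector_derivative d \<theta>) (at \<theta> within {- h..0})"
    "d 0 = complexify h L (apply_bcontfun \<phi>)"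
    using \<phi> unfolding dom_A_def by blast
  have cont: "continuous_on {0..h} (\<lambda>s. d (- s))" by (rule continuous_on_reflect[OF d(1)])
  have "bounded ((\<lambda>s. d (- s)) ` {0..h})"
    by (intro compact_imp_bounded compact_continuous_image cont) auto
  then obtain C where C: "\<And>s. s \<in> {0..h} \<Longrightarrow> norm (d (- s)) \<le> C"
    unfolding bounded_iff by blast
  have prim: "apply_bcontfun \<phi> (- \<theta>) = apply_bcontfun \<phi> 0 - integral {0..\<theta>} (\<lambda>s. d (- s))"
    if \<theta>: "\<theta> \<in> {0..h}" for \<theta>
  proof -
    have "(d has_integral apply_bcontfun \<phi> 0 - apply_bcontfun \<phi> (- \<theta>)) {- \<theta>..0}"
      by (rule fundamental_theorem_of_calculus)
        (use \<theta> has_vector_derivative_within_subset[OF d(2), of _ "{- \<theta>..0}"] in auto)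
    then have "((\<lambda>s. d (- s)) has_integral apply_bcontfun \<phi> 0 - apply_bcontfun \<phi> (- \<theta>)) {0..\<theta>}"
      using has_integral_reflect_real[where f=d and a="- \<theta>" and b=0] by simp
    then show ?thesis by (simp add: integral_unique)
  qed
  have "has_RS_integral row_col (apply_bv ?g) (\<lambda>\<theta>. apply_bcontfun \<phi> (- \<theta>)) {0..h}
      (integral {0..h} (\<lambda>s. row_col (apply_bv ?g s) (d (- s))))"
    using g C prim
    by (intro has_RS_integral_star_deriv[where C=C] h0 absolutely_integrable_continuous_real cont)
      (auto simp: is_star_deriv_def)
  then have 1: "pairing h ?g \<phi> = integral {0..h} (\<lambda>s. row_col (apply_bv ?g s) (d (- s)))"
    by (rule pairing_eqI)
  have 2: "pairing h (row_kernel h Z ?c) \<phi> = row_col ?c (d 0)"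
    unfolding d(3) by (intro pairing_eqI has_RS_integral_row_kernel Z h0 L) simp
  have "has_RS_integral row_col (apply_bv f) (\<lambda>s. d (- s)) {0..h}
      (row_col ?c (d (- 0)) + integral {0..h} (\<lambda>s. row_col (apply_bv ?g s) (d (- s))))"
    using g by (intro has_RS_integral_jump_density h absolutely_integrable_apply_bv cont)
      (auto simp: is_star_deriv_def)
  then have "has_RS_integral row_col (apply_bv f) (\<lambda>\<theta>. apply_bcontfun (op_A h \<phi>) (- \<theta>)) {0..h}
      (row_col ?c (d 0) + integral {0..h} (\<lambda>s. row_col (apply_bv ?g s) (d (- s))))"
    unfolding minus_zero by (rule has_RS_integral_transfer) (subst apply_op_A(1)[OF h d(1,2)], auto)
  then have 3: "pairing h f (op_A h \<phi>)
      = row_col ?c (d 0) + integral {0..h} (\<lambda>s. row_col (apply_bv ?g s) (d (- s)))"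
    by (rule pairing_eqI)
  show ?thesis
    unfolding op_A_star_def 3 bounded_bilinear.add_left[OF bounded_bilinear_pairing[OF h0]] 1 2
    by simp
qed

section \<open>Periodic functions\<close>

lemma periodic_reduce:
  fixes T :: real
  assumes T: "0 < T" and per: "\<And>\<tau>. u (\<tau> + T) = u \<tau>"
  shows "\<exists>y\<in>{0..T}. u x = u y"
proof -
  have n: "u (y + real n * T) = u y" for y n
  proof (induction n)
    case (Suc n)
    have "u (y + real (Suc n) * T) = u ((y + real n * T) + T)" by (simp add: algebra_simps)
    with Suc show ?case by (simp add: per)
  qed simp
  have i: "u (y + of_int k * T) = u y" for y k
  proof (cases "0 \<le> k")
    case True
    then show ?thesis using n[of y "nat k"] by simp
  next
    case False
    then show ?thesis using n[of "y + of_int k * T" "nat (- k)"] by simp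
  qed
  have "u x = u (T * frac (x / T))"
    using i[of "T * frac (x / T)" "\<lfloor>x / T\<rfloor>"] T by (simp add: frac_def algebra_simps)
  moreover have "T * frac (x / T) \<in> {0..T}"
    using T frac_lt_1[of "x / T"] by (simp add: mult_left_le frac_ge_0 less_imp_le)
  ultimately show ?thesis by blast
qed

lemma C1_perD:
  assumes "u \<in> C1_per T E"
  shows "(u has_vector_derivative vector_derivative u (at \<tau>)) (at \<tau>)"
    "continuous_on UNIV (\<lambda>\<tau>. vector_derivative u (at \<tau>))"
    "continuous_on UNIV u" "u (\<tau> + T) = u \<tau>" "u \<tau> \<in> E"
proof -
  have u: "u \<in> C_per T E" "u C1_differentiable_on UNIV"
    using assms unfolding C1_per_def by auto
  then show "continuous_on UNIV u" "u (\<tau> + T) = u \<tau>" "u \<tau> \<in> E"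
    unfolding C_per_def by auto
  obtain D where D: "\<And>\<tau>. (u has_vector_derivative D \<tau>) (at \<tau>)" "continuous_on UNIV D"
    using u(2) unfolding C1_differentiable_on_def by blast
  have "vector_derivative u (at \<tau>) = D \<tau>" for \<tau>
    by (rule vector_derivative_at[OF D(1)])
  then show "(u has_vector_derivative vector_derivative u (at \<tau>)) (at \<tau>)"
    "continuous_on UNIV (\<lambda>\<tau>. vector_derivative u (at \<tau>))"
    using D by simp_all
qed

lemma C1_perI:
  assumes "\<And>\<tau>. (u has_vector_derivative D \<tau>) (at \<tau>)" "continuous_on UNIV D"
    and "\<And>\<tau>. u (\<tau> + T) = u \<tau>" "\<And>\<tau>. u \<tau> \<in> E"
  shows "u \<in> C1_per T E"
proof -
  have "continuous_on UNIV u"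
    by (intro continuous_at_imp_continuous_on ballI has_vector_derivative_continuous[OF assms(1)])
  then show ?thesis
    using assms unfolding C1_per_def C_per_def C1_differentiable_on_def by auto
qed

lemma C1_per_derivative_periodic:
  assumes "u \<in> C1_per T E"
  shows "vector_derivative u (at (\<tau> + T)) = vector_derivative u (at \<tau>)"
proof -
  note u = C1_perD[OF assms]
  have "(\<lambda>s. u (s + T)) = u" by (rule ext) (rule u(4))
  moreover have "((\<lambda>s. u (s + T)) has_vector_derivative vector_derivative u (at (\<tau> + T))) (at \<tau>)"
    using vector_diff_chain_at[of "\<lambda>s. s + T" 1 \<tau> u, OF _ u(1)]
    by (simp add: o_def has_vector_derivative_add_const)
  ultimately show ?thesis using vector_derivative_at by metis
qed

lemma C_perI:
  "continuous_on UNIV u \<Longrightarrow> (\<And>\<tau>. u (\<tau> + T) = u \<tau>) \<Longrightarrow> (\<And>\<tau>. u \<tau> \<in> E) \<Longrightarrow> u \<in> C_per T E"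
  unfolding C_per_def by auto

lemma C_perD:
  assumes "u \<in> C_per T E"
  shows "continuous_on UNIV u" "u (\<tau> + T) = u \<tau>" "u \<tau> \<in> E"
  using assms unfolding C_per_def by auto

lemma C_per_add:
  assumes "u \<in> C_per T E" "v \<in> C_per T E" "\<And>x y. x \<in> E \<Longrightarrow> y \<in> E \<Longrightarrow> x + y \<in> E"
  shows "(\<lambda>\<tau>. u \<tau> + v \<tau>) \<in> C_per T E"
  using C_perD[OF assms(1)] C_perD[OF assms(2)] assms(3)
  by (intro C_perI continuous_on_add) auto

lemma C_per_map:
  assumes "u \<in> C_per T E" "bounded_linear A" "\<And>x. x \<in> E \<Longrightarrow> A x \<in> E"
  shows "(\<lambda>\<tau>. A (u \<tau>)) \<in> C_per T E"
  using C_perD[OF assms(1)] assms(3)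
  by (intro C_perI bounded_linear.continuous_on[OF assms(2)]) auto

lemma C1_per_add:
  assumes "u \<in> C1_per T E" "v \<in> C1_per T E" "\<And>x y. x \<in> E \<Longrightarrow> y \<in> E \<Longrightarrow> x + y \<in> E"
  shows "(\<lambda>\<tau>. u \<tau> + v \<tau>) \<in> C1_per T E"
    "vector_derivative (\<lambda>\<tau>. u \<tau> + v \<tau>) (at \<tau>) = vector_derivative u (at \<tau>) + vector_derivative v (at \<tau>)"
proof -
  note u = C1_perD[OF assms(1)] and v = C1_perD[OF assms(2)]
  note d = has_vector_derivative_add[OF u(1) v(1)]
  show "(\<lambda>\<tau>. u \<tau> + v \<tau>) \<in> C1_per T E"
    by (rule C1_perI[OF d continuous_on_add[OF u(2) v(2)]]) (simp_all add: u v assms(3))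
  show "vector_derivative (\<lambda>\<tau>. u \<tau> + v \<tau>) (at \<tau>) = vector_derivative u (at \<tau>) + vector_derivative v (at \<tau>)"
    by (rule vector_derivative_at[OF d])
qed

lemma C1_per_map:
  assumes "u \<in> C1_per T E" "bounded_linear A" "\<And>x. x \<in> E \<Longrightarrow> A x \<in> E"
  shows "(\<lambda>\<tau>. A (u \<tau>)) \<in> C1_per T E"
    "vector_derivative (\<lambda>\<tau>. A (u \<tau>)) (at \<tau>) = A (vector_derivative u (at \<tau>))"
proof -
  note u = C1_perD[OF assms(1)]
  note d = bounded_linear.has_vector_derivative[OF assms(2) u(1)]
  show "(\<lambda>\<tau>. A (u \<tau>)) \<in> C1_per T E"
    by (rule C1_perI[OF d bounded_linear.continuous_on[OF assms(2) u(2)]]) (simp_all add: u assms(3))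
  show "vector_derivative (\<lambda>\<tau>. A (u \<tau>)) (at \<tau>) = A (vector_derivative u (at \<tau>))"
    by (rule vector_derivative_at[OF d])
qed

lemma linear_operator_part:
  assumes "\<And>u v. u \<in> D \<Longrightarrow> v \<in> D \<Longrightarrow>
      (\<lambda>\<tau>. u \<tau> + v \<tau>) \<in> D \<and> A (\<lambda>\<tau>. u \<tau> + v \<tau>) = (\<lambda>\<tau>. A u \<tau> + A v \<tau>)"
    and "\<And>c u. u \<in> D \<Longrightarrow>
      (\<lambda>\<tau>. smul c (u \<tau>)) \<in> D \<and> A (\<lambda>\<tau>. smul c (u \<tau>)) = (\<lambda>\<tau>. smul c (A u \<tau>))"
    and "\<And>u v. u \<in> R \<Longrightarrow> v \<in> R \<Longrightarrow> (\<lambda>\<tau>. u \<tau> + v \<tau>) \<in> R"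
    and "\<And>c u. u \<in> R \<Longrightarrow> (\<lambda>\<tau>. smul c (u \<tau>)) \<in> R"
  shows "linear_operator smul (part D R A) R A"
  using assms unfolding linear_operator_def part_def by auto

text \<open>Two integrands whose difference \<open>p + q\<close> integrates to zero have the same integral; if one of
  them is not integrable then neither is the other, and both integrals have the default value.\<close>

lemma integral_eq_if_difference_exact:
  fixes a p q :: "real \<Rightarrow> 'a::banach"
  assumes "((\<lambda>\<tau>. p \<tau> + q \<tau>) has_integral 0) S"
  shows "integral S (\<lambda>\<tau>. a \<tau> + p \<tau>) = integral S (\<lambda>\<tau>. a \<tau> - q \<tau>)"
proof (cases "(\<lambda>\<tau>. a \<tau> - q \<tau>) integrable_on S")
  case True
  then have "((\<lambda>\<tau>. (a \<tau> - q \<tau>) + (p \<tau> + q \<tau>)) has_integral integral S (\<lambda>\<tau>. a \<tau> - q \<tau>) + 0) S"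
    by (intro has_integral_add assms integrable_integral)
  then show ?thesis by (simp add: integral_unique add_ac)
next
  case False
  have "\<not> (\<lambda>\<tau>. a \<tau> + p \<tau>) integrable_on S"
  proof
    assume "(\<lambda>\<tau>. a \<tau> + p \<tau>) integrable_on S"
    then have "(\<lambda>\<tau>. (a \<tau> + p \<tau>) - (p \<tau> + q \<tau>)) integrable_on S"
      using assms by (intro integrable_diff) auto
    with False show False by simp
  qed
  with False show ?thesis by (simp add: not_integrable_integral)
qed

text \<open>Over a period, the derivative of a periodic function integrates to zero.\<close>

lemma has_integral_periodic_derivative:
  fixes P :: "real \<Rightarrow> 'a::banach"
  assumes "0 \<le> T" "\<And>\<tau>. (P has_vector_derivative P' \<tau>) (at \<tau>)" "P T = P 0"
  shows "(P' has_integral 0) {0..T}"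
  using fundamental_theorem_of_calculus[OF assms(1), of P P'] has_vector_derivative_at_within[OF assms(2)] assms(3)
  by simp

section \<open>Duality of the first pair of operators\<close>

text \<open>By duality at each time, the integrands of both sides differ by the derivative of
  \<open>\<langle>\<phi>s(\<tau>), \<phi>(\<tau>)\<rangle>\<close>, whose integral over a period is \<open>0\<close>.\<close>

lemma pairing_per_cA_star:
  fixes L :: "real \<Rightarrow> (real \<Rightarrow>\<^sub>C (real ^ 'n)) \<Rightarrow> real ^ 'n"
  assumes h: "0 < h" and T: "0 < T"
    and Z: "\<And>t. NBV h (\<zeta> t)"
    and L: "\<And>t \<phi>. has_RS_integral (*v) (\<zeta> t) (\<lambda>\<theta>. apply_bcontfun \<phi> (-\<theta>)) {0..h} (L t \<phi>)"
    and \<phi>: "\<phi> \<in> dom_cA h T L" and \<phi>s: "\<phi>s \<in> dom_cA_star h T"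
  shows "pairing_per h T (cA_star h \<zeta> \<phi>s) \<phi> = pairing_per h T \<phi>s (cA h \<phi>)"
proof -
  have h0: "0 \<le> h" using h by simp
  interpret bounded_bilinear "pairing h :: (complex ^ 'n) bv \<Rightarrow> _"
    by (rule bounded_bilinear_pairing[OF h0])
  have "\<phi> \<in> C1_per T (state_space h)" "\<phi>s \<in> C1_per T (star_space h)"
    using \<phi> \<phi>s unfolding dom_cA_def dom_cA_star_def by auto
  note u = C1_perD[OF this(1)] and f = C1_perD[OF this(2)]
  let ?p = "\<lambda>\<tau>. pairing h (vector_derivative \<phi>s (at \<tau>)) (\<phi> \<tau>)"
  let ?q = "\<lambda>\<tau>. pairing h (\<phi>s \<tau>) (vector_derivative \<phi> (at \<tau>))"
  have "((\<lambda>\<tau>. pairing h (\<phi>s \<tau>) (\<phi> \<tau>)) has_vector_derivative ?p \<tau> + ?q \<tau>) (at \<tau>)" for \<tau>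
    using has_vector_derivative[OF f(1) u(1), of \<tau>] by (simp add: add.commute)
  then have "((\<lambda>\<tau>. ?p \<tau> + ?q \<tau>) has_integral 0) {0..T}"
    using u(4)[of 0] f(4)[of 0] T
    by (intro has_integral_periodic_derivative[where P="\<lambda>\<tau>. pairing h (\<phi>s \<tau>) (\<phi> \<tau>)"]) auto
  from integral_eq_if_difference_exact[OF this, of "\<lambda>\<tau>. pairing h (op_A_star h (\<zeta> \<tau>) (\<phi>s \<tau>)) (\<phi> \<tau>)"]
  show ?thesis
    using \<phi> \<phi>s pairing_op_A_star[OF Z h L]
    unfolding pairing_per_def cA_star_def cA_def dom_cA_def dom_cA_star_def
    by (simp add: add_left diff_right)
qed

lemma linear_operator_cA_star:
  fixes \<zeta> :: "real \<Rightarrow> real \<Rightarrow> real ^ 'n ^ 'n"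
  assumes h: "0 < h" and Z: "\<And>t. NBV h (\<zeta> t)"
  shows "linear_operator scaleC_bv
    (part (dom_cA_star h T) (C_per T (star_space h)) (cA_star h \<zeta>)) (C_per T (star_space h)) (cA_star h \<zeta>)"
proof (rule linear_operator_part)
  fix u v :: "real \<Rightarrow> (complex ^ 'n) bv" and c :: complex
  note lin = op_A_star_linear[OF Z h] dom_A0_star_linear[OF h]
  have scaleC: "scaleC_bv c f \<in> dom_A0_star h"
    "op_A_star h (\<zeta> \<tau>) (scaleC_bv c f) = scaleC_bv c (op_A_star h (\<zeta> \<tau>) f)"
    if "f \<in> dom_A0_star h" for f \<tau>
    using lin(2,5)[OF that that] by auto
  show "(\<lambda>\<tau>. u \<tau> + v \<tau>) \<in> dom_cA_star h T \<and>
      cA_star h \<zeta> (\<lambda>\<tau>. u \<tau> + v \<tau>) = (\<lambda>\<tau>. cA_star h \<zeta> u \<tau> + cA_star h \<zeta> v \<tau>)"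
    if "u \<in> dom_cA_star h T" "v \<in> dom_cA_star h T"
    using that C1_per_add[of u T "star_space h" v]
    by (simp add: dom_cA_star_def cA_star_def lin star_space_linear add_ac)
  show "(\<lambda>\<tau>. scaleC_bv c (u \<tau>)) \<in> dom_cA_star h T \<and>
      cA_star h \<zeta> (\<lambda>\<tau>. scaleC_bv c (u \<tau>)) = (\<lambda>\<tau>. scaleC_bv c (cA_star h \<zeta> u \<tau>))"
    if "u \<in> dom_cA_star h T"
    using that C1_per_map[of u T "star_space h", OF _ bounded_linear_scaleC_bv[of c]]
    by (auto simp: dom_cA_star_def cA_star_def scaleC star_space_linear scaleC_bv_add fun_eq_iff)
  show "(\<lambda>\<tau>. u \<tau> + v \<tau>) \<in> C_per T (star_space h)"
    if "u \<in> C_per T (star_space h)" "v \<in> C_per T (star_space h)"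
    using that by (rule C_per_add) (rule star_space_linear)
  show "(\<lambda>\<tau>. scaleC_bv c (u \<tau>)) \<in> C_per T (star_space h)" if "u \<in> C_per T (star_space h)"
    using that bounded_linear_scaleC_bv by (rule C_per_map) (rule star_space_linear)
qed

section \<open>Periodic functions orthogonal to smooth periodic functions\<close>

text \<open>Let \<open>G\<close> be a primitive of \<open>g\<close>, periodic since \<open>g\<close> is orthogonal to constants, and \<open>\<omega>\<close> a
  primitive of \<open>G - m\<close>, periodic if \<open>m\<close> is the mean of \<open>G\<close>. Partial integration turns
  \<open>\<integral> \<omega> g = 0\<close> into \<open>\<integral> (G - m)\<^sup>2 = 0\<close>, so \<open>G\<close> is constant.\<close>

lemma periodic_zero_if_orthogonal_real:
  fixes g :: "real \<Rightarrow> real"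
  assumes T: "0 < T" and cont: "continuous_on UNIV g" and per: "\<And>\<tau>. g (\<tau> + T) = g \<tau>"
    and orth: "\<And>\<omega> :: real \<Rightarrow> real. \<omega> \<in> C1_per T UNIV \<Longrightarrow> integral {0..T} (\<lambda>\<tau>. \<omega> \<tau> * g \<tau>) = 0"
  shows "g \<tau> = 0"
proof -
  have T0: "0 \<le> T" using T by simp
  have antiderivative: "\<exists>F. \<forall>x. (F has_vector_derivative f x) (at x)"
    if "continuous_on UNIV f" for f :: "real \<Rightarrow> real"
    using einterval_antiderivative[of "-\<infinity>" "\<infinity>" f] that by (simp add: continuous_on_eq_continuous_at)
  have per_primitive: "F (x + T) = F x"
    if F: "\<And>x. (F has_vector_derivative f x) (at x)" and f: "\<And>x. f (x + T) = f x"
      and mean: "integral {0..T} f = 0" for F f :: "real \<Rightarrow> real" and x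
  proof -
    have "((\<lambda>x. F (x + T) - F x) has_vector_derivative f (x + T) * 1 - f x) (at x)" for x
      using F[of "x + T"] F[of x] unfolding has_real_derivative_iff_has_vector_derivative[symmetric]
      by (auto intro!: derivative_eq_intros DERIV_chain2[where f=F])
    then have "\<forall>x. ((\<lambda>x. F (x + T) - F x) has_real_derivative 0) (at x)"
      by (simp add: f has_real_derivative_iff_has_vector_derivative)
    then have "F (x + T) - F x = F (0 + T) - F 0" by (rule DERIV_isconst_all)
    also have "(f has_integral F T - F 0) {0..T}"
      using has_vector_derivative_at_within[OF F] by (intro fundamental_theorem_of_calculus T0)
    then have "F (0 + T) - F 0 = 0" using mean by (simp add: integral_unique)
    finally show ?thesis by simp
  qed
  obtain G where G: "\<And>x. (G has_vector_derivative g x) (at x)"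
    using antiderivative[OF cont] by blast
  have "(\<lambda>_. 1) \<in> C1_per T (UNIV :: real set)"
    by (rule C1_perI[where D="\<lambda>_. 0"]) auto
  from orth[OF this] have "integral {0..T} g = 0" by simp
  note G_per = per_primitive[OF G per this]
  have G_cont: "continuous_on UNIV G"
    by (intro continuous_at_imp_continuous_on ballI has_vector_derivative_continuous[OF G])
  define m where "m = integral {0..T} G / T"
  have Gm_cont: "continuous_on S (\<lambda>x. G x - m)" for S
    using continuous_on_subset[OF G_cont] by (intro continuous_on_diff continuous_on_const) auto
  obtain \<omega> where \<omega>: "\<And>x. (\<omega> has_vector_derivative G x - m) (at x)"
    using antiderivative[OF Gm_cont] by blast
  have "integral {0..T} (\<lambda>x. G x - m) = integral {0..T} G - m * T"
    using T G_cont continuous_on_subset[OF G_cont]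
    by (subst Henstock_Kurzweil_Integration.integral_diff) (auto intro!: integrable_continuous_real)
  also have "\<dots> = 0" using T by (simp add: m_def)
  finally have \<omega>_per: "\<omega> (x + T) = \<omega> x" for x
    using per_primitive[OF \<omega>] G_per by simp
  have "\<omega> \<in> C1_per T UNIV"
    by (rule C1_perI[OF \<omega> Gm_cont \<omega>_per]) auto
  note zero = orth[OF this]
  have "((\<lambda>x. \<omega> x * (G x - m)) has_vector_derivative \<omega> x * g x + (G x - m) * (G x - m)) (at x)" for x
    using \<omega>[of x] G[of x] unfolding has_real_derivative_iff_has_vector_derivative[symmetric]
    by (auto intro!: derivative_eq_intros)
  then have "((\<lambda>x. \<omega> x * g x + (G x - m) * (G x - m)) has_integral 0) {0..T}"
    by (rule has_integral_periodic_derivative[OF T0]) (use \<omega>_per[of 0] G_per[of 0] in auto)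
  moreover have \<omega>_cont: "continuous_on UNIV \<omega>"
    by (intro continuous_at_imp_continuous_on ballI has_vector_derivative_continuous[OF \<omega>])
  have "(\<lambda>x. \<omega> x * g x) integrable_on {0..T}"
    using continuous_on_subset[OF \<omega>_cont] continuous_on_subset[OF cont]
    by (intro integrable_continuous_real continuous_intros) auto
  then have "((\<lambda>x. \<omega> x * g x) has_integral 0) {0..T}"
    using zero by (simp add: has_integral_integral)
  ultimately have "((\<lambda>x. (\<omega> x * g x + (G x - m) * (G x - m)) - \<omega> x * g x) has_integral 0 - 0) {0..T}"
    by (rule has_integral_diff)
  then have "integral {0..T} (\<lambda>x. (G x - m) * (G x - m)) = 0"
    by (simp add: integral_unique)
  then have Gm: "\<forall>x\<in>{0..T}. (G x - m) * (G x - m) = 0"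
    by (subst (asm) integral_eq_0_iff) (auto intro!: continuous_intros Gm_cont T)
  have "G x = m" for x
    using periodic_reduce[of T G x, OF T G_per] Gm by auto
  then have "(G has_vector_derivative 0) (at \<tau>)"
    using has_vector_derivative_const[of m "at \<tau>"] by (metis ext)
  with G[of \<tau>] show ?thesis by (rule vector_derivative_unique_at)
qed

lemma periodic_zero_if_orthogonal:
  fixes g :: "real \<Rightarrow> complex"
  assumes T: "0 < T" and cont: "continuous_on UNIV g" and per: "\<And>\<tau>. g (\<tau> + T) = g \<tau>"
    and orth: "\<And>\<omega> :: real \<Rightarrow> real. \<omega> \<in> C1_per T UNIV \<Longrightarrow> integral {0..T} (\<lambda>\<tau>. \<omega> \<tau> *\<^sub>R g \<tau>) = 0"
  shows "g \<tau> = 0"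
proof -
  have int: "(\<lambda>\<tau>. \<omega> \<tau> *\<^sub>R g \<tau>) integrable_on {0..T}" if "\<omega> \<in> C1_per T UNIV" for \<omega> :: "real \<Rightarrow> real"
    using continuous_on_subset[OF C1_perD(3)[OF that]] continuous_on_subset[OF cont]
    by (intro integrable_continuous_real continuous_intros) auto
  have "Re (g \<tau>) = 0"
  proof (rule periodic_zero_if_orthogonal_real[where g="\<lambda>\<tau>. Re (g \<tau>)", OF T])
    show "continuous_on UNIV (\<lambda>\<tau>. Re (g \<tau>))" using cont by (intro continuous_intros)
    show "integral {0..T} (\<lambda>\<tau>. \<omega> \<tau> * Re (g \<tau>)) = 0" if "\<omega> \<in> C1_per T UNIV" for \<omega> :: "real \<Rightarrow> real"
      using integral_linear[OF int[OF that] bounded_linear_Re] orth[OF that] by (simp add: o_def)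
  qed (simp add: per)
  moreover have "Im (g \<tau>) = 0"
  proof (rule periodic_zero_if_orthogonal_real[where g="\<lambda>\<tau>. Im (g \<tau>)", OF T])
    show "continuous_on UNIV (\<lambda>\<tau>. Im (g \<tau>))" using cont by (intro continuous_intros)
    show "integral {0..T} (\<lambda>\<tau>. \<omega> \<tau> * Im (g \<tau>)) = 0" if "\<omega> \<in> C1_per T UNIV" for \<omega> :: "real \<Rightarrow> real"
      using integral_linear[OF int[OF that] bounded_linear_Im] orth[OF that] by (simp add: o_def)
  qed (simp add: per)
  ultimately show ?thesis by (simp add: complex_eq_iff)
qed

section \<open>Smoothness of the linearisation along the periodic solution\<close>

lemma bounded_linear_linear_bound:
  assumes "linear f" "\<And>v. norm (f v) \<le> M * norm v"
  shows "bounded_linear f"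
  using assms by (intro bounded_linear_intro[where K=M])
    (auto simp: linear_add linear_cmul mult.commute)

text \<open>The continuity of the second derivative is part of the definition if \<open>m = 2\<close>; if \<open>m > 2\<close> then it
  follows from differentiability.\<close>

lemma Ck_smooth_second_derivative:
  fixes F :: "'a::real_normed_vector \<Rightarrow> 'b::real_normed_vector"
  assumes F: "Ck_smooth m F" and m: "2 \<le> m"
  obtains F' :: "'a \<Rightarrow> 'a \<Rightarrow>\<^sub>L 'b" and F'' :: "'a \<Rightarrow> 'a \<Rightarrow>\<^sub>L ('a \<Rightarrow>\<^sub>L 'b)"
    where "\<And>x. (F has_derivative blinfun_apply (F' x)) (at x)"
      and "\<And>x. (F' has_derivative blinfun_apply (F'' x)) (at x)"
      and "continuous_on UNIV F''"
proof -
  obtain D :: "'a \<Rightarrow> 'a list \<Rightarrow> 'b" where D: "\<forall>x. D x [] = F x"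
    "\<forall>x us vs. length us + length vs < m \<longrightarrow> linear (\<lambda>v. D x (us @ v # vs))"
    "\<forall>x. \<forall>j\<le>m. \<exists>M. \<forall>vs. length vs = j \<longrightarrow> norm (D x vs) \<le> M * (\<Prod>v\<leftarrow>vs. norm v)"
    "\<forall>x. \<forall>j<m. \<forall>e>0. \<exists>d>0. \<forall>y. norm (y - x) < d \<longrightarrow> (\<forall>vs. length vs = j \<longrightarrow>
        norm (D y vs - D x vs - D x ((y - x) # vs)) \<le> e * norm (y - x) * (\<Prod>v\<leftarrow>vs. norm v))"
    "\<forall>x. \<forall>e>0. \<exists>d>0. \<forall>y. norm (y - x) < d \<longrightarrow> (\<forall>vs. length vs = m \<longrightarrow>
        norm (D y vs - D x vs) \<le> e * (\<Prod>v\<leftarrow>vs. norm v))"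
    using F unfolding Ck_smooth_def by (elim exE conjE)
  note D0 = D(1)[rule_format]
  have lin: "linear (\<lambda>v. D x (us @ v # vs))" if "length us + length vs < m" for x us vs
    using D(2) that by simp
  note bound = D(3)[THEN spec, THEN spec, THEN mp]
  note diff = D(4)[THEN spec, THEN spec, THEN mp, THEN spec, THEN mp]
  note cont = D(5)[THEN spec, THEN spec, THEN mp]
  have lin1: "linear (\<lambda>v. D x [v])" for x
    using lin[of "[]" "[]" x] m by simp
  have lin2: "linear (\<lambda>u. D x [u, v])" "linear (\<lambda>v. D x [u, v])" for x u v
    using lin[of "[]" "[v]" x] lin[of "[u]" "[]" x] m by simp_all
  have bl1: "bounded_linear (\<lambda>v. D x [v])" for x
  proof -
    obtain M where M: "\<forall>vs. length vs = 1 \<longrightarrow> norm (D x vs) \<le> M * (\<Prod>v\<leftarrow>vs. norm v)"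
      using bound[of 1 x] m by auto
    have "norm (D x [v]) \<le> M * norm v" for v
      using M[rule_format, of "[v]"] by simp
    then show ?thesis by (rule bounded_linear_linear_bound[OF lin1])
  qed
  have "\<exists>M. \<forall>u v. norm (D x [u, v]) \<le> M * norm u * norm v" for x
  proof -
    obtain M where M: "\<forall>vs. length vs = 2 \<longrightarrow> norm (D x vs) \<le> M * (\<Prod>v\<leftarrow>vs. norm v)"
      using bound[of 2 x] m by auto
    have "norm (D x [u, v]) \<le> M * norm u * norm v" for u v
      using M[rule_format, of "[u, v]"] by (simp add: mult.assoc)
    then show ?thesis by blast
  qed
  then obtain M where M: "\<And>x u v. norm (D x [u, v]) \<le> M x * norm u * norm v" by metis
  have bl2: "bounded_linear (\<lambda>v. D x [u, v])" for x u
    by (rule bounded_linear_linear_bound[OF lin2(2) M])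
  define F' where "F' x = Blinfun (\<lambda>v. D x [v])" for x
  define F2 where "F2 x u = Blinfun (\<lambda>v. D x [u, v])" for x u
  define F'' where "F'' x = Blinfun (F2 x)" for x
  have F': "blinfun_apply (F' x) v = D x [v]" for x v
    unfolding F'_def by (simp add: bounded_linear_Blinfun_apply[OF bl1])
  have F2: "blinfun_apply (F2 x u) v = D x [u, v]" for x u v
    unfolding F2_def by (simp add: bounded_linear_Blinfun_apply[OF bl2])
  have "bounded_linear (F2 x)" for x
  proof (rule bounded_linear_intro[where K="\<bar>M x\<bar>"])
    show "F2 x (u + u') = F2 x u + F2 x u'" for u u'
      by (rule blinfun_eqI) (simp add: F2 blinfun.add_left linear_add[OF lin2(1)])
    show "F2 x (r *\<^sub>R u) = r *\<^sub>R F2 x u" for r u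
      by (rule blinfun_eqI) (simp add: F2 blinfun.scaleR_left linear_cmul[OF lin2(1)])
    show "norm (F2 x u) \<le> norm u * \<bar>M x\<bar>" for u
    proof (rule norm_blinfun_bound)
      fix v
      have "norm (D x [u, v]) \<le> M x * norm u * norm v" by (rule M)
      also have "\<dots> \<le> \<bar>M x\<bar> * norm u * norm v" by (intro mult_right_mono) auto
      finally show "norm (blinfun_apply (F2 x u) v) \<le> norm u * \<bar>M x\<bar> * norm v"
        by (simp add: F2 mult_ac)
    qed simp
  qed
  then have F'': "blinfun_apply (F'' x) u = F2 x u" for x u
    unfolding F''_def by (simp add: bounded_linear_Blinfun_apply)
  have 1: "(F has_derivative blinfun_apply (F' x)) (at x)" for x
    unfolding has_derivative_at_alt
  proof (intro conjI allI impI blinfun.bounded_linear_right)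
    fix e :: real assume "e > 0"
    then obtain d where "d > 0" "\<forall>y. norm (y - x) < d \<longrightarrow> (\<forall>vs. length vs = 0 \<longrightarrow>
        norm (D y vs - D x vs - D x ((y - x) # vs)) \<le> e * norm (y - x) * (\<Prod>v\<leftarrow>vs. norm v))"
      using diff[of 0 e x] m by auto
    then show "\<exists>d>0. \<forall>y. norm (y - x) < d \<longrightarrow>
        norm (F y - F x - blinfun_apply (F' x) (y - x)) \<le> e * norm (y - x)"
      by (intro exI[of _ d]) (simp add: F' D0)
  qed
  have 2: "(F' has_derivative blinfun_apply (F'' x)) (at x)" for x
    unfolding has_derivative_at_alt
  proof (intro conjI allI impI blinfun.bounded_linear_right)
    fix e :: real assume e: "e > 0"
    then obtain d where d: "d > 0" "\<forall>y. norm (y - x) < d \<longrightarrow> (\<forall>vs. length vs = 1 \<longrightarrow>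
        norm (D y vs - D x vs - D x ((y - x) # vs)) \<le> e * norm (y - x) * (\<Prod>v\<leftarrow>vs. norm v))"
      using diff[of 1 e x] m by auto
    have "norm (F' y - F' x - blinfun_apply (F'' x) (y - x)) \<le> e * norm (y - x)"
      if y: "norm (y - x) < d" for y
    proof (rule norm_blinfun_bound)
      show "norm (blinfun_apply (F' y - F' x - blinfun_apply (F'' x) (y - x)) v) \<le> e * norm (y - x) * norm v" for v
        using d(2)[rule_format, OF y, of "[v]"] by (simp add: blinfun.diff_left F' F'' F2)
    qed (use e in simp)
    with d(1) show "\<exists>d>0. \<forall>y. norm (y - x) < d \<longrightarrow>
        norm (F' y - F' x - blinfun_apply (F'' x) (y - x)) \<le> e * norm (y - x)"
      by (intro exI[of _ d]) simp
  qed
  have cont2: "\<exists>d>0. \<forall>y. norm (y - x) < d \<longrightarrow> (\<forall>vs. length vs = 2 \<longrightarrow>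
        norm (D y vs - D x vs) \<le> e * (\<Prod>v\<leftarrow>vs. norm v))" if e: "e > 0" for x e
  proof (cases "m = 2")
    case True
    then show ?thesis using cont[OF e, of x] by simp
  next
    case False
    then have m3: "2 < m" "3 \<le> m" using m by auto
    obtain N where N: "\<forall>vs. length vs = 3 \<longrightarrow> norm (D x vs) \<le> N * (\<Prod>v\<leftarrow>vs. norm v)"
      using bound[OF m3(2), of x] by auto
    obtain d where d: "d > 0" "\<forall>y. norm (y - x) < d \<longrightarrow> (\<forall>vs. length vs = 2 \<longrightarrow>
        norm (D y vs - D x vs - D x ((y - x) # vs)) \<le> 1 * norm (y - x) * (\<Prod>v\<leftarrow>vs. norm v))"
      using diff[OF m3(1), of 1 x] by auto
    define d' where "d' = min d (e / (1 + \<bar>N\<bar>))"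
    have "d' > 0" using d(1) e by (simp add: d'_def)
    moreover have "norm (D y vs - D x vs) \<le> e * (\<Prod>v\<leftarrow>vs. norm v)"
      if y: "norm (y - x) < d'" and vs: "length vs = 2" for y vs
    proof -
      let ?P = "\<Prod>v\<leftarrow>vs. norm v"
      have P: "0 \<le> ?P" by (induction vs) auto
      have "norm (D y vs - D x vs) \<le> norm (D y vs - D x vs - D x ((y - x) # vs)) + norm (D x ((y - x) # vs))"
        by norm
      also have "\<dots> \<le> norm (y - x) * ?P + \<bar>N\<bar> * (norm (y - x) * ?P)"
      proof (rule add_mono)
        show "norm (D y vs - D x vs - D x ((y - x) # vs)) \<le> norm (y - x) * ?P"
          using d(2)[rule_format, of y vs] y vs by (simp add: d'_def)
        have "norm (D x ((y - x) # vs)) \<le> N * (norm (y - x) * ?P)"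
          using N[rule_format, of "(y - x) # vs"] vs by simp
        also have "\<dots> \<le> \<bar>N\<bar> * (norm (y - x) * ?P)"
          using P by (intro mult_right_mono) auto
        finally show "norm (D x ((y - x) # vs)) \<le> \<bar>N\<bar> * (norm (y - x) * ?P)" .
      qed
      also have "\<dots> = ((1 + \<bar>N\<bar>) * norm (y - x)) * ?P" by (simp add: algebra_simps)
      also have "\<dots> \<le> e * ?P"
      proof (rule mult_right_mono[OF _ P])
        have "norm (y - x) < e / (1 + \<bar>N\<bar>)" using y by (simp add: d'_def)
        then show "(1 + \<bar>N\<bar>) * norm (y - x) \<le> e" by (simp add: pos_less_divide_eq mult.commute less_imp_le)
      qed
      finally show ?thesis .
    qed
    ultimately show ?thesis by blast
  qed
  have 3: "continuous_on UNIV F''"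
    unfolding continuous_on_iff
  proof (intro ballI allI impI)
    fix x and e :: real assume "e > 0"
    then have e2: "e / 2 > 0" by simp
    then obtain d where d: "d > 0" "\<forall>y. norm (y - x) < d \<longrightarrow> (\<forall>vs. length vs = 2 \<longrightarrow>
        norm (D y vs - D x vs) \<le> e / 2 * (\<Prod>v\<leftarrow>vs. norm v))"
      using cont2[OF e2, of x] by auto
    have "dist (F'' y) (F'' x) < e" if y: "dist y x < d" for y
    proof -
      have "norm (F'' y - F'' x) \<le> e / 2"
      proof (rule norm_blinfun_bound)
        fix u
        show "norm (blinfun_apply (F'' y - F'' x) u) \<le> e / 2 * norm u"
        proof (rule norm_blinfun_bound)
          show "norm (blinfun_apply (blinfun_apply (F'' y - F'' x) u) v) \<le> e / 2 * norm u * norm v" for v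
            using d(2)[rule_format, of y "[u, v]"] y
            by (simp add: blinfun.diff_left F'' F2 dist_norm mult.assoc)
        qed (use e2 in simp)
      qed (use e2 in simp)
      then show ?thesis using \<open>e > 0\<close> by (simp add: dist_norm)
    qed
    with d(1) show "\<exists>d>0. \<forall>x'\<in>UNIV. dist x' x < d \<longrightarrow> dist (F'' x') (F'' x) < e" by blast
  qed
  show thesis by (rule that[OF 1 2 3])
qed

text \<open>By uniform continuity of \<open>x\<close> on compact intervals.\<close>

lemma continuous_on_hist:
  fixes x :: "real \<Rightarrow> 'a::metric_space"
  assumes x: "continuous_on UNIV x" and h: "0 \<le> h"
  shows "continuous_on UNIV (hist h x)"
  unfolding continuous_on_iff
proof (intro ballI allI impI)
  fix t e :: real assume "e > 0"
  then have e2: "e / 2 > 0" by simp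
  have ap: "apply_bcontfun (hist h x s) \<theta> = x (s + max (- h) (min 0 \<theta>))" for s \<theta>
    using continuous_on_subset[OF x] h by (intro apply_hist) auto
  have "uniformly_continuous_on {t - h - 1..t + 1} x"
    by (intro compact_uniformly_continuous continuous_on_subset[OF x]) auto
  then obtain d where d: "d > 0" "\<And>s r. s \<in> {t - h - 1..t + 1} \<Longrightarrow> r \<in> {t - h - 1..t + 1} \<Longrightarrow>
      dist r s < d \<Longrightarrow> dist (x r) (x s) < e / 2"
    using e2 unfolding uniformly_continuous_on_def by metis
  have "dist (hist h x s) (hist h x t) < e" if s: "dist s t < min d 1" for s
  proof -
    have "dist (hist h x s) (hist h x t) \<le> e / 2"
    proof (rule dist_bound)
      fix \<theta> :: real
      have "dist (x (s + max (- h) (min 0 \<theta>))) (x (t + max (- h) (min 0 \<theta>))) < e / 2"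
        using s h by (intro d(2)) (auto simp: dist_real_def)
      then show "dist (apply_bcontfun (hist h x s) \<theta>) (apply_bcontfun (hist h x t) \<theta>) \<le> e / 2"
        by (simp add: ap)
    qed
    then show ?thesis using \<open>e > 0\<close> by simp
  qed
  then show "\<exists>d>0. \<forall>x'\<in>UNIV. dist x' t < d \<longrightarrow> dist (hist h x x') (hist h x t) < e"
    using d(1) by (intro exI[of _ "min d 1"]) auto
qed

text \<open>The mean value inequality bounds the error of the linearisation by the oscillation of \<open>x'\<close>, which is
  small uniformly on compact intervals.\<close>

lemma has_vector_derivative_hist:
  fixes x :: "real \<Rightarrow> 'a::real_normed_vector"
  assumes x: "\<And>t. (x has_vector_derivative x' t) (at t)" and x': "continuous_on UNIV x'" and h: "0 \<le> h"
  shows "(hist h x has_vector_derivative hist h x' t) (at t)"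
  unfolding has_vector_derivative_def has_derivative_at_alt
proof (intro conjI allI impI bounded_linear_scaleR_left)
  fix e :: real assume e: "e > 0"
  have xc: "continuous_on UNIV x"
    by (intro continuous_at_imp_continuous_on ballI has_vector_derivative_continuous[OF x])
  have ap: "apply_bcontfun (hist h x s) \<theta> = x (s + max (- h) (min 0 \<theta>))"
    "apply_bcontfun (hist h x' s) \<theta> = x' (s + max (- h) (min 0 \<theta>))" for s \<theta>
    using continuous_on_subset[OF xc] continuous_on_subset[OF x'] h by (auto intro!: apply_hist)
  have "uniformly_continuous_on {t - h - 1..t + 1} x'"
    by (intro compact_uniformly_continuous continuous_on_subset[OF x']) auto
  then obtain d where d: "d > 0" "\<And>s r. s \<in> {t - h - 1..t + 1} \<Longrightarrow> r \<in> {t - h - 1..t + 1} \<Longrightarrow>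
      dist r s < d \<Longrightarrow> dist (x' r) (x' s) < e"
    using e unfolding uniformly_continuous_on_def by metis
  have "norm (hist h x s - hist h x t - (s - t) *\<^sub>R hist h x' t) \<le> e * norm (s - t)"
    if s: "norm (s - t) < min d 1" for s
  proof (rule norm_bound)
    fix \<theta> :: real
    let ?\<theta> = "max (- h) (min 0 \<theta>)"
    have "norm (x (s + ?\<theta>) - x (t + ?\<theta>) - ((s + ?\<theta>) - (t + ?\<theta>)) *\<^sub>R x' (t + ?\<theta>))
        \<le> norm ((s + ?\<theta>) - (t + ?\<theta>)) * e"
    proof (rule vector_differentiable_bound_linearization)
      show "(x has_vector_derivative x' r) (at r within closed_segment (t + ?\<theta>) (s + ?\<theta>))" for r
        by (rule has_vector_derivative_at_within[OF x])
      show "norm (x' r - x' (t + ?\<theta>)) \<le> e" if r: "r \<in> closed_segment (t + ?\<theta>) (s + ?\<theta>)" for r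
      proof -
        have "dist r (t + ?\<theta>) \<le> dist (s + ?\<theta>) (t + ?\<theta>)"
          using r by (auto simp: closed_segment_eq_real_ivl dist_real_def split: if_splits)
        then have r': "\<bar>r - (t + ?\<theta>)\<bar> < min d 1" using s by (simp add: dist_real_def)
        then have "dist (x' r) (x' (t + ?\<theta>)) < e"
          using h by (intro d(2)) (auto simp: dist_real_def)
        then show ?thesis by (simp add: dist_norm)
      qed
    qed auto
    then show "norm (apply_bcontfun (hist h x s - hist h x t - (s - t) *\<^sub>R hist h x' t) \<theta>) \<le> e * norm (s - t)"
      by (simp add: ap mult.commute)
  qed
  then show "\<exists>d>0. \<forall>y. norm (y - t) < d \<longrightarrow>
      norm (hist h x y - hist h x t - (y - t) *\<^sub>R hist h x' t) \<le> e * norm (y - t)"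
    using d(1) by (intro exI[of _ "min d 1"]) auto
qed

text \<open>The solution \<open>\<gamma>\<close> is \<open>C\<^sup>1\<close> by its equation, so its segments form a \<open>C\<^sup>1\<close> curve, and the chain rule
  applies to the derivative of \<open>F\<close> along this curve.\<close>

lemma linearisation_C1:
  fixes F :: "(real \<Rightarrow>\<^sub>C (real ^ 'n)) \<Rightarrow> real ^ 'n"
  assumes h: "0 \<le> h" and F: "Ck_smooth m F" "2 \<le> m"
    and \<gamma>: "\<And>t. (\<gamma> has_vector_derivative F (hist h \<gamma> t)) (at t)" "\<And>t. \<gamma> (t + T) = \<gamma> t"
    and L: "\<And>t. L t = frechet_derivative F (at (hist h \<gamma> t))"
  obtains Lb L' where "\<And>t. blinfun_apply (Lb t) = L t" "\<And>t. (Lb has_vector_derivative L' t) (at t)"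
    "continuous_on UNIV L'" "\<And>t. Lb (t + T) = Lb t"
proof -
  obtain F' F'' where F': "\<And>x. (F has_derivative blinfun_apply (F' x)) (at x)"
    and F'': "\<And>x. (F' has_derivative blinfun_apply (F'' x)) (at x)" "continuous_on UNIV F''"
    using Ck_smooth_second_derivative[OF F] by blast
  define \<gamma>' where "\<gamma>' t = F (hist h \<gamma> t)" for t
  have \<gamma>c: "continuous_on UNIV \<gamma>"
    by (intro continuous_at_imp_continuous_on ballI has_vector_derivative_continuous[OF \<gamma>(1)])
  have Fc: "continuous_on UNIV F"
    by (intro continuous_at_imp_continuous_on ballI has_derivative_continuous[OF F'])
  note hc = continuous_on_hist[OF \<gamma>c h]
  have \<gamma>'c: "continuous_on UNIV \<gamma>'"
    unfolding \<gamma>'_def by (rule continuous_on_compose2[OF Fc hc]) auto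
  have hd: "(hist h \<gamma> has_vector_derivative hist h \<gamma>' t) (at t)" for t
    by (rule has_vector_derivative_hist[OF _ \<gamma>'c h]) (simp add: \<gamma>'_def \<gamma>)
  show thesis
  proof
    show "blinfun_apply (F' (hist h \<gamma> t)) = L t" for t
      unfolding L by (rule frechet_derivative_at[OF F'])
    show "((\<lambda>t. F' (hist h \<gamma> t)) has_vector_derivative
        blinfun_apply (F'' (hist h \<gamma> t)) (hist h \<gamma>' t)) (at t)" for t
      using has_derivative_compose[OF hd[of t, unfolded has_vector_derivative_def] F''(1)]
      by (simp add: has_vector_derivative_def blinfun.scaleR_right)
    show "continuous_on UNIV (\<lambda>t. blinfun_apply (F'' (hist h \<gamma> t)) (hist h \<gamma>' t))"
      by (intro blinfun.continuous_on continuous_on_compose2[OF F''(2) hc] continuous_on_hist \<gamma>'c h) auto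
    have "hist h \<gamma> (t + T) = hist h \<gamma> t" for t
    proof -
      have "\<gamma> (t + T + s) = \<gamma> (t + s)" for s
        using \<gamma>(2)[of "t + s"] by (simp add: algebra_simps)
      then show ?thesis unfolding hist_def by simp
    qed
    then show "F' (hist h \<gamma> (t + T)) = F' (hist h \<gamma> t)" for t by simp
  qed
qed

section \<open>Smooth inversion of perturbations of the identity\<close>

lemma has_vector_derivative_iff_difference_quotient:
  "(f has_vector_derivative D) (at t) \<longleftrightarrow> ((\<lambda>s. (f s - f t) /\<^sub>R (s - t)) \<longlongrightarrow> D) (at t)"
proof -
  have "((\<lambda>s. norm (f s - f t - (s - t) *\<^sub>R D) / norm (s - t)) \<longlongrightarrow> 0) (at t)
      \<longleftrightarrow> ((\<lambda>s. norm ((f s - f t) /\<^sub>R (s - t) - D)) \<longlongrightarrow> 0) (at t)"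
  proof (rule filterlim_cong[OF refl refl])
    show "\<forall>\<^sub>F s in at t. norm (f s - f t - (s - t) *\<^sub>R D) / norm (s - t) = norm ((f s - f t) /\<^sub>R (s - t) - D)"
      unfolding eventually_at_filter
    proof (intro always_eventually allI impI)
      fix s assume "s \<noteq> t"
      then have "(f s - f t) /\<^sub>R (s - t) - D = (f s - f t - (s - t) *\<^sub>R D) /\<^sub>R (s - t)"
        by (simp add: scaleR_diff_right)
      then show "norm (f s - f t - (s - t) *\<^sub>R D) / norm (s - t) = norm ((f s - f t) /\<^sub>R (s - t) - D)"
        by (simp add: divide_inverse mult.commute)
    qed
  qed
  then show ?thesis
    unfolding has_vector_derivative_def has_derivative_iff_norm
    by (simp add: bounded_linear_scaleR_left tendsto_norm_zero_iff LIM_zero_iff)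
qed

lemma perturbed_identity_bound:
  fixes N :: "'a::real_normed_vector \<Rightarrow>\<^sub>L 'a"
  assumes "norm N \<le> 1 / 2"
  shows "norm z \<le> 2 * norm (z - blinfun_apply N z)"
proof -
  have "norm (blinfun_apply N z) \<le> norm N * norm z" by (rule norm_blinfun)
  also have "\<dots> \<le> 1 / 2 * norm z" using assms by (rule mult_right_mono) simp
  finally show ?thesis using norm_triangle_ineq2[of z "blinfun_apply N z"] by linarith
qed

text \<open>By the lower bound the map is injective, and the space has finite dimension.\<close>

lemma perturbed_identity_surj:
  fixes N :: "'a::euclidean_space \<Rightarrow>\<^sub>L 'a"
  assumes "norm N \<le> 1 / 2"
  shows "\<exists>x. x - blinfun_apply N x = y"
proof -
  have lin: "linear (\<lambda>x. x - blinfun_apply N x)"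
    by (rule linearI) (simp_all add: blinfun.add_right blinfun.scaleR_right scaleR_diff_right)
  have "inj (\<lambda>x. x - blinfun_apply N x)"
    unfolding linear_injective_0[OF lin]
    using perturbed_identity_bound[OF assms] by (metis norm_zero mult_zero_right norm_le_zero_iff)
  then have "surj (\<lambda>x. x - blinfun_apply N x)"
    by (rule linear_inj_imp_surj[OF lin])
  then show ?thesis by (metis surjD)
qed

text \<open>Since \<open>(1 - M s) (x s - x0) = y s - (1 - M s) x0\<close> and \<open>1 - M s\<close> is bounded below uniformly.\<close>

lemma perturbed_identity_tendsto:
  fixes M :: "'c \<Rightarrow> 'a::real_normed_vector \<Rightarrow>\<^sub>L 'a"
  assumes M: "(M \<longlongrightarrow> M0) F" and y: "(y \<longlongrightarrow> y0) F"
    and eq: "\<forall>\<^sub>F s in F. x s - blinfun_apply (M s) (x s) = y s" "x0 - blinfun_apply M0 x0 = y0"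
    and bound: "\<And>s. norm (M s) \<le> 1 / 2"
  shows "(x \<longlongrightarrow> x0) F"
proof (rule LIM_zero_cancel, rule Lim_null_comparison)
  show "\<forall>\<^sub>F s in F. norm (x s - x0) \<le> 2 * norm (y s - (x0 - blinfun_apply (M s) x0))"
    using eq(1)
  proof eventually_elim
    case (elim s)
    have "x s - x0 - blinfun_apply (M s) (x s - x0) = y s - (x0 - blinfun_apply (M s) x0)"
      unfolding elim[symmetric] by (simp add: blinfun.diff_right)
    then show ?case using perturbed_identity_bound[OF bound[of s], of "x s - x0"] by (simp only:)
  qed
  have "((\<lambda>s. 2 * norm (y s - (x0 - blinfun_apply (M s) x0))) \<longlongrightarrow>
      2 * norm (y0 - (x0 - blinfun_apply M0 x0))) F"
    by (intro tendsto_intros y M blinfun.tendsto)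
  then show "((\<lambda>s. 2 * norm (y s - (x0 - blinfun_apply (M s) x0))) \<longlongrightarrow> 0) F"
    using eq(2) by simp
qed

text \<open>The difference quotients of the solution of \<open>(1 - M t) c = b\<close> solve an equation of the same
  form, with right-hand side converging to \<open>b' + M' c\<close>.\<close>

lemma perturbed_identity_C1:
  fixes M :: "real \<Rightarrow> 'a::euclidean_space \<Rightarrow>\<^sub>L 'a" and b :: "real \<Rightarrow> 'a"
  assumes M: "\<And>t. (M has_vector_derivative M' t) (at t)" "continuous_on UNIV M'"
    and b: "\<And>t. (b has_vector_derivative b' t) (at t)" "continuous_on UNIV b'"
    and bound: "\<And>t. norm (M t) \<le> 1 / 2"
  obtains c c' where "\<And>t. c t - blinfun_apply (M t) (c t) = b t"
    "\<And>t. (c has_vector_derivative c' t) (at t)" "continuous_on UNIV c'"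
proof -
  define R where "R t y = (SOME x. x - blinfun_apply (M t) x = y)" for t y
  have R: "R t y - blinfun_apply (M t) (R t y) = y" for t y
    unfolding R_def by (rule someI_ex[OF perturbed_identity_surj[OF bound]])
  define c where "c t = R t (b t)" for t
  define r where "r t = b' t + blinfun_apply (M' t) (c t)" for t
  define c' where "c' t = R t (r t)" for t
  have Mc: "(M \<longlongrightarrow> M t) (at t)" "(b \<longlongrightarrow> b t) (at t)" for t
    using has_vector_derivative_continuous[OF M(1), of t] has_vector_derivative_continuous[OF b(1), of t]
    by (simp_all add: continuous_within)
  have Rc: "c t - blinfun_apply (M t) (c t) = b t" "c' t - blinfun_apply (M t) (c' t) = r t" for t
    unfolding c_def c'_def by (rule R)+
  have c: "(c \<longlongrightarrow> c t) (at t)" for t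
    by (rule perturbed_identity_tendsto[OF Mc _ Rc(1) bound]) (simp add: Rc)
  have "(c has_vector_derivative c' t) (at t)" for t
    unfolding has_vector_derivative_iff_difference_quotient
  proof (rule perturbed_identity_tendsto[OF Mc(1) _ _ _ bound])
    show "((\<lambda>s. (b s - b t) /\<^sub>R (s - t) + blinfun_apply ((M s - M t) /\<^sub>R (s - t)) (c t)) \<longlongrightarrow> r t) (at t)"
      unfolding r_def
      using M(1)[of t] b(1)[of t] unfolding has_vector_derivative_iff_difference_quotient
      by (intro tendsto_intros blinfun.tendsto)
    show "c' t - blinfun_apply (M t) (c' t) = r t"
      by (rule Rc)
    have "(c s - c t) /\<^sub>R (s - t) - blinfun_apply (M s) ((c s - c t) /\<^sub>R (s - t))
        = (b s - b t) /\<^sub>R (s - t) + blinfun_apply ((M s - M t) /\<^sub>R (s - t)) (c t)" for s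
      unfolding Rc(1)[symmetric]
      by (simp add: blinfun.diff_right blinfun.scaleR_right blinfun.diff_left blinfun.scaleR_left algebra_simps)
    then show "\<forall>\<^sub>F s in at t. (c s - c t) /\<^sub>R (s - t) - blinfun_apply (M s) ((c s - c t) /\<^sub>R (s - t))
        = (b s - b t) /\<^sub>R (s - t) + blinfun_apply ((M s - M t) /\<^sub>R (s - t)) (c t)"
      by simp
  qed
  moreover have "continuous_on UNIV c'"
  proof (intro continuous_at_imp_continuous_on ballI)
    fix t
    have "(r \<longlongrightarrow> r t) (at t)"
      unfolding r_def using M(2) b(2)
      by (intro tendsto_intros blinfun.tendsto c) (simp_all add: continuous_on_eq_continuous_at isCont_def)
    then have "(c' \<longlongrightarrow> c' t) (at t)"
      by (rule perturbed_identity_tendsto[OF Mc(1) _ _ Rc(2) bound]) (simp add: Rc)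
    then show "isCont c' t" by (simp add: isCont_def)
  qed
  moreover have "c t - blinfun_apply (M t) (c t) = b t" for t
    by (rule Rc)
  ultimately show thesis using that by blast
qed

section \<open>Periodic functions in the domain of the first operator\<close>

definition complex_vec :: "real ^ 'n \<Rightarrow> complex ^ 'n" where
  "complex_vec x = (\<chi> i. complex_of_real (x $ i))"

lemma bounded_linear_complex_vec: "bounded_linear complex_vec"
proof -
  have "linear (complex_vec :: real ^ 'n \<Rightarrow> _)"
    by (rule linearI) (simp_all add: complex_vec_def vec_eq_iff complex_eq_iff)
  then show ?thesis by (simp add: linear_conv_bounded_linear)
qed

lemmas complex_vec_add = linear_add[OF bounded_linear.linear[OF bounded_linear_complex_vec]]
  and complex_vec_scaleR = linear_cmul[OF bounded_linear.linear[OF bounded_linear_complex_vec]]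

lemma complex_vec_axis: "complex_vec (axis i 1) = axis i 1"
  by (simp add: complex_vec_def vec_eq_iff axis_def)

lemma hist_0_cong: "0 \<le> h \<Longrightarrow> (\<And>\<theta>. \<theta> \<in> {- h..0} \<Longrightarrow> f \<theta> = g \<theta>) \<Longrightarrow> hist h f 0 = hist h g 0"
  unfolding hist_def by (intro arg_cong[where f=Bcontfun] ext) auto

lemma complexify_complex_vec:
  assumes h: "0 \<le> h" and L: "L 0 = 0" and \<phi>: "\<And>\<theta>. \<theta> \<in> {- h..0} \<Longrightarrow> \<phi> \<theta> = complex_vec (u \<theta>)"
  shows "complexify h L \<phi> = complex_vec (L (hist h u 0))"
proof -
  have "hist h (\<lambda>\<theta>. \<chi> j. Re (\<phi> \<theta> $ j)) 0 = hist h u 0"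
    by (rule hist_0_cong[OF h]) (simp add: \<phi> complex_vec_def)
  moreover have "hist h (\<lambda>\<theta>. \<chi> j. Im (\<phi> \<theta> $ j)) 0 = hist h (\<lambda>\<theta>. 0 :: real ^ 'a) 0"
    by (rule hist_0_cong[OF h]) (simp add: \<phi> complex_vec_def vec_eq_iff)
  moreover have "hist h (\<lambda>\<theta>. 0 :: real ^ 'a) 0 = 0"
    by (rule bcontfun_eqI) (simp add: apply_hist[OF h])
  ultimately show ?thesis
    by (simp add: complexify_def L complex_vec_def vec_eq_iff complex_eq_iff)
qed

lemma norm_hist_le:
  assumes "0 \<le> h" "continuous_on UNIV u" "\<And>\<theta>. \<theta> \<in> {- h..0} \<Longrightarrow> norm (u \<theta>) \<le> B"
  shows "norm (hist h u 0) \<le> B"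
proof (rule norm_bound)
  show "norm (apply_bcontfun (hist h u 0) \<theta>) \<le> B" for \<theta>
    using assms continuous_on_subset[OF assms(2)] by (subst apply_hist) auto
qed

lemma hist_add_scaleR:
  assumes "0 \<le> h" "continuous_on UNIV u" "continuous_on UNIV v"
  shows "hist h (\<lambda>\<theta>. u \<theta> + v \<theta>) 0 = hist h u 0 + hist h v 0" "hist h (\<lambda>\<theta>. r *\<^sub>R u \<theta>) 0 = r *\<^sub>R hist h u 0"
proof -
  note c = continuous_on_subset[OF assms(2) subset_UNIV] continuous_on_subset[OF assms(3) subset_UNIV]
  show "hist h (\<lambda>\<theta>. u \<theta> + v \<theta>) 0 = hist h u 0 + hist h v 0" "hist h (\<lambda>\<theta>. r *\<^sub>R u \<theta>) 0 = r *\<^sub>R hist h u 0"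
    by (rule bcontfun_eqI, simp add: apply_hist[OF assms(1)] c continuous_on_add continuous_on_scaleR)+
qed

lemma bounded_linear_profile:
  fixes A :: "'a::real_normed_vector \<Rightarrow> 'b::real_normed_vector"
  assumes h: "0 \<le> h" and p: "continuous_on UNIV p" and A: "bounded_linear A"
  shows "bounded_linear (\<lambda>x. hist h (\<lambda>\<theta>. p \<theta> *\<^sub>R A x) 0)"
proof -
  have cont: "continuous_on S (\<lambda>\<theta>. p \<theta> *\<^sub>R A x)" for x S
    by (intro continuous_intros continuous_on_subset[OF p]) auto
  obtain K where K: "K > 0" "\<And>x. norm (A x) \<le> norm x * K"
    using bounded_linear.pos_bounded[OF A] by blast
  have "compact (p ` {- h..0})"
    by (intro compact_continuous_image continuous_on_subset[OF p]) auto
  then have "bounded (p ` {- h..0})" by (rule compact_imp_bounded)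
  then obtain B where B: "\<And>\<theta>. \<theta> \<in> {- h..0} \<Longrightarrow> norm (p \<theta>) \<le> B"
    unfolding bounded_iff by blast
  have B0: "0 \<le> B" using order_trans[OF norm_ge_zero B[of 0]] h by simp
  show ?thesis
  proof (rule bounded_linear_intro[where K="B * K"])
    fix x y :: 'a and r :: real
    show "hist h (\<lambda>\<theta>. p \<theta> *\<^sub>R A (x + y)) 0 = hist h (\<lambda>\<theta>. p \<theta> *\<^sub>R A x) 0 + hist h (\<lambda>\<theta>. p \<theta> *\<^sub>R A y) 0"
      by (rule bcontfun_eqI) (simp add: apply_hist[OF h] cont continuous_on_add linear_add[OF bounded_linear.linear[OF A]] scaleR_add_right)
    show "hist h (\<lambda>\<theta>. p \<theta> *\<^sub>R A (r *\<^sub>R x)) 0 = r *\<^sub>R hist h (\<lambda>\<theta>. p \<theta> *\<^sub>R A x) 0"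
      using hist_add_scaleR(2)[OF h cont[of UNIV x] cont[of UNIV x], of r]
      by (simp add: linear_cmul[OF bounded_linear.linear[OF A]] mult.commute)
    show "norm (hist h (\<lambda>\<theta>. p \<theta> *\<^sub>R A x) 0) \<le> norm x * (B * K)"
    proof (rule norm_hist_le[OF h cont])
      fix \<theta> assume "\<theta> \<in> {- h..0}"
      then have "\<bar>p \<theta>\<bar> * norm (A x) \<le> B * (norm x * K)"
        using B[of \<theta>] K(2)[of x] B0 by (intro mult_mono) auto
      then show "norm (p \<theta> *\<^sub>R A x) \<le> norm x * (B * K)" by (simp add: mult_ac)
    qed
  qed
qed

text \<open>The boundary condition \<open>\<phi>'(0) = L(t) \<phi>\<close> is met by adding to \<open>w(t) \<psi>\<close> a small multiple of
  \<open>\<epsilon> sin (\<theta> / \<epsilon>)\<close>, a function of size \<open>\<epsilon>\<close> with derivative \<open>1\<close> at \<open>0\<close>. The coefficient \<open>c(t)\<close> solves a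
  linear equation that is a small perturbation of the identity, and remains bounded as \<open>\<epsilon>\<close> tends
  to \<open>0\<close>.\<close>

lemma dom_cA_test_function:
  fixes Lb L' :: "real \<Rightarrow> (real \<Rightarrow>\<^sub>C (real ^ 'n)) \<Rightarrow>\<^sub>L (real ^ 'n)" and \<psi> \<psi>' :: "real \<Rightarrow> real ^ 'n"
  assumes h: "0 < h" and Lb: "\<And>t. blinfun_apply (Lb t) = L t" "\<And>t. (Lb has_vector_derivative L' t) (at t)"
    "continuous_on UNIV L'" "\<And>t. Lb (t + T) = Lb t" "\<And>t. norm (Lb t) \<le> \<Lambda>"
    and \<psi>: "\<And>\<theta>. (\<psi> has_vector_derivative \<psi>' \<theta>) (at \<theta>)" "continuous_on UNIV \<psi>'"
    and w: "w \<in> C1_per T (UNIV :: real set)"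
    and \<epsilon>: "0 < \<epsilon>" "\<Lambda> * \<epsilon> \<le> 1 / 2"
    and \<beta>: "\<And>t. norm (w t *\<^sub>R (L t (hist h \<psi> 0) - \<psi>' 0)) \<le> \<beta>"
  obtains \<phi> c where "\<phi> \<in> part (dom_cA h T L) (C_per T (state_space h)) (cA h)"
    "\<And>t. \<phi> t = w t *\<^sub>R hist h (\<lambda>\<theta>. complex_vec (\<psi> \<theta>)) 0
            + hist h (\<lambda>\<theta>. (\<epsilon> * sin (\<theta> / \<epsilon>)) *\<^sub>R complex_vec (c t)) 0"
    "\<And>t. norm (c t) \<le> 2 * \<beta>"
    "continuous_on UNIV (\<lambda>t. hist h (\<lambda>\<theta>. (\<epsilon> * sin (\<theta> / \<epsilon>)) *\<^sub>R complex_vec (c t)) 0)"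
proof -
  have h0: "0 \<le> h" using h by simp
  let ?e = "\<lambda>\<theta>. \<epsilon> * sin (\<theta> / \<epsilon>)" and ?e' = "\<lambda>\<theta>. cos (\<theta> / \<epsilon>)"
  have ec: "continuous_on UNIV ?e" "continuous_on UNIV ?e'"
    using \<epsilon>(1) by (auto intro!: continuous_intros)
  have \<psi>c: "continuous_on UNIV \<psi>"
    by (intro continuous_at_imp_continuous_on ballI has_vector_derivative_continuous[OF \<psi>(1)])
  note w' = C1_perD[OF w]
  define E :: "(real ^ 'n) \<Rightarrow>\<^sub>L _" where "E = Blinfun (\<lambda>x. hist h (\<lambda>\<theta>. ?e \<theta> *\<^sub>R x) 0)"
  have E: "blinfun_apply E x = hist h (\<lambda>\<theta>. ?e \<theta> *\<^sub>R x) 0" for x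
    unfolding E_def
    by (simp add: bounded_linear_Blinfun_apply[OF bounded_linear_profile[OF h0 ec(1) bounded_linear_ident]])
  have "norm E \<le> \<epsilon>"
  proof (rule norm_blinfun_bound)
    fix x :: "real ^ 'n"
    show "norm (blinfun_apply E x) \<le> \<epsilon> * norm x"
      unfolding E using ec(1) \<epsilon>(1)
      by (intro norm_hist_le h0 continuous_intros) (auto simp: abs_mult mult_left_le_one_le)
  qed (use \<epsilon> in simp)
  have \<Lambda>: "0 \<le> \<Lambda>" using Lb(5)[of 0] norm_ge_zero[of "Lb 0"] by linarith
  \<comment> \<open>The boundary condition reads \<open>c(t) - M(t) c(t) = b(t)\<close>.\<close>
  define M where "M t = Lb t o\<^sub>L E" for t
  define b where "b t = w t *\<^sub>R (L t (hist h \<psi> 0) - \<psi>' 0)" for t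
  define b' where "b' t = w t *\<^sub>R blinfun_apply (L' t) (hist h \<psi> 0)
      + vector_derivative w (at t) *\<^sub>R (L t (hist h \<psi> 0) - \<psi>' 0)" for t
  have M_bound: "norm (M t) \<le> 1 / 2" for t
  proof -
    have "norm (M t) \<le> norm (Lb t) * norm E" unfolding M_def by (rule norm_blinfun_compose)
    also have "\<dots> \<le> \<Lambda> * \<epsilon>"
      using Lb(5)[of t] \<open>norm E \<le> \<epsilon>\<close> \<Lambda> by (intro mult_mono) auto
    finally show ?thesis using \<epsilon>(2) by simp
  qed
  have M': "(M has_vector_derivative L' t o\<^sub>L E) (at t)" for t
    unfolding M_def
    by (rule bounded_linear.has_vector_derivative[OF
          bounded_bilinear.bounded_linear_left[OF bounded_bilinear_blinfun_compose] Lb(2)])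
  have M'c: "continuous_on UNIV (\<lambda>t. L' t o\<^sub>L E)"
    by (rule bounded_linear.continuous_on[OF
          bounded_bilinear.bounded_linear_left[OF bounded_bilinear_blinfun_compose] Lb(3)])
  have Lx: "((\<lambda>t. L t x) has_vector_derivative blinfun_apply (L' t) x) (at t)" for t x
    unfolding Lb(1)[symmetric]
    by (rule bounded_linear.has_vector_derivative[OF blinfun.bounded_linear_left Lb(2)])
  have Lxc: "continuous_on UNIV (\<lambda>t. L t x)" for x
    by (intro continuous_at_imp_continuous_on ballI has_vector_derivative_continuous[OF Lx])
  have bd: "(b has_vector_derivative b' t) (at t)" for t
    unfolding b_def b'_def
    by (rule bounded_bilinear.has_vector_derivative[OF bounded_bilinear_scaleR w'(1)])
      (use has_vector_derivative_diff[OF Lx has_vector_derivative_const] in simp)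
  have b'c: "continuous_on UNIV b'"
    unfolding b'_def by (intro continuous_intros w'(2,3) Lxc blinfun.continuous_on Lb(3))
  obtain c c' where c: "\<And>t. c t - blinfun_apply (M t) (c t) = b t"
    "\<And>t. (c has_vector_derivative c' t) (at t)" "continuous_on UNIV c'"
    using perturbed_identity_C1[OF M' M'c bd b'c M_bound] by blast
  have c_bound: "norm (c t) \<le> 2 * \<beta>" for t
    using perturbed_identity_bound[OF M_bound[of t], of "c t"] \<beta>[of t] by (simp add: c(1) b_def)
  have c_per: "c (t + T) = c t" for t
  proof -
    have "b (t + T) = b t" "M (t + T) = M t"
      unfolding b_def M_def Lb(1)[symmetric] Lb(4) w'(4) by simp_all
    then have "(c (t + T) - c t) - blinfun_apply (M t) (c (t + T) - c t) = 0"
      using c(1)[of t] c(1)[of "t + T"] unfolding blinfun.diff_right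
      by (metis (no_types, lifting) add_diff_eq diff_add_eq diff_diff_eq2 diff_self)
    then show ?thesis
      using perturbed_identity_bound[OF M_bound[of t], of "c (t + T) - c t"] by simp
  qed
  let ?\<Psi> = "hist h (\<lambda>\<theta>. complex_vec (\<psi> \<theta>)) 0" and ?\<Psi>' = "hist h (\<lambda>\<theta>. complex_vec (\<psi>' \<theta>)) 0"
  let ?C = "\<lambda>x. hist h (\<lambda>\<theta>. ?e \<theta> *\<^sub>R complex_vec x) 0" and ?C' = "\<lambda>x. hist h (\<lambda>\<theta>. ?e' \<theta> *\<^sub>R complex_vec x) 0"
  note C = bounded_linear_profile[OF h0 ec(1) bounded_linear_complex_vec]
  note C' = bounded_linear_profile[OF h0 ec(2) bounded_linear_complex_vec]
  have cc: "continuous_on UNIV c"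
    by (intro continuous_at_imp_continuous_on ballI has_vector_derivative_continuous[OF c(2)])
  have \<psi>cv: "continuous_on S (\<lambda>\<theta>. complex_vec (\<psi> \<theta>))" "continuous_on S (\<lambda>\<theta>. complex_vec (\<psi>' \<theta>))" for S
    by (intro bounded_linear.continuous_on[OF bounded_linear_complex_vec] continuous_on_subset[OF \<psi>c] continuous_on_subset[OF \<psi>(2)]; simp)+
  have ecv: "continuous_on S (\<lambda>\<theta>. ?e \<theta> *\<^sub>R complex_vec x)" "continuous_on S (\<lambda>\<theta>. ?e' \<theta> *\<^sub>R complex_vec x)" for S x
    by (intro continuous_on_scaleR continuous_on_const continuous_on_subset[OF ec(1)] continuous_on_subset[OF ec(2)]; simp)+
  define \<phi> where "\<phi> t = w t *\<^sub>R ?\<Psi> + ?C (c t)" for t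
  define d where "d t \<theta> = complex_vec (w t *\<^sub>R \<psi>' \<theta> + ?e' \<theta> *\<^sub>R c t)" for t \<theta>
  have \<phi>_apply: "apply_bcontfun (\<phi> t) \<theta> = complex_vec (w t *\<^sub>R \<psi> \<theta> + ?e \<theta> *\<^sub>R c t)" if "\<theta> \<in> {- h..0}" for t \<theta>
    unfolding \<phi>_def using that
    by (simp add: apply_hist[OF h0] \<psi>cv ecv complex_vec_add complex_vec_scaleR)
  have dc: "continuous_on S (d t)" for S t
    unfolding d_def complex_vec_add complex_vec_scaleR
    by (intro continuous_on_add continuous_on_scaleR continuous_on_const \<psi>cv continuous_on_subset[OF ec(2)]) auto
  have \<phi>_deriv: "(apply_bcontfun (\<phi> t) has_vector_derivative d t \<theta>) (at \<theta> within {- h..0})"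
    if \<theta>: "\<theta> \<in> {- h..0}" for t \<theta>
  proof (rule has_vector_derivative_transform[OF \<theta> \<phi>_apply])
    have e: "(?e has_real_derivative ?e' \<theta>) (at \<theta>)"
      using \<epsilon>(1) by (auto intro!: derivative_eq_intros)
    have "((\<lambda>\<theta>. w t *\<^sub>R \<psi> \<theta> + ?e \<theta> *\<^sub>R c t) has_vector_derivative w t *\<^sub>R \<psi>' \<theta> + ?e' \<theta> *\<^sub>R c t) (at \<theta>)"
      by (intro has_vector_derivative_add bounded_linear.has_vector_derivative[OF bounded_linear_scaleR_right \<psi>(1)]
          bounded_linear.has_vector_derivative[OF bounded_linear_scaleR_left]
          e[unfolded has_real_derivative_iff_has_vector_derivative])
    then show "((\<lambda>\<theta>. complex_vec (w t *\<^sub>R \<psi> \<theta> + ?e \<theta> *\<^sub>R c t)) has_vector_derivative d t \<theta>) (at \<theta> within {- h..0})"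
      unfolding d_def by (intro has_vector_derivative_at_within[OF bounded_linear.has_vector_derivative[OF bounded_linear_complex_vec]])
  qed
  have \<phi>_d0: "d t 0 = complexify h (L t) (apply_bcontfun (\<phi> t))" for t
  proof -
    have "complexify h (L t) (apply_bcontfun (\<phi> t))
        = complex_vec (L t (hist h (\<lambda>\<theta>. w t *\<^sub>R \<psi> \<theta> + ?e \<theta> *\<^sub>R c t) 0))"
      by (rule complexify_complex_vec[OF h0 _ \<phi>_apply]) (simp_all add: Lb(1)[symmetric] blinfun.zero_right)
    also have "hist h (\<lambda>\<theta>. w t *\<^sub>R \<psi> \<theta> + ?e \<theta> *\<^sub>R c t) 0 = w t *\<^sub>R hist h \<psi> 0 + blinfun_apply E (c t)"
      unfolding E using hist_add_scaleR(1)[OF h0, of "\<lambda>\<theta>. w t *\<^sub>R \<psi> \<theta>" "\<lambda>\<theta>. ?e \<theta> *\<^sub>R c t"]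
        hist_add_scaleR(2)[OF h0 \<psi>c \<psi>c, of "w t"] \<psi>c ec(1) by (simp add: continuous_on_scaleR)
    also have "L t \<dots> = w t *\<^sub>R \<psi>' 0 + c t"
      using c(1)[of t] unfolding b_def M_def Lb(1)[symmetric]
      by (simp add: blinfun.add_right blinfun.scaleR_right algebra_simps)
    finally show ?thesis by (simp add: d_def)
  qed
  have state: "?\<Psi> \<in> state_space h" "?C x \<in> state_space h" for x
    by (intro hist_in_state_space h0 \<psi>cv ecv)+
  have state_lin: "r *\<^sub>R x + y \<in> state_space h" "x - y \<in> state_space h"
    if "x \<in> state_space h" "y \<in> state_space h" for x y :: "real \<Rightarrow>\<^sub>C (complex ^ 'n)" and r
    using that unfolding state_space_def by auto
  have \<phi>_dom: "\<phi> t \<in> dom_A h (L t)" for t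
    unfolding dom_A_def using dc \<phi>_deriv \<phi>_d0 state
    by (auto simp: \<phi>_def intro!: state_lin exI[of _ "d t"])
  have \<phi>': "(\<phi> has_vector_derivative vector_derivative w (at t) *\<^sub>R ?\<Psi> + ?C (c' t)) (at t)" for t
    unfolding \<phi>_def
    by (intro has_vector_derivative_add bounded_linear.has_vector_derivative[OF C c(2)]
        bounded_linear.has_vector_derivative[OF bounded_linear_scaleR_left w'(1)])
  have \<phi>'c: "continuous_on UNIV (\<lambda>t. vector_derivative w (at t) *\<^sub>R ?\<Psi> + ?C (c' t))"
    by (intro continuous_intros w'(2) bounded_linear.continuous_on[OF C c(3)])
  have \<phi>_per: "\<phi> (t + T) = \<phi> t" for t by (simp add: \<phi>_def c_per w'(4))
  have C1: "\<phi> \<in> C1_per T (state_space h)"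
    by (rule C1_perI[OF \<phi>' \<phi>'c \<phi>_per]) (simp add: \<phi>_def state state_lin)
  have cA: "cA h \<phi> = (\<lambda>t. (w t *\<^sub>R ?\<Psi>' + ?C' (c t)) - (vector_derivative w (at t) *\<^sub>R ?\<Psi> + ?C (c' t)))"
  proof
    fix t
    have "op_A h (\<phi> t) = hist h (d t) 0"
      by (rule apply_op_A(2)[OF h dc \<phi>_deriv, of 0]) (use h0 in auto)
    also have "\<dots> = w t *\<^sub>R ?\<Psi>' + ?C' (c t)"
      by (rule bcontfun_eqI)
        (simp add: apply_hist[OF h0 dc] apply_hist[OF h0] \<psi>cv ecv, simp add: d_def complex_vec_add complex_vec_scaleR)
    finally show "cA h \<phi> t = (w t *\<^sub>R ?\<Psi>' + ?C' (c t)) - (vector_derivative w (at t) *\<^sub>R ?\<Psi> + ?C (c' t))"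
      unfolding cA_def by (simp add: vector_derivative_at[OF \<phi>'])
  qed
  have cA_per: "cA h \<phi> \<in> C_per T (state_space h)"
  proof (rule C_perI)
    show "continuous_on UNIV (cA h \<phi>)"
      unfolding cA
      by (intro continuous_on_diff[OF _ \<phi>'c] continuous_intros w'(3) bounded_linear.continuous_on[OF C' cc])
    show "cA h \<phi> (t + T) = cA h \<phi> t" for t
      unfolding cA_def by (simp only: \<phi>_per C1_per_derivative_periodic[OF C1])
    show "cA h \<phi> t \<in> state_space h" for t
      unfolding cA by (intro state_lin state hist_in_state_space h0 \<psi>cv ecv)
  qed
  show thesis
  proof (rule that[of \<phi> c])
    show "\<phi> \<in> part (dom_cA h T L) (C_per T (state_space h)) (cA h)"
      unfolding part_def dom_cA_def using C1 \<phi>_dom cA_per by auto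
    show "continuous_on UNIV (\<lambda>t. ?C (c t))" by (rule bounded_linear.continuous_on[OF C cc])
  qed (simp_all add: \<phi>_def c_bound)
qed

section \<open>Uniqueness of the first adjoint\<close>

text \<open>Continuous functions approximate the indicator function of \<open>{..x}\<close> pointwise and boundedly, so that
  dominated convergence applies.\<close>

lemma integral_zero_if_orthogonal_continuous:
  fixes f :: "real \<Rightarrow> 'a::euclidean_space"
  assumes f: "f absolutely_integrable_on {a..b}" and x: "x \<in> {a..b}"
    and orth: "\<And>q :: real \<Rightarrow> real. continuous_on UNIV q \<Longrightarrow> integral {a..b} (\<lambda>s. q s *\<^sub>R f s) = 0"
  shows "integral {a..x} f = 0"
proof -
  \<comment> \<open>Continuous functions decreasing to the indicator function of \<open>s \<le> x\<close>.\<close>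
  define q where "q n s = max 0 (min 1 (1 + real n * (x - s)))" for n s
  have q: "continuous_on S (q n)" for n S
    unfolding q_def by (intro continuous_intros)
  have q01: "\<bar>q n s\<bar> \<le> 1" for n s by (simp add: q_def)
  have "bilinear ((*\<^sub>R) :: real \<Rightarrow> 'a \<Rightarrow> 'a)"
    by (simp add: bilinear_conv_bounded_bilinear bounded_bilinear_scaleR)
  then have int: "(\<lambda>s. q n s *\<^sub>R f s) absolutely_integrable_on {a..b}" for n
    using q01 by (intro absolutely_integrable_bounded_measurable_product[where h="(*\<^sub>R)"] f
        continuous_imp_measurable_on_sets_lebesgue q boundedI[where B=1]) auto
  have "(\<lambda>n. integral {a..b} (\<lambda>s. q n s *\<^sub>R f s)) \<longlonglongrightarrow> integral {a..b} (\<lambda>s. if s \<in> {..x} then f s else 0)"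
  proof (rule dominated_convergence(2))
    show "(\<lambda>s. q n s *\<^sub>R f s) integrable_on {a..b}" for n
      using int set_lebesgue_integral_eq_integral(1) by blast
    show "(\<lambda>s. norm (f s)) integrable_on {a..b}"
      using absolutely_integrable_norm[OF f, unfolded o_def] set_lebesgue_integral_eq_integral(1) by blast
    show "norm (q n s *\<^sub>R f s) \<le> norm (f s)" for n s
      using q01[of n s] by (simp add: mult_left_le_one_le)
    show "(\<lambda>n. q n s *\<^sub>R f s) \<longlonglongrightarrow> (if s \<in> {..x} then f s else 0)" for s
    proof (cases "s \<le> x")
      case True
      then have "q n s = 1" for n by (simp add: q_def)
      with True show ?thesis by simp
    next
      case False
      obtain N :: nat where N: "1 < real N * (s - x)"
        using ex_less_of_nat_mult[of "s - x" 1] False by auto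
      have "q n s = 0" if "n \<ge> N" for n
      proof -
        have "real N * (s - x) \<le> real n * (s - x)" using that False by (intro mult_right_mono) auto
        then have "1 + real n * (x - s) \<le> 0" using N by (simp add: algebra_simps)
        then show ?thesis by (simp add: q_def)
      qed
      then have "\<forall>\<^sub>F n in sequentially. 0 = q n s *\<^sub>R f s"
        unfolding eventually_sequentially by (intro exI[of _ N]) simp
      with False show ?thesis by (simp add: Lim_transform_eventually[OF tendsto_const])
    qed
  qed
  moreover have "integral {a..b} (\<lambda>s. if s \<in> {..x} then f s else 0) = integral {a..x} f"
    using x unfolding integral_restrict_Int by (intro arg_cong2[where f=integral]) auto
  moreover have "integral {a..b} (\<lambda>s. q n s *\<^sub>R f s) = 0" for n by (rule orth[OF q])
  ultimately have "(\<lambda>n. 0) \<longlonglongrightarrow> integral {a..x} f" by (simp only:)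
  then show ?thesis by (simp add: LIMSEQ_const_iff)
qed

text \<open>Partial integration turns the pairing with \<open>\<psi>\<close> into \<open>f(h) \<psi>(- h) + \<integral> f(s) \<psi>'(- s) ds\<close>. Constants
  \<open>\<psi>\<close> give \<open>f(h) = 0\<close>, and then \<open>\<psi>'\<close> may be any continuous function.\<close>

lemma star_space_annihilator:
  fixes f :: "(complex ^ 'n) bv"
  assumes h: "0 < h" and f: "f \<in> star_space h"
    and zero: "\<And>\<psi> \<psi>'. (\<And>\<theta>. (\<psi> has_vector_derivative \<psi>' \<theta>) (at \<theta>)) \<Longrightarrow> continuous_on UNIV \<psi>' \<Longrightarrow>
       pairing h f (hist h (\<lambda>\<theta>. complex_vec (\<psi> \<theta>)) 0) = 0"
  shows "f = 0"
proof -
  have h0: "0 \<le> h" using h by simp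
  have formula: "row_col (apply_bv f h) (complex_vec (\<psi> (- h)))
      + integral {0..h} (\<lambda>s. row_col (apply_bv f s) (complex_vec (\<psi>' (- s)))) = 0"
    if \<psi>: "\<And>\<theta>. (\<psi> has_vector_derivative \<psi>' \<theta>) (at \<theta>)" and \<psi>': "continuous_on UNIV \<psi>'" for \<psi> \<psi>'
  proof -
    let ?y = "\<lambda>\<theta>. complex_vec (\<psi> (- \<theta>))" and ?y' = "\<lambda>\<theta>. - complex_vec (\<psi>' (- \<theta>))"
    have \<psi>c: "continuous_on UNIV \<psi>"
      by (intro continuous_at_imp_continuous_on ballI has_vector_derivative_continuous[OF \<psi>])
    have y': "continuous_on S ?y'" for S
      by (intro continuous_intros bounded_linear.continuous_on[OF bounded_linear_complex_vec]
          continuous_on_compose2[OF \<psi>']) auto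
    have "bounded (?y' ` {0..h})"
      by (intro compact_imp_bounded compact_continuous_image y') auto
    then obtain C where C: "\<And>s. s \<in> {0..h} \<Longrightarrow> norm (?y' s) \<le> C"
      unfolding bounded_iff by blast
    have dy: "(?y has_vector_derivative ?y' \<theta>) (at \<theta>)" for \<theta>
    proof -
      have "((\<lambda>\<theta>. \<psi> (- \<theta>)) has_vector_derivative - \<psi>' (- \<theta>)) (at \<theta>)"
        using vector_diff_chain_at[of uminus "- 1" \<theta> \<psi> "\<psi>' (- \<theta>)"] \<psi>[of "- \<theta>"]
        by (simp add: o_def has_vector_derivative_minus[OF has_vector_derivative_id, simplified])
      from bounded_linear.has_vector_derivative[OF bounded_linear_complex_vec this]
      show ?thesis by (simp add: linear_neg[OF bounded_linear.linear[OF bounded_linear_complex_vec]])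
    qed
    have "?y \<theta> = ?y 0 + integral {0..\<theta>} ?y'" if "\<theta> \<in> {0..h}" for \<theta>
    proof -
      have "(?y' has_integral ?y \<theta> - ?y 0) {0..\<theta>}"
        by (rule fundamental_theorem_of_calculus) (use that has_vector_derivative_at_within[OF dy] in auto)
      then show ?thesis by (subst integral_unique) auto
    qed
    then have "has_RS_integral row_col (apply_bv f) ?y {0..h}
        (row_col (apply_bv f h) (?y h) - integral {0..h} (\<lambda>s. row_col (apply_bv f s) (?y' s)))"
      by (intro has_RS_integral_by_parts[OF h0 absolutely_integrable_continuous_real[OF y'] C])
    then have "has_RS_integral row_col (apply_bv f)
        (\<lambda>\<theta>. apply_bcontfun (hist h (\<lambda>\<theta>. complex_vec (\<psi> \<theta>)) 0) (- \<theta>)) {0..h}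
        (row_col (apply_bv f h) (?y h) - integral {0..h} (\<lambda>s. row_col (apply_bv f s) (?y' s)))"
      by (rule has_RS_integral_transfer)
        (subst apply_hist_0, auto simp: h0 intro!: bounded_linear.continuous_on[OF bounded_linear_complex_vec]
          continuous_on_subset[OF \<psi>c])
    then have "pairing h f (hist h (\<lambda>\<theta>. complex_vec (\<psi> \<theta>)) 0)
        = row_col (apply_bv f h) (?y h) - integral {0..h} (\<lambda>s. row_col (apply_bv f s) (?y' s))"
      by (rule pairing_eqI)
    then show ?thesis
      using zero[OF \<psi> \<psi>'] by (simp add: row_col.minus_right)
  qed
  have fh: "apply_bv f h = 0"
  proof -
    have "apply_bv f h $ i = 0" for i
      using formula[of "\<lambda>_. axis i 1" "\<lambda>_. 0"]
      by (simp add: complex_vec_axis row_col_axis row_col.zero_right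
          linear_0[OF bounded_linear.linear[OF bounded_linear_complex_vec]])
    then show ?thesis by (simp add: vec_eq_iff)
  qed
  show ?thesis
  proof (rule star_space_zeroI[OF f h fh])
    fix x assume x: "x \<in> {0..h}"
    show "integral {0..x} (apply_bv f) = 0"
    proof (rule integral_zero_if_orthogonal_continuous[OF absolutely_integrable_apply_bv x])
      fix q :: "real \<Rightarrow> real" assume q: "continuous_on UNIV q"
      have int: "(\<lambda>s. q s *\<^sub>R apply_bv f s) integrable_on {0..h}"
      proof -
        have "bounded (q ` {0..h})"
          by (intro compact_imp_bounded compact_continuous_image continuous_on_subset[OF q]) auto
        moreover have "bilinear ((*\<^sub>R) :: real \<Rightarrow> complex ^ 'n \<Rightarrow> _)"
          by (simp add: bilinear_conv_bounded_bilinear bounded_bilinear_scaleR)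
        ultimately have "(\<lambda>s. q s *\<^sub>R apply_bv f s) absolutely_integrable_on {0..h}"
          using continuous_on_subset[OF q]
          by (intro absolutely_integrable_bounded_measurable_product[where h="(*\<^sub>R)"]
              continuous_imp_measurable_on_sets_lebesgue absolutely_integrable_apply_bv) auto
        then show ?thesis using set_lebesgue_integral_eq_integral(1) by blast
      qed
      have "integral {0..h} (\<lambda>s. q s *\<^sub>R apply_bv f s) $ i = 0" for i
      proof -
        let ?p = "\<lambda>\<theta>. q (- \<theta>) *\<^sub>R (axis i 1 :: real ^ 'n)"
        have p: "continuous_on UNIV ?p"
          by (intro continuous_intros continuous_on_compose2[OF q]) auto
        then obtain \<psi> where "\<And>\<theta>. (\<psi> has_vector_derivative ?p \<theta>) (at \<theta>)"
          using einterval_antiderivative[of "-\<infinity>" "\<infinity>" ?p] by (auto simp: continuous_on_eq_continuous_at)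
        from formula[OF this p]
        have "integral {0..h} (\<lambda>s. q s *\<^sub>R apply_bv f s $ i) = 0"
          by (simp add: fh row_col.zero_left complex_vec_scaleR complex_vec_axis row_col.scaleR_right row_col_axis)
        then show ?thesis
          using integral_linear[OF int bounded_linear_vec_nth[of i]] by (simp add: o_def)
      qed
      then show "integral {0..h} (\<lambda>s. q s *\<^sub>R apply_bv f s) = 0" by (simp add: vec_eq_iff)
    qed
  qed
qed

lemma periodic_bounded:
  fixes u :: "real \<Rightarrow> 'a::real_normed_vector"
  assumes "0 < T" "continuous_on UNIV u" "\<And>\<tau>. u (\<tau> + T) = u \<tau>"
  obtains B where "0 \<le> B" "\<And>\<tau>. norm (u \<tau>) \<le> B"
proof -
  have "compact (u ` {0..T})"
    by (intro compact_continuous_image continuous_on_subset[OF assms(2)]) auto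
  then have "bounded (u ` {0..T})" by (rule compact_imp_bounded)
  then obtain B where B: "\<And>y. y \<in> {0..T} \<Longrightarrow> norm (u y) \<le> B"
    unfolding bounded_iff by blast
  have "norm (u \<tau>) \<le> B" for \<tau>
    using periodic_reduce[of T u \<tau>, OF assms(1,3)] B by auto
  moreover from this have "0 \<le> B" using norm_ge_zero order_trans by blast
  ultimately show thesis using that by blast
qed

text \<open>For a smooth profile \<open>\<psi>\<close> and a periodic weight \<open>w\<close>, the functional annihilates \<open>w(t) \<psi>\<close> up to a
  corrector of size \<open>O(\<epsilon>)\<close>. As \<open>\<epsilon>\<close> tends to \<open>0\<close>, the function \<open>\<langle>f(\<tau>), \<psi>\<rangle>\<close> is seen to be orthogonal to
  all weights, hence zero.\<close>

lemma cA_annihilator: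
  fixes Lb L' :: "real \<Rightarrow> (real \<Rightarrow>\<^sub>C (real ^ 'n)) \<Rightarrow>\<^sub>L (real ^ 'n)" and f :: "real \<Rightarrow> (complex ^ 'n) bv"
  assumes h: "0 < h" and T: "0 < T"
    and Lb: "\<And>t. blinfun_apply (Lb t) = L t" "\<And>t. (Lb has_vector_derivative L' t) (at t)"
      "continuous_on UNIV L'" "\<And>t. Lb (t + T) = Lb t"
    and f: "f \<in> C_per T (star_space h)"
    and zero: "\<And>\<phi>. \<phi> \<in> part (dom_cA h T L) (C_per T (state_space h)) (cA h) \<Longrightarrow> pairing_per h T f \<phi> = 0"
  shows "f \<tau> = 0"
proof (rule star_space_annihilator[OF h C_perD(3)[OF f]])
  have h0: "0 \<le> h" using h by simp
  interpret pr: bounded_bilinear "pairing h :: (complex ^ 'n) bv \<Rightarrow> _"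
    by (rule bounded_bilinear_pairing[OF h0])
  note f' = C_perD[OF f]
  have Lbc: "continuous_on UNIV Lb"
    by (intro continuous_at_imp_continuous_on ballI has_vector_derivative_continuous[OF Lb(2)])
  obtain \<Lambda> where \<Lambda>: "0 \<le> \<Lambda>" "\<And>t. norm (Lb t) \<le> \<Lambda>" using periodic_bounded[OF T Lbc Lb(4)] by blast
  obtain B where B: "0 \<le> B" "\<And>t. norm (f t) \<le> B" using periodic_bounded[OF T f'(1,2)] by blast
  obtain K where K: "K \<ge> 0" "\<And>g \<phi>. norm (pairing h (g :: (complex ^ 'n) bv) \<phi>) \<le> norm g * norm \<phi> * K"
    using pr.nonneg_bounded by blast
  obtain N where N: "N > 0" "\<And>x :: real ^ 'n. norm (complex_vec x) \<le> norm x * N"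
    using bounded_linear.pos_bounded[OF bounded_linear_complex_vec] by blast
  fix \<psi> \<psi>' :: "real \<Rightarrow> real ^ 'n"
  assume \<psi>: "\<And>\<theta>. (\<psi> has_vector_derivative \<psi>' \<theta>) (at \<theta>)" "continuous_on UNIV \<psi>'"
  let ?\<Psi> = "hist h (\<lambda>\<theta>. complex_vec (\<psi> \<theta>)) 0"
  show "pairing h (f \<tau>) ?\<Psi> = 0"
  proof (rule periodic_zero_if_orthogonal[where g="\<lambda>\<tau>. pairing h (f \<tau>) ?\<Psi>", OF T])
    show "continuous_on UNIV (\<lambda>\<tau>. pairing h (f \<tau>) ?\<Psi>)"
      by (intro pr.continuous_on f'(1) continuous_on_const)
    show "pairing h (f (\<tau> + T)) ?\<Psi> = pairing h (f \<tau>) ?\<Psi>" for \<tau> by (simp add: f'(2))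
    fix w :: "real \<Rightarrow> real" assume w: "w \<in> C1_per T UNIV"
    note w' = C1_perD[OF w]
    have "continuous_on UNIV (\<lambda>t. w t *\<^sub>R (L t (hist h \<psi> 0) - \<psi>' 0))"
      unfolding Lb(1)[symmetric] by (intro continuous_intros w'(3) blinfun.continuous_on Lbc)
    then obtain \<beta> where \<beta>: "0 \<le> \<beta>" "\<And>t. norm (w t *\<^sub>R (L t (hist h \<psi> 0) - \<psi>' 0)) \<le> \<beta>"
      by (rule periodic_bounded[OF T]) (simp_all add: w'(4) Lb(4) Lb(1)[symmetric])
    let ?I = "integral {0..T} (\<lambda>\<tau>. w \<tau> *\<^sub>R pairing h (f \<tau>) ?\<Psi>)"
    define Q where "Q = B * (2 * \<beta> * N) * K * T"
    have Q: "0 \<le> Q" unfolding Q_def using B(1) \<beta>(1) N(1) K(1) T by simp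
    have small: "norm ?I \<le> Q * \<epsilon>" if \<epsilon>: "0 < \<epsilon>" "\<Lambda> * \<epsilon> \<le> 1 / 2" for \<epsilon>
    proof -
      obtain \<phi> c where \<phi>: "\<phi> \<in> part (dom_cA h T L) (C_per T (state_space h)) (cA h)"
        "\<And>t. \<phi> t = w t *\<^sub>R ?\<Psi> + hist h (\<lambda>\<theta>. (\<epsilon> * sin (\<theta> / \<epsilon>)) *\<^sub>R complex_vec (c t)) 0"
        "\<And>t. norm (c t) \<le> 2 * \<beta>"
        "continuous_on UNIV (\<lambda>t. hist h (\<lambda>\<theta>. (\<epsilon> * sin (\<theta> / \<epsilon>)) *\<^sub>R complex_vec (c t)) 0)"
        using dom_cA_test_function[OF h Lb \<Lambda>(2) \<psi> w \<epsilon> \<beta>(2)] by blast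
      let ?C = "\<lambda>t. hist h (\<lambda>\<theta>. (\<epsilon> * sin (\<theta> / \<epsilon>)) *\<^sub>R complex_vec (c t)) 0"
      have C: "norm (?C t) \<le> \<epsilon> * (2 * \<beta> * N)" for t
      proof (rule norm_hist_le[OF h0])
        show "continuous_on UNIV (\<lambda>\<theta>. (\<epsilon> * sin (\<theta> / \<epsilon>)) *\<^sub>R complex_vec (c t))"
          using \<epsilon>(1) by (intro continuous_intros) auto
        fix \<theta>
        have "\<bar>\<epsilon> * sin (\<theta> / \<epsilon>)\<bar> \<le> \<epsilon>" using \<epsilon>(1) by (simp add: abs_mult mult_left_le)
        moreover have "norm (complex_vec (c t)) \<le> 2 * \<beta> * N"
          using N(2)[of "c t"] \<phi>(3)[of t] N(1) by (meson less_imp_le mult_right_mono order_trans)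
        ultimately show "norm ((\<epsilon> * sin (\<theta> / \<epsilon>)) *\<^sub>R complex_vec (c t)) \<le> \<epsilon> * (2 * \<beta> * N)"
          unfolding norm_scaleR using \<epsilon>(1) by (intro mult_mono) auto
      qed
      have cont: "continuous_on S (\<lambda>\<tau>. w \<tau> *\<^sub>R pairing h (f \<tau>) ?\<Psi>)" "continuous_on S (\<lambda>\<tau>. pairing h (f \<tau>) (?C \<tau>))" for S
        by (intro continuous_intros pr.continuous_on continuous_on_subset[OF w'(3)] continuous_on_subset[OF f'(1)]
            continuous_on_subset[OF \<phi>(4)]; simp)+
      have "0 = integral {0..T} (\<lambda>\<tau>. w \<tau> *\<^sub>R pairing h (f \<tau>) ?\<Psi> + pairing h (f \<tau>) (?C \<tau>))"
        using zero[OF \<phi>(1)] unfolding pairing_per_def by (simp add: \<phi>(2) pr.add_right pr.scaleR_right)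
      also have "\<dots> = ?I + integral {0..T} (\<lambda>\<tau>. pairing h (f \<tau>) (?C \<tau>))"
        by (intro Henstock_Kurzweil_Integration.integral_add integrable_continuous_real cont)
      finally have "?I = - integral {0..T} (\<lambda>\<tau>. pairing h (f \<tau>) (?C \<tau>))"
        unfolding eq_neg_iff_add_eq_0 by (rule sym)
      then have "norm ?I = norm (integral {0..T} (\<lambda>\<tau>. pairing h (f \<tau>) (?C \<tau>)))"
        by (simp only: norm_minus_cancel)
      also have "\<dots> \<le> (B * (\<epsilon> * (2 * \<beta> * N)) * K) * (T - 0)"
      proof (rule integral_bound[OF _ cont(2)])
        fix t
        have "norm (pairing h (f t) (?C t)) \<le> norm (f t) * norm (?C t) * K" by (rule K(2))
        also have "\<dots> \<le> B * (\<epsilon> * (2 * \<beta> * N)) * K"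
          using B C K(1) by (intro mult_right_mono mult_mono) auto
        finally show "norm (pairing h (f t) (?C t)) \<le> B * (\<epsilon> * (2 * \<beta> * N)) * K" .
      qed (use T in simp)
      finally show ?thesis by (simp add: Q_def mult_ac)
    qed
    have "norm ?I \<le> 0 + e" if e: "e > 0" for e
    proof -
      \<comment> \<open>The first bound makes \<open>Q * \<epsilon>\<close> at most \<open>e\<close>, the second one keeps the perturbation of the identity small.\<close>
      define \<epsilon> where "\<epsilon> = min (e / (Q + 1)) (1 / (2 * (\<Lambda> + 1)))"
      have \<epsilon>: "0 < \<epsilon>" unfolding \<epsilon>_def using Q \<Lambda>(1) e by simp
      have "\<Lambda> * \<epsilon> \<le> \<Lambda> * (1 / (2 * (\<Lambda> + 1)))"
        unfolding \<epsilon>_def using \<Lambda>(1) by (intro mult_left_mono) auto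
      also have "\<dots> \<le> 1 / 2" using \<Lambda>(1) by (simp add: field_simps)
      finally have "norm ?I \<le> Q * \<epsilon>" by (rule small[OF \<epsilon>])
      also have "\<dots> \<le> Q * (e / (Q + 1))"
        unfolding \<epsilon>_def using Q by (intro mult_left_mono) auto
      also have "\<dots> \<le> e" using Q e by (simp add: field_simps)
      finally show ?thesis by simp
    qed
    then have "norm ?I \<le> 0" by (rule field_le_epsilon)
    then show "?I = 0" by simp
  qed
qed

text \<open>For any other operator with this property and any \<open>u\<close> in the domain, the difference of the two images
  of \<open>u\<close> annihilates the domain of the first operator.\<close>

lemma unique_linear_operator_cA_star:
  fixes L :: "real \<Rightarrow> (real \<Rightarrow>\<^sub>C (real ^ 'n)) \<Rightarrow> real ^ 'n" and Lb L' :: "real \<Rightarrow> (real \<Rightarrow>\<^sub>C (real ^ 'n)) \<Rightarrow>\<^sub>L (real ^ 'n)"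
  assumes h: "0 < h" and T: "0 < T"
    and Z: "\<And>t. NBV h (\<zeta> t)"
    and L: "\<And>t \<phi>. has_RS_integral (*v) (\<zeta> t) (\<lambda>\<theta>. apply_bcontfun \<phi> (-\<theta>)) {0..h} (L t \<phi>)"
    and Lb: "\<And>t. blinfun_apply (Lb t) = L t" "\<And>t. (Lb has_vector_derivative L' t) (at t)"
      "continuous_on UNIV L'" "\<And>t. Lb (t + T) = Lb t"
  shows "unique_linear_operator scaleC_bv
       (part (dom_cA_star h T) (C_per T (star_space h)) (cA_star h \<zeta>))
       (C_per T (star_space h))
       (\<lambda>B. \<forall>\<phi>\<in>part (dom_cA h T L) (C_per T (state_space h)) (cA h).
            \<forall>\<phi>s\<in>part (dom_cA_star h T) (C_per T (star_space h)) (cA_star h \<zeta>).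
              pairing_per h T (B \<phi>s) \<phi> = pairing_per h T \<phi>s (cA h \<phi>))
       (cA_star h \<zeta>)"
    (is "unique_linear_operator _ ?D ?R ?P ?A")
  unfolding unique_linear_operator_def
proof (intro conjI allI impI ballI)
  show "linear_operator scaleC_bv ?D ?R ?A"
    by (rule linear_operator_cA_star[OF h Z])
  have dual: "pairing_per h T (?A \<phi>s) \<phi> = pairing_per h T \<phi>s (cA h \<phi>)"
    if "\<phi> \<in> part (dom_cA h T L) (C_per T (state_space h)) (cA h)" "\<phi>s \<in> ?D" for \<phi> \<phi>s
    using that pairing_per_cA_star[where L=L and \<zeta>=\<zeta>, OF h T Z L] unfolding part_def by blast
  then show "pairing_per h T (?A \<phi>s) \<phi> = pairing_per h T \<phi>s (cA h \<phi>)"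
    if "\<phi> \<in> part (dom_cA h T L) (C_per T (state_space h)) (cA h)" "\<phi>s \<in> ?D" for \<phi> \<phi>s
    using that by blast
  fix B u assume B: "linear_operator scaleC_bv ?D ?R B \<and> ?P B" and u: "u \<in> ?D"
  interpret pr: bounded_bilinear "pairing h :: (complex ^ 'n) bv \<Rightarrow> _"
    using h by (intro bounded_bilinear_pairing) simp
  have Bu: "B u \<in> ?R" "?A u \<in> ?R"
    using B u unfolding linear_operator_def part_def by auto
  have "(\<lambda>\<tau>. B u \<tau> - ?A u \<tau>) \<tau> = 0" for \<tau>
  proof (rule cA_annihilator[OF h T Lb])
    show "(\<lambda>\<tau>. B u \<tau> - ?A u \<tau>) \<in> ?R"
      using C_perD[OF Bu(1)] C_perD[OF Bu(2)] by (intro C_perI continuous_on_diff star_space_linear) auto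
    fix \<phi> assume \<phi>: "\<phi> \<in> part (dom_cA h T L) (C_per T (state_space h)) (cA h)"
    then have "continuous_on UNIV \<phi>"
      unfolding part_def dom_cA_def using C1_perD(3) by blast
    then have int: "(\<lambda>\<tau>. pairing h (B u \<tau>) (\<phi> \<tau>)) integrable_on {0..T}"
      "(\<lambda>\<tau>. pairing h (?A u \<tau>) (\<phi> \<tau>)) integrable_on {0..T}"
      using C_perD(1)[OF Bu(1)] C_perD(1)[OF Bu(2)]
      by (auto intro!: integrable_continuous_real pr.continuous_on intro: continuous_on_subset)
    have "pairing_per h T (\<lambda>\<tau>. B u \<tau> - ?A u \<tau>) \<phi> = pairing_per h T (B u) \<phi> - pairing_per h T (?A u) \<phi>"
      unfolding pairing_per_def pr.diff_left
      by (rule Henstock_Kurzweil_Integration.integral_diff[OF int])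
    also have "\<dots> = 0" using B \<phi> u dual[OF \<phi> u] by auto
    finally show "pairing_per h T (\<lambda>\<tau>. B u \<tau> - ?A u \<tau>) \<phi> = 0" .
  qed
  then show "B u = ?A u" by auto
qed

section \<open>Lipschitz functions are primitives of their derivatives\<close>

lemma AE_lborel_negligible:
  fixes P :: "real \<Rightarrow> bool"
  assumes "AE x in lborel. P x"
  shows "negligible {x. \<not> P x}"
proof -
  obtain N where N: "{x \<in> space lborel. \<not> P x} \<subseteq> N" "emeasure lborel N = 0" "N \<in> sets lborel"
    using assms by (rule AE_E)
  then have "N \<in> null_sets lebesgue" by (intro null_sets_completionI) auto
  then have "negligible N" by (simp only: negligible_iff_null_sets)
  then show ?thesis by (rule negligible_subset) (use N(1) in auto)
qed

lemma AE_lborel_uminus: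
  fixes P :: "real \<Rightarrow> bool"
  assumes "AE x in lborel. P x"
  shows "AE x in lborel. P (- x)"
proof -
  obtain N where N: "{x \<in> space lborel. \<not> P x} \<subseteq> N" "emeasure lborel N = 0" "N \<in> sets lborel"
    using assms by (rule AE_E)
  have "emeasure lborel (uminus -` N) = emeasure (distr lborel borel uminus) N"
    using N(3) by (subst emeasure_distr) auto
  also have "\<dots> = 0" using N(2) by (simp add: lborel_distr_uminus)
  finally have "emeasure lborel (uminus -` N) = 0" .
  moreover have "uminus -` N \<in> sets lborel"
    using measurable_sets[of "uminus :: real \<Rightarrow> real" borel borel N] N(3) by simp
  ultimately show ?thesis
    by (intro AE_I[where N="uminus -` N"]) (use N(1) in auto)
qed

text \<open>Lebesgue's differentiation theorem holds for right-hand difference quotients; reflection gives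
  the left-hand ones.\<close>

lemma has_real_derivative_primitive_AE:
  fixes F d :: "real \<Rightarrow> real"
  assumes F: "\<And>a b. a \<le> b \<Longrightarrow> (d has_integral F b - F a) {a..b}"
  shows "AE x in lborel. (F has_real_derivative d x) (at x)"
proof -
  have "d integrable_on cbox a b" for a b
  proof (cases "a \<le> b")
    case True then show ?thesis using F[of a b] by auto
  next
    case False then show ?thesis by (simp add: integrable_on_empty)
  qed
  then obtain N where N: "negligible N" "\<And>x e. x \<notin> N \<Longrightarrow> 0 < e \<Longrightarrow>
      \<exists>\<delta>>0. \<forall>r. 0 < r \<and> r < \<delta> \<longrightarrow> norm (integral (cbox x (x + r *\<^sub>R One)) d /\<^sub>R r ^ DIM(real) - d x) < e"
    using integrable_ccontinuous_explicit[of d] by metis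
  have refl: "((\<lambda>x. d (- x)) has_integral F (- a) - F (- b)) {a..b}" if "a \<le> b" for a b
    using F[of "- b" "- a"] has_integral_reflect_real[where f=d and a="- b" and b="- a"] that by simp
  have "(\<lambda>x. d (- x)) integrable_on cbox a b" for a b
  proof (cases "a \<le> b")
    case True then show ?thesis using refl[of a b] by auto
  next
    case False then show ?thesis by (simp add: integrable_on_empty)
  qed
  then obtain N' where N': "negligible N'" "\<And>x e. x \<notin> N' \<Longrightarrow> 0 < e \<Longrightarrow>
      \<exists>\<delta>>0. \<forall>r. 0 < r \<and> r < \<delta> \<longrightarrow>
        norm (integral (cbox x (x + r *\<^sub>R One)) (\<lambda>x. d (- x)) /\<^sub>R r ^ DIM(real) - d (- x)) < e"
    using integrable_ccontinuous_explicit[of "\<lambda>x. d (- x)"] by metis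
  have deriv: "(F has_real_derivative d x) (at x)" if x: "x \<notin> N" "- x \<notin> N'" for x
    unfolding has_field_derivative_iff LIM_eq
  proof (intro allI impI)
    fix e :: real assume e: "0 < e"
    obtain \<delta> where \<delta>: "\<delta> > 0" "\<And>r. 0 < r \<Longrightarrow> r < \<delta> \<Longrightarrow> \<bar>integral {x..x + r} d / r - d x\<bar> < e"
      using N(2)[OF x(1) e] by (auto simp: divide_inverse mult.commute)
    obtain \<delta>' where \<delta>': "\<delta>' > 0"
      "\<And>r. 0 < r \<Longrightarrow> r < \<delta>' \<Longrightarrow> \<bar>integral {- x..- x + r} (\<lambda>x. d (- x)) / r - d x\<bar> < e"
      using N'(2)[OF x(2) e] by (auto simp: divide_inverse mult.commute)
    have "norm ((F y - F x) / (y - x) - d x) < e" if y: "y \<noteq> x" "norm (y - x) < min \<delta> \<delta>'" for y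
    proof (cases "x < y")
      case True
      have "integral {x..x + (y - x)} d = F y - F x"
        using integral_unique[OF F[of x y]] True by simp
      then show ?thesis using \<delta>(2)[of "y - x"] True y by simp
    next
      case False
      have "integral {- x..- x + (x - y)} (\<lambda>x. d (- x)) = F x - F y"
        using integral_unique[OF refl[of "- x" "- y"]] False by simp
      then have "\<bar>(F x - F y) / (x - y) - d x\<bar> < e"
        using \<delta>'(2)[of "x - y"] False y by simp
      moreover have "(F y - F x) / (y - x) = (F x - F y) / (x - y)"
        by (metis minus_diff_eq minus_divide_divide)
      ultimately show ?thesis by simp
    qed
    then show "\<exists>s>0. \<forall>y. y \<noteq> x \<and> norm (y - x) < s \<longrightarrow> norm ((F y - F x) / (y - x) - d x) < e"
      using \<delta>(1) \<delta>'(1) by (intro exI[of _ "min \<delta> \<delta>'"]) auto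
  qed
  have "AE x in lebesgue. x \<notin> N" "AE x in lebesgue. x \<notin> N'"
    using AE_not_in N(1) N'(1) negligible_iff_null_sets by blast+
  then have "AE x in lborel. x \<notin> N" "AE x in lborel. - x \<notin> N'"
    using AE_lborel_uminus[of "\<lambda>x. x \<notin> N'"] by (simp_all add: AE_completion_iff)
  then show ?thesis
    by eventually_elim (rule deriv)
qed

text \<open>If \<open>F\<close> and \<open>x - F x\<close> are monotone then the Stieltjes measures of both functions add up to
  Lebesgue measure, so that of \<open>F\<close> has a density.\<close>

lemma monotone_density:
  fixes F :: "real \<Rightarrow> real"
  assumes mono: "mono F" "mono (\<lambda>x. x - F x)" and cont: "continuous_on UNIV F"
  obtains d where "d \<in> borel_measurable borel" "\<And>a b. a \<le> b \<Longrightarrow> (d has_integral F b - F a) {a..b}"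
proof -
  define G where "G x = x - F x" for x
  have contG: "continuous_on UNIV G" unfolding G_def by (intro continuous_intros cont)
  let ?\<mu> = "interval_measure F" and ?\<nu> = "interval_measure G"
  have mF: "x \<le> y \<Longrightarrow> F x \<le> F y" and mG: "x \<le> y \<Longrightarrow> G x \<le> G y" for x y
    using mono unfolding G_def by (auto dest: monoD)
  have Icc: "emeasure ?\<mu> {a..b} = F b - F a" "emeasure ?\<nu> {a..b} = G b - G a" if "a \<le> b" for a b
    by (auto intro!: emeasure_interval_measure_Icc that cont contG mF mG)
  have Ioo: "emeasure ?\<mu> {a<..<b} = F b - F a" "emeasure ?\<nu> {a<..<b} = G b - G a" if "a \<le> b" for a b
  proof -
    have null: "{a, b} \<in> null_sets ?\<mu>" "{a, b} \<in> null_sets ?\<nu>"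
      using Icc(1)[of a a] Icc(1)[of b b] Icc(2)[of a a] Icc(2)[of b b] null_sets.Un[of "{a}" _ "{b}"]
      by (auto simp: null_sets_def insert_commute)
    have eq: "insert a (insert b {a<..<b}) = {a..b}" using that by auto
    show "emeasure ?\<mu> {a<..<b} = F b - F a" "emeasure ?\<nu> {a<..<b} = G b - G a"
      using emeasure_Un_null_set[of "{a<..<b}" ?\<mu>, OF _ null(1)] emeasure_Un_null_set[of "{a<..<b}" ?\<nu>, OF _ null(2)]
        Icc[OF that] that
      by (simp_all add: eq)
  qed
  \<comment> \<open>The sum of the two Stieltjes measures agrees with Lebesgue measure on open intervals.\<close>
  define S where "S = measure_of UNIV (sets borel) (\<lambda>A. emeasure ?\<mu> A + emeasure ?\<nu> A)"
  have S: "emeasure S A = emeasure ?\<mu> A + emeasure ?\<nu> A" if A: "A \<in> sets borel" for A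
    unfolding S_def
  proof (rule emeasure_measure_of_sigma[OF _ _ _ A])
    show "sigma_algebra UNIV (sets borel)" using sets.sigma_algebra_axioms[of borel] by simp
    show "positive (sets borel) (\<lambda>A. emeasure ?\<mu> A + emeasure ?\<nu> A)" by (simp add: positive_def)
    show "countably_additive (sets borel) (\<lambda>A. emeasure ?\<mu> A + emeasure ?\<nu> A)"
    proof (rule countably_additiveI)
      fix A :: "nat \<Rightarrow> real set" assume "range A \<subseteq> sets borel" "disjoint_family A"
      then show "(\<Sum>i. emeasure ?\<mu> (A i) + emeasure ?\<nu> (A i)) = emeasure ?\<mu> (\<Union>i. A i) + emeasure ?\<nu> (\<Union>i. A i)"
        using suminf_emeasure[of A ?\<mu>] suminf_emeasure[of A ?\<nu>] by (simp add: suminf_add[symmetric])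
    qed
  qed
  have "lborel = S"
  proof (rule lborel_eqI)
    fix l u :: real assume "\<And>b. b \<in> Basis \<Longrightarrow> l \<bullet> b \<le> u \<bullet> b"
    then have lu: "l \<le> u" by simp
    have "emeasure S (box l u) = ennreal (F u - F l) + ennreal (G u - G l)"
      using Ioo[OF lu] by (simp add: S box_real)
    also have "\<dots> = ennreal (u - l)"
      using mF[OF lu] mG[OF lu] by (subst ennreal_plus[symmetric]) (auto simp: G_def)
    finally show "emeasure S (box l u) = ennreal (\<Prod>b\<in>Basis. (u - l) \<bullet> b)" by simp
  qed (simp add: S_def sets_measure_of_conv sets.sigma_sets_eq[of borel, simplified])
  then have "absolutely_continuous lborel ?\<mu>"
    unfolding absolutely_continuous_def null_sets_def using S by (auto simp: add_eq_0_iff_both_eq_0)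
  then obtain f where f: "f \<in> borel_measurable lborel" "density lborel f = ?\<mu>"
    using sigma_finite_measure.Radon_Nikodym[OF sigma_finite_lborel, of ?\<mu>] by auto
  define d where "d x = enn2real (f x)" for x
  have d: "d \<in> borel_measurable borel" using f(1) unfolding d_def by simp
  have "(d has_integral F b - F a) {a..b}" if ab: "a \<le> b" for a b
  proof -
    have nn: "(\<integral>\<^sup>+ x. f x * indicator {a..b} x \<partial>lborel) = F b - F a"
      using emeasure_density[OF f(1), of "{a..b}"] Icc(1)[OF ab] ab by (simp add: f(2))
    have "AE x in lborel. f x * indicator {a..b} x \<noteq> \<infinity>"
      using nn f(1) by (intro nn_integral_PInf_AE) auto
    then have "AE x in lborel. ennreal (d x * indicator {a..b} x) = f x * indicator {a..b} x"
      by eventually_elim (auto simp: d_def indicator_def less_top)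
    then have "(\<integral>\<^sup>+ x. ennreal (d x * indicator {a..b} x) \<partial>lborel) = (\<integral>\<^sup>+ x. f x * indicator {a..b} x \<partial>lborel)"
      by (rule nn_integral_cong_AE)
    then have "((\<lambda>x. d x * indicator {a..b} x) has_integral F b - F a) UNIV"
      using nn mF[OF ab] by (intro nn_integral_has_integral borel_measurable_times[OF d borel_measurable_indicator])
        (auto simp: d_def)
    moreover have "(\<lambda>x. d x * indicator {a..b} x) = (\<lambda>x. if x \<in> {a..b} then d x else 0)"
      by (auto simp: indicator_def)
    ultimately show ?thesis by (simp only: has_integral_restrict_UNIV)
  qed
  with d show thesis by (rule that)
qed

lemma lipschitz_density_real:
  fixes u :: "real \<Rightarrow> real"
  assumes "C-lipschitz_on UNIV u"
  obtains d where "d \<in> borel_measurable borel" "\<And>a b. a \<le> b \<Longrightarrow> (d has_integral u b - u a) {a..b}"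
proof -
  have C: "0 \<le> C" "\<And>x y. \<bar>u x - u y\<bar> \<le> C * \<bar>x - y\<bar>"
    using assms unfolding lipschitz_on_def dist_real_def by auto
  \<comment> \<open>Both \<open>F\<close> and \<open>x - F x\<close> are monotone because the Lipschitz constant of \<open>u / K\<close> is at most 1.\<close>
  define K where "K = C + 1"
  define F where "F x = (x + u x / K) / 2" for x
  have K: "K > 0" using C(1) by (simp add: K_def)
  have slope: "\<bar>u y / K - u x / K\<bar> \<le> y - x" if "x \<le> y" for x y
  proof -
    have "\<bar>u y - u x\<bar> \<le> K * (y - x)"
      using C(2)[of y x] that mult_right_mono[of C K "y - x"] by (simp add: K_def)
    then show ?thesis using K by (simp add: field_simps flip: diff_divide_distrib)
  qed
  have "F x \<le> F y \<and> x - F x \<le> y - F y" if xy: "x \<le> y" for x y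
  proof -
    have "u y / K - u x / K \<le> y - x" "- (u y / K - u x / K) \<le> y - x"
      using slope[OF xy] unfolding abs_le_iff by auto
    moreover have "(x + a) / 2 \<le> (y + b) / 2 \<and> x - (x + a) / 2 \<le> y - (y + b) / 2"
      if "b - a \<le> y - x" "- (b - a) \<le> y - x" for a b using that by (simp add: field_simps)
    ultimately show ?thesis unfolding F_def by blast
  qed
  then have "mono F" "mono (\<lambda>x. x - F x)"
    unfolding mono_def by blast+
  moreover have "continuous_on UNIV F"
    unfolding F_def using lipschitz_on_continuous_on[OF assms] K by (intro continuous_intros) auto
  ultimately obtain d where d: "d \<in> borel_measurable borel" "\<And>a b. a \<le> b \<Longrightarrow> (d has_integral F b - F a) {a..b}"
    using monotone_density by blast
  show thesis
  proof (rule that[of "\<lambda>x. K * (2 * d x - 1)"])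
    show "(\<lambda>x. K * (2 * d x - 1)) \<in> borel_measurable borel" using d(1) by simp
    fix a b :: real assume ab: "a \<le> b"
    have "((\<lambda>x. K * (2 * d x - 1)) has_integral K * (2 * (F b - F a) - (b - a))) {a..b}"
      using has_integral_const_real[of "1::real" a b] ab
      by (intro has_integral_mult_right has_integral_diff d(2)) auto
    also have "K * (2 * (F b - F a) - (b - a)) = u b - u a"
      using K by (simp add: F_def field_simps)
    finally show "((\<lambda>x. K * (2 * d x - 1)) has_integral u b - u a) {a..b}" .
  qed
qed

text \<open>The components have densities, which are the derivatives almost everywhere. Where the derivative
  exists its norm is at most \<open>C\<close>; elsewhere the density is replaced by \<open>0\<close> if its norm exceeds \<open>C\<close>.\<close>

lemma lipschitz_has_derivative:
  fixes u :: "real \<Rightarrow> 'a::euclidean_space"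
  assumes u: "C-lipschitz_on UNIV u"
  obtains d where "d \<in> borel_measurable borel" "\<And>x. norm (d x) \<le> C"
    "\<And>a b. a \<le> b \<Longrightarrow> (d has_integral u b - u a) {a..b}"
    "AE x in lborel. (u has_vector_derivative d x) (at x)"
proof -
  have C: "0 \<le> C" "\<And>x y. norm (u x - u y) \<le> C * \<bar>x - y\<bar>"
    using u unfolding lipschitz_on_def dist_norm by (auto simp: dist_norm)
  have "\<exists>d. d \<in> borel_measurable borel \<and> (\<forall>a b. a \<le> b \<longrightarrow> (d has_integral u b \<bullet> i - u a \<bullet> i) {a..b})"
    if i: "i \<in> Basis" for i
  proof -
    have "C-lipschitz_on UNIV (\<lambda>x. u x \<bullet> i)"
    proof (rule lipschitz_onI[OF _ C(1)])
      fix x y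
      have "\<bar>(u x - u y) \<bullet> i\<bar> \<le> norm (u x - u y)" by (rule Basis_le_norm[OF i])
      then show "dist (u x \<bullet> i) (u y \<bullet> i) \<le> C * dist x y"
        using C(2)[of x y] by (simp add: dist_real_def inner_diff_left)
    qed
    then show ?thesis using lipschitz_density_real by metis
  qed
  then obtain di where di: "\<And>i. i \<in> Basis \<Longrightarrow> di i \<in> borel_measurable borel"
    "\<And>i a b. i \<in> Basis \<Longrightarrow> a \<le> b \<Longrightarrow> (di i has_integral u b \<bullet> i - u a \<bullet> i) {a..b}"
    by metis
  define d0 where "d0 x = (\<Sum>i\<in>Basis. di i x *\<^sub>R i)" for x
  have d0_meas: "d0 \<in> borel_measurable borel"
    unfolding d0_def[abs_def] by (intro borel_measurable_sum borel_measurable_scaleR di(1) borel_measurable_const)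
  have d0_int: "(d0 has_integral u b - u a) {a..b}" if "a \<le> b" for a b
    unfolding has_integral_componentwise_iff[of d0]
    using di(2)[OF _ that] by (simp add: d0_def inner_diff_left)
  have "AE x in lborel. \<forall>i\<in>Basis. ((\<lambda>x. u x \<bullet> i) has_real_derivative di i x) (at x)"
    using has_real_derivative_primitive_AE[OF di(2)] by (simp add: AE_finite_all)
  then have d0_deriv: "AE x in lborel. (u has_vector_derivative d0 x) (at x)"
  proof eventually_elim
    case (elim x)
    have "((\<lambda>y. \<Sum>i\<in>Basis. (u y \<bullet> i) *\<^sub>R i) has_vector_derivative (\<Sum>i\<in>Basis. di i x *\<^sub>R i)) (at x)"
      using elim unfolding has_real_derivative_iff_has_vector_derivative
      by (intro has_vector_derivative_sum bounded_linear.has_vector_derivative[OF bounded_linear_scaleR_left]) auto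
    then show ?case by (simp add: euclidean_representation d0_def)
  qed
  have bound: "norm (d0 x) \<le> C" if "(u has_vector_derivative d0 x) (at x)" for x
  proof -
    have "((\<lambda>s. (u s - u x) /\<^sub>R (s - x)) \<longlongrightarrow> d0 x) (at x)"
      using that by (simp add: has_vector_derivative_iff_difference_quotient)
    from tendsto_norm[OF this] show ?thesis
    proof (rule tendsto_upperbound)
      show "\<forall>\<^sub>F s in at x. norm ((u s - u x) /\<^sub>R (s - x)) \<le> C"
        unfolding eventually_at_filter
      proof (intro always_eventually allI impI)
        fix s assume "s \<noteq> x"
        have "norm ((u s - u x) /\<^sub>R (s - x)) = norm (u s - u x) / \<bar>s - x\<bar>"
          unfolding norm_scaleR abs_inverse by (simp add: divide_inverse mult.commute)
        also have "\<dots> \<le> C" using \<open>s \<noteq> x\<close> C(2)[of s x] by (simp add: pos_divide_le_eq)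
        finally show "norm ((u s - u x) /\<^sub>R (s - x)) \<le> C" .
      qed
    qed simp
  qed
  define d where "d x = (if norm (d0 x) \<le> C then d0 x else 0)" for x
  have eq: "AE x in lborel. d x = d0 x"
    using d0_deriv by eventually_elim (simp add: d_def bound)
  show thesis
  proof (rule that[of d])
    show "d \<in> borel_measurable borel" unfolding d_def[abs_def] using d0_meas by measurable
    show "norm (d x) \<le> C" for x using C(1) by (simp add: d_def)
    show "AE x in lborel. (u has_vector_derivative d x) (at x)"
      using d0_deriv eq by eventually_elim simp
    fix a b :: real assume "a \<le> b"
    have "negligible {x. d x \<noteq> d0 x}" by (rule AE_lborel_negligible[OF eq])
    then show "(d has_integral u b - u a) {a..b}"
      by (rule has_integral_spike[OF _ _ d0_int[OF \<open>a \<le> b\<close>]]) auto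
  qed
qed

section \<open>Densities of the elements of the sun dual\<close>

text \<open>Completeness of \<open>L\<^sup>1\<close>: by monotone convergence the series of the norms converges almost everywhere.\<close>

lemma absolutely_integrable_series:
  fixes d :: "nat \<Rightarrow> real \<Rightarrow> 'a::euclidean_space"
  assumes d: "\<And>n. d n absolutely_integrable_on {a..b}"
    and sum: "summable (\<lambda>n. integral {a..b} (\<lambda>s. norm (d n s)))"
  obtains G where "G absolutely_integrable_on {a..b}"
    "\<And>x. x \<in> {a..b} \<Longrightarrow> (\<lambda>n. integral {a..x} (d n)) sums integral {a..x} G"
proof -
  define D where "D n x = indicator {a..b} x *\<^sub>R d n x" for n x
  have D: "integrable lebesgue (D n)" for n
    using d[of n] unfolding set_integrable_def D_def .
  have norm_D: "(LINT x|lebesgue. norm (D n x)) = integral {a..b} (\<lambda>s. norm (d n s))" for n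
  proof -
    have "(\<lambda>s. norm (d n s)) absolutely_integrable_on {a..b}"
      using absolutely_integrable_norm[OF d[of n]] by (simp add: o_def)
    from set_lebesgue_integral_eq_integral(2)[OF this] show ?thesis
      unfolding set_lebesgue_integral_def D_def by simp
  qed
  have sum_D: "summable (\<lambda>n. LINT x|lebesgue. norm (D n x))" using sum by (simp add: norm_D)
  have "(\<integral>\<^sup>+ x. (\<Sum>n. ennreal (norm (D n x))) \<partial>lebesgue) = (\<Sum>n. \<integral>\<^sup>+ x. ennreal (norm (D n x)) \<partial>lebesgue)"
    using borel_measurable_integrable[OF D] by (intro nn_integral_suminf) simp
  also have "\<dots> = (\<Sum>n. ennreal (LINT x|lebesgue. norm (D n x)))"
    by (intro suminf_cong nn_integral_eq_integral integrable_norm D) auto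
  also have "\<dots> = ennreal (\<Sum>n. LINT x|lebesgue. norm (D n x))"
    by (intro suminf_ennreal2 sum_D integral_nonneg_AE) auto
  finally have "(\<integral>\<^sup>+ x. (\<Sum>n. ennreal (norm (D n x))) \<partial>lebesgue) \<noteq> \<infinity>" by simp
  then have "AE x in lebesgue. (\<Sum>n. ennreal (norm (D n x))) \<noteq> \<infinity>"
    using borel_measurable_integrable[OF D] by (intro nn_integral_PInf_AE) auto
  then have AE_D: "AE x in lebesgue. summable (\<lambda>n. norm (D n x))"
    by eventually_elim (rule summable_suminf_not_top, auto)
  define G where "G x = (\<Sum>n. D n x)" for x
  have "integrable lebesgue G"
    unfolding G_def by (rule integrable_suminf[OF D AE_D sum_D])
  moreover have "indicator {a..b} x *\<^sub>R G x = G x" for x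
    by (auto simp: G_def D_def indicator_def)
  ultimately have G: "G absolutely_integrable_on {a..b}"
    unfolding set_integrable_def by simp
  have "(\<lambda>n. integral {a..x} (d n)) sums integral {a..x} G" if x: "x \<in> {a..b}" for x
  proof -
    have sub: "{a..x} \<subseteq> {a..b}" using x by auto
    define E where "E n y = indicator {a..x} y *\<^sub>R d n y" for n y
    have dx: "d n absolutely_integrable_on {a..x}" for n
      by (rule set_integrable_subset[OF d _ sub]) simp
    then have E: "integrable lebesgue (E n)" for n
      unfolding set_integrable_def E_def .
    have le: "norm (E n y) \<le> norm (D n y)" for n y
      using sub by (auto simp: E_def D_def indicator_def)
    have AE_E: "AE y in lebesgue. summable (\<lambda>n. norm (E n y))"
      using AE_D by eventually_elim (rule summable_comparison_test', assumption, simp add: le)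
    have "(\<lambda>n. LINT y|lebesgue. E n y) sums (LINT y|lebesgue. (\<Sum>n. E n y))"
    proof (rule sums_integral[OF E AE_E])
      show "summable (\<lambda>n. LINT y|lebesgue. norm (E n y))"
        by (rule summable_comparison_test'[OF sum_D])
          (simp add: integral_nonneg_AE integral_mono integrable_norm E D le)
    qed
    moreover have "(LINT y|lebesgue. E n y) = integral {a..x} (d n)" for n
      using set_lebesgue_integral_eq_integral(2)[OF dx] unfolding set_lebesgue_integral_def E_def .
    moreover have "(\<Sum>n. E n y) = indicator {a..x} y *\<^sub>R G y" for y
      using sub by (auto simp: E_def G_def D_def indicator_def)
    moreover have "(LINT y|lebesgue. indicator {a..x} y *\<^sub>R G y) = integral {a..x} G"
      using set_lebesgue_integral_eq_integral(2)[OF set_integrable_subset[OF G _ sub]]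
      unfolding set_lebesgue_integral_def by simp
    ultimately show ?thesis by simp
  qed
  with G show thesis by (rule that)
qed

definition has_sun_density :: "real \<Rightarrow> (complex ^ 'n) bv \<Rightarrow> (real \<Rightarrow> complex ^ 'n) \<Rightarrow> bool" where
  "has_sun_density h f g \<longleftrightarrow> g absolutely_integrable_on {0..h} \<and>
     (\<forall>\<theta>\<in>{0<..h}. apply_bv f \<theta> = value0 f + integral {0..\<theta>} g)"

lemma sun_density_eq_SOME: "sun_density h f = (SOME g. has_sun_density h f g)"
  unfolding sun_density_def has_sun_density_def ..

lemma has_sun_density_integrable:
  assumes "has_sun_density h f g" "0 \<le> u" "v \<le> h"
  shows "g integrable_on {u..v}"
  using integrable_on_subinterval[OF set_lebesgue_integral_eq_integral(1), of "{0..h}" g u v] assms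
  unfolding has_sun_density_def by auto

lemma has_sun_density_add:
  assumes "has_sun_density h f g" "has_sun_density h f' g'"
  shows "has_sun_density h (f + f') (\<lambda>s. g s + g' s)"
  using assms has_sun_density_integrable[OF assms(1)] has_sun_density_integrable[OF assms(2)]
  by (auto simp: has_sun_density_def plus_bv.rep_eq value0_add Henstock_Kurzweil_Integration.integral_add
      intro!: set_integral_add)

lemma has_sun_density_scaleR:
  assumes "has_sun_density h f g"
  shows "has_sun_density h (r *\<^sub>R f) (\<lambda>s. r *\<^sub>R g s)"
  using assms linear_cmul[OF bounded_linear.linear[OF bounded_linear_value0], of r f]
  by (auto simp: has_sun_density_def scaleR_bv.rep_eq scaleR_add_right)

lemma has_sun_density_diff:
  assumes "has_sun_density h f g" "has_sun_density h f' g'"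
  shows "has_sun_density h (f - f') (\<lambda>s. g s - g' s)"
  using has_sun_density_add[OF assms(1) has_sun_density_scaleR[OF assms(2), of "-1"]] by simp

lemma has_sun_density_star_deriv:
  assumes "0 < h" "f \<in> dom_A0_star h"
  shows "has_sun_density h f (apply_bv (star_deriv h f))"
  using is_star_deriv_star_deriv[OF assms]
  unfolding has_sun_density_def is_star_deriv_def by (auto intro: absolutely_integrable_apply_bv)

text \<open>By Henstock's lemma the integral of \<open>norm g\<close> is approximated by the sums of the norms of the
  integrals of \<open>g\<close> over subintervals, which are increments of \<open>f\<close>.\<close>

lemma sun_density_norm_le:
  fixes f :: "(complex ^ 'n) bv"
  assumes h: "0 < h" and fg: "has_sun_density h f g"
  shows "integral {0..h} (\<lambda>s. norm (g s)) \<le> norm f"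
proof (rule field_le_epsilon)
  fix e :: real assume e: "e > 0"
  then have e2: "e / 2 > 0" by simp
  have g: "g absolutely_integrable_on {0..h}"
    and f: "\<And>\<theta>. \<theta> \<in> {0<..h} \<Longrightarrow> apply_bv f \<theta> = value0 f + integral {0..\<theta>} g"
    using fg unfolding has_sun_density_def by auto
  note g_int = has_sun_density_integrable[OF fg]
  have ng: "(\<lambda>s. norm (g s)) integrable_on {0..h}"
    using absolutely_integrable_norm[OF g, unfolded o_def] set_lebesgue_integral_eq_integral(1) by blast
  let ?V = "variation_to f"
  have piece: "norm (integral {u..v} g) \<le> 1 * (?V v - ?V u)" if uv: "0 \<le> u" "u \<le> v" "v \<le> h" for u v
  proof (cases "v = 0 \<or> u = v")
    case True
    then show ?thesis using uv by auto
  next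
    case v: False
    show ?thesis
    proof (cases "u = 0")
      case False
      have "integral {u..v} g = apply_bv f v - apply_bv f u"
        using f[of u] f[of v] Henstock_Kurzweil_Integration.integral_combine[of 0 u v g] g_int[of 0 v] uv False v
        by (simp add: algebra_simps)
      then show ?thesis using variation_to_step[of u v f] uv by simp
    next
      case True
      have "integral {u..v} g = apply_bv f v - value0 f"
        using f[of v] uv v True by simp
      moreover have "norm (apply_bv f v - value0 f) \<le> ?V v - ?V 0"
      proof (rule tendsto_upperbound[OF tendsto_norm[OF tendsto_diff[OF tendsto_const value0_tendsto]]])
        have "norm (apply_bv f v - apply_bv f s) \<le> ?V v - ?V 0" if s: "0 < s" "s < v" for s
          using variation_to_step[of s v f] variation_to_mono[of 0 s f] s by simp
        then show "\<forall>\<^sub>F s in at_right 0. norm (apply_bv f v - apply_bv f s) \<le> ?V v - ?V 0"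
          unfolding eventually_at_right_field using uv v by (intro exI[of _ v]) auto
      qed simp
      ultimately show ?thesis using True by simp
    qed
  qed
  have "g integrable_on cbox 0 h" using g_int[of 0 h] by simp
  then obtain \<gamma> where \<gamma>: "gauge \<gamma>"
    "\<And>p. p tagged_partial_division_of (cbox 0 h) \<Longrightarrow> \<gamma> fine p \<Longrightarrow>
       (\<Sum>(x, K)\<in>p. norm (measure lborel K *\<^sub>R g x - integral K g)) < e / 2"
    using e2 by (rule Henstock_lemma) blast
  have ng': "((\<lambda>s. norm (g s)) has_integral integral {0..h} (\<lambda>s. norm (g s))) (cbox 0 h)"
    using ng by (simp add: has_integral_integral)
  obtain \<gamma>' where \<gamma>': "gauge \<gamma>'"
    "\<forall>p. p tagged_division_of (cbox 0 h) \<and> \<gamma>' fine p \<longrightarrow>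
       norm ((\<Sum>(x, K)\<in>p. measure lborel K *\<^sub>R norm (g x)) - integral {0..h} (\<lambda>s. norm (g s))) < e / 2"
    using ng'[unfolded has_integral, THEN spec, THEN mp, OF e2] by (elim exE conjE)
  obtain p where p: "p tagged_division_of {0..h}" "(\<lambda>x. \<gamma> x \<inter> \<gamma>' x) fine p"
    using fine_division_exists_real[OF gauge_Int[OF \<gamma>(1) \<gamma>'(1)]] by blast
  have fine: "\<gamma> fine p" "\<gamma>' fine p" using p(2) by (auto simp: fine_Int)
  have p': "p tagged_division_of (cbox 0 h)" using p(1) by simp
  have "(\<Sum>(x, K)\<in>p. measure lborel K *\<^sub>R norm (g x))
      \<le> (\<Sum>(x, K)\<in>p. norm (measure lborel K *\<^sub>R g x - integral K g) + norm (integral K g))"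
  proof (rule sum_mono, clarify)
    fix x K assume "(x, K) \<in> p"
    have "measure lborel K *\<^sub>R norm (g x) = norm (measure lborel K *\<^sub>R g x)" by simp
    also have "\<dots> \<le> norm (measure lborel K *\<^sub>R g x - integral K g) + norm (integral K g)"
      using norm_triangle_ineq[of "measure lborel K *\<^sub>R g x - integral K g" "integral K g"] by simp
    finally show "measure lborel K *\<^sub>R norm (g x) \<le> norm (measure lborel K *\<^sub>R g x - integral K g) + norm (integral K g)" .
  qed
  also have "\<dots> = (\<Sum>(x, K)\<in>p. norm (measure lborel K *\<^sub>R g x - integral K g)) + (\<Sum>(x, K)\<in>p. norm (integral K g))"
    by (simp add: sum.distrib case_prod_beta)
  also have "\<dots> \<le> e / 2 + norm f"
  proof (rule add_mono)
    show "(\<Sum>(x, K)\<in>p. norm (measure lborel K *\<^sub>R g x - integral K g)) \<le> e / 2"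
      using \<gamma>(2)[OF p'[unfolded tagged_division_of_def, THEN conjunct1] fine(1)] by simp
    have "norm (\<Sum>(x, K)\<in>p. norm (integral K g)) \<le> 1 * (?V h - ?V 0)"
      by (rule tagged_sum_norm_le[OF p(1)]) (use h piece in auto)
    also have "\<dots> \<le> norm f" using variation_to_increment_le[where f=f] by simp
    finally show "(\<Sum>(x, K)\<in>p. norm (integral K g)) \<le> norm f" by simp
  qed
  finally have "(\<Sum>(x, K)\<in>p. measure lborel K *\<^sub>R norm (g x)) \<le> e / 2 + norm f" .
  moreover have "norm ((\<Sum>(x, K)\<in>p. measure lborel K *\<^sub>R norm (g x)) - integral {0..h} (\<lambda>s. norm (g s))) < e / 2"
    using \<gamma>'(2) p' fine(2) by simp
  ultimately show "integral {0..h} (\<lambda>s. norm (g s)) \<le> norm f + e"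
    unfolding real_norm_def abs_less_iff by linarith
qed

text \<open>The densities of a rapidly converging sequence in the domain form a convergent series in
  \<open>L\<^sup>1\<close>, by the preceding bound.\<close>

lemma sun_space_has_density:
  fixes f :: "(complex ^ 'n) bv"
  assumes h: "0 < h" and f: "f \<in> sun_space h"
  shows "\<exists>g. has_sun_density h f g"
proof -
  have "\<exists>F. F \<in> dom_A0_star h \<and> dist F f < (1 / 2) ^ n" for n
    using f[unfolded sun_space_def closure_approachable, rule_format, of "(1 / 2) ^ n"] by auto
  then obtain F where F: "\<And>n. F n \<in> dom_A0_star h" "\<And>n. dist (F n) f < (1 / 2) ^ n" by metis
  define g where "g n = apply_bv (star_deriv h (F n))" for n
  have g: "has_sun_density h (F n) (g n)" for n
    unfolding g_def by (rule has_sun_density_star_deriv[OF h F(1)])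
  define d where "d n s = g (Suc n) s - g n s" for n s
  have d: "has_sun_density h (F (Suc n) - F n) (d n)" for n
    unfolding d_def by (rule has_sun_density_diff[OF g g])
  have d_abs: "d n absolutely_integrable_on {0..h}" for n
    using d[of n] unfolding has_sun_density_def by simp
  have sum_d: "summable (\<lambda>n. integral {0..h} (\<lambda>s. norm (d n s)))"
  proof (rule summable_comparison_test')
    show "summable (\<lambda>n. 2 * (1 / 2 :: real) ^ n)" by (intro summable_mult summable_geometric) simp
    fix n :: nat
    have "0 \<le> integral {0..h} (\<lambda>s. norm (d n s))"
      using absolutely_integrable_norm[OF d_abs, unfolded o_def] set_lebesgue_integral_eq_integral(1)
      by (intro integral_nonneg) auto
    moreover have "integral {0..h} (\<lambda>s. norm (d n s)) \<le> norm (F (Suc n) - F n)"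
      by (rule sun_density_norm_le[OF h d])
    moreover have "norm (F (Suc n) - F n) \<le> dist (F (Suc n)) f + dist (F n) f"
      using dist_triangle2[of "F (Suc n)" "F n" f] by (simp add: dist_norm)
    moreover have "dist (F (Suc n)) f + dist (F n) f \<le> 2 * (1 / 2) ^ n"
    proof -
      have "0 \<le> (1 / 2 :: real) ^ n" by simp
      then show ?thesis using F(2)[of n] F(2)[of "Suc n"] unfolding power_Suc by linarith
    qed
    ultimately show "norm (integral {0..h} (\<lambda>s. norm (d n s))) \<le> 2 * (1 / 2) ^ n" by simp
  qed
  obtain G where G: "G absolutely_integrable_on {0..h}"
    "\<And>x. x \<in> {0..h} \<Longrightarrow> (\<lambda>n. integral {0..x} (d n)) sums integral {0..x} G"
    by (rule absolutely_integrable_series[where d=d, OF d_abs sum_d]) blast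
  have "(\<lambda>n. dist (F n) f) \<longlonglongrightarrow> 0"
  proof (rule real_tendsto_sandwich[where f="\<lambda>_. 0" and h="\<lambda>n. (1 / 2 :: real) ^ n"])
    show "\<forall>\<^sub>F n in sequentially. dist (F n) f \<le> (1 / 2) ^ n"
      by (rule always_eventually) (rule allI, rule less_imp_le[OF F(2)])
    show "(\<lambda>n. (1 / 2 :: real) ^ n) \<longlonglongrightarrow> 0" by (rule LIMSEQ_realpow_zero) simp_all
    show "\<forall>\<^sub>F n in sequentially. 0 \<le> dist (F n) f" by (rule always_eventually) simp
  qed (rule tendsto_const)
  then have lim: "F \<longlonglongrightarrow> f" by (simp only: tendsto_dist_iff[symmetric])
  have "apply_bv f \<theta> = value0 f + integral {0..\<theta>} (\<lambda>s. g 0 s + G s)" if \<theta>: "\<theta> \<in> {0<..h}" for \<theta>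
  proof -
    have eq: "apply_bv (F n) \<theta> = value0 (F n) + integral {0..\<theta>} (g n)" for n
      using g[of n] \<theta> unfolding has_sun_density_def by blast
    have "(\<Sum>i<n. integral {0..\<theta>} (d i)) = apply_bv (F n) \<theta> - value0 (F n) - integral {0..\<theta>} (g 0)" for n
    proof -
      have "integral {0..\<theta>} (d i) = integral {0..\<theta>} (g (Suc i)) - integral {0..\<theta>} (g i)" for i
        unfolding d_def using has_sun_density_integrable[OF g] \<theta>
        by (intro Henstock_Kurzweil_Integration.integral_diff) auto
      then show ?thesis
        using sum_lessThan_telescope[of "\<lambda>i. integral {0..\<theta>} (g i)" n] by (simp add: eq)
    qed
    moreover have "(\<lambda>n. apply_bv (F n) \<theta> - value0 (F n) - integral {0..\<theta>} (g 0))
        \<longlonglongrightarrow> apply_bv f \<theta> - value0 f - integral {0..\<theta>} (g 0)"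
      by (intro tendsto_diff tendsto_const bounded_linear.tendsto[OF bounded_linear_apply_bv lim]
          bounded_linear.tendsto[OF bounded_linear_value0 lim])
    moreover have "(\<lambda>n. \<Sum>i<n. integral {0..\<theta>} (d i)) \<longlonglongrightarrow> integral {0..\<theta>} G"
      using G(2)[of \<theta>] \<theta> unfolding sums_def by simp
    ultimately have "integral {0..\<theta>} G = apply_bv f \<theta> - value0 f - integral {0..\<theta>} (g 0)"
      using LIMSEQ_unique by simp
    moreover have "integral {0..\<theta>} (\<lambda>s. g 0 s + G s) = integral {0..\<theta>} (g 0) + integral {0..\<theta>} G"
      using has_sun_density_integrable[OF g] \<theta>
        integrable_on_subinterval[OF set_lebesgue_integral_eq_integral(1)[OF G(1)], of 0 \<theta>]
      by (intro Henstock_Kurzweil_Integration.integral_add) auto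
    ultimately show ?thesis by simp
  qed
  moreover have "(\<lambda>s. g 0 s + G s) absolutely_integrable_on {0..h}"
    using g[of 0] G(1) unfolding has_sun_density_def by (intro set_integral_add) auto
  ultimately show ?thesis unfolding has_sun_density_def by blast
qed

lemma closure_closed_linear:
  fixes S :: "'a::real_normed_vector set"
  shows "\<lbrakk>\<And>x y. x \<in> S \<Longrightarrow> y \<in> S \<Longrightarrow> x + y \<in> S; x \<in> closure S; y \<in> closure S\<rbrakk> \<Longrightarrow> x + y \<in> closure S"
    and "\<lbrakk>bounded_linear A; \<And>x. x \<in> S \<Longrightarrow> A x \<in> S; x \<in> closure S\<rbrakk> \<Longrightarrow> A x \<in> closure S"
proof -
  assume S: "\<And>x y. x \<in> S \<Longrightarrow> y \<in> S \<Longrightarrow> x + y \<in> S" and "x \<in> closure S" "y \<in> closure S"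
  then obtain a b where ab: "\<forall>n. a n \<in> S" "a \<longlonglongrightarrow> x" "\<forall>n. b n \<in> S" "b \<longlonglongrightarrow> y"
    unfolding closure_sequential by blast
  show "x + y \<in> closure S"
    unfolding closure_sequential
    by (intro exI[of _ "\<lambda>n. a n + b n"] conjI allI S tendsto_add ab(2,4)) (simp_all add: ab(1,3))
next
  assume A: "bounded_linear A" "\<And>x. x \<in> S \<Longrightarrow> A x \<in> S" and "x \<in> closure S"
  then obtain a where a: "\<forall>n. a n \<in> S" "a \<longlonglongrightarrow> x"
    unfolding closure_sequential by blast
  show "A x \<in> closure S"
    unfolding closure_sequential
    by (intro exI[of _ "\<lambda>n. A (a n)"] conjI allI A(2) bounded_linear.tendsto[OF A(1) a(2)]) (simp add: a(1))
qed

lemma scaleR_bv_eq_scaleC: "r *\<^sub>R f = scaleC_bv (complex_of_real r) f"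
  by (rule bv_eqI) (simp add: scaleR_bv.rep_eq scaleC_bv.rep_eq vec_eq_iff complex_eq_iff)

lemma sun_space_linear:
  fixes f f' :: "(complex ^ 'n) bv"
  assumes "0 < h" "f \<in> sun_space h"
  shows "f' \<in> sun_space h \<Longrightarrow> f + f' \<in> sun_space h" "scaleC_bv a f \<in> sun_space h" "r *\<^sub>R f \<in> sun_space h"
    "f' \<in> sun_space h \<Longrightarrow> f - f' \<in> sun_space h"
proof -
  have add: "f + f' \<in> sun_space h" if "f \<in> sun_space h" "f' \<in> sun_space h" for f f' :: "(complex ^ 'n) bv"
    using that dom_A0_star_linear(1)[OF assms(1)] unfolding sun_space_def by (intro closure_closed_linear(1))
  have scale: "scaleC_bv a f \<in> sun_space h" if "f \<in> sun_space h" for f :: "(complex ^ 'n) bv" and a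
    using closure_closed_linear(2)[OF bounded_linear_scaleC_bv[of a], of "dom_A0_star h" f]
      dom_A0_star_linear(3)[OF assms(1)] that unfolding sun_space_def by blast
  show "f' \<in> sun_space h \<Longrightarrow> f + f' \<in> sun_space h" "scaleC_bv a f \<in> sun_space h" "r *\<^sub>R f \<in> sun_space h"
    using add scale assms(2) by (auto simp: scaleR_bv_eq_scaleC)
  show "f - f' \<in> sun_space h" if "f' \<in> sun_space h"
    using add[OF assms(2) scale[OF that, of "complex_of_real (-1)"]]
    unfolding scaleR_bv_eq_scaleC[symmetric] by simp
qed

lemma dom_A0_star_subset_sun_space: "dom_A0_star h \<subseteq> sun_space h"
  unfolding sun_space_def by (rule closure_subset)

section \<open>The pairing of the sun-star space with the sun dual\<close>

lemma ess_bounded_rep: "ess_bounded (rep_linf \<psi>)"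
  using Quotient_rep_reflp[OF Quotient_linf] by blast

lemma rep_abs_linf: "ess_bounded f \<Longrightarrow> AE x in lborel. rep_linf (abs_linf f) x = f x"
  using Quotient_rep_abs[OF Quotient_linf, of f] by auto

lemma linf_eqI: "AE x in lborel. rep_linf \<psi> x = rep_linf \<phi> x \<Longrightarrow> \<psi> = \<phi>"
  using Quotient_rel_rep[OF Quotient_linf, of \<psi> \<phi>] ess_bounded_rep by blast

lemma abs_rep_linf: "abs_linf (rep_linf \<psi>) = \<psi>"
  by (rule Quotient_abs_rep[OF Quotient_linf])

lemma rep_linf_add: "AE x in lborel. rep_linf (\<psi> + \<phi>) x = rep_linf \<psi> x + rep_linf \<phi> x"
proof -
  have "\<psi> + \<phi> = abs_linf (\<lambda>x. rep_linf \<psi> x + rep_linf \<phi> x)"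
    using plus_linf.abs_eq[of "rep_linf \<psi>" "rep_linf \<phi>"] by (simp add: ess_bounded_rep abs_rep_linf)
  then show ?thesis
    using rep_abs_linf[OF ess_bounded_add(1)[OF ess_bounded_rep ess_bounded_rep]] by metis
qed

lemma rep_linf_scaleR: "AE x in lborel. rep_linf (r *\<^sub>R \<psi>) x = r *\<^sub>R rep_linf \<psi> x"
proof -
  have "r *\<^sub>R \<psi> = abs_linf (\<lambda>x. r *\<^sub>R rep_linf \<psi> x)"
    using scaleR_linf.abs_eq[of "rep_linf \<psi>" r] by (simp add: ess_bounded_rep abs_rep_linf)
  then show ?thesis
    using rep_abs_linf[OF ess_bounded_linear[OF ess_bounded_rep bounded_linear_scaleR_right]] by metis
qed

lemma rep_linf_scaleC: "AE x in lborel. rep_linf (scaleC_linf c \<psi>) x = c *s rep_linf \<psi> x"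
proof -
  have "scaleC_linf c \<psi> = abs_linf (\<lambda>x. c *s rep_linf \<psi> x)"
    using scaleC_linf.abs_eq[of "rep_linf \<psi>" c] by (simp add: ess_bounded_rep abs_rep_linf)
  then show ?thesis
    using rep_abs_linf[OF ess_bounded_linear[OF ess_bounded_rep bounded_linear_vector_scalar_mult]] by metis
qed

lemma rep_linf_zero: "AE x in lborel. rep_linf 0 x = 0"
  using rep_linf_scaleR[of 0 0] by simp

lemma norm_linf_eq: "norm \<psi> = ess_sup_norm (rep_linf \<psi>)"
  using norm_linf.abs_eq[of "rep_linf \<psi>"] by (simp add: ess_bounded_rep abs_rep_linf)

lemma linf_bounded_representative:
  fixes \<psi> :: "'a::euclidean_space linf"
  obtains u where "u \<in> borel_measurable borel" "\<And>x. norm (u x) \<le> norm \<psi>" "AE x in lborel. rep_linf \<psi> x = u x"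
proof (rule that[of "\<lambda>x. if norm (rep_linf \<psi> x) \<le> norm \<psi> then rep_linf \<psi> x else 0"])
  have "rep_linf \<psi> \<in> borel_measurable borel" using ess_bounded_rep unfolding ess_bounded_def by blast
  then show "(\<lambda>x. if norm (rep_linf \<psi> x) \<le> norm \<psi> then rep_linf \<psi> x else 0) \<in> borel_measurable borel"
    by measurable
  show "norm (if norm (rep_linf \<psi> x) \<le> norm \<psi> then rep_linf \<psi> x else 0) \<le> norm \<psi>" for x by simp
  show "AE x in lborel. rep_linf \<psi> x = (if norm (rep_linf \<psi> x) \<le> norm \<psi> then rep_linf \<psi> x else 0)"
    using AE_le_ess_sup_norm[OF ess_bounded_rep, of \<psi>] unfolding norm_linf_eq by eventually_elim simp
qed

definition density_pairing ::
  "real \<Rightarrow> (complex ^ 'n) linf \<Rightarrow> (real \<Rightarrow> complex ^ 'n) \<Rightarrow> complex" where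
  "density_pairing h \<psi> g = integral {0..h} (\<lambda>s. row_col (g s) (rep_linf \<psi> (- s)))"

lemma AE_reflected_negligible:
  fixes u :: "real \<Rightarrow> 'a"
  assumes "AE x in lborel. x \<in> {- h..0} \<longrightarrow> v x = u x"
  shows "negligible {s. \<not> (- s \<in> {- h..0} \<longrightarrow> v (- s) = u (- s))}"
  using AE_lborel_negligible[OF AE_lborel_uminus[OF assms]] .

lemma density_pairing_eq:
  assumes "AE x in lborel. x \<in> {- h..0} \<longrightarrow> rep_linf \<psi> x = u x"
  shows "density_pairing h \<psi> g = integral {0..h} (\<lambda>s. row_col (g s) (u (- s)))"
  unfolding density_pairing_def
  by (rule integral_spike[OF AE_reflected_negligible[OF assms]]) auto

lemma absolutely_integrable_density_pairing:
  fixes g :: "real \<Rightarrow> complex ^ 'n"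
  assumes K: "\<And>a b. norm (row_col (a::complex ^ 'n) b) \<le> norm a * norm b * K" "0 \<le> K"
    and g: "g absolutely_integrable_on {0..h}"
  shows "(\<lambda>s. row_col (g s) (rep_linf \<psi> (- s))) absolutely_integrable_on {0..h}"
    and "norm (integral {0..h} (\<lambda>s. row_col (g s) (rep_linf \<psi> (- s))))
      \<le> K * norm \<psi> * integral {0..h} (\<lambda>s. norm (g s))"
proof -
  obtain u where u: "u \<in> borel_measurable borel" "\<And>x. norm (u x) \<le> norm \<psi>" "AE x in lborel. rep_linf \<psi> x = u x"
    by (rule linf_bounded_representative[where \<psi>=\<psi>]) blast
  have u': "AE x in lborel. x \<in> {- h..0} \<longrightarrow> rep_linf \<psi> x = u x"
    using u(3) by eventually_elim simp
  have "(\<lambda>s. u (- s)) \<in> borel_measurable borel" using u(1) by measurable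
  then have "(\<lambda>s. u (- s)) \<in> borel_measurable (lebesgue_on {0..h})"
    by (simp add: measurable_restrict_space1 measurable_completion)
  then have int: "(\<lambda>s. row_col (g s) (u (- s))) absolutely_integrable_on {0..h}"
    using u(2) by (intro absolutely_integrable_row_col_bounded_right g) (auto intro!: boundedI)
  then show "(\<lambda>s. row_col (g s) (rep_linf \<psi> (- s))) absolutely_integrable_on {0..h}"
    by (rule absolutely_integrable_spike[OF _ AE_reflected_negligible[OF u']]) auto
  have "norm (integral {0..h} (\<lambda>s. row_col (g s) (u (- s))))
      \<le> integral {0..h} (\<lambda>s. (K * norm \<psi>) *\<^sub>R norm (g s))"
  proof (rule integral_norm_bound_integral)
    show "(\<lambda>s. row_col (g s) (u (- s))) integrable_on {0..h}"
      using int set_lebesgue_integral_eq_integral(1) by blast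
    show "(\<lambda>s. (K * norm \<psi>) *\<^sub>R norm (g s)) integrable_on {0..h}"
      using absolutely_integrable_norm[OF g, unfolded o_def] set_lebesgue_integral_eq_integral(1)
      by (intro integrable_cmul) blast
    fix s
    have "norm (row_col (g s) (u (- s))) \<le> norm (g s) * norm (u (- s)) * K" by (rule K(1))
    also have "\<dots> \<le> norm (g s) * norm \<psi> * K"
      using u(2) K(2) by (intro mult_right_mono mult_left_mono) auto
    finally show "norm (row_col (g s) (u (- s))) \<le> (K * norm \<psi>) *\<^sub>R norm (g s)"
      by (simp add: mult_ac)
  qed
  then show "norm (integral {0..h} (\<lambda>s. row_col (g s) (rep_linf \<psi> (- s))))
      \<le> K * norm \<psi> * integral {0..h} (\<lambda>s. norm (g s))"
    using density_pairing_eq[OF u', of g] by (simp add: density_pairing_def)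
qed

lemma density_pairing_bound:
  obtains K where "0 \<le> K" "\<And>\<psi> g. g absolutely_integrable_on {0..h} \<Longrightarrow>
    norm (density_pairing h \<psi> (g :: real \<Rightarrow> complex ^ 'n)) \<le> K * norm \<psi> * integral {0..h} (\<lambda>s. norm (g s))"
proof -
  obtain K where K: "K > 0" "\<And>a b. norm (row_col (a::complex ^ 'n) b) \<le> norm a * norm b * K"
    using row_col.pos_bounded by blast
  show thesis
    by (rule that[of K])
      (use K absolutely_integrable_density_pairing(2)[OF K(2)] in \<open>auto simp: density_pairing_def\<close>)
qed

lemma integrable_density_pairing:
  fixes g :: "real \<Rightarrow> complex ^ 'n"
  assumes "g absolutely_integrable_on {0..h}"
  shows "(\<lambda>s. row_col (g s) (rep_linf \<psi> (- s))) integrable_on {0..h}"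
proof -
  obtain K where K: "K > 0" "\<And>a b. norm (row_col (a::complex ^ 'n) b) \<le> norm a * norm b * K"
    using row_col.pos_bounded by blast
  show ?thesis
    using absolutely_integrable_density_pairing(1)[OF K(2) less_imp_le[OF K(1)] assms]
      set_lebesgue_integral_eq_integral(1) by blast
qed

lemma density_pairing_linear:
  fixes g g' :: "real \<Rightarrow> complex ^ 'n"
  assumes g: "g absolutely_integrable_on {0..h}" and g': "g' absolutely_integrable_on {0..h}"
  shows "density_pairing h \<psi> (\<lambda>s. g s + g' s) = density_pairing h \<psi> g + density_pairing h \<psi> g'"
    "density_pairing h \<psi> (\<lambda>s. r *\<^sub>R g s) = r *\<^sub>R density_pairing h \<psi> g"
    "density_pairing h (\<psi> + \<phi>) g = density_pairing h \<psi> g + density_pairing h \<phi> g"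
    "density_pairing h (r *\<^sub>R \<psi>) g = r *\<^sub>R density_pairing h \<psi> g"
proof -
  note int = integrable_density_pairing
  show "density_pairing h \<psi> (\<lambda>s. g s + g' s) = density_pairing h \<psi> g + density_pairing h \<psi> g'"
    unfolding density_pairing_def row_col.add_left
    by (intro Henstock_Kurzweil_Integration.integral_add int g g')
  show "density_pairing h \<psi> (\<lambda>s. r *\<^sub>R g s) = r *\<^sub>R density_pairing h \<psi> g"
    unfolding density_pairing_def row_col.scaleR_left by (rule integral_cmul)
  have "AE x in lborel. x \<in> {- h..0} \<longrightarrow> rep_linf (\<psi> + \<phi>) x = rep_linf \<psi> x + rep_linf \<phi> x"
    using rep_linf_add[of \<psi> \<phi>] by eventually_elim simp
  from density_pairing_eq[OF this, of g]
  show "density_pairing h (\<psi> + \<phi>) g = density_pairing h \<psi> g + density_pairing h \<phi> g"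
    unfolding density_pairing_def row_col.add_right
    by (simp add: Henstock_Kurzweil_Integration.integral_add int g)
  have "AE x in lborel. x \<in> {- h..0} \<longrightarrow> rep_linf (r *\<^sub>R \<psi>) x = r *\<^sub>R rep_linf \<psi> x"
    using rep_linf_scaleR[of r \<psi>] by eventually_elim simp
  from density_pairing_eq[OF this, of g]
  show "density_pairing h (r *\<^sub>R \<psi>) g = r *\<^sub>R density_pairing h \<psi> g"
    unfolding density_pairing_def row_col.scaleR_right by simp
qed

text \<open>Two densities of the same element differ by a density of \<open>0\<close>, whose \<open>L\<^sup>1\<close> norm is \<open>0\<close>.\<close>

lemma sun_pairing_eq:
  fixes f :: "(complex ^ 'n) bv"
  assumes h: "0 < h" and g: "has_sun_density h f g"
  shows "sun_pairing h v f = row_col (value0 f) (fst v) + density_pairing h (snd v) g"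
proof -
  let ?g = "sun_density h f"
  have g': "has_sun_density h f ?g"
    unfolding sun_density_eq_SOME by (rule someI[of "has_sun_density h f" g, OF g])
  note abs = g[unfolded has_sun_density_def, THEN conjunct1] g'[unfolded has_sun_density_def, THEN conjunct1]
  obtain K where K: "0 \<le> K" "\<And>\<psi> g. g absolutely_integrable_on {0..h} \<Longrightarrow>
      norm (density_pairing h \<psi> (g :: real \<Rightarrow> complex ^ 'n)) \<le> K * norm \<psi> * integral {0..h} (\<lambda>s. norm (g s))"
    by (rule density_pairing_bound[where h=h]) blast
  have diff: "has_sun_density h (f - f) (\<lambda>s. ?g s - g s)" by (rule has_sun_density_diff[OF g' g])
  then have "integral {0..h} (\<lambda>s. norm (?g s - g s)) \<le> 0"
    using sun_density_norm_le[OF h diff] by simp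
  then have "K * norm (snd v) * integral {0..h} (\<lambda>s. norm (?g s - g s)) \<le> 0"
    using K(1) by (intro mult_nonneg_nonpos) auto
  with K(2)[OF diff[unfolded has_sun_density_def, THEN conjunct1], of "snd v"]
  have "norm (density_pairing h (snd v) (\<lambda>s. ?g s - g s)) \<le> 0"
    by (rule order_trans)
  then have "density_pairing h (snd v) (\<lambda>s. ?g s + (-1) *\<^sub>R g s) = 0" by simp
  moreover have neg: "(\<lambda>s. (-1) *\<^sub>R g s) absolutely_integrable_on {0..h}"
    using has_sun_density_scaleR[OF g, where r="-1"] unfolding has_sun_density_def by blast
  ultimately have "density_pairing h (snd v) ?g + (-1) *\<^sub>R density_pairing h (snd v) g = 0"
    using density_pairing_linear(1)[OF abs(2) neg] density_pairing_linear(2)[OF abs(1) abs(1)] by metis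
  then have "density_pairing h (snd v) ?g = density_pairing h (snd v) g" by simp
  then show ?thesis
    unfolding sun_pairing_def density_pairing_def by simp
qed

lemma sun_pairing_linear:
  fixes f f' :: "(complex ^ 'n) bv"
  assumes h: "0 < h" and f: "f \<in> sun_space h"
  shows "f' \<in> sun_space h \<Longrightarrow> sun_pairing h v (f + f') = sun_pairing h v f + sun_pairing h v f'"
    "sun_pairing h v (r *\<^sub>R f) = r *\<^sub>R sun_pairing h v f"
    "sun_pairing h (v + w) f = sun_pairing h v f + sun_pairing h w f"
    "sun_pairing h (r *\<^sub>R v) f = r *\<^sub>R sun_pairing h v f"
    "f' \<in> sun_space h \<Longrightarrow> sun_pairing h v (f - f') = sun_pairing h v f - sun_pairing h v f'"
    "sun_pairing h (v - w) f = sun_pairing h v f - sun_pairing h w f"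
proof -
  obtain g where g: "has_sun_density h f g" using sun_space_has_density[OF h f] by blast
  note abs = g[unfolded has_sun_density_def, THEN conjunct1]
  note eq = sun_pairing_eq[OF h g]
  have add: "sun_pairing h v (f + f') = sun_pairing h v f + sun_pairing h v f'" if f': "f' \<in> sun_space h" for f'
  proof -
    obtain g' where g': "has_sun_density h f' g'" using sun_space_has_density[OF h f'] by blast
    have "g' absolutely_integrable_on {0..h}" using g' unfolding has_sun_density_def by blast
    then show ?thesis
      unfolding eq sun_pairing_eq[OF h g'] sun_pairing_eq[OF h has_sun_density_add[OF g g']]
      by (simp add: value0_add row_col.add_left density_pairing_linear abs)
  qed
  have scale: "sun_pairing h v (r *\<^sub>R f) = r *\<^sub>R sun_pairing h v f"
    if f: "f \<in> sun_space h" for r and f :: "(complex ^ 'n) bv"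
  proof -
    obtain g where g: "has_sun_density h f g" using sun_space_has_density[OF h f] by blast
    note abs = g[unfolded has_sun_density_def, THEN conjunct1]
    show ?thesis
      unfolding sun_pairing_eq[OF h g] sun_pairing_eq[OF h has_sun_density_scaleR[OF g]]
      by (simp add: linear_cmul[OF bounded_linear.linear[OF bounded_linear_value0]] row_col.scaleR_left
          density_pairing_linear(2)[OF abs abs] scaleR_add_right)
  qed
  show "f' \<in> sun_space h \<Longrightarrow> sun_pairing h v (f + f') = sun_pairing h v f + sun_pairing h v f'"
    "sun_pairing h v (r *\<^sub>R f) = r *\<^sub>R sun_pairing h v f"
    by (rule add scale f, simp?)+
  have add_left: "sun_pairing h (v + w) f = sun_pairing h v f + sun_pairing h w f" for v w
    unfolding eq by (simp add: row_col.add_right density_pairing_linear(3)[OF abs abs])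
  have scale_left: "sun_pairing h (r *\<^sub>R v) f = r *\<^sub>R sun_pairing h v f" for r v
    unfolding eq by (simp add: row_col.scaleR_right density_pairing_linear(4)[OF abs abs] scaleR_add_right)
  show "sun_pairing h (v + w) f = sun_pairing h v f + sun_pairing h w f"
    "sun_pairing h (r *\<^sub>R v) f = r *\<^sub>R sun_pairing h v f" by (rule add_left scale_left)+
  show "sun_pairing h (v - w) f = sun_pairing h v f - sun_pairing h w f"
    using add_left[of v "(-1) *\<^sub>R w"] scale_left[of "-1" w] by simp
  show "sun_pairing h v (f - f') = sun_pairing h v f - sun_pairing h v f'" if "f' \<in> sun_space h"
    using add[OF sun_space_linear(3)[OF h that, of "-1"]] scale[OF that, of "-1"] by simp
qed

text \<open>The value at \<open>0+\<close> and the \<open>L\<^sup>1\<close> norm of the density are bounded by the norm of \<open>f\<close>.\<close>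

lemma sun_pairing_bound:
  assumes h: "0 < h"
  obtains K where "0 \<le> K" "\<And>v f. f \<in> sun_space h \<Longrightarrow>
    norm (sun_pairing h v (f :: (complex ^ 'n) bv)) \<le> K * norm v * norm f"
proof -
  obtain K where K: "K > 0" "\<And>a b. norm (row_col (a::complex ^ 'n) b) \<le> norm a * norm b * K"
    using row_col.pos_bounded by blast
  obtain K' where K': "0 \<le> K'" "\<And>\<psi> g. g absolutely_integrable_on {0..h} \<Longrightarrow>
      norm (density_pairing h \<psi> (g :: real \<Rightarrow> complex ^ 'n)) \<le> K' * norm \<psi> * integral {0..h} (\<lambda>s. norm (g s))"
    by (rule density_pairing_bound[where h=h]) blast
  have "norm (sun_pairing h v f) \<le> (K + K') * norm v * norm f" if f: "f \<in> sun_space h"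
    for v and f :: "(complex ^ 'n) bv"
  proof -
    obtain g where g: "has_sun_density h f g" using sun_space_has_density[OF h f] by blast
    have fst: "norm (fst v) \<le> norm v" and snd: "norm (snd v) \<le> norm v"
      by (metis norm_fst_le prod.collapse) (metis norm_snd_le prod.collapse)
    have v0: "norm (value0 f) \<le> norm f"
      by (rule tendsto_upperbound[OF tendsto_norm[OF value0_tendsto]]) (simp_all add: norm_apply_bv_le)
    have "norm (row_col (value0 f) (fst v)) \<le> norm (value0 f) * norm (fst v) * K" by (rule K(2))
    also have "\<dots> \<le> norm f * norm v * K"
      using v0 fst K(1) by (intro mult_mono) auto
    finally have 1: "norm (row_col (value0 f) (fst v)) \<le> norm f * norm v * K" .
    have "norm (density_pairing h (snd v) g) \<le> K' * norm (snd v) * integral {0..h} (\<lambda>s. norm (g s))"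
      using g unfolding has_sun_density_def by (intro K'(2)) auto
    also have "\<dots> \<le> K' * norm (snd v) * norm f"
      using sun_density_norm_le[OF h g] K'(1) by (intro mult_left_mono) auto
    also have "\<dots> \<le> K' * norm v * norm f"
      using snd K'(1) by (intro mult_left_mono mult_right_mono) auto
    finally have 2: "norm (density_pairing h (snd v) g) \<le> K' * norm v * norm f" .
    show ?thesis
      unfolding sun_pairing_eq[OF h g]
      using norm_triangle_ineq[of "row_col (value0 f) (fst v)" "density_pairing h (snd v) g"] 1 2
      by (simp add: algebra_simps)
  qed
  then show thesis using K(1) K'(1) by (intro that[of "K + K'"]) auto
qed

lemma tendsto_sun_pairing:
  assumes h: "0 < h" and v: "(v \<longlongrightarrow> v0) F" and f: "(f \<longlongrightarrow> f0) F"
    and S: "\<And>s. f s \<in> sun_space h" "f0 \<in> sun_space h"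
  shows "((\<lambda>s. sun_pairing h (v s) (f s)) \<longlongrightarrow> sun_pairing h v0 (f0 :: (complex ^ 'n) bv)) F"
proof -
  obtain K where K: "0 \<le> K" "\<And>v f. f \<in> sun_space h \<Longrightarrow>
      norm (sun_pairing h v (f :: (complex ^ 'n) bv)) \<le> K * norm v * norm f"
    by (rule sun_pairing_bound[OF h]) blast
  have bound: "\<forall>\<^sub>F s in F. norm (sun_pairing h (v s) (f s) - sun_pairing h v0 f0)
      \<le> K * norm (v s - v0) * norm (f s) + K * norm v0 * norm (f s - f0)"
  proof (intro always_eventually allI)
    fix s
    have "sun_pairing h (v s) (f s) - sun_pairing h v0 f0
        = sun_pairing h (v s - v0) (f s) + sun_pairing h v0 (f s - f0)"
      by (simp add: sun_pairing_linear[OF h S(1)] S)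
    also have "norm \<dots> \<le> K * norm (v s - v0) * norm (f s) + K * norm v0 * norm (f s - f0)"
      using S by (intro order_trans[OF norm_triangle_ineq] add_mono K(2) sun_space_linear(4)[OF h])
    finally show "norm (sun_pairing h (v s) (f s) - sun_pairing h v0 f0)
      \<le> K * norm (v s - v0) * norm (f s) + K * norm v0 * norm (f s - f0)" .
  qed
  have "((\<lambda>s. K * norm (v s - v0) * norm (f s) + K * norm v0 * norm (f s - f0)) \<longlongrightarrow>
      K * norm (v0 - v0) * norm f0 + K * norm v0 * norm (f0 - f0)) F"
    by (intro tendsto_intros v f)
  then have "((\<lambda>s. K * norm (v s - v0) * norm (f s) + K * norm v0 * norm (f s - f0)) \<longlongrightarrow> 0) F" by simp
  then show ?thesis by (rule LIM_zero_cancel[OF Lim_null_comparison[OF bound]])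
qed

lemma continuous_on_sun_pairing:
  assumes "0 < h" "continuous_on S v" "continuous_on S f" "\<And>s. f s \<in> sun_space h"
  shows "continuous_on S (\<lambda>s. sun_pairing h (v s) (f s))"
  using assms(2,3) unfolding continuous_on_def by (intro ballI tendsto_sun_pairing assms(1,4)) auto

lemma has_vector_derivative_sun_pairing:
  assumes h: "0 < h" and v: "(v has_vector_derivative v') (at t)" and f: "(f has_vector_derivative f') (at t)"
    and S: "\<And>s. f s \<in> sun_space h" "f' \<in> sun_space h"
  shows "((\<lambda>s. sun_pairing h (v s) (f s)) has_vector_derivative
           sun_pairing h v' (f t) + sun_pairing h (v t) (f' :: (complex ^ 'n) bv)) (at t)"
  unfolding has_vector_derivative_iff_difference_quotient
proof -
  have quot: "(f s - f t) /\<^sub>R (s - t) \<in> sun_space h" for s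
    by (intro sun_space_linear(3,4)[OF h] S)
  have "(sun_pairing h (v s) (f s) - sun_pairing h (v t) (f t)) /\<^sub>R (s - t)
      = sun_pairing h ((v s - v t) /\<^sub>R (s - t)) (f s) + sun_pairing h (v t) ((f s - f t) /\<^sub>R (s - t))" for s
    by (simp add: sun_pairing_linear[OF h S(1)] sun_pairing_linear(2)[OF h sun_space_linear(4)[OF h S(1) S(1)]] S
        flip: scaleR_add_right)
  moreover have "((\<lambda>s. sun_pairing h ((v s - v t) /\<^sub>R (s - t)) (f s)
      + sun_pairing h (v t) ((f s - f t) /\<^sub>R (s - t))) \<longlongrightarrow> sun_pairing h v' (f t) + sun_pairing h (v t) f') (at t)"
    using v f has_vector_derivative_continuous[OF f] unfolding has_vector_derivative_iff_difference_quotient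
    by (intro tendsto_add tendsto_sun_pairing h S quot tendsto_const) (auto simp: continuous_within)
  ultimately show "((\<lambda>s. (sun_pairing h (v s) (f s) - sun_pairing h (v t) (f t)) /\<^sub>R (s - t)) \<longlongrightarrow>
      sun_pairing h v' (f t) + sun_pairing h (v t) f') (at t)" by simp
qed

text \<open>The difference quotients belong to the space, which is closed.\<close>

lemma sun_space_derivative:
  assumes h: "0 < h" and f: "(f has_vector_derivative f') (at t)" and S: "\<And>s. f s \<in> sun_space h"
  shows "(f' :: (complex ^ 'n) bv) \<in> sun_space h"
proof (rule Lim_in_closed_set)
  show "closed (sun_space h :: (complex ^ 'n) bv set)" unfolding sun_space_def by simp
  show "((\<lambda>s. (f s - f t) /\<^sub>R (s - t)) \<longlongrightarrow> f') (at t)"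
    using f by (simp add: has_vector_derivative_iff_difference_quotient)
  show "\<forall>\<^sub>F s in at t. (f s - f t) /\<^sub>R (s - t) \<in> sun_space h"
    by (intro always_eventually allI sun_space_linear(3,4)[OF h] S)
qed simp

section \<open>The sun-star operator at a fixed time\<close>

lemma lipschitz_rep_continuous: "lipschitz_rep h v u \<Longrightarrow> continuous_on {- h..0} u"
  unfolding lipschitz_rep_def using lipschitz_on_continuous_on by blast

text \<open>Continuous functions that agree almost everywhere on an interval agree on it.\<close>

lemma lipschitz_rep_unique:
  assumes h: "0 < h" and u: "lipschitz_rep h v u" "lipschitz_rep h v u'" and \<theta>: "\<theta> \<in> {- h..0}"
  shows "u \<theta> = u' \<theta>"
proof -
  let ?w = "\<lambda>x. norm (u x - u' x)"
  have cont: "continuous_on {- h..0} ?w"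
    by (intro continuous_on_norm continuous_on_diff lipschitz_rep_continuous[OF u(1)] lipschitz_rep_continuous[OF u(2)])
  have "AE x in lborel. x \<in> {- h..0} \<longrightarrow> rep_linf (snd v) x = u x" "AE x in lborel. x \<in> {- h..0} \<longrightarrow> rep_linf (snd v) x = u' x"
    using u unfolding lipschitz_rep_def represents_def by auto
  then have "AE x in lborel. x \<in> {- h..0} \<longrightarrow> ?w x = 0"
    by eventually_elim simp
  from AE_lborel_negligible[OF this]
  have "integral {- h..0} ?w = integral {- h..0} (\<lambda>_. 0)"
    by (rule integral_spike) auto
  then have "integral {- h..0} ?w = 0" by simp
  then have "\<forall>x\<in>{- h..0}. ?w x = 0"
    using integral_eq_0_iff[OF cont] h by simp
  then show ?thesis using \<theta> by simp
qed

lemma complexify_cong: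
  assumes "0 \<le> h" "\<And>\<theta>. \<theta> \<in> {- h..0} \<Longrightarrow> u \<theta> = w \<theta>"
  shows "complexify h L u = complexify h L w"
proof -
  have "hist h (\<lambda>\<theta>. \<chi> j. Re (u \<theta> $ j)) 0 = hist h (\<lambda>\<theta>. \<chi> j. Re (w \<theta> $ j)) 0"
    "hist h (\<lambda>\<theta>. \<chi> j. Im (u \<theta> $ j)) 0 = hist h (\<lambda>\<theta>. \<chi> j. Im (w \<theta> $ j)) 0"
    by (rule hist_0_cong[OF assms(1)], simp add: assms(2))+
  then show ?thesis unfolding complexify_def by simp
qed

text \<open>The Lipschitz representatives agree on the interval. The almost everywhere derivative determines
  \<open>\<psi>\<close> inside the interval, and outside of it \<open>\<psi>\<close> vanishes because \<open>(0, \<psi>)\<close> is in the sun-star space.\<close>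

lemma op_A_sunstar_eqI:
  assumes h: "0 < h" and u: "lipschitz_rep h v u" and \<psi>: "(0, \<psi>) \<in> sunstar_space h"
    and deriv: "AE \<theta> in lborel. \<theta> \<in> {- h<..<0} \<longrightarrow> (u has_vector_derivative rep_linf \<psi> \<theta>) (at \<theta>)"
  shows "op_A_sunstar h L v = (complexify h L u, \<psi>)"
proof -
  define u0 where "u0 = (SOME u. lipschitz_rep h v u)"
  have u0: "lipschitz_rep h v u0" unfolding u0_def by (rule someI[of "lipschitz_rep h v" u, OF u])
  have eq: "u \<theta> = u0 \<theta>" if "\<theta> \<in> {- h..0}" for \<theta>
    by (rule lipschitz_rep_unique[OF h u u0 that])
  have L: "complexify h L u0 = complexify h L u"
    by (rule complexify_cong) (use h eq in auto)
  have "(THE \<phi>. (0, \<phi>) \<in> sunstar_space h \<and>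
        (AE \<theta> in lborel. \<theta> \<in> {- h<..<0} \<longrightarrow> (u0 has_vector_derivative rep_linf \<phi> \<theta>) (at \<theta>))) = \<psi>"
  proof (rule the_equality, intro conjI \<psi>)
    show d0: "AE \<theta> in lborel. \<theta> \<in> {- h<..<0} \<longrightarrow> (u0 has_vector_derivative rep_linf \<psi> \<theta>) (at \<theta>)"
      using deriv
    proof eventually_elim
      case (elim \<theta>)
      show ?case
      proof
        assume \<theta>: "\<theta> \<in> {- h<..<0}"
        then have "(u has_vector_derivative rep_linf \<psi> \<theta>) (at \<theta>)" using elim by blast
        then show "(u0 has_vector_derivative rep_linf \<psi> \<theta>) (at \<theta>)"
          by (rule has_vector_derivative_transform_within_open[OF _ open_greaterThanLessThan \<theta>]) (auto intro: eq)
      qed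
    qed
    fix \<phi> assume \<phi>: "(0, \<phi>) \<in> sunstar_space h \<and>
        (AE \<theta> in lborel. \<theta> \<in> {- h<..<0} \<longrightarrow> (u0 has_vector_derivative rep_linf \<phi> \<theta>) (at \<theta>))"
    then have z: "AE \<theta> in lborel. \<theta> \<notin> {- h..0} \<longrightarrow> rep_linf \<phi> \<theta> = 0"
      and d: "AE \<theta> in lborel. \<theta> \<in> {- h<..<0} \<longrightarrow> (u0 has_vector_derivative rep_linf \<phi> \<theta>) (at \<theta>)"
      unfolding sunstar_space_def by auto
    have z0: "AE \<theta> in lborel. \<theta> \<notin> {- h..0} \<longrightarrow> rep_linf \<psi> \<theta> = 0"
      using \<psi> unfolding sunstar_space_def by auto
    have ne: "AE \<theta> in lborel. \<theta> \<noteq> - h" "AE \<theta> in lborel. \<theta> \<noteq> (0::real)"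
      by (rule AE_lborel_singleton)+
    show "\<phi> = \<psi>"
    proof (rule linf_eqI)
      show "AE \<theta> in lborel. rep_linf \<phi> \<theta> = rep_linf \<psi> \<theta>"
        using z z0 d d0 ne
      proof eventually_elim
        case (elim \<theta>)
        show ?case
        proof (cases "\<theta> \<in> {- h<..<0}")
          case True
          then show ?thesis using elim(3,4) vector_derivative_unique_at by blast
        next
          case False
          then have "\<theta> \<notin> {- h..0}" using elim(5,6) by auto
          then show ?thesis using elim(1,2) by simp
        qed
      qed
    qed
  qed
  then show ?thesis
    unfolding op_A_sunstar_def Let_def u0_def[symmetric] by (simp add: L)
qed

text \<open>The extension of \<open>u\<close> by its values at the end points is Lipschitz on the real line.\<close>

lemma sunstar_derivative:
  assumes h: "0 < h" and u: "lipschitz_rep h v u"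
  obtains \<psi> d C where "(0, \<psi>) \<in> sunstar_space h"
    "AE \<theta> in lborel. \<theta> \<in> {- h<..<0} \<longrightarrow> (u has_vector_derivative rep_linf \<psi> \<theta>) (at \<theta>)"
    "d \<in> borel_measurable borel" "\<And>x. norm (d x) \<le> C"
    "AE x in lborel. x \<in> {- h..0} \<longrightarrow> rep_linf \<psi> x = d x"
    "\<And>\<theta>. \<theta> \<in> {0..h} \<Longrightarrow> u (- \<theta>) = u 0 - integral {0..\<theta>} (\<lambda>s. d (- s))"
proof -
  obtain C where C: "C-lipschitz_on {- h..0} u" using u unfolding lipschitz_rep_def by blast
  define U where "U \<theta> = u (max (- h) (min 0 \<theta>))" for \<theta>
  have U_eq: "U \<theta> = u \<theta>" if "\<theta> \<in> {- h..0}" for \<theta> using that by (simp add: U_def)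
  have "C-lipschitz_on UNIV U"
  proof (rule lipschitz_onI)
    show C0: "0 \<le> C" using C by (rule lipschitz_on_nonneg)
    fix x y :: real
    have "dist (U x) (U y) \<le> C * dist (max (- h) (min 0 x)) (max (- h) (min 0 y))"
      unfolding U_def using h by (intro lipschitz_onD[OF C]) auto
    also have "\<dots> \<le> C * dist x y"
      using C0 by (intro mult_left_mono) (auto simp: dist_real_def)
    finally show "dist (U x) (U y) \<le> C * dist x y" .
  qed
  then obtain d where d: "d \<in> borel_measurable borel" "\<And>x. norm (d x) \<le> C"
    "\<And>a b. a \<le> b \<Longrightarrow> (d has_integral U b - U a) {a..b}"
    "AE x in lborel. (U has_vector_derivative d x) (at x)"
    by (rule lipschitz_has_derivative) blast
  let ?d = "\<lambda>\<theta>. if \<theta> \<in> {- h..0} then d \<theta> else 0"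
  have ess: "ess_bounded ?d"
    unfolding ess_bounded_def
  proof (intro conjI exI[of _ C])
    show "?d \<in> borel_measurable borel" using d(1) by measurable
    have "norm (?d \<theta>) \<le> C" for \<theta> using d(2)[of \<theta>] order_trans[OF norm_ge_zero d(2)] by simp
    then show "AE \<theta> in lborel. norm (?d \<theta>) \<le> C" by (intro AE_I2)
  qed
  note rep = rep_abs_linf[OF ess]
  show thesis
  proof (rule that[of "abs_linf ?d" d C, OF _ _ d(1,2)])
    show "(0, abs_linf ?d) \<in> sunstar_space h"
      unfolding sunstar_space_def using rep by (simp, eventually_elim) simp
    show "AE x in lborel. x \<in> {- h..0} \<longrightarrow> rep_linf (abs_linf ?d) x = d x"
      using rep by eventually_elim simp
    show "AE \<theta> in lborel. \<theta> \<in> {- h<..<0} \<longrightarrow> (u has_vector_derivative rep_linf (abs_linf ?d) \<theta>) (at \<theta>)"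
      using rep d(4)
    proof eventually_elim
      case (elim \<theta>)
      show ?case
      proof
        assume \<theta>: "\<theta> \<in> {- h<..<0}"
        have "(u has_vector_derivative d \<theta>) (at \<theta>)"
          by (rule has_vector_derivative_transform_within_open[OF elim(2) open_greaterThanLessThan \<theta>]) (auto intro: U_eq)
        then show "(u has_vector_derivative rep_linf (abs_linf ?d) \<theta>) (at \<theta>)"
          using elim(1) \<theta> by simp
      qed
    qed
    fix \<theta> assume \<theta>: "\<theta> \<in> {0..h}"
    then have "(d has_integral u 0 - u (- \<theta>)) {- \<theta>..0}"
      using d(3)[of "- \<theta>" 0] by (simp add: U_eq)
    then have "((\<lambda>s. d (- s)) has_integral u 0 - u (- \<theta>)) {0..\<theta>}"
      using has_integral_reflect_real[where f=d and a="- \<theta>" and b=0] \<theta> by simp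
    then show "u (- \<theta>) = u 0 - integral {0..\<theta>} (\<lambda>s. d (- s))" by (simp add: integral_unique)
  qed
qed

text \<open>As in the first duality, for a function \<open>u\<close> that is only Lipschitz: both sides are computed from the
  Stieltjes integral of \<open>u\<close> with respect to \<open>op_A_star h Z f\<close>, on the right as an element with a density
  and on the left as the sum of the derivative of \<open>f\<close> and the kernel part.\<close>

lemma sun_pairing_op_A_sunstar:
  fixes L :: "(real \<Rightarrow>\<^sub>C (real ^ 'n)) \<Rightarrow> real ^ 'n"
  assumes Z: "NBV h Z" and h: "0 < h"
    and L: "\<And>\<phi>. has_RS_integral (*v) Z (\<lambda>\<theta>. apply_bcontfun \<phi> (- \<theta>)) {0..h} (L \<phi>)"
    and f: "f \<in> dom_A_sun h Z" and v: "v \<in> dom_A_sunstar h"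
  shows "sun_pairing h (op_A_sunstar h L v) f = sun_pairing h v (op_A_sun h Z f)"
proof -
  have h0: "0 \<le> h" using h by simp
  have f0: "f \<in> dom_A0_star h" and w: "op_A_star h Z f \<in> sun_space h"
    using f unfolding dom_A_sun_def by auto
  let ?g = "star_deriv h f" and ?c = "value0 f" and ?w = "op_A_star h Z f"
  obtain u where u: "lipschitz_rep h v u" using v unfolding dom_A_sunstar_def by blast
  note uc = lipschitz_rep_continuous[OF u]
  obtain \<psi> d C where \<psi>: "(0, \<psi>) \<in> sunstar_space h"
    "AE \<theta> in lborel. \<theta> \<in> {- h<..<0} \<longrightarrow> (u has_vector_derivative rep_linf \<psi> \<theta>) (at \<theta>)"
    and d: "d \<in> borel_measurable borel" "\<And>x. norm (d x) \<le> C"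
    "AE x in lborel. x \<in> {- h..0} \<longrightarrow> rep_linf \<psi> x = d x"
    "\<And>\<theta>. \<theta> \<in> {0..h} \<Longrightarrow> u (- \<theta>) = u 0 - integral {0..\<theta>} (\<lambda>s. d (- s))"
    by (rule sunstar_derivative[OF h u]) blast
  have left: "sun_pairing h (op_A_sunstar h L v) f
      = row_col ?c (complexify h L u) + integral {0..h} (\<lambda>s. row_col (apply_bv ?g s) (d (- s)))"
    unfolding op_A_sunstar_eqI[OF h u \<psi>] sun_pairing_eq[OF h has_sun_density_star_deriv[OF h f0]]
    by (simp add: density_pairing_eq[OF d(3)])
  obtain g' where g': "has_sun_density h ?w g'" using sun_space_has_density[OF h w] by blast
  have "AE x in lborel. x \<in> {- h..0} \<longrightarrow> rep_linf (snd v) x = u x" and u0: "u 0 = fst v"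
    using u unfolding lipschitz_rep_def represents_def by auto
  then have right: "sun_pairing h v ?w = row_col (value0 ?w) (u 0) + integral {0..h} (\<lambda>s. row_col (g' s) (u (- s)))"
    unfolding sun_pairing_eq[OF h g'] by (simp add: density_pairing_eq)
  have "has_RS_integral row_col (apply_bv ?w) (\<lambda>\<theta>. u (- \<theta>)) {0..h}
      (row_col (value0 ?w) (u (- 0)) + integral {0..h} (\<lambda>s. row_col (g' s) (u (- s))))"
    using g' unfolding has_sun_density_def
    by (intro has_RS_integral_jump_density h continuous_on_reflect[OF uc]) auto
  then have 1: "has_RS_integral row_col (apply_bv ?w) (\<lambda>\<theta>. u (- \<theta>)) {0..h} (sun_pairing h v ?w)"
    by (simp add: right)
  have "(\<lambda>s. d (- s)) \<in> borel_measurable borel" using d(1) by measurable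
  then have d_abs: "(\<lambda>s. d (- s)) absolutely_integrable_on {0..h}"
    by (intro measurable_bounded_by_integrable_imp_absolutely_integrable[where g="\<lambda>_. C"])
      (auto simp: measurable_restrict_space1 measurable_completion d(2))
  have "apply_bv ?g h = 0" using is_star_deriv_star_deriv[OF h f0] unfolding is_star_deriv_def by blast
  then have 2: "has_RS_integral row_col (apply_bv ?g) (\<lambda>\<theta>. u (- \<theta>)) {0..h}
      (integral {0..h} (\<lambda>s. row_col (apply_bv ?g s) (d (- s))))"
    by (rule has_RS_integral_star_deriv[OF h0 _ d_abs d(2) d(4)])
  note 3 = has_RS_integral_row_kernel[OF Z h0 L uc, of ?c]
  have "has_RS_integral row_col (apply_bv ?w) (\<lambda>\<theta>. u (- \<theta>)) {0..h}
      (integral {0..h} (\<lambda>s. row_col (apply_bv ?g s) (d (- s))) + row_col ?c (complexify h L u))"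
    by (rule has_RS_integral_add[OF 2 3])
      (simp add: op_A_star_def plus_bv.rep_eq row_col.add_left row_col.diff_left)
  from has_RS_integral_unique[OF this 1] show ?thesis
    unfolding op_A_sun_def left by (simp add: add.commute)
qed

section \<open>Linearity of the sun-star operator\<close>

lemma hist_linear:
  fixes u w :: "real \<Rightarrow> 'a::real_normed_vector"
  assumes "0 \<le> h" "continuous_on {- h..0} u" "continuous_on {- h..0} w"
  shows "hist h (\<lambda>\<theta>. r *\<^sub>R u \<theta> + s *\<^sub>R w \<theta>) 0 = r *\<^sub>R hist h u 0 + s *\<^sub>R hist h w 0"
proof (rule bcontfun_eqI)
  fix \<theta>
  have "continuous_on {0 - h..0} (\<lambda>\<theta>. r *\<^sub>R u \<theta> + s *\<^sub>R w \<theta>)"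
    "continuous_on {0 - h..0} u" "continuous_on {0 - h..0} w"
    using assms by (auto intro!: continuous_on_add continuous_on_scaleR continuous_on_const)
  then show "apply_bcontfun (hist h (\<lambda>\<theta>. r *\<^sub>R u \<theta> + s *\<^sub>R w \<theta>) 0) \<theta>
      = apply_bcontfun (r *\<^sub>R hist h u 0 + s *\<^sub>R hist h w 0) \<theta>"
    by (simp only: apply_hist[OF assms(1)] plus_bcontfun.rep_eq scaleR_bcontfun.rep_eq)
qed

lemma complexify_linear:
  fixes L :: "(real \<Rightarrow>\<^sub>C (real ^ 'n)) \<Rightarrow> real ^ 'n"
  assumes h: "0 \<le> h" and L: "linear L" and u: "continuous_on {- h..0} u" and w: "continuous_on {- h..0} w"
  shows "complexify h L (\<lambda>\<theta>. u \<theta> + w \<theta>) = complexify h L u + complexify h L w"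
    "complexify h L (\<lambda>\<theta>. a *s u \<theta>) = a *s complexify h L u"
proof -
  let ?R = "\<lambda>u \<theta>. \<chi> j. Re (u \<theta> $ j)" and ?I = "\<lambda>u \<theta>. \<chi> j. Im (u \<theta> $ j)"
  have c: "continuous_on {- h..0} (?R u)" "continuous_on {- h..0} (?I u)"
    "continuous_on {- h..0} (?R w)" "continuous_on {- h..0} (?I w)"
    using u w by (auto intro!: continuous_intros)
  have comb: "L (hist h (\<lambda>\<theta>. r *\<^sub>R p \<theta> + s *\<^sub>R q \<theta>) 0) = r *\<^sub>R L (hist h p 0) + s *\<^sub>R L (hist h q 0)"
    if "continuous_on {- h..0} p" "continuous_on {- h..0} q" for p q r s
    by (simp only: hist_linear[OF h that] linear_add[OF L] linear_cmul[OF L])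
  have "?R (\<lambda>\<theta>. u \<theta> + w \<theta>) = (\<lambda>\<theta>. 1 *\<^sub>R ?R u \<theta> + 1 *\<^sub>R ?R w \<theta>)"
    "?I (\<lambda>\<theta>. u \<theta> + w \<theta>) = (\<lambda>\<theta>. 1 *\<^sub>R ?I u \<theta> + 1 *\<^sub>R ?I w \<theta>)"
    by (simp_all add: vec_eq_iff fun_eq_iff)
  then show "complexify h L (\<lambda>\<theta>. u \<theta> + w \<theta>) = complexify h L u + complexify h L w"
    unfolding complexify_def by (simp only: comb c) (simp add: vec_eq_iff complex_eq_iff)
  have "?R (\<lambda>\<theta>. a *s u \<theta>) = (\<lambda>\<theta>. Re a *\<^sub>R ?R u \<theta> + (- Im a) *\<^sub>R ?I u \<theta>)"
    "?I (\<lambda>\<theta>. a *s u \<theta>) = (\<lambda>\<theta>. Re a *\<^sub>R ?I u \<theta> + Im a *\<^sub>R ?R u \<theta>)"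
    by (simp_all add: vec_eq_iff fun_eq_iff)
  then show "complexify h L (\<lambda>\<theta>. a *s u \<theta>) = a *s complexify h L u"
    unfolding complexify_def by (simp only: comb c) (simp add: vec_eq_iff complex_eq_iff)
qed

lemma scaleC_linf_linear: "linear (scaleC_linf c)"
proof (rule linearI)
  note lin = bounded_linear.linear[OF bounded_linear_vector_scalar_mult[of c]]
  fix \<psi> \<phi> :: "(complex ^ 'n) linf" and r :: real
  show "scaleC_linf c (\<psi> + \<phi>) = scaleC_linf c \<psi> + scaleC_linf c \<phi>"
  proof (rule linf_eqI)
    show "AE x in lborel. rep_linf (scaleC_linf c (\<psi> + \<phi>)) x = rep_linf (scaleC_linf c \<psi> + scaleC_linf c \<phi>) x"
      using rep_linf_scaleC[of c "\<psi> + \<phi>"] rep_linf_add[of \<psi> \<phi>] rep_linf_scaleC[of c \<psi>]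
        rep_linf_scaleC[of c \<phi>] rep_linf_add[of "scaleC_linf c \<psi>" "scaleC_linf c \<phi>"]
      by eventually_elim (simp add: linear_add[OF lin])
  qed
  show "scaleC_linf c (r *\<^sub>R \<psi>) = r *\<^sub>R scaleC_linf c \<psi>"
  proof (rule linf_eqI)
    show "AE x in lborel. rep_linf (scaleC_linf c (r *\<^sub>R \<psi>)) x = rep_linf (r *\<^sub>R scaleC_linf c \<psi>) x"
      using rep_linf_scaleC[of c "r *\<^sub>R \<psi>"] rep_linf_scaleR[of r \<psi>] rep_linf_scaleC[of c \<psi>]
        rep_linf_scaleR[of r "scaleC_linf c \<psi>"]
      by eventually_elim (simp add: linear_cmul[OF lin])
  qed
qed

lemma bounded_linear_scaleC_sunstar: "bounded_linear (scaleC_sunstar c :: (complex ^ 'n) \<times> (complex ^ 'n) linf \<Rightarrow> _)"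
proof -
  obtain K where K: "K > 0" "\<And>x :: complex ^ 'n. norm (c *s x) \<le> norm x * K"
    using bounded_linear.pos_bounded[OF bounded_linear_vector_scalar_mult] by blast
  have "bounded_linear (scaleC_linf c :: (complex ^ 'n) linf \<Rightarrow> _)"
  proof (rule bounded_linear_linear_bound[OF scaleC_linf_linear, of c K])
    fix \<psi> :: "(complex ^ 'n) linf"
    have "AE x in lborel. norm (rep_linf (scaleC_linf c \<psi>) x) \<le> K * norm \<psi>"
      using rep_linf_scaleC[of c \<psi>] AE_le_ess_sup_norm[OF ess_bounded_rep, of \<psi>]
    proof eventually_elim
      case (elim x)
      have "norm (c *s rep_linf \<psi> x) \<le> norm (rep_linf \<psi> x) * K" by (rule K(2))
      also have "\<dots> \<le> norm \<psi> * K"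
        using elim(2) K(1) unfolding norm_linf_eq by (intro mult_right_mono) auto
      finally show ?case using elim(1) by (simp add: mult.commute)
    qed
    then show "norm (scaleC_linf c \<psi>) \<le> K * norm \<psi>"
      unfolding norm_linf_eq[of "scaleC_linf c \<psi>"] using K(1) by (intro ess_sup_norm_le) auto
  qed
  then show ?thesis
    unfolding scaleC_sunstar_def[abs_def]
    by (intro bounded_linear_Pair bounded_linear_compose[OF bounded_linear_vector_scalar_mult bounded_linear_fst]
        bounded_linear_compose[OF _ bounded_linear_snd, of "scaleC_linf c"])
qed

lemma sunstar_space_add:
  assumes "v \<in> sunstar_space h" "w \<in> sunstar_space h"
  shows "v + w \<in> sunstar_space h"
proof -
  have "AE x in lborel. x \<notin> {- h..0} \<longrightarrow> rep_linf (snd v) x = 0" "AE x in lborel. x \<notin> {- h..0} \<longrightarrow> rep_linf (snd w) x = 0"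
    using assms unfolding sunstar_space_def by auto
  then have "AE x in lborel. x \<notin> {- h..0} \<longrightarrow> rep_linf (snd v + snd w) x = 0"
    using rep_linf_add[of "snd v" "snd w"] by eventually_elim simp
  then show ?thesis unfolding sunstar_space_def by (cases v, cases w) simp
qed

lemma sunstar_space_scaleC:
  assumes "v \<in> sunstar_space h"
  shows "scaleC_sunstar c v \<in> sunstar_space h"
proof -
  have "AE x in lborel. x \<notin> {- h..0} \<longrightarrow> rep_linf (snd v) x = 0"
    using assms unfolding sunstar_space_def by auto
  then have "AE x in lborel. x \<notin> {- h..0} \<longrightarrow> rep_linf (scaleC_linf c (snd v)) x = 0"
    using rep_linf_scaleC[of c "snd v"] by eventually_elim simp
  then show ?thesis unfolding sunstar_space_def scaleC_sunstar_def by simp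
qed

lemma lipschitz_rep_add:
  assumes "lipschitz_rep h v u" "lipschitz_rep h v' u'"
  shows "lipschitz_rep h (v + v') (\<lambda>\<theta>. u \<theta> + u' \<theta>)"
proof -
  obtain C C' where "C-lipschitz_on {- h..0} u" "C'-lipschitz_on {- h..0} u'"
    using assms unfolding lipschitz_rep_def by blast
  then have "(C + C')-lipschitz_on {- h..0} (\<lambda>\<theta>. u \<theta> + u' \<theta>)" by (rule lipschitz_on_add)
  moreover have "AE x in lborel. x \<in> {- h..0} \<longrightarrow> rep_linf (snd v) x = u x"
    "AE x in lborel. x \<in> {- h..0} \<longrightarrow> rep_linf (snd v') x = u' x"
    using assms unfolding lipschitz_rep_def represents_def by auto
  then have "AE x in lborel. x \<in> {- h..0} \<longrightarrow> rep_linf (snd v + snd v') x = u x + u' x"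
    using rep_linf_add[of "snd v" "snd v'"] by eventually_elim simp
  ultimately show ?thesis using assms unfolding lipschitz_rep_def represents_def by auto
qed

lemma lipschitz_rep_scaleC:
  assumes "lipschitz_rep h v u"
  shows "lipschitz_rep h (scaleC_sunstar c v) (\<lambda>\<theta>. c *s u \<theta>)"
proof -
  obtain K where K: "K > 0" "\<And>x :: complex ^ 'a. norm (c *s x) \<le> norm x * K"
    using bounded_linear.pos_bounded[OF bounded_linear_vector_scalar_mult] by blast
  obtain C where C: "C-lipschitz_on {- h..0} u" using assms unfolding lipschitz_rep_def by blast
  have "(C * K)-lipschitz_on {- h..0} (\<lambda>\<theta>. c *s u \<theta>)"
  proof (rule lipschitz_onI)
    show "0 \<le> C * K" using lipschitz_on_nonneg[OF C] K(1) by simp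
    fix x y assume xy: "x \<in> {- h..0}" "y \<in> {- h..0}"
    have "dist (c *s u x) (c *s u y) = norm (c *s (u x - u y))"
      unfolding dist_norm linear_diff[OF bounded_linear.linear[OF bounded_linear_vector_scalar_mult]] ..
    also have "\<dots> \<le> norm (u x - u y) * K" by (rule K(2))
    also have "\<dots> \<le> (C * dist x y) * K"
      using lipschitz_onD[OF C xy] K(1) by (intro mult_right_mono) (auto simp: dist_norm)
    finally show "dist (c *s u x) (c *s u y) \<le> C * K * dist x y" by (simp add: mult_ac)
  qed
  moreover have "AE x in lborel. x \<in> {- h..0} \<longrightarrow> rep_linf (snd v) x = u x"
    using assms unfolding lipschitz_rep_def represents_def by auto
  then have "AE x in lborel. x \<in> {- h..0} \<longrightarrow> rep_linf (scaleC_linf c (snd v)) x = c *s u x"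
    using rep_linf_scaleC[of c "snd v"] by eventually_elim simp
  ultimately show ?thesis
    using assms unfolding lipschitz_rep_def represents_def scaleC_sunstar_def by auto
qed

lemma op_A_sunstar_linear:
  fixes L :: "(real \<Rightarrow>\<^sub>C (real ^ 'n)) \<Rightarrow> real ^ 'n"
  assumes h: "0 < h" and L: "linear L" and v: "v \<in> dom_A_sunstar h" and w: "w \<in> dom_A_sunstar h"
  shows "v + w \<in> dom_A_sunstar h" "op_A_sunstar h L (v + w) = op_A_sunstar h L v + op_A_sunstar h L w"
    "scaleC_sunstar c v \<in> dom_A_sunstar h" "op_A_sunstar h L (scaleC_sunstar c v) = scaleC_sunstar c (op_A_sunstar h L v)"
proof -
  have h0: "0 \<le> h" using h by simp
  obtain u u' where u: "lipschitz_rep h v u" and u': "lipschitz_rep h w u'"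
    using v w unfolding dom_A_sunstar_def by blast
  note uc = lipschitz_rep_continuous[OF u] lipschitz_rep_continuous[OF u']
  obtain \<psi> where \<psi>: "(0, \<psi>) \<in> sunstar_space h"
    "AE \<theta> in lborel. \<theta> \<in> {- h<..<0} \<longrightarrow> (u has_vector_derivative rep_linf \<psi> \<theta>) (at \<theta>)"
    by (rule sunstar_derivative[OF h u]) blast
  obtain \<psi>' where \<psi>': "(0, \<psi>') \<in> sunstar_space h"
    "AE \<theta> in lborel. \<theta> \<in> {- h<..<0} \<longrightarrow> (u' has_vector_derivative rep_linf \<psi>' \<theta>) (at \<theta>)"
    by (rule sunstar_derivative[OF h u']) blast
  show "v + w \<in> dom_A_sunstar h" "scaleC_sunstar c v \<in> dom_A_sunstar h"
    using v w lipschitz_rep_add[OF u u'] lipschitz_rep_scaleC[OF u] unfolding dom_A_sunstar_def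
    by (auto intro: sunstar_space_add sunstar_space_scaleC)
  have "op_A_sunstar h L (v + w) = (complexify h L (\<lambda>\<theta>. u \<theta> + u' \<theta>), \<psi> + \<psi>')"
  proof (rule op_A_sunstar_eqI[OF h lipschitz_rep_add[OF u u']])
    show "(0, \<psi> + \<psi>') \<in> sunstar_space h" using sunstar_space_add[OF \<psi>(1) \<psi>'(1)] by simp
    show "AE \<theta> in lborel. \<theta> \<in> {- h<..<0} \<longrightarrow>
        ((\<lambda>\<theta>. u \<theta> + u' \<theta>) has_vector_derivative rep_linf (\<psi> + \<psi>') \<theta>) (at \<theta>)"
      using \<psi>(2) \<psi>'(2) rep_linf_add[of \<psi> \<psi>'] by eventually_elim (auto intro: has_vector_derivative_add)
  qed
  then show "op_A_sunstar h L (v + w) = op_A_sunstar h L v + op_A_sunstar h L w"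
    by (simp add: op_A_sunstar_eqI[OF h u \<psi>] op_A_sunstar_eqI[OF h u' \<psi>'] complexify_linear(1)[OF h0 L uc])
  have "op_A_sunstar h L (scaleC_sunstar c v) = (complexify h L (\<lambda>\<theta>. c *s u \<theta>), scaleC_linf c \<psi>)"
  proof (rule op_A_sunstar_eqI[OF h lipschitz_rep_scaleC[OF u]])
    show "(0, scaleC_linf c \<psi>) \<in> sunstar_space h"
      using sunstar_space_scaleC[OF \<psi>(1), of c] by (simp add: scaleC_sunstar_def)
    show "AE \<theta> in lborel. \<theta> \<in> {- h<..<0} \<longrightarrow>
        ((\<lambda>\<theta>. c *s u \<theta>) has_vector_derivative rep_linf (scaleC_linf c \<psi>) \<theta>) (at \<theta>)"
      using \<psi>(2) rep_linf_scaleC[of c \<psi>]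
      by eventually_elim (auto intro: bounded_linear.has_vector_derivative[OF bounded_linear_vector_scalar_mult])
  qed
  then show "op_A_sunstar h L (scaleC_sunstar c v) = scaleC_sunstar c (op_A_sunstar h L v)"
    by (simp add: op_A_sunstar_eqI[OF h u \<psi>] complexify_linear(2)[OF h0 L uc(1) uc(1)] scaleC_sunstar_def)
qed

section \<open>Duality of the second pair of operators\<close>

text \<open>Again the integrands of both sides differ by the derivative of the pairing. It follows the product rule
  because the derivative of \<open>f\<close> stays in the sun dual.\<close>

lemma sun_pairing_per_cA_sunstar:
  fixes L :: "real \<Rightarrow> (real \<Rightarrow>\<^sub>C (real ^ 'n)) \<Rightarrow> real ^ 'n"
  assumes h: "0 < h" and T: "0 < T"
    and Z: "\<And>t. NBV h (\<zeta> t)"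
    and L: "\<And>t \<phi>. has_RS_integral (*v) (\<zeta> t) (\<lambda>\<theta>. apply_bcontfun \<phi> (-\<theta>)) {0..h} (L t \<phi>)"
    and f: "f \<in> dom_cA_sun h T \<zeta>" and v: "v \<in> dom_cA_sunstar h T"
  shows "sun_pairing_per h T (cA_sunstar h L v) f = sun_pairing_per h T v (cA_sun h \<zeta> f)"
proof -
  have f1: "f \<in> C1_per T (sun_space h)" "\<And>\<tau>. f \<tau> \<in> dom_A_sun h (\<zeta> \<tau>)"
    and v1: "v \<in> C1_per T (sunstar_space h)" "\<And>\<tau>. v \<tau> \<in> dom_A_sunstar h"
    using f v unfolding dom_cA_sun_def dom_cA_sunstar_def by auto
  note f' = C1_perD[OF f1(1)] and v' = C1_perD[OF v1(1)]
  note f'_sun = sun_space_derivative[OF h f'(1) f'(5)]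
  have Af: "op_A_sun h (\<zeta> \<tau>) (f \<tau>) \<in> sun_space h" for \<tau>
    using f1(2)[of \<tau>] unfolding dom_A_sun_def op_A_sun_def by blast
  let ?p = "\<lambda>\<tau>. sun_pairing h (vector_derivative v (at \<tau>)) (f \<tau>)"
  let ?q = "\<lambda>\<tau>. sun_pairing h (v \<tau>) (vector_derivative f (at \<tau>))"
  have "((\<lambda>\<tau>. sun_pairing h (v \<tau>) (f \<tau>)) has_vector_derivative ?q \<tau> + ?p \<tau>) (at \<tau>)" for \<tau>
    using has_vector_derivative_sun_pairing[OF h v'(1) f'(1) f'(5) f'_sun, of \<tau>] by (simp add: add.commute)
  then have "((\<lambda>\<tau>. ?q \<tau> + ?p \<tau>) has_integral 0) {0..T}"
    using f'(4)[of 0] v'(4)[of 0] T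
    by (intro has_integral_periodic_derivative[where P="\<lambda>\<tau>. sun_pairing h (v \<tau>) (f \<tau>)"]) auto
  from integral_eq_if_difference_exact[OF this, of "\<lambda>\<tau>. sun_pairing h (op_A_sunstar h (L \<tau>) (v \<tau>)) (f \<tau>)"]
  have "integral {0..T} (\<lambda>\<tau>. sun_pairing h (op_A_sunstar h (L \<tau>) (v \<tau>)) (f \<tau>) - ?p \<tau>)
      = integral {0..T} (\<lambda>\<tau>. sun_pairing h (op_A_sunstar h (L \<tau>) (v \<tau>)) (f \<tau>) + ?q \<tau>)"
    by (rule sym)
  moreover have "sun_pairing h (op_A_sunstar h (L \<tau>) (v \<tau>)) (f \<tau>) = sun_pairing h (v \<tau>) (op_A_sun h (\<zeta> \<tau>) (f \<tau>))" for \<tau>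
    by (rule sun_pairing_op_A_sunstar[OF Z h L f1(2) v1(2)])
  ultimately show ?thesis
    unfolding sun_pairing_per_def cA_sunstar_def cA_sun_def
    by (simp add: sun_pairing_linear(6)[OF h f'(5)] sun_pairing_linear(1)[OF h Af f'_sun])
qed

lemma linear_operator_cA_sunstar:
  fixes L :: "real \<Rightarrow> (real \<Rightarrow>\<^sub>C (real ^ 'n)) \<Rightarrow> real ^ 'n"
  assumes h: "0 < h" and L: "\<And>t. linear (L t)"
  shows "linear_operator scaleC_sunstar
    (part (dom_cA_sunstar h T) (C_per T (sunstar_space h)) (cA_sunstar h L)) (C_per T (sunstar_space h)) (cA_sunstar h L)"
proof (rule linear_operator_part)
  fix u v :: "real \<Rightarrow> (complex ^ 'n) \<times> (complex ^ 'n) linf" and c :: complex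
  have scaleC_diff: "scaleC_sunstar c (x - y) = scaleC_sunstar c x - scaleC_sunstar c y"
    for x y :: "(complex ^ 'n) \<times> (complex ^ 'n) linf"
    by (rule linear_diff[OF bounded_linear.linear[OF bounded_linear_scaleC_sunstar]])
  show "(\<lambda>\<tau>. u \<tau> + v \<tau>) \<in> dom_cA_sunstar h T \<and>
      cA_sunstar h L (\<lambda>\<tau>. u \<tau> + v \<tau>) = (\<lambda>\<tau>. cA_sunstar h L u \<tau> + cA_sunstar h L v \<tau>)"
    if u: "u \<in> dom_cA_sunstar h T" and v: "v \<in> dom_cA_sunstar h T"
  proof -
    have u1: "u \<in> C1_per T (sunstar_space h)" "\<And>\<tau>. u \<tau> \<in> dom_A_sunstar h"
      and v1: "v \<in> C1_per T (sunstar_space h)" "\<And>\<tau>. v \<tau> \<in> dom_A_sunstar h"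
      using u v unfolding dom_cA_sunstar_def by auto
    show ?thesis
      using C1_per_add(1)[OF u1(1) v1(1) sunstar_space_add]
      by (simp add: dom_cA_sunstar_def cA_sunstar_def C1_per_add(2)[OF u1(1) v1(1) sunstar_space_add]
          op_A_sunstar_linear(1,2)[OF h L u1(2) v1(2)] algebra_simps)
  qed
  show "(\<lambda>\<tau>. scaleC_sunstar c (u \<tau>)) \<in> dom_cA_sunstar h T \<and>
      cA_sunstar h L (\<lambda>\<tau>. scaleC_sunstar c (u \<tau>)) = (\<lambda>\<tau>. scaleC_sunstar c (cA_sunstar h L u \<tau>))"
    if u: "u \<in> dom_cA_sunstar h T"
  proof -
    have u1: "u \<in> C1_per T (sunstar_space h)" "\<And>\<tau>. u \<tau> \<in> dom_A_sunstar h"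
      using u unfolding dom_cA_sunstar_def by auto
    show ?thesis
      using C1_per_map(1)[OF u1(1) bounded_linear_scaleC_sunstar sunstar_space_scaleC]
      by (simp add: dom_cA_sunstar_def cA_sunstar_def
          C1_per_map(2)[OF u1(1) bounded_linear_scaleC_sunstar sunstar_space_scaleC]
          op_A_sunstar_linear(3,4)[OF h L u1(2) u1(2)] scaleC_diff)
  qed
  show "(\<lambda>\<tau>. u \<tau> + v \<tau>) \<in> C_per T (sunstar_space h)"
    if "u \<in> C_per T (sunstar_space h)" "v \<in> C_per T (sunstar_space h)"
    using that by (rule C_per_add) (rule sunstar_space_add)
  show "(\<lambda>\<tau>. scaleC_sunstar c (u \<tau>)) \<in> C_per T (sunstar_space h)" if "u \<in> C_per T (sunstar_space h)"
    using that bounded_linear_scaleC_sunstar by (rule C_per_map) (rule sunstar_space_scaleC)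
qed

section \<open>Test elements of the sun dual\<close>

text \<open>The sums of increments of \<open>W\<close> telescope.\<close>

lemma Bv_dominated:
  fixes F :: "real \<Rightarrow> 'a::real_normed_vector"
  assumes F0: "F 0 = 0" and le: "\<And>x y. x \<le> y \<Longrightarrow> norm (F y - F x) \<le> W y - W x"
    and W: "\<And>x. 0 \<le> W x" "\<And>x. W x \<le> B"
  shows "apply_bv (Bv F) = F" "norm (Bv F) \<le> B"
proof -
  have sum: "(\<Sum>i<m. norm (F (t (Suc i)) - F (t i))) \<le> B" if t: "mono t" for t :: "nat \<Rightarrow> real" and m
  proof -
    have "(\<Sum>i<m. norm (F (t (Suc i)) - F (t i))) \<le> (\<Sum>i<m. W (t (Suc i)) - W (t i))"
      using t by (intro sum_mono le) (simp add: monoD)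
    also have "\<dots> = W (t m) - W (t 0)" by (rule sum_lessThan_telescope)
    also have "\<dots> \<le> B" using W(1)[of "t 0"] W(2)[of "t m"] by simp
    finally show ?thesis .
  qed
  then have "bounded_variation_on UNIV F" unfolding bounded_variation_iff by blast
  then show eq: "apply_bv (Bv F) = F" by (rule apply_Bv[of F, OF F0])
  show "norm (Bv F) \<le> B" unfolding norm_bv_eq eq by (rule total_variation_le[OF sum])
qed

lemma Bv_lipschitz_clamp:
  fixes F :: "real \<Rightarrow> 'a::real_normed_vector"
  assumes h: "0 \<le> h" and C: "0 \<le> C" and F0: "F 0 = 0"
    and F: "\<And>x y. x \<in> {0..h} \<Longrightarrow> y \<in> {0..h} \<Longrightarrow> norm (F y - F x) \<le> C * \<bar>y - x\<bar>"
  shows "apply_bv (Bv (\<lambda>\<theta>. F (max 0 (min h \<theta>)))) \<theta> = F (max 0 (min h \<theta>))"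
    "norm (Bv (\<lambda>\<theta>. F (max 0 (min h \<theta>)))) \<le> C * h"
proof -
  note d = Bv_dominated[where F="\<lambda>\<theta>. F (max 0 (min h \<theta>))" and W="\<lambda>\<theta>. C * max 0 (min h \<theta>)" and B="C * h"]
  have *: "norm (F (max 0 (min h y)) - F (max 0 (min h x))) \<le> C * max 0 (min h y) - C * max 0 (min h x)"
    if "x \<le> y" for x y
  proof -
    have "norm (F (max 0 (min h y)) - F (max 0 (min h x))) \<le> C * \<bar>max 0 (min h y) - max 0 (min h x)\<bar>"
      using h by (intro F) auto
    also have "\<bar>max 0 (min h y) - max 0 (min h x)\<bar> = max 0 (min h y) - max 0 (min h x)"
      using that by (auto simp: max_def min_def)
    finally show ?thesis by (simp add: right_diff_distrib)
  qed
  have B: "C * max 0 (min h x) \<le> C * h" "0 \<le> C * max 0 (min h x)" for x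
    using h C by (auto intro!: mult_left_mono)
  have z: "F (max 0 (min h 0)) = 0" using h F0 by simp
  show "apply_bv (Bv (\<lambda>\<theta>. F (max 0 (min h \<theta>)))) \<theta> = F (max 0 (min h \<theta>))"
    using d(1)[OF z * B(2) B(1)] by (rule fun_cong)
  show "norm (Bv (\<lambda>\<theta>. F (max 0 (min h \<theta>)))) \<le> C * h"
    by (rule d(2)[OF z * B(2) B(1)])
qed

lemma clamped_in_star_space:
  assumes h: "0 \<le> h" and f: "\<And>\<theta>. apply_bv f \<theta> = F (max 0 (min h \<theta>))" and F: "continuous_on {0..h} F"
  shows "f \<in> star_space h" "F 0 = 0 \<Longrightarrow> value0 f = 0"
proof -
  have cont: "continuous_on UNIV (apply_bv f)"
    unfolding f by (rule continuous_on_compose2[OF F]) (use h in \<open>auto intro!: continuous_intros\<close>)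
  show "f \<in> star_space h"
    unfolding star_space_iff
  proof (intro conjI ballI allI)
    show "continuous (at_right \<theta>) (apply_bv f)" for \<theta>
      using cont continuous_on_eq_continuous_at open_UNIV continuous_at_imp_continuous_within by blast
    show "apply_bv f \<theta> = apply_bv f (max 0 (min h \<theta>))" for \<theta>
      unfolding f using h by auto
  qed
  assume "F 0 = 0"
  have "(apply_bv f \<longlongrightarrow> apply_bv f 0) (at_right 0)"
    using cont tendsto_mono[OF at_le[OF subset_UNIV]] by (simp only: continuous_on_def) blast
  then show "value0 f = 0" by (intro value0_eqI) simp
qed

definition profile_bv :: "real \<Rightarrow> (real \<Rightarrow> real) \<Rightarrow> complex ^ 'n \<Rightarrow> (complex ^ 'n) bv" where
  "profile_bv h p x = Bv (\<lambda>\<theta>. p (max 0 (min h \<theta>)) *\<^sub>R x)"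

lemma apply_profile_bv:
  assumes h: "0 \<le> h" and p: "\<And>\<theta>. (p has_real_derivative p' \<theta>) (at \<theta>)" "continuous_on UNIV p'" "p 0 = 0"
  shows "apply_bv (profile_bv h p x) \<theta> = p (max 0 (min h \<theta>)) *\<^sub>R x"
    "profile_bv h p x \<in> star_space h" "value0 (profile_bv h p x) = 0"
proof -
  have "compact (p' ` {0..h})" by (intro compact_continuous_image continuous_on_subset[OF p(2)]) auto
  then have "bounded (p' ` {0..h})" by (rule compact_imp_bounded)
  then obtain B where B: "\<And>s. s \<in> {0..h} \<Longrightarrow> \<bar>p' s\<bar> \<le> B"
    unfolding bounded_iff real_norm_def by blast
  have B0: "0 \<le> B" using B[of 0] h by (simp add: order_trans[OF abs_ge_zero])
  have lip: "norm (p y *\<^sub>R x - p z *\<^sub>R x) \<le> (B * norm x) * \<bar>y - z\<bar>" if "y \<in> {0..h}" "z \<in> {0..h}" for y z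
  proof -
    have "norm (p y - p z) \<le> B * norm (y - z)"
      by (rule field_differentiable_bound[of "{0..h}" p p' B])
        (use that B DERIV_subset[OF p(1)] in \<open>auto simp: convex_real_interval\<close>)
    then have "\<bar>p y - p z\<bar> * norm x \<le> (B * \<bar>y - z\<bar>) * norm x" by (intro mult_right_mono) auto
    then show ?thesis by (simp add: mult_ac flip: scaleR_diff_left)
  qed
  have eq: "apply_bv (profile_bv h p x) \<theta> = p (max 0 (min h \<theta>)) *\<^sub>R x" for \<theta>
    unfolding profile_bv_def
    by (rule Bv_lipschitz_clamp(1)[where F="\<lambda>s. p s *\<^sub>R x" and C="B * norm x", OF h _ _ lip]) (use B0 p(3) in auto)
  then show "apply_bv (profile_bv h p x) \<theta> = p (max 0 (min h \<theta>)) *\<^sub>R x" .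
  have pc: "continuous_on {0..h} (\<lambda>s. p s *\<^sub>R x)"
    by (intro continuous_on_scaleR continuous_on_const DERIV_continuous_on[where D=p'])
      (rule DERIV_subset[OF p(1)], simp)
  show "profile_bv h p x \<in> star_space h" "value0 (profile_bv h p x) = 0"
    using clamped_in_star_space[OF h eq pc] p(3) by auto
qed

lemma is_star_deriv_profile_bv:
  assumes h: "0 \<le> h" and p: "\<And>\<theta>. (p has_real_derivative p' \<theta>) (at \<theta>)" "\<And>\<theta>. (p' has_real_derivative p'' \<theta>) (at \<theta>)"
    "continuous_on UNIV p''" and 0: "p 0 = 0" "p' 0 = 0" "p' h = 0"
  shows "is_star_deriv h (profile_bv h p x) (profile_bv h p' x)"
proof -
  have p'c: "continuous_on S p'" for S
    by (rule DERIV_continuous_on[where D=p'']) (rule DERIV_subset[OF p(2)], simp)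
  note a = apply_profile_bv[OF h p(1) p'c 0(1)] and a' = apply_profile_bv[OF h p(2,3) 0(2)]
  show ?thesis
    unfolding is_star_deriv_def
  proof (intro conjI ballI a'(2))
    show "apply_bv (profile_bv h p' x) h = 0" using h 0(3) by (simp add: a')
    fix \<theta> assume \<theta>: "\<theta> \<in> {0<..h}"
    have "((\<lambda>s. p' s *\<^sub>R x) has_integral (p \<theta> *\<^sub>R x - p 0 *\<^sub>R x)) {0..\<theta>}"
      by (rule fundamental_theorem_of_calculus)
        (use \<theta> in \<open>auto intro!: bounded_linear.has_vector_derivative[OF bounded_linear_scaleR_left]
          simp: has_real_derivative_iff_has_vector_derivative[symmetric] has_field_derivative_at_within[OF p(1)]\<close>)
    then have "integral {0..\<theta>} (\<lambda>s. p' s *\<^sub>R x) = p \<theta> *\<^sub>R x" using 0(1) by (simp add: integral_unique)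
    also have "integral {0..\<theta>} (\<lambda>s. p' s *\<^sub>R x) = integral {0..\<theta>} (apply_bv (profile_bv h p' x))"
      by (rule integral_cong) (use \<theta> in \<open>auto simp: a'\<close>)
    finally show "apply_bv (profile_bv h p x) \<theta> = value0 (profile_bv h p x) + integral {0..\<theta>} (apply_bv (profile_bv h p' x))"
      using \<theta> by (simp add: a)
  qed
qed

definition jump_bv :: "complex ^ 'n \<Rightarrow> (complex ^ 'n) bv" where
  "jump_bv x = Bv (\<lambda>\<theta>. if \<theta> \<le> 0 then 0 else x)"

lemma apply_jump_bv: "apply_bv (jump_bv x) \<theta> = (if \<theta> \<le> 0 then 0 else x)"
  and norm_jump_bv_le: "norm (jump_bv x) \<le> norm x"
  using Bv_dominated[where F="\<lambda>\<theta>. if \<theta> \<le> 0 then 0 else x" and W="\<lambda>\<theta>. if \<theta> \<le> 0 then 0 else norm x" and B="norm x"]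
  unfolding jump_bv_def by auto

lemma bounded_linear_jump_bv: "bounded_linear jump_bv"
proof (rule bounded_linear_intro[where K=1])
  fix x y :: "complex ^ 'n" and r :: real
  show "jump_bv (x + y) = jump_bv x + jump_bv y"
    by (rule bv_eqI) (simp add: apply_jump_bv plus_bv.rep_eq)
  show "jump_bv (r *\<^sub>R x) = r *\<^sub>R jump_bv x"
    by (rule bv_eqI) (simp add: apply_jump_bv scaleR_bv.rep_eq)
  show "norm (jump_bv x) \<le> norm x * 1" by (simp add: norm_jump_bv_le)
qed

lemma value0_jump_bv: "value0 (jump_bv x) = x"
proof (rule value0_eqI, rule Lim_transform_eventually[OF tendsto_const])
  show "\<forall>\<^sub>F s in at_right 0. x = apply_bv (jump_bv x) s"
    unfolding eventually_at_right_field by (intro exI[of _ 1]) (auto simp: apply_jump_bv)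
qed

lemma jump_bv_in_star_space:
  assumes h: "0 < h"
  shows "jump_bv x \<in> star_space h"
  unfolding star_space_iff
proof (intro conjI ballI allI)
  fix \<theta> assume \<theta>: "\<theta> \<in> {0<..<h}"
  have "(apply_bv (jump_bv x) \<longlongrightarrow> x) (at_right \<theta>)"
  proof (rule Lim_transform_eventually[OF tendsto_const])
    show "\<forall>\<^sub>F s in at_right \<theta>. x = apply_bv (jump_bv x) s"
      unfolding eventually_at_right_field using \<theta> by (intro exI[of _ h]) (auto simp: apply_jump_bv)
  qed
  then show "continuous (at_right \<theta>) (apply_bv (jump_bv x))"
    using \<theta> unfolding continuous_within by (simp add: apply_jump_bv)
qed (use h in \<open>auto simp: apply_jump_bv\<close>)

lemma jump_bv_in_sun_space:
  assumes h: "0 < h"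
  shows "jump_bv x \<in> sun_space h"
proof -
  have "is_star_deriv h (jump_bv x) 0"
    unfolding is_star_deriv_def
    by (auto simp: star_space_iff zero_bv.rep_eq[abs_def] apply_jump_bv value0_jump_bv)
  then have "jump_bv x \<in> dom_A0_star h"
    unfolding dom_A0_star_def using jump_bv_in_star_space[OF h] by blast
  then show ?thesis using dom_A0_star_subset_sun_space by blast
qed

text \<open>If an admissible family \<open>f\<close> may be multiplied by every periodic weight then a functional that
  annihilates all these products annihilates \<open>f(\<tau>)\<close> for each \<open>\<tau>\<close>.\<close>

lemma sun_pairing_zero_of_test_family:
  fixes f :: "real \<Rightarrow> (complex ^ 'n) bv"
  assumes h: "0 < h" and T: "0 < T" and Z: "\<And>t. NBV h (\<zeta> t)"
    and q: "q \<in> C_per T (sunstar_space h)"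
    and zero: "\<And>\<phi>. \<phi> \<in> part (dom_cA_sun h T \<zeta>) (C_per T (sun_space h)) (cA_sun h \<zeta>) \<Longrightarrow> sun_pairing_per h T q \<phi> = 0"
    and f: "f \<in> C1_per T (sun_space h)" "\<And>\<tau>. f \<tau> \<in> dom_A0_star h"
    and a: "\<And>\<tau>. op_A_star h (\<zeta> \<tau>) (f \<tau>) = a \<tau>" "a \<in> C_per T (sun_space h)"
  shows "sun_pairing h (q \<tau>) (f \<tau>) = 0"
proof (rule periodic_zero_if_orthogonal[where g="\<lambda>\<tau>. sun_pairing h (q \<tau>) (f \<tau>)", OF T])
  note f' = C1_perD[OF f(1)] and q' = C_perD[OF q] and a' = C_perD[OF a(2)]
  show "continuous_on UNIV (\<lambda>\<tau>. sun_pairing h (q \<tau>) (f \<tau>))"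
    by (rule continuous_on_sun_pairing[OF h q'(1) f'(3,5)])
  show "sun_pairing h (q (\<tau> + T)) (f (\<tau> + T)) = sun_pairing h (q \<tau>) (f \<tau>)" for \<tau>
    by (simp add: q'(2) f'(4))
  fix w :: "real \<Rightarrow> real" assume w: "w \<in> C1_per T UNIV"
  note w' = C1_perD[OF w]
  define u where "u \<tau> = w \<tau> *\<^sub>R f \<tau>" for \<tau>
  define u' where "u' \<tau> = w \<tau> *\<^sub>R vector_derivative f (at \<tau>) + vector_derivative w (at \<tau>) *\<^sub>R f \<tau>" for \<tau>
  have du: "(u has_vector_derivative u' \<tau>) (at \<tau>)" for \<tau>
    unfolding u_def u'_def
    by (rule bounded_bilinear.has_vector_derivative[OF bounded_bilinear_scaleR w'(1) f'(1)])
  have u'c: "continuous_on UNIV u'"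
    unfolding u'_def by (intro continuous_intros w'(2,3) f'(2,3))
  have u_sun: "u \<tau> \<in> sun_space h" for \<tau>
    unfolding u_def by (rule sun_space_linear(3)[OF h f'(5)])
  have u'_sun: "u' \<tau> \<in> sun_space h" for \<tau>
    by (rule sun_space_derivative[OF h du u_sun])
  have u_C1: "u \<in> C1_per T (sun_space h)"
    by (rule C1_perI[OF du u'c _ u_sun]) (simp add: u_def w'(4) f'(4))
  have u_dom: "u \<tau> \<in> dom_A0_star h" for \<tau>
    unfolding u_def scaleR_bv_eq_scaleC by (rule dom_A0_star_linear(3)[OF h f(2) f(2)])
  have op_u: "op_A_star h (\<zeta> \<tau>) (u \<tau>) = w \<tau> *\<^sub>R a \<tau>" for \<tau>
    unfolding u_def scaleR_bv_eq_scaleC op_A_star_linear(2)[OF Z h f(2) f(2)] a(1) ..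
  have wa: "w \<tau> *\<^sub>R a \<tau> \<in> sun_space h" for \<tau>
    by (rule sun_space_linear(3)[OF h a'(3)])
  have cA: "cA_sun h \<zeta> u = (\<lambda>\<tau>. w \<tau> *\<^sub>R a \<tau> + u' \<tau>)"
    unfolding cA_sun_def op_A_sun_def by (simp add: op_u vector_derivative_at[OF du])
  have "cA_sun h \<zeta> u \<in> C_per T (sun_space h)"
    unfolding cA
  proof (rule C_perI)
    show "continuous_on UNIV (\<lambda>\<tau>. w \<tau> *\<^sub>R a \<tau> + u' \<tau>)"
      by (intro continuous_intros w'(3) a'(1) u'c)
    show "w (\<tau> + T) *\<^sub>R a (\<tau> + T) + u' (\<tau> + T) = w \<tau> *\<^sub>R a \<tau> + u' \<tau>" for \<tau>
      unfolding u'_def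
      by (simp add: w'(4) a'(2) f'(4) C1_per_derivative_periodic[OF w] C1_per_derivative_periodic[OF f(1)])
    show "w \<tau> *\<^sub>R a \<tau> + u' \<tau> \<in> sun_space h" for \<tau>
      by (rule sun_space_linear(1)[OF h wa u'_sun])
  qed
  then have "u \<in> part (dom_cA_sun h T \<zeta>) (C_per T (sun_space h)) (cA_sun h \<zeta>)"
    unfolding part_def dom_cA_sun_def dom_A_sun_def using u_C1 u_dom op_u wa by auto
  from zero[OF this] show "integral {0..T} (\<lambda>\<tau>. w \<tau> *\<^sub>R sun_pairing h (q \<tau>) (f \<tau>)) = 0"
    unfolding sun_pairing_per_def u_def by (simp add: sun_pairing_linear(2)[OF h f'(5)])
qed

section \<open>The essentially bounded component\<close>

lemma continuous_on_real_polynomial: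
  fixes p :: "real \<Rightarrow> real"
  assumes "real_polynomial_function p"
  shows "continuous_on S p"
  using continuous_real_polymonial_function[OF assms] by (intro continuous_at_imp_continuous_on) auto

text \<open>If \<open>P\<close> is a multiple of \<open>(s (h - s))\<^sup>2\<close> by a polynomial then \<open>P\<close> and its derivative vanish at both
  ends. A primitive of \<open>P\<close> that vanishes at \<open>0\<close> therefore belongs to the domain of the sun operator at
  every time, and its image \<open>P\<close> does not depend on the kernel because the value at \<open>0+\<close> is \<open>0\<close>. By the
  theorem of Weierstrass these functions detect every element of \<open>L\<^sup>\<infinity>\<close>.\<close>

lemma sunstar_density_zero:
  fixes q :: "real \<Rightarrow> (complex ^ 'n) \<times> (complex ^ 'n) linf"
  assumes h: "0 < h" and T: "0 < T" and Z: "\<And>t. NBV h (\<zeta> t)"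
    and q: "q \<in> C_per T (sunstar_space h)"
    and zero: "\<And>\<phi>. \<phi> \<in> part (dom_cA_sun h T \<zeta>) (C_per T (sun_space h)) (cA_sun h \<zeta>) \<Longrightarrow> sun_pairing_per h T q \<phi> = 0"
  shows "snd (q \<tau>) = 0"
proof -
  have h0: "0 \<le> h" using h by simp
  let ?m = "\<lambda>s::real. (s * (h - s))\<^sup>2"
  let ?\<psi> = "snd (q \<tau>)"
  obtain u where u: "u \<in> borel_measurable borel" "\<And>x. norm (u x) \<le> norm ?\<psi>" "AE x in lborel. rep_linf ?\<psi> x = u x"
    by (rule linf_bounded_representative[where \<psi>="?\<psi>"]) blast
  define r where "r s = ?m s *\<^sub>R u (- s)" for s
  have mc: "continuous_on S ?m" for S by (intro continuous_intros)
  have bil: "bilinear ((*\<^sub>R) :: real \<Rightarrow> complex ^ 'n \<Rightarrow> _)"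
    by (simp add: bilinear_conv_bounded_bilinear bounded_bilinear_scaleR)
  have "(\<lambda>s. u (- s)) \<in> borel_measurable borel" using u(1) by measurable
  then have u_abs: "(\<lambda>s. u (- s)) absolutely_integrable_on {0..h}"
    by (intro measurable_bounded_by_integrable_imp_absolutely_integrable[where g="\<lambda>_. norm ?\<psi>"])
      (auto simp: measurable_restrict_space1 measurable_completion u(2))
  have scale_abs: "(\<lambda>s. k s *\<^sub>R g s) absolutely_integrable_on {0..h}"
    if "continuous_on {0..h} k" "g absolutely_integrable_on {0..h}" for k :: "real \<Rightarrow> real" and g :: "real \<Rightarrow> complex ^ 'n"
    using that by (intro absolutely_integrable_bounded_measurable_product[OF bil]
        continuous_imp_measurable_on_sets_lebesgue compact_imp_bounded compact_continuous_image) auto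
  have r: "r absolutely_integrable_on {0..h}"
    unfolding r_def by (rule scale_abs[OF mc u_abs])
  have poly: "integral {0..h} (\<lambda>s. p s *\<^sub>R r s) = 0" if p: "real_polynomial_function p" for p
  proof -
    obtain p1 where p1: "real_polynomial_function p1" "\<And>x. (p has_real_derivative p1 x) (at x)"
      using has_real_derivative_polynomial_function[OF p] by blast
    define P where "P s = ?m s * p s" for s
    define P' where "P' s = 2 * (s * (h - s)) * (h - 2 * s) * p s + ?m s * p1 s" for s
    have pc: "continuous_on S p" "continuous_on S p1" for S
      using continuous_on_real_polynomial[OF p] continuous_on_real_polynomial[OF p1(1)] by auto
    have dP: "(P has_real_derivative P' s) (at s)" for s
      unfolding P_def P'_def
      by (auto intro!: derivative_eq_intros p1(2) simp: algebra_simps power2_eq_square)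
    have P'c: "continuous_on S P'" for S unfolding P'_def by (intro continuous_intros pc)
    have Pc: "continuous_on S P" for S unfolding P_def by (intro continuous_intros pc)
    obtain Q0 where Q0: "\<And>s. (Q0 has_vector_derivative P s) (at s)"
      using einterval_antiderivative[of "-\<infinity>" "\<infinity>" P] Pc[of UNIV] by (auto simp: continuous_on_eq_continuous_at)
    define Q where "Q s = Q0 s - Q0 0" for s
    have dQ: "(Q has_real_derivative P s) (at s)" for s
      unfolding Q_def using Q0[of s] unfolding has_real_derivative_iff_has_vector_derivative[symmetric]
      by (auto intro!: derivative_eq_intros)
    obtain p2 where p2: "real_polynomial_function p2" "\<And>x. (p1 has_real_derivative p2 x) (at x)"
      using has_real_derivative_polynomial_function[OF p1(1)] by blast
    define P'' where "P'' s = (2 * ((h - 2 * s) * (h - 2 * s)) - 4 * (s * (h - s))) * p s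
        + 4 * (s * (h - s)) * (h - 2 * s) * p1 s + ?m s * p2 s" for s
    have dP': "(P' has_real_derivative P'' s) (at s)" for s
      unfolding P'_def P''_def
      by (auto intro!: derivative_eq_intros p1(2) p2(2) simp: algebra_simps power2_eq_square)
    have P''c: "continuous_on UNIV P''"
      unfolding P''_def by (intro continuous_intros pc continuous_on_real_polynomial[OF p2(1)])
    have ends: "Q 0 = 0" "P 0 = 0" "P h = 0" "P' 0 = 0" "P' h = 0"
      by (simp_all add: Q_def P_def P'_def)
    have "integral {0..h} (\<lambda>s. p s *\<^sub>R r s) $ i = 0" for i
    proof -
      let ?e = "axis i 1 :: complex ^ 'n"
      let ?f = "profile_bv h Q ?e" and ?g = "profile_bv h P ?e"
      have fg: "is_star_deriv h ?f ?g"
        by (rule is_star_deriv_profile_bv[OF h0 dQ dP P'c ends(1-3)])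
      have gg: "is_star_deriv h ?g (profile_bv h P' ?e)"
        by (rule is_star_deriv_profile_bv[OF h0 dP dP' P''c ends(2,4,5)])
      have f0: "?f \<in> dom_A0_star h"
        unfolding dom_A0_star_def using fg apply_profile_bv(2)[OF h0 dQ Pc ends(1)] by blast
      have g0: "?g \<in> dom_A0_star h"
        unfolding dom_A0_star_def using gg apply_profile_bv(2)[OF h0 dP P'c ends(2)] by blast
      have v0: "value0 ?f = 0" by (rule apply_profile_bv(3)[OF h0 dQ Pc ends(1)])
      have op: "op_A_star h (\<zeta> t) ?f = ?g" for t
      proof -
        have "row_kernel h (\<zeta> t) 0 = 0"
          by (rule bv_eqI) (simp add: apply_row_kernel[OF Z h0] zero_bv.rep_eq vector_matrix_mult_def vec_eq_iff)
        then show ?thesis unfolding op_A_star_def v0 star_deriv_eq[OF h fg] by simp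
      qed
      have "sun_pairing h (q \<tau>) ?f = 0"
      proof (rule sun_pairing_zero_of_test_family[where f="\<lambda>_. ?f" and a="\<lambda>_. ?g", OF h T Z q zero])
        show "(\<lambda>_. ?f) \<in> C1_per T (sun_space h)"
          by (rule C1_perI[where D="\<lambda>_. 0"]) (use f0 dom_A0_star_subset_sun_space in auto)
        show "(\<lambda>_. ?g) \<in> C_per T (sun_space h)"
          by (rule C_perI) (use g0 dom_A0_star_subset_sun_space in auto)
      qed (use f0 op in auto)
      moreover have "sun_pairing h (q \<tau>) ?f = density_pairing h ?\<psi> (apply_bv ?g)"
        using sun_pairing_eq[OF h has_sun_density_star_deriv[OF h f0], of "q \<tau>"]
        by (simp add: v0 row_col.zero_left star_deriv_eq[OF h fg])
      moreover have "density_pairing h ?\<psi> (apply_bv ?g) = integral {0..h} (\<lambda>s. row_col (apply_bv ?g s) (u (- s)))"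
      proof (rule density_pairing_eq)
        show "AE x in lborel. x \<in> {- h..0} \<longrightarrow> rep_linf ?\<psi> x = u x" using u(3) by eventually_elim simp
      qed
      moreover have "integral {0..h} (\<lambda>s. row_col (apply_bv ?g s) (u (- s))) = integral {0..h} (\<lambda>s. (p s *\<^sub>R r s) $ i)"
      proof (rule integral_cong)
        fix s assume s: "s \<in> {0..h}"
        show "row_col (apply_bv ?g s) (u (- s)) = (p s *\<^sub>R r s) $ i"
          using s by (simp add: apply_profile_bv(1)[OF h0 dP P'c ends(2)] row_col.scaleR_left row_col_axis P_def r_def mult.commute)
      qed
      moreover have "integral {0..h} (\<lambda>s. (p s *\<^sub>R r s) $ i) = integral {0..h} (\<lambda>s. p s *\<^sub>R r s) $ i"
        using integral_linear[OF set_lebesgue_integral_eq_integral(1)[OF scale_abs[OF pc(1) r]] bounded_linear_vec_nth[of i]]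
        by (simp add: o_def)
      ultimately show ?thesis by simp
    qed
    then show ?thesis by (simp add: vec_eq_iff)
  qed
  have nr: "(\<lambda>s. norm (r s)) integrable_on {0..h}"
    using absolutely_integrable_norm[OF r, unfolded o_def] set_lebesgue_integral_eq_integral(1) by blast
  have cont: "integral {0..h} (\<lambda>s. k s *\<^sub>R r s) = 0" if k: "continuous_on UNIV k" for k :: "real \<Rightarrow> real"
  proof -
    let ?N = "integral {0..h} (\<lambda>s. norm (r s))"
    have N: "0 \<le> ?N" by (rule integral_nonneg[OF nr]) simp
    have kc: "continuous_on {0..h} k" by (rule continuous_on_subset[OF k]) simp
    have "norm (integral {0..h} (\<lambda>s. k s *\<^sub>R r s)) \<le> 0 + e" if e: "e > 0" for e
    proof -
      have e': "e / (?N + 1) > 0" using e N by simp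
      obtain p where p: "real_polynomial_function p" "\<And>x. x \<in> {0..h} \<Longrightarrow> \<bar>k x - p x\<bar> < e / (?N + 1)"
        using Stone_Weierstrass_real_polynomial_function[OF compact_Icc kc e'] by blast
      have pc: "continuous_on {0..h} p" by (rule continuous_on_real_polynomial[OF p(1)])
      note int = set_lebesgue_integral_eq_integral(1)[OF scale_abs[OF _ r]]
      have "integral {0..h} (\<lambda>s. k s *\<^sub>R r s) = integral {0..h} (\<lambda>s. k s *\<^sub>R r s) - integral {0..h} (\<lambda>s. p s *\<^sub>R r s)"
        by (simp add: poly[OF p(1)])
      also have "\<dots> = integral {0..h} (\<lambda>s. (k s - p s) *\<^sub>R r s)"
        unfolding scaleR_diff_left by (rule Henstock_Kurzweil_Integration.integral_diff[OF int[OF kc] int[OF pc], symmetric])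
      also have "norm \<dots> \<le> integral {0..h} (\<lambda>s. (e / (?N + 1)) *\<^sub>R norm (r s))"
      proof (rule integral_norm_bound_integral)
        show "(\<lambda>s. (k s - p s) *\<^sub>R r s) integrable_on {0..h}"
          by (rule int) (intro continuous_on_diff kc pc)
        show "(\<lambda>s. (e / (?N + 1)) *\<^sub>R norm (r s)) integrable_on {0..h}" by (rule integrable_cmul[OF nr])
        show "norm ((k s - p s) *\<^sub>R r s) \<le> (e / (?N + 1)) *\<^sub>R norm (r s)" if "s \<in> {0..h}" for s
          using mult_right_mono[OF less_imp_le[OF p(2)[OF that]] norm_ge_zero[of "r s"]] by simp
      qed
      also have "\<dots> = e / (?N + 1) * ?N" by (subst integral_cmul) simp
      also have "\<dots> \<le> e" using e N by (simp add: field_simps)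
      finally show ?thesis by simp
    qed
    then have "norm (integral {0..h} (\<lambda>s. k s *\<^sub>R r s)) \<le> 0" by (rule field_le_epsilon)
    then show ?thesis by simp
  qed
  \<comment> \<open>So \<open>r\<close> is a density of \<open>0\<close>, and its \<open>L\<^sup>1\<close> norm is at most the norm of \<open>0\<close>.\<close>
  have "has_sun_density h 0 r"
    unfolding has_sun_density_def
  proof (intro conjI r ballI)
    fix \<theta> assume "\<theta> \<in> {0<..h}"
    then have "integral {0..\<theta>} r = 0"
      by (intro integral_zero_if_orthogonal_continuous[OF r _ cont]) auto
    then show "apply_bv 0 \<theta> = value0 0 + integral {0..\<theta>} r"
      by (simp add: zero_bv.rep_eq linear_0[OF bounded_linear.linear[OF bounded_linear_value0]])
  qed
  from sun_density_norm_le[OF h this] have "integral {0..h} (\<lambda>s. norm (r s)) \<le> 0" by simp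
  moreover have "0 \<le> integral {0..h} (\<lambda>s. norm (r s))" by (rule integral_nonneg[OF nr]) simp
  ultimately have r0: "integral {0..h} (\<lambda>s. norm (r s)) = 0" by simp
  have nr_abs: "(\<lambda>s. norm (r s)) absolutely_integrable_on {0..h}"
    using absolutely_integrable_norm[OF r] by (simp add: o_def)
  have "(LINT s|lebesgue. indicator {0..h} s *\<^sub>R norm (r s)) = 0"
    using set_lebesgue_integral_eq_integral(2)[OF nr_abs] r0 unfolding set_lebesgue_integral_def by simp
  then have "AE s in lebesgue. indicator {0..h} s *\<^sub>R norm (r s) = 0"
    using nr_abs unfolding set_integrable_def
    by (subst (asm) integral_nonneg_eq_0_iff_AE) auto
  then have "AE s in lborel. indicator {0..h} s *\<^sub>R norm (r s) = 0" by (simp add: AE_completion_iff)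
  from AE_lborel_uminus[OF this]
  have r_AE: "AE x in lborel. indicator {0..h} (- x) *\<^sub>R norm (r (- x)) = 0" .
  have ne: "AE x in lborel. x \<noteq> - h" "AE x in lborel. x \<noteq> (0::real)"
    by (rule AE_lborel_singleton)+
  have out: "AE x in lborel. x \<notin> {- h..0} \<longrightarrow> rep_linf ?\<psi> x = 0"
    using C_perD(3)[OF q, of \<tau>] unfolding sunstar_space_def by (auto simp: case_prod_beta)
  show ?thesis
  proof (rule linf_eqI)
    show "AE x in lborel. rep_linf ?\<psi> x = rep_linf 0 x"
      using r_AE ne out u(3) rep_linf_zero[where 'a="complex ^ 'n"]
    proof eventually_elim
      case (elim x)
      show ?case
      proof (cases "x \<in> {- h..0}")
        case True
        then have "?m (- x) \<noteq> 0" using elim(2,3) by auto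
        moreover have "norm (r (- x)) = 0" using elim(1) True by (simp add: indicator_def)
        ultimately have "u x = 0" unfolding r_def by simp
        then show ?thesis using elim(5,6) by simp
      next
        case False
        then show ?thesis using elim(4,6) by simp
      qed
    qed
  qed
qed

section \<open>The component at zero\<close>

text \<open>If \<open>l\<close> is represented by the kernel \<open>Z\<close> then partial integration expresses the primitive of
  \<open>Z h - Z\<close> by the values of \<open>l\<close> at the functions \<open>t \<mapsto> min (- t) \<theta>\<close>. In this form it is Lipschitz in
  \<open>\<theta>\<close> and depends linearly and continuously on \<open>l\<close> alone, without reference to \<open>Z\<close>.\<close>

definition kernel_primitive ::
  "real \<Rightarrow> 'n \<Rightarrow> ((real \<Rightarrow>\<^sub>C (real ^ 'n)) \<Rightarrow>\<^sub>L (real ^ 'n)) \<Rightarrow> real \<Rightarrow> complex ^ 'n" where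
  "kernel_primitive h i l \<theta> =
     (\<chi> j. complex_of_real (blinfun_apply l (hist h (\<lambda>t. min (- t) \<theta> *\<^sub>R axis j 1) 0) $ i))"

definition kernel_primitive_bv ::
  "real \<Rightarrow> 'n \<Rightarrow> ((real \<Rightarrow>\<^sub>C (real ^ 'n)) \<Rightarrow>\<^sub>L (real ^ 'n)) \<Rightarrow> (complex ^ 'n) bv" where
  "kernel_primitive_bv h i l = Bv (\<lambda>\<theta>. kernel_primitive h i l (max 0 (min h \<theta>)))"

lemma norm_vec_le_sum: "norm (x :: complex ^ 'n) \<le> (\<Sum>j\<in>UNIV. norm (x $ j))"
  unfolding norm_vec_def by (rule L2_set_le_sum) simp

lemma kernel_primitive_lipschitz:
  fixes l :: "(real \<Rightarrow>\<^sub>C (real ^ 'n)) \<Rightarrow>\<^sub>L (real ^ 'n)"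
  assumes h: "0 \<le> h"
  shows "norm (kernel_primitive h i l y - kernel_primitive h i l x) \<le> real CARD('n) * norm l * \<bar>y - x\<bar>"
    "kernel_primitive h i l 0 = 0"
proof -
  let ?H = "\<lambda>j \<theta>. hist h (\<lambda>t. min (- t) \<theta> *\<^sub>R (axis j 1 :: real ^ 'n)) 0"
  have cont: "continuous_on S (\<lambda>t. min (- t) \<theta> *\<^sub>R (axis j 1 :: real ^ 'n))" for S j \<theta>
    by (intro continuous_intros)
  have H: "norm (?H j y - ?H j x) \<le> \<bar>y - x\<bar>" for j
  proof (rule norm_bound)
    fix t
    show "norm (apply_bcontfun (?H j y - ?H j x) t) \<le> \<bar>y - x\<bar>"
      by (simp add: apply_hist[OF h cont] flip: scaleR_diff_left) (auto simp: min_def max_def)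
  qed
  have "norm (kernel_primitive h i l y - kernel_primitive h i l x)
      \<le> (\<Sum>j\<in>UNIV. norm ((kernel_primitive h i l y - kernel_primitive h i l x) $ j))"
    by (rule norm_vec_le_sum)
  also have "\<dots> \<le> (\<Sum>j\<in>(UNIV :: 'n set). norm l * \<bar>y - x\<bar>)"
  proof (rule sum_mono)
    fix j
    have "norm ((kernel_primitive h i l y - kernel_primitive h i l x) $ j)
        = \<bar>blinfun_apply l (?H j y - ?H j x) $ i\<bar>"
      by (simp add: kernel_primitive_def blinfun.diff_right flip: of_real_diff)
    also have "\<dots> \<le> norm (blinfun_apply l (?H j y - ?H j x))" by (rule component_le_norm_cart)
    also have "\<dots> \<le> norm l * norm (?H j y - ?H j x)" by (rule norm_blinfun)
    also have "\<dots> \<le> norm l * \<bar>y - x\<bar>" by (rule mult_left_mono[OF H norm_ge_zero])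
    finally show "norm ((kernel_primitive h i l y - kernel_primitive h i l x) $ j) \<le> norm l * \<bar>y - x\<bar>" .
  qed
  finally show "norm (kernel_primitive h i l y - kernel_primitive h i l x) \<le> real CARD('n) * norm l * \<bar>y - x\<bar>"
    by simp
  have "?H j 0 = 0" for j
  proof (rule bcontfun_eqI)
    fix x
    have "min (- max (- h) (min 0 x)) 0 = 0" using h by (auto simp: min_def max_def)
    then show "apply_bcontfun (?H j 0) x = apply_bcontfun 0 x" by (simp add: apply_hist[OF h cont])
  qed
  then show "kernel_primitive h i l 0 = 0"
    by (simp add: kernel_primitive_def blinfun.zero_right vec_eq_iff)
qed

lemma kernel_primitive_bv:
  fixes l :: "(real \<Rightarrow>\<^sub>C (real ^ 'n)) \<Rightarrow>\<^sub>L (real ^ 'n)"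
  assumes h: "0 \<le> h"
  shows "apply_bv (kernel_primitive_bv h i l) \<theta> = kernel_primitive h i l (max 0 (min h \<theta>))"
    "norm (kernel_primitive_bv h i l) \<le> real CARD('n) * norm l * h"
    "kernel_primitive_bv h i l \<in> star_space h" "value0 (kernel_primitive_bv h i l) = 0"
proof -
  have C: "0 \<le> real CARD('n) * norm l" by simp
  note lip = kernel_primitive_lipschitz[OF h, of i l]
  have eq: "apply_bv (kernel_primitive_bv h i l) \<theta> = kernel_primitive h i l (max 0 (min h \<theta>))" for \<theta>
    unfolding kernel_primitive_bv_def by (rule Bv_lipschitz_clamp(1)[OF h C lip(2,1)])
  then show "apply_bv (kernel_primitive_bv h i l) \<theta> = kernel_primitive h i l (max 0 (min h \<theta>))" .
  show "norm (kernel_primitive_bv h i l) \<le> real CARD('n) * norm l * h"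
    unfolding kernel_primitive_bv_def by (rule Bv_lipschitz_clamp(2)[OF h C lip(2,1)])
  have "(real CARD('n) * norm l)-lipschitz_on {0..h} (kernel_primitive h i l)"
    by (rule lipschitz_onI) (use lip(1) C in \<open>auto simp: dist_norm\<close>)
  then have cont: "continuous_on {0..h} (kernel_primitive h i l)" by (rule lipschitz_on_continuous_on)
  show "kernel_primitive_bv h i l \<in> star_space h" "value0 (kernel_primitive_bv h i l) = 0"
    using clamped_in_star_space[OF h eq cont] lip(2) by auto
qed

lemma bounded_linear_kernel_primitive_bv:
  assumes h: "0 \<le> h"
  shows "bounded_linear (kernel_primitive_bv h (i :: 'n::finite))"
proof (rule bounded_linear_intro[where K="real CARD('n) * h"])
  fix l l' :: "(real \<Rightarrow>\<^sub>C (real ^ 'n)) \<Rightarrow>\<^sub>L (real ^ 'n)" and r :: real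
  show "kernel_primitive_bv h i (l + l') = kernel_primitive_bv h i l + kernel_primitive_bv h i l'"
    by (rule bv_eqI)
      (simp add: kernel_primitive_bv(1)[OF h] plus_bv.rep_eq kernel_primitive_def blinfun.add_left vec_eq_iff)
  show "kernel_primitive_bv h i (r *\<^sub>R l) = r *\<^sub>R kernel_primitive_bv h i l"
    by (rule bv_eqI)
      (simp add: kernel_primitive_bv(1)[OF h] scaleR_bv.rep_eq kernel_primitive_def blinfun.scaleR_left
        vec_eq_iff complex_eq_iff)
  show "norm (kernel_primitive_bv h i l) \<le> norm l * (real CARD('n) * h)"
    using kernel_primitive_bv(2)[OF h, of i l] by (simp add: mult_ac)
qed

definition kernel_total ::
  "real \<Rightarrow> 'n \<Rightarrow> ((real \<Rightarrow>\<^sub>C (real ^ 'n)) \<Rightarrow>\<^sub>L (real ^ 'n)) \<Rightarrow> complex ^ 'n" where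
  "kernel_total h i l = (\<chi> j. complex_of_real (blinfun_apply l (hist h (\<lambda>t. axis j 1) 0) $ i))"

lemma has_RS_integral_row_kernel_axis:
  fixes l :: "(real \<Rightarrow>\<^sub>C (real ^ 'n)) \<Rightarrow>\<^sub>L (real ^ 'n)"
  assumes Z: "NBV h Z" and h: "0 \<le> h"
    and l: "\<And>\<phi>. has_RS_integral (*v) Z (\<lambda>\<theta>. apply_bcontfun \<phi> (- \<theta>)) {0..h} (blinfun_apply l \<phi>)"
    and y: "continuous_on UNIV y"
  shows "has_RS_integral row_col (apply_bv (row_kernel h Z (axis i 1))) (\<lambda>s. y s *\<^sub>R axis j 1) {0..h}
    (complex_of_real (blinfun_apply l (hist h (\<lambda>t. y (- t) *\<^sub>R axis j 1) 0) $ i))"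
proof -
  let ?u = "\<lambda>t. complex_vec (y (- t) *\<^sub>R (axis j 1 :: real ^ 'n))"
  have "continuous_on UNIV (\<lambda>t. y (- t))"
    by (rule continuous_on_compose2[OF y]) (auto intro!: continuous_intros)
  then have "continuous_on {- h..0} ?u"
    by (intro bounded_linear.continuous_on[OF bounded_linear_complex_vec] continuous_on_scaleR continuous_on_const)
      (rule continuous_on_subset, auto)
  from has_RS_integral_row_kernel[OF Z h l this, of "axis i 1"]
  have "has_RS_integral row_col (apply_bv (row_kernel h Z (axis i 1))) (\<lambda>s. ?u (- s)) {0..h}
      (row_col (axis i 1) (complexify h (blinfun_apply l) ?u))" .
  moreover have "complexify h (blinfun_apply l) ?u = complex_vec (blinfun_apply l (hist h (\<lambda>t. y (- t) *\<^sub>R axis j 1) 0))"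
    by (rule complexify_complex_vec[OF h]) (simp_all add: blinfun.zero_right)
  ultimately show ?thesis
    by (simp add: row_col_axis complex_vec_scaleR complex_vec_axis) (simp add: complex_vec_def)
qed

text \<open>A constant integrand yields the total increment of the kernel.\<close>

lemma row_kernel_total:
  fixes l :: "(real \<Rightarrow>\<^sub>C (real ^ 'n)) \<Rightarrow>\<^sub>L (real ^ 'n)"
  assumes Z: "NBV h Z" and h: "0 \<le> h"
    and l: "\<And>\<phi>. has_RS_integral (*v) Z (\<lambda>\<theta>. apply_bcontfun \<phi> (- \<theta>)) {0..h} (blinfun_apply l \<phi>)"
  shows "apply_bv (row_kernel h Z (axis i 1)) h = kernel_total h i l"
proof -
  let ?r = "apply_bv (row_kernel h Z (axis i 1))"
  have "?r h $ j = kernel_total h i l $ j" for j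
  proof -
    have "has_RS_integral row_col ?r (\<lambda>s. axis j 1) {0..h}
        (row_col (?r h) (axis j 1) - integral {0..h} (\<lambda>s. row_col (?r s) 0))"
      by (rule has_RS_integral_by_parts[OF h, where C=0]) auto
    moreover have "has_RS_integral row_col ?r (\<lambda>s. axis j 1) {0..h} (kernel_total h i l $ j)"
      using has_RS_integral_row_kernel_axis[OF Z h l, of "\<lambda>_. 1" i j] by (simp add: kernel_total_def)
    ultimately show ?thesis
      using has_RS_integral_unique by (simp add: row_col_axis row_col.zero_right) blast
  qed
  then show ?thesis by (simp add: vec_eq_iff)
qed

text \<open>Partial integration with the integrand \<open>min s \<theta>\<close>, whose density is the indicator function of \<open>s \<le> \<theta>\<close>.\<close>

lemma row_kernel_primitive:
  fixes l :: "(real \<Rightarrow>\<^sub>C (real ^ 'n)) \<Rightarrow>\<^sub>L (real ^ 'n)"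
  assumes Z: "NBV h Z" and h: "0 \<le> h"
    and l: "\<And>\<phi>. has_RS_integral (*v) Z (\<lambda>\<theta>. apply_bcontfun \<phi> (- \<theta>)) {0..h} (blinfun_apply l \<phi>)"
    and \<theta>: "\<theta> \<in> {0..h}"
  shows "integral {0..\<theta>} (apply_bv (row_kernel h Z (axis i 1)))
    = \<theta> *\<^sub>R apply_bv (row_kernel h Z (axis i 1)) h - kernel_primitive h i l \<theta>"
proof -
  let ?r = "apply_bv (row_kernel h Z (axis i 1))"
  have "integral {0..\<theta>} ?r $ j = (\<theta> *\<^sub>R ?r h - kernel_primitive h i l \<theta>) $ j" for j
  proof -
    let ?e = "axis j 1 :: complex ^ 'n"
    let ?y = "\<lambda>s. min s \<theta> *\<^sub>R ?e" and ?y' = "\<lambda>s. if s \<in> {..\<theta>} then ?e else 0"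
    have y': "integral {0..s} ?y' = min s \<theta> *\<^sub>R ?e" if "0 \<le> s" for s
    proof -
      have "{0..s} \<inter> {..\<theta>} = {0..min s \<theta>}" by auto
      then show ?thesis using that \<theta> unfolding integral_restrict_Int by simp
    qed
    have "?y' \<in> borel_measurable borel" by measurable
    then have "?y' absolutely_integrable_on {0..h}"
      by (intro measurable_bounded_by_integrable_imp_absolutely_integrable[where g="\<lambda>_. norm ?e"])
        (auto simp: measurable_restrict_space1 measurable_completion)
    then have I: "has_RS_integral row_col ?r ?y {0..h} (row_col (?r h) (?y h) - integral {0..h} (\<lambda>s. row_col (?r s) (?y' s)))"
      by (rule has_RS_integral_by_parts[OF h, where C="norm ?e"]) (use \<theta> y' in auto)
    have restrict: "integral {0..h} (\<lambda>s. row_col (?r s) (?y' s)) = integral {0..\<theta>} ?r $ j"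
    proof -
      have "(\<lambda>s. row_col (?r s) (?y' s)) = (\<lambda>s. if s \<in> {..\<theta>} then ?r s $ j else 0)"
        by (auto simp: row_col_axis row_col.zero_right)
      then have "integral {0..h} (\<lambda>s. row_col (?r s) (?y' s)) = integral ({0..h} \<inter> {..\<theta>}) (\<lambda>s. ?r s $ j)"
        by (simp only: integral_restrict_Int Int_commute)
      also have "{0..h} \<inter> {..\<theta>} = {0..\<theta>}" using \<theta> by auto
      also have "integral {0..\<theta>} (\<lambda>s. ?r s $ j) = integral {0..\<theta>} ?r $ j"
        using integral_linear[OF bv_integrable[of "row_kernel h Z (axis i 1)" 0 \<theta>] bounded_linear_vec_nth[of j]] by (simp add: o_def)
      finally show ?thesis .
    qed
    have J: "has_RS_integral row_col ?r ?y {0..h} (kernel_primitive h i l \<theta> $ j)"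
      using has_RS_integral_row_kernel_axis[OF Z h l, of "\<lambda>s. min s \<theta>" i j]
      by (simp add: kernel_primitive_def continuous_on_min)
    have "row_col (?r h) (?y h) - integral {0..\<theta>} ?r $ j = kernel_primitive h i l \<theta> $ j"
      using has_RS_integral_unique[OF I J] unfolding restrict .
    moreover have "row_col (?r h) (?y h) = \<theta> *\<^sub>R ?r h $ j"
      using \<theta> by (simp add: row_col.scaleR_right row_col_axis)
    ultimately show ?thesis by (simp add: algebra_simps)
  qed
  then show ?thesis by (simp add: vec_eq_iff)
qed

lemma integral_jump_bv:
  assumes "0 \<le> \<theta>"
  shows "integral {0..\<theta>} (apply_bv (jump_bv x)) = \<theta> *\<^sub>R x"
proof -
  have "integral {0..\<theta>} (apply_bv (jump_bv x)) = integral {0..\<theta>} (\<lambda>_. x)"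
    by (rule integral_spike[of "{0}"]) (auto simp: apply_jump_bv)
  then show ?thesis using assms by simp
qed

text \<open>The element with value \<open>axis i 1\<close> at \<open>0\<close> and density \<open>Z h - Z\<close> in row \<open>i\<close>: its image under the
  operator is a pure jump.\<close>

lemma is_star_deriv_kernel_primitive:
  fixes l :: "(real \<Rightarrow>\<^sub>C (real ^ 'n)) \<Rightarrow>\<^sub>L (real ^ 'n)"
  assumes Z: "NBV h Z" and h: "0 < h"
    and l: "\<And>\<phi>. has_RS_integral (*v) Z (\<lambda>\<theta>. apply_bcontfun \<phi> (- \<theta>)) {0..h} (blinfun_apply l \<phi>)"
  shows "jump_bv (axis i 1) + kernel_primitive_bv h i l \<in> dom_A0_star h"
    "op_A_star h Z (jump_bv (axis i 1) + kernel_primitive_bv h i l) = jump_bv (kernel_total h i l)"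
    "value0 (jump_bv (axis i 1) + kernel_primitive_bv h i l) = axis i 1"
proof -
  have h0: "0 \<le> h" using h by simp
  let ?f = "jump_bv (axis i 1) + kernel_primitive_bv h i l" and ?r = "row_kernel h Z (axis i 1)"
  let ?g = "jump_bv (apply_bv ?r h) - ?r"
  note kp = kernel_primitive_bv[OF h0, of i l]
  show v0: "value0 ?f = axis i 1" by (simp add: value0_add value0_jump_bv kp(4))
  have d: "is_star_deriv h ?f ?g"
    unfolding is_star_deriv_def
  proof (intro conjI ballI)
    show "?g \<in> star_space h"
      by (intro star_space_linear jump_bv_in_star_space[OF h] row_kernel_in_star_space[OF Z h0])
    show "apply_bv ?g h = 0" using h by (simp add: minus_bv.rep_eq apply_jump_bv)
    fix \<theta> assume \<theta>: "\<theta> \<in> {0<..h}"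
    have "integral {0..\<theta>} (apply_bv ?g) = integral {0..\<theta>} (apply_bv (jump_bv (apply_bv ?r h))) - integral {0..\<theta>} (apply_bv ?r)"
      unfolding minus_bv.rep_eq[abs_def] by (intro Henstock_Kurzweil_Integration.integral_diff bv_integrable)
    also have "\<dots> = kernel_primitive h i l \<theta>"
      using row_kernel_primitive[OF Z h0 l, of \<theta> i] \<theta> by (simp add: integral_jump_bv)
    finally show "apply_bv ?f \<theta> = value0 ?f + integral {0..\<theta>} (apply_bv ?g)"
      unfolding v0 using \<theta> by (simp add: plus_bv.rep_eq apply_jump_bv kp(1))
  qed
  show "?f \<in> dom_A0_star h"
    unfolding dom_A0_star_def using d star_space_linear(1)[OF jump_bv_in_star_space[OF h] kp(3)] by blast
  show "op_A_star h Z ?f = jump_bv (kernel_total h i l)"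
    unfolding op_A_star_def v0 star_deriv_eq[OF h d] by (simp add: row_kernel_total[OF Z h0 l])
qed

lemma bounded_linear_kernel_total: "bounded_linear (kernel_total h i)"
proof -
  have "kernel_total h i = (\<lambda>l. \<Sum>j\<in>UNIV. (blinfun_apply l (hist h (\<lambda>t. axis j 1) 0) $ i) *\<^sub>R (axis j 1 :: complex ^ 'a))"
    by (rule ext) (simp add: kernel_total_def vec_eq_iff complex_eq_iff axis_def if_distrib[of Re] if_distrib[of Im]
        if_distrib[of "(*) _"] cong: if_cong)
  then show ?thesis
    by (auto intro!: bounded_linear_sum bounded_linear_compose[OF bounded_linear_scaleR_left]
        bounded_linear_compose[OF bounded_linear_vec_nth] blinfun.bounded_linear_left)
qed

section \<open>Uniqueness of the second adjoint\<close>

text \<open>The essentially bounded component is known to vanish. What remains is the value at \<open>0+\<close>, which is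
  \<open>axis i 1\<close> for the kernel primitives; these form an admissible family because they depend on time only
  through \<open>Lb\<close>, which is \<open>C\<^sup>1\<close>.\<close>

lemma cA_sun_annihilator:
  fixes Lb L' :: "real \<Rightarrow> (real \<Rightarrow>\<^sub>C (real ^ 'n)) \<Rightarrow>\<^sub>L (real ^ 'n)"
    and q :: "real \<Rightarrow> (complex ^ 'n) \<times> (complex ^ 'n) linf"
  assumes h: "0 < h" and T: "0 < T" and Z: "\<And>t. NBV h (\<zeta> t)"
    and L: "\<And>t \<phi>. has_RS_integral (*v) (\<zeta> t) (\<lambda>\<theta>. apply_bcontfun \<phi> (-\<theta>)) {0..h} (L t \<phi>)"
    and Lb: "\<And>t. blinfun_apply (Lb t) = L t" "\<And>t. (Lb has_vector_derivative L' t) (at t)"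
      "continuous_on UNIV L'" "\<And>t. Lb (t + T) = Lb t"
    and q: "q \<in> C_per T (sunstar_space h)"
    and zero: "\<And>\<phi>. \<phi> \<in> part (dom_cA_sun h T \<zeta>) (C_per T (sun_space h)) (cA_sun h \<zeta>) \<Longrightarrow> sun_pairing_per h T q \<phi> = 0"
  shows "q \<tau> = 0"
proof -
  have h0: "0 \<le> h" using h by simp
  have snd0: "snd (q \<tau>) = 0" by (rule sunstar_density_zero[OF h T Z q zero])
  have l: "has_RS_integral (*v) (\<zeta> t) (\<lambda>\<theta>. apply_bcontfun \<phi> (-\<theta>)) {0..h} (blinfun_apply (Lb t) \<phi>)" for t \<phi>
    unfolding Lb(1) by (rule L)
  note k = is_star_deriv_kernel_primitive[OF Z h l]
  note kb = bounded_linear_kernel_primitive_bv[OF h0]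
  note jt = bounded_linear_compose[OF bounded_linear_jump_bv bounded_linear_kernel_total]
  have Lbc: "continuous_on UNIV Lb"
    by (intro continuous_at_imp_continuous_on ballI has_vector_derivative_continuous[OF Lb(2)])
  have "fst (q \<tau>) $ i = 0" for i
  proof -
    let ?f = "\<lambda>t. jump_bv (axis i 1) + kernel_primitive_bv h i (Lb t)"
    have "sun_pairing h (q \<tau>) (?f \<tau>) = 0"
    proof (rule sun_pairing_zero_of_test_family[where f="?f" and a="\<lambda>t. jump_bv (kernel_total h i (Lb t))", OF h T Z q zero])
      show "?f \<in> C1_per T (sun_space h)"
      proof (rule C1_perI[where D="\<lambda>t. kernel_primitive_bv h i (L' t)"])
        show "(?f has_vector_derivative kernel_primitive_bv h i (L' t)) (at t)" for t
          using has_vector_derivative_add[OF has_vector_derivative_const bounded_linear.has_vector_derivative[OF kb Lb(2)]]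
          by simp
        show "continuous_on UNIV (\<lambda>t. kernel_primitive_bv h i (L' t))"
          by (rule bounded_linear.continuous_on[OF kb Lb(3)])
        show "?f (t + T) = ?f t" for t by (simp add: Lb(4))
        show "?f t \<in> sun_space h" for t using k(1) dom_A0_star_subset_sun_space by blast
      qed
      show "?f t \<in> dom_A0_star h" for t by (rule k(1))
      show "op_A_star h (\<zeta> t) (?f t) = jump_bv (kernel_total h i (Lb t))" for t by (rule k(2))
      show "(\<lambda>t. jump_bv (kernel_total h i (Lb t))) \<in> C_per T (sun_space h)"
        by (rule C_perI)
          (simp_all add: bounded_linear.continuous_on[OF jt Lbc] Lb(4) jump_bv_in_sun_space[OF h])
    qed
    moreover have "density_pairing h 0 g = 0" if "g absolutely_integrable_on {0..h}" for g :: "real \<Rightarrow> complex ^ 'n"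
      using density_pairing_linear(4)[OF that that, of 0 0] by simp
    then have "density_pairing h (snd (q \<tau>)) (apply_bv (star_deriv h (?f \<tau>))) = 0"
      unfolding snd0 by (simp add: absolutely_integrable_apply_bv)
    ultimately show ?thesis
      unfolding sun_pairing_eq[OF h has_sun_density_star_deriv[OF h k(1)]] k(3) by (simp add: row_col_axis)
  qed
  then have "fst (q \<tau>) = 0" by (simp add: vec_eq_iff)
  with snd0 show ?thesis by (simp add: prod_eq_iff)
qed

text \<open>As for the first operator: the difference of two images annihilates the domain of the predual
  operator.\<close>

lemma unique_linear_operator_cA_sunstar:
  fixes L :: "real \<Rightarrow> (real \<Rightarrow>\<^sub>C (real ^ 'n)) \<Rightarrow> real ^ 'n" and Lb L' :: "real \<Rightarrow> (real \<Rightarrow>\<^sub>C (real ^ 'n)) \<Rightarrow>\<^sub>L (real ^ 'n)"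
  assumes h: "0 < h" and T: "0 < T"
    and Z: "\<And>t. NBV h (\<zeta> t)"
    and L: "\<And>t \<phi>. has_RS_integral (*v) (\<zeta> t) (\<lambda>\<theta>. apply_bcontfun \<phi> (-\<theta>)) {0..h} (L t \<phi>)"
    and Lb: "\<And>t. blinfun_apply (Lb t) = L t" "\<And>t. (Lb has_vector_derivative L' t) (at t)"
      "continuous_on UNIV L'" "\<And>t. Lb (t + T) = Lb t"
  shows "unique_linear_operator scaleC_sunstar
       (part (dom_cA_sunstar h T) (C_per T (sunstar_space h)) (cA_sunstar h L))
       (C_per T (sunstar_space h))
       (\<lambda>B. \<forall>\<phi>o\<in>part (dom_cA_sun h T \<zeta>) (C_per T (sun_space h)) (cA_sun h \<zeta>).
            \<forall>\<phi>os\<in>part (dom_cA_sunstar h T) (C_per T (sunstar_space h)) (cA_sunstar h L).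
              sun_pairing_per h T (B \<phi>os) \<phi>o = sun_pairing_per h T \<phi>os (cA_sun h \<zeta> \<phi>o))
       (cA_sunstar h L)"
    (is "unique_linear_operator _ ?D ?R ?P ?A")
  unfolding unique_linear_operator_def
proof (intro conjI allI impI ballI)
  have "linear (L t)" for t
    unfolding Lb(1)[symmetric] by (rule bounded_linear.linear[OF blinfun.bounded_linear_right])
  then show "linear_operator scaleC_sunstar ?D ?R ?A" by (rule linear_operator_cA_sunstar[OF h])
  have dual: "sun_pairing_per h T (?A v) f = sun_pairing_per h T v (cA_sun h \<zeta> f)"
    if "f \<in> part (dom_cA_sun h T \<zeta>) (C_per T (sun_space h)) (cA_sun h \<zeta>)" "v \<in> ?D" for f v
    using that sun_pairing_per_cA_sunstar[where L=L and \<zeta>=\<zeta>, OF h T Z L] unfolding part_def by blast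
  then show "sun_pairing_per h T (?A v) f = sun_pairing_per h T v (cA_sun h \<zeta> f)"
    if "f \<in> part (dom_cA_sun h T \<zeta>) (C_per T (sun_space h)) (cA_sun h \<zeta>)" "v \<in> ?D" for f v
    using that by blast
  fix B u assume B: "linear_operator scaleC_sunstar ?D ?R B \<and> ?P B" and u: "u \<in> ?D"
  have Bu: "B u \<in> ?R" "?A u \<in> ?R"
    using B u unfolding linear_operator_def part_def by auto
  have neg: "- x \<in> sunstar_space h" if "x \<in> sunstar_space h" for x :: "(complex ^ 'n) \<times> (complex ^ 'n) linf"
  proof -
    have "scaleC_linf (-1) \<psi> = - \<psi>" for \<psi> :: "(complex ^ 'n) linf"
    proof (rule linf_eqI)
      show "AE s in lborel. rep_linf (scaleC_linf (-1) \<psi>) s = rep_linf (- \<psi>) s"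
        using rep_linf_scaleC[of "-1" \<psi>] rep_linf_scaleR[of "-1" \<psi>]
        by eventually_elim (simp add: vec_eq_iff)
    qed
    then have "scaleC_sunstar (-1) x = - x"
      by (simp add: scaleC_sunstar_def prod_eq_iff vec_eq_iff)
    then show ?thesis using sunstar_space_scaleC[OF that, of "-1"] by simp
  qed
  have "(\<lambda>\<tau>. B u \<tau> - ?A u \<tau>) \<tau> = 0" for \<tau>
  proof (rule cA_sun_annihilator[where L=L and \<zeta>=\<zeta>, OF h T Z L Lb])
    show "(\<lambda>\<tau>. B u \<tau> - ?A u \<tau>) \<in> ?R"
    proof (rule C_perI)
      show "continuous_on UNIV (\<lambda>\<tau>. B u \<tau> - ?A u \<tau>)"
        by (intro continuous_on_diff C_perD(1)[OF Bu(1)] C_perD(1)[OF Bu(2)])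
      show "B u (\<tau> + T) - ?A u (\<tau> + T) = B u \<tau> - ?A u \<tau>" for \<tau>
        by (simp only: C_perD(2)[OF Bu(1)] C_perD(2)[OF Bu(2)])
      show "B u \<tau> - ?A u \<tau> \<in> sunstar_space h" for \<tau>
        using sunstar_space_add[OF C_perD(3)[OF Bu(1)] neg[OF C_perD(3)[OF Bu(2)]], of \<tau> \<tau>] by simp
    qed
    fix f assume f: "f \<in> part (dom_cA_sun h T \<zeta>) (C_per T (sun_space h)) (cA_sun h \<zeta>)"
    then have f1: "f \<in> C1_per T (sun_space h)"
      unfolding part_def dom_cA_sun_def by blast
    have "continuous_on UNIV (\<lambda>\<tau>. sun_pairing h (B u \<tau>) (f \<tau>))" "continuous_on UNIV (\<lambda>\<tau>. sun_pairing h (?A u \<tau>) (f \<tau>))"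
      by (rule continuous_on_sun_pairing[OF h _ C1_perD(3,5)[OF f1]], rule C_perD(1), rule Bu)+
    then have int: "(\<lambda>\<tau>. sun_pairing h (B u \<tau>) (f \<tau>)) integrable_on {0..T}"
      "(\<lambda>\<tau>. sun_pairing h (?A u \<tau>) (f \<tau>)) integrable_on {0..T}"
      by (auto intro!: integrable_continuous_real intro: continuous_on_subset)
    have "sun_pairing_per h T (\<lambda>\<tau>. B u \<tau> - ?A u \<tau>) f = sun_pairing_per h T (B u) f - sun_pairing_per h T (?A u) f"
      unfolding sun_pairing_per_def sun_pairing_linear(6)[OF h C1_perD(5)[OF f1]]
      by (rule Henstock_Kurzweil_Integration.integral_diff[OF int])
    also have "\<dots> = 0" using B f u dual[OF f u] by auto
    finally show "sun_pairing_per h T (\<lambda>\<tau>. B u \<tau> - ?A u \<tau>) f = 0" .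
  qed
  then show "B u = ?A u" by auto
qed

section \<open>The duality theorem\<close>

theorem proposition3p23:
  fixes h T :: real and k :: nat
    and F :: "(real \<Rightarrow>\<^sub>C (real ^ 'n)) \<Rightarrow> real ^ 'n"
    and \<gamma> :: "real \<Rightarrow> real ^ 'n"
    and L :: "real \<Rightarrow> (real \<Rightarrow>\<^sub>C (real ^ 'n)) \<Rightarrow> real ^ 'n"
    and \<zeta> :: "real \<Rightarrow> real \<Rightarrow> real ^ 'n ^ 'n"
  assumes h: "0 < h"
    and k: "1 \<le> k"
    and F_segment: "depends_on_segment h F"
    and F_smooth: "Ck_smooth (k + 1) F"
    and solution: "\<And>t. (\<gamma> has_vector_derivative F (hist h \<gamma> t)) (at t)"
    and T: "0 < T"
    and periodic: "\<And>t. \<gamma> (t + T) = \<gamma> t"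
    and minimal: "\<And>S. 0 < S \<Longrightarrow> S < T \<Longrightarrow> \<exists>t. \<gamma> (t + S) \<noteq> \<gamma> t"
    and L: "\<And>t. L t = frechet_derivative F (at (hist h \<gamma> t))"
    and \<zeta>_NBV: "\<And>t. NBV h (\<zeta> t)"
    and \<zeta>_repr: "\<And>t \<phi>. has_RS_integral (*v) (\<zeta> t) (\<lambda>\<theta>. apply_bcontfun \<phi> (-\<theta>)) {0..h} (L t \<phi>)"
  shows
    "(\<forall>\<phi>\<in>dom_cA h T L. \<forall>\<phi>s\<in>dom_cA_star h T.
        pairing_per h T (cA_star h \<zeta> \<phi>s) \<phi> = pairing_per h T \<phi>s (cA h \<phi>)) \<and>
     (\<forall>\<phi>o\<in>dom_cA_sun h T \<zeta>. \<forall>\<phi>os\<in>dom_cA_sunstar h T.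
        sun_pairing_per h T (cA_sunstar h L \<phi>os) \<phi>o = sun_pairing_per h T \<phi>os (cA_sun h \<zeta> \<phi>o)) \<and>
     unique_linear_operator scaleC_bv
       (part (dom_cA_star h T) (C_per T (star_space h)) (cA_star h \<zeta>))
       (C_per T (star_space h))
       (\<lambda>B. \<forall>\<phi>\<in>part (dom_cA h T L) (C_per T (state_space h)) (cA h).
            \<forall>\<phi>s\<in>part (dom_cA_star h T) (C_per T (star_space h)) (cA_star h \<zeta>).
              pairing_per h T (B \<phi>s) \<phi> = pairing_per h T \<phi>s (cA h \<phi>))
       (cA_star h \<zeta>) \<and>
     unique_linear_operator scaleC_sunstar
       (part (dom_cA_sunstar h T) (C_per T (sunstar_space h)) (cA_sunstar h L))
       (C_per T (sunstar_space h))
       (\<lambda>B. \<forall>\<phi>o\<in>part (dom_cA_sun h T \<zeta>) (C_per T (sun_space h)) (cA_sun h \<zeta>).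
            \<forall>\<phi>os\<in>part (dom_cA_sunstar h T) (C_per T (sunstar_space h)) (cA_sunstar h L).
              sun_pairing_per h T (B \<phi>os) \<phi>o = sun_pairing_per h T \<phi>os (cA_sun h \<zeta> \<phi>o))
       (cA_sunstar h L)"
proof -
  have "0 \<le> h" "2 \<le> k + 1" using h k by simp_all
  then obtain Lb L' where Lb: "\<And>t. blinfun_apply (Lb t) = L t"
    "\<And>t. (Lb has_vector_derivative L' t) (at t)" "continuous_on UNIV L'" "\<And>t. Lb (t + T) = Lb t"
    using linearisation_C1[OF _ F_smooth _ solution periodic L] by blast
  show ?thesis
    by (intro conjI ballI pairing_per_cA_star[where L=L and \<zeta>=\<zeta>, OF h T \<zeta>_NBV \<zeta>_repr]
        sun_pairing_per_cA_sunstar[where L=L and \<zeta>=\<zeta>, OF h T \<zeta>_NBV \<zeta>_repr]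
        unique_linear_operator_cA_star[where L=L and \<zeta>=\<zeta>, OF h T \<zeta>_NBV \<zeta>_repr Lb]
        unique_linear_operator_cA_sunstar[where L=L and \<zeta>=\<zeta>, OF h T \<zeta>_NBV \<zeta>_repr Lb])
qed

end
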